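(* (1) If $\mathbb{D}$ is a reverse CGW category, then its classifying diagram $N^\square\mathbb{D}$ is a pointed stable double Segal space. (2) If $\mathbb{D}$ is a double category with shared isomorphisms in which every horizontal morphism is monic (in the category of horizontal morphisms) and every vertical morphism is epic (in the category of vertical morphisms), and if its classifying diagram $N^\square\mathbb{D}$ is a pointed stable double Segal space, then $\mathbb{D}$ is a reverse CGW category.
   Context: A double category $\mathbb{D}$ has objects, horizontal morphisms (forming a category $\mathcal{H}(\mathbb{D})$), vertical morphisms (forming a category $\mathcal{V}(\mathbb{D})$ with the same objects), and squares; a square written (top $f$; left $h$; right $k$; bottom $g$) has boundary $f\colon A\to B$, $g\colon C\to D$ horizontal and $h\colon A\to C$, $k\colon B\to D$ vertical. Squares compose horizontally and vertically, with identities, subject to unit, associativity and interchange laws. A double functor preserves all of this structure. $[m]\boxtimes[n]$ is the double category freely generated by an $m\times n$ grid of squares ($m$ in the horizontal direction). Shared isomorphism: a pair $(f,f')$ of a horizontal isomorphism $f\colon A\to B$ and a vertical isomorphism $f'\colon A\to B$ equipped with squares (top $f$; left $f'$; right $\mathrm{id}_B$; bottom $\mathrm{id}_B$), (top $\mathrm{id}_A$; left $\mathrm{id}_A$; right $f'$; bottom $f$), (top $f$; left $\mathrm{id}_A$; right $f'^{-1}$; bottom $\mathrm{id}_A$), (top $\mathrm{id}_A$; left $f'$; right $\mathrm{id}_A$; bottom $f^{-1}$). $\mathbb{D}$ has shared isomorphisms if there are bijections $\varphi$ from horizontal isomorphisms $A\to B$ to vertical isomorphisms $A\to B$, for all objects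 $A,B$, such that: (a) for horizontal $f\colon A\to A'$, $g\colon B\to B'$ and horizontal isomorphisms $h\colon A\to B$, $k\colon A'\to B'$, one has $kf=gh$ if and only if there is a square (top $f$; left $\varphi(h)$; right $\varphi(k)$; bottom $g$), and such a square is unique relative to its boundary; (b) for vertical $u\colon A\to B$, $u'\colon A'\to B'$ and horizontal isomorphisms $h\colon A\to A'$, $k\colon B\to B'$, one has $u'\varphi(h)=\varphi(k)u$ if and only if there is a square (top $h$; left $u$; right $u'$; bottom $k$), and such a square is unique relative to its boundary. In such a double category every horizontal or vertical isomorphism belongs to a unique shared isomorphism, and "isomorphism" means shared isomorphism. A natural (shared) isomorphism between double functors $F,G\colon\mathbb{C}\to\mathbb{D}$ is a family of shared isomorphisms $(\theta_A,\theta'_A)\colon FA\to GA$, one for each object $A$ of $\mathbb{C}$, such that the $\theta_A$ are the components of a natural horizontal transformation (natural for horizontal morphisms; with a square (top $\theta_A$; left $Fu$; right $Gu$; bottom $\theta_B$) for each vertical $u\colon A\to B$, compatible with vertical identities and composition, and with horizontal composition with the images $F\sigma,G\sigma$ of squares $\sigma$ of $\mathbb{C}$), and the $\theta'_A$ are, dually, the components of a natural vertical transformation. A zero object of $\mathbb{D}$ is an object initial in $\mathcal{H}(\mathbb{D})$ and terminal in $\mathcal{V}(\mathbb{D})$; $\mathbb{D}$ is pointed if it has a zero object. $\mathbb{D}$ is a reverse CGW category if: (I') it has shared isomorphisms; (M') all horizontal morphisms are monic in $\mathcal{H}(\mathbb{D})$ and all vertical morphisms are epic in $\mathcal{V}(\mathbb{D})$;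 (Z') it is pointed; (K'') any pair consisting of a vertical $h\colon A\to C$ and a horizontal $f\colon A\to B$, and any pair consisting of a horizontal $g\colon C\to D$ and a vertical $k\colon B\to D$, extends to a square (top $f$; left $h$; right $k$; bottom $g$), uniquely up to a unique (natural shared) isomorphism of squares that is the identity on the three objects of the given pair. A bisimplicial space is a functor $Y\colon\Delta^{op}\times\Delta^{op}\to s\mathbf{Set}$; it is a double Segal space if the Segal maps $Y_{n,k}\to Y_{1,k}\times_{Y_{0,k}}\cdots\times_{Y_{0,k}}Y_{1,k}$ and $Y_{\ell,m}\to Y_{\ell,1}\times_{Y_{\ell,0}}\cdots\times_{Y_{\ell,0}}Y_{\ell,1}$ are weak equivalences of simplicial sets for $k,\ell\ge 0$, $m,n\ge 2$. It is stable if the restriction maps $Y_{1,1}\to Y_{0,1}\times_{Y_{0,0}}Y_{1,0}$ (the span formed by left and top edges) and $Y_{1,1}\to Y_{1,0}\times_{Y_{0,0}}Y_{0,1}$ (the cospan formed by bottom and right edges) are weak equivalences. A preaugmented bisimplicial space is a bisimplicial space $Y$ together with a simplicial set $Y_{-1}$ and a map $Y_{-1}\to Y_{0,0}$. It is pointed if $Y_{-1}$ is contractible and the composites $Y_{1,0}\times_{Y_{0,0}}Y_{-1}\to Y_{1,0}\to Y_{0,0}$ (fiber product over the horizontal source map, followed by horizontal target) and $Y_{0,1}\times_{Y_{0,0}}Y_{-1}\to Y_{0,1}\to Y_{0,0}$ (fiber product over the vertical target map, followed by vertical source) are weak equivalences. A pointed stable double Segal space is a pointed preaugmented bisimplicial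 space whose underlying bisimplicial space is a stable double Segal space. Classifying diagram: for $\mathbb{D}$ with shared isomorphisms, $(N^\square\mathbb{D})_{m,n}$ is the nerve of the groupoid of double functors $[m]\boxtimes[n]\to\mathbb{D}$ and natural shared isomorphisms; the preaugmentation $(N^\square\mathbb{D})_{-1}$ is the nerve of the full subgroupoid of zero objects of $\mathbb{D}$ (empty if there are none), with its inclusion into $(N^\square\mathbb{D})_{0,0}$. *)

theory Defs
  imports "HOL-Homology.Simplices"
begin

section \<open>Categories and functors\<close>

record ('o, 'm) cat =
  Ob :: "'o set"
  Ar :: "'m set"
  src :: "'m \<Rightarrow> 'o"
  trg :: "'m \<Rightarrow> 'o"
  ident :: "'o \<Rightarrow> 'm"
  cmp :: "'m \<Rightarrow> 'm \<Rightarrow> 'm"  \<comment> \<open>\<open>cmp C g f\<close> is \<open>g\<close> after \<open>f\<close>\<close>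

definition arrows :: "('o, 'm) cat \<Rightarrow> 'o \<Rightarrow> 'o \<Rightarrow> 'm set" where
  "arrows C A B = {f \<in> Ar C. src C f = A \<and> trg C f = B}"

locale category =
  fixes C :: "('o, 'm) cat"
  assumes src_closed: "f \<in> Ar C \<Longrightarrow> src C f \<in> Ob C"
    and trg_closed: "f \<in> Ar C \<Longrightarrow> trg C f \<in> Ob C"
    and ident_closed: "A \<in> Ob C \<Longrightarrow> ident C A \<in> arrows C A A"
    and cmp_closed: "f \<in> Ar C \<Longrightarrow> g \<in> Ar C \<Longrightarrow> src C g = trg C f \<Longrightarrow>
          cmp C g f \<in> arrows C (src C f) (trg C g)"
    and cmp_ident_right: "f \<in> Ar C \<Longrightarrow> cmp C f (ident C (src C f)) = f"
    and cmp_ident_left: "f \<in> Ar C \<Longrightarrow> cmp C (ident C (trg C f)) f = f"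
    and cmp_assoc: "f \<in> Ar C \<Longrightarrow> g \<in> Ar C \<Longrightarrow> h \<in> Ar C \<Longrightarrow>
          src C g = trg C f \<Longrightarrow> src C h = trg C g \<Longrightarrow>
          cmp C h (cmp C g f) = cmp C (cmp C h g) f"

text \<open>Functors are pairs of maps that are \<open>undefined\<close> outside the source category, so that
  functors with equal values are equal.\<close>

definition functors ::
  "('o, 'm) cat \<Rightarrow> ('p, 'n) cat \<Rightarrow> (('o \<Rightarrow> 'p) \<times> ('m \<Rightarrow> 'n)) set" where
  "functors C D = {(P, Q). P \<in> Ob C \<rightarrow>\<^sub>E Ob D \<and> Q \<in> Ar C \<rightarrow>\<^sub>E Ar D \<and>
     (\<forall>f\<in>Ar C. src D (Q f) = P (src C f) \<and> trg D (Q f) = P (trg C f)) \<and>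
     (\<forall>A\<in>Ob C. Q (ident C A) = ident D (P A)) \<and>
     (\<forall>f\<in>Ar C. \<forall>g\<in>Ar C. src C g = trg C f \<longrightarrow> Q (cmp C g f) = cmp D (Q g) (Q f))}"

definition inverses :: "('o, 'm) cat \<Rightarrow> 'm \<Rightarrow> 'm \<Rightarrow> bool" where
  "inverses C f g \<longleftrightarrow> f \<in> Ar C \<and> g \<in> arrows C (trg C f) (src C f) \<and>
     cmp C g f = ident C (src C f) \<and> cmp C f g = ident C (trg C f)"

definition isos :: "('o, 'm) cat \<Rightarrow> 'o \<Rightarrow> 'o \<Rightarrow> 'm set" where
  "isos C A B = {f \<in> arrows C A B. \<exists>g. inverses C f g}"

definition monic :: "('o, 'm) cat \<Rightarrow> 'm \<Rightarrow> bool" where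
  "monic C f \<longleftrightarrow> f \<in> Ar C \<and>
     (\<forall>A\<in>Ob C. \<forall>x\<in>arrows C A (src C f). \<forall>y\<in>arrows C A (src C f).
        cmp C f x = cmp C f y \<longrightarrow> x = y)"

definition epic :: "('o, 'm) cat \<Rightarrow> 'm \<Rightarrow> bool" where
  "epic C f \<longleftrightarrow> f \<in> Ar C \<and>
     (\<forall>B\<in>Ob C. \<forall>x\<in>arrows C (trg C f) B. \<forall>y\<in>arrows C (trg C f) B.
        cmp C x f = cmp C y f \<longrightarrow> x = y)"

definition initial :: "('o, 'm) cat \<Rightarrow> 'o \<Rightarrow> bool" where
  "initial C A \<longleftrightarrow> A \<in> Ob C \<and> (\<forall>B\<in>Ob C. \<exists>!f. f \<in> arrows C A B)"

definition terminal :: "('o, 'm) cat \<Rightarrow> 'o \<Rightarrow> bool" where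
  "terminal C B \<longleftrightarrow> B \<in> Ob C \<and> (\<forall>A\<in>Ob C. \<exists>!f. f \<in> arrows C A B)"

text \<open>The poset \<open>{0 \<le> \<dots> \<le> n}\<close> as a category; the arrow \<open>i \<rightarrow> j\<close> is the pair \<open>(i, j)\<close>.\<close>

definition ordinal :: "nat \<Rightarrow> (nat, nat \<times> nat) cat" where
  "ordinal n = \<lparr>Ob = {..n}, Ar = {(i, j). i \<le> j \<and> j \<le> n}, src = fst, trg = snd,
     ident = (\<lambda>i. (i, i)), cmp = (\<lambda>g f. (fst f, snd g))\<rparr>"


section \<open>Double categories\<close>

text \<open>A square is an arrow in two ways: in \<open>hsq\<close>, whose objects are the vertical morphisms, from
  its left to its right edge, composed horizontally; and in \<open>vsq\<close>, whose objects are the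
  horizontal morphisms, from its top to its bottom edge, composed vertically.\<close>

record ('o, 'h, 'v, 's) dblcat =
  hor :: "('o, 'h) cat"
  ver :: "('o, 'v) cat"
  hsq :: "('v, 's) cat"
  vsq :: "('h, 's) cat"

abbreviation Sq :: "('o, 'h, 'v, 's) dblcat \<Rightarrow> 's set" where
  "Sq D \<equiv> Ar (hsq D)"
abbreviation left_edge :: "('o, 'h, 'v, 's) dblcat \<Rightarrow> 's \<Rightarrow> 'v" where
  "left_edge D \<equiv> src (hsq D)"
abbreviation right_edge :: "('o, 'h, 'v, 's) dblcat \<Rightarrow> 's \<Rightarrow> 'v" where
  "right_edge D \<equiv> trg (hsq D)"
abbreviation top_edge :: "('o, 'h, 'v, 's) dblcat \<Rightarrow> 's \<Rightarrow> 'h" where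
  "top_edge D \<equiv> src (vsq D)"
abbreviation bottom_edge :: "('o, 'h, 'v, 's) dblcat \<Rightarrow> 's \<Rightarrow> 'h" where
  "bottom_edge D \<equiv> trg (vsq D)"

text \<open>Arguments of \<open>squares\<close> in the order top, left, right, bottom.\<close>

definition squares :: "('o, 'h, 'v, 's) dblcat \<Rightarrow> 'h \<Rightarrow> 'v \<Rightarrow> 'v \<Rightarrow> 'h \<Rightarrow> 's set" where
  "squares D f h k g =
     {s \<in> Sq D. top_edge D s = f \<and> left_edge D s = h \<and> right_edge D s = k \<and> bottom_edge D s = g}"

locale double_category =
  fixes D :: "('o, 'h, 'v, 's) dblcat"
  assumes category_hor: "category (hor D)"
    and category_ver: "category (ver D)"
    and category_hsq: "category (hsq D)"
    and category_vsq: "category (vsq D)"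
    and same_objects: "Ob (ver D) = Ob (hor D)"
    and hsq_objects: "Ob (hsq D) = Ar (ver D)"
    and vsq_objects: "Ob (vsq D) = Ar (hor D)"
    and same_squares: "Ar (vsq D) = Sq D"
    and corner_top_left: "s \<in> Sq D \<Longrightarrow> src (ver D) (left_edge D s) = src (hor D) (top_edge D s)"
    and corner_top_right: "s \<in> Sq D \<Longrightarrow> src (ver D) (right_edge D s) = trg (hor D) (top_edge D s)"
    and corner_bottom_left: "s \<in> Sq D \<Longrightarrow> trg (ver D) (left_edge D s) = src (hor D) (bottom_edge D s)"
    and corner_bottom_right: "s \<in> Sq D \<Longrightarrow> trg (ver D) (right_edge D s) = trg (hor D) (bottom_edge D s)"
    and boundary_hcmp: "s \<in> Sq D \<Longrightarrow> t \<in> Sq D \<Longrightarrow> left_edge D t = right_edge D s \<Longrightarrow>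
          top_edge D (cmp (hsq D) t s) = cmp (hor D) (top_edge D t) (top_edge D s) \<and>
          bottom_edge D (cmp (hsq D) t s) = cmp (hor D) (bottom_edge D t) (bottom_edge D s)"
    and boundary_vcmp: "s \<in> Sq D \<Longrightarrow> t \<in> Sq D \<Longrightarrow> top_edge D t = bottom_edge D s \<Longrightarrow>
          left_edge D (cmp (vsq D) t s) = cmp (ver D) (left_edge D t) (left_edge D s) \<and>
          right_edge D (cmp (vsq D) t s) = cmp (ver D) (right_edge D t) (right_edge D s)"
    and boundary_hident: "u \<in> Ar (ver D) \<Longrightarrow>
          top_edge D (ident (hsq D) u) = ident (hor D) (src (ver D) u) \<and>
          bottom_edge D (ident (hsq D) u) = ident (hor D) (trg (ver D) u)"
    and boundary_vident: "f \<in> Ar (hor D) \<Longrightarrow>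
          left_edge D (ident (vsq D) f) = ident (ver D) (src (hor D) f) \<and>
          right_edge D (ident (vsq D) f) = ident (ver D) (trg (hor D) f)"
    and hident_cmp: "u \<in> Ar (ver D) \<Longrightarrow> w \<in> Ar (ver D) \<Longrightarrow> src (ver D) w = trg (ver D) u \<Longrightarrow>
          ident (hsq D) (cmp (ver D) w u) = cmp (vsq D) (ident (hsq D) w) (ident (hsq D) u)"
    and vident_cmp: "f \<in> Ar (hor D) \<Longrightarrow> g \<in> Ar (hor D) \<Longrightarrow> src (hor D) g = trg (hor D) f \<Longrightarrow>
          ident (vsq D) (cmp (hor D) g f) = cmp (hsq D) (ident (vsq D) g) (ident (vsq D) f)"
    and ident_ident: "A \<in> Ob (hor D) \<Longrightarrow>
          ident (hsq D) (ident (ver D) A) = ident (vsq D) (ident (hor D) A)"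
    and interchange: "s \<in> Sq D \<Longrightarrow> t \<in> Sq D \<Longrightarrow> s' \<in> Sq D \<Longrightarrow> t' \<in> Sq D \<Longrightarrow>
          left_edge D t = right_edge D s \<Longrightarrow> left_edge D t' = right_edge D s' \<Longrightarrow>
          top_edge D s' = bottom_edge D s \<Longrightarrow> top_edge D t' = bottom_edge D t \<Longrightarrow>
          cmp (vsq D) (cmp (hsq D) t' s') (cmp (hsq D) t s) =
          cmp (hsq D) (cmp (vsq D) t' t) (cmp (vsq D) s' s)"

record ('o, 'h, 'v, 's, 'p, 'k, 'w, 't) dfun =
  on_ob :: "'o \<Rightarrow> 'p"
  on_hor :: "'h \<Rightarrow> 'k"
  on_ver :: "'v \<Rightarrow> 'w"
  on_sq :: "'s \<Rightarrow> 't"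

definition double_functors ::
  "('o, 'h, 'v, 's) dblcat \<Rightarrow> ('p, 'k, 'w, 't) dblcat \<Rightarrow>
   ('o, 'h, 'v, 's, 'p, 'k, 'w, 't) dfun set" where
  "double_functors C D = {F.
     (on_ob F, on_hor F) \<in> functors (hor C) (hor D) \<and>
     (on_ob F, on_ver F) \<in> functors (ver C) (ver D) \<and>
     (on_ver F, on_sq F) \<in> functors (hsq C) (hsq D) \<and>
     (on_hor F, on_sq F) \<in> functors (vsq C) (vsq D)}"

definition dfun_compose ::
  "('o, 'h, 'v, 's) dblcat \<Rightarrow> ('p, 'k, 'w, 't, 'a, 'b, 'c, 'd) dfun \<Rightarrow>
   ('o, 'h, 'v, 's, 'p, 'k, 'w, 't) dfun \<Rightarrow> ('o, 'h, 'v, 's, 'a, 'b, 'c, 'd) dfun" where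
  "dfun_compose B F K = \<lparr>
     on_ob = compose (Ob (hor B)) (on_ob F) (on_ob K),
     on_hor = compose (Ar (hor B)) (on_hor F) (on_hor K),
     on_ver = compose (Ar (ver B)) (on_ver F) (on_ver K),
     on_sq = compose (Sq B) (on_sq F) (on_sq K)\<rparr>"


section \<open>Shared isomorphisms\<close>

text \<open>In a double category with shared isomorphisms (see \<open>has_shared_isos\<close>), the only place where
  this predicate is used, the four squares are determined by their boundaries, so a shared
  isomorphism is recorded as the pair \<open>(f, f')\<close>.\<close>

definition shared_iso :: "('o, 'h, 'v, 's) dblcat \<Rightarrow> 'h \<Rightarrow> 'v \<Rightarrow> bool" where
  "shared_iso D f f' \<longleftrightarrow>
     (\<exists>A\<in>Ob (hor D). \<exists>B\<in>Ob (hor D). \<exists>g g'.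
        f \<in> arrows (hor D) A B \<and> f' \<in> arrows (ver D) A B \<and>
        inverses (hor D) f g \<and> inverses (ver D) f' g' \<and>
        squares D f f' (ident (ver D) B) (ident (hor D) B) \<noteq> {} \<and>
        squares D (ident (hor D) A) (ident (ver D) A) f' f \<noteq> {} \<and>
        squares D f (ident (ver D) A) g' (ident (hor D) A) \<noteq> {} \<and>
        squares D (ident (hor D) A) f' (ident (ver D) A) g \<noteq> {})"

text \<open>The bijections between isomorphisms \<open>A \<rightarrow> B\<close>, one for each \<open>A\<close> and \<open>B\<close>, are combined into
  one map \<open>\<phi>\<close>.\<close>

definition has_shared_isos :: "('o, 'h, 'v, 's) dblcat \<Rightarrow> bool" where
  "has_shared_isos D \<longleftrightarrow> (\<exists>\<phi>.
     (\<forall>A\<in>Ob (hor D). \<forall>B\<in>Ob (hor D). bij_betw \<phi> (isos (hor D) A B) (isos (ver D) A B)) \<and>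
     (\<forall>A\<in>Ob (hor D). \<forall>A'\<in>Ob (hor D). \<forall>B\<in>Ob (hor D). \<forall>B'\<in>Ob (hor D).
      \<forall>f\<in>arrows (hor D) A A'. \<forall>g\<in>arrows (hor D) B B'.
      \<forall>h\<in>isos (hor D) A B. \<forall>k\<in>isos (hor D) A' B'.
        (cmp (hor D) k f = cmp (hor D) g h \<longleftrightarrow> (\<exists>s. s \<in> squares D f (\<phi> h) (\<phi> k) g)) \<and>
        (\<forall>s\<in>squares D f (\<phi> h) (\<phi> k) g. \<forall>t\<in>squares D f (\<phi> h) (\<phi> k) g. s = t)) \<and>
     (\<forall>A\<in>Ob (hor D). \<forall>A'\<in>Ob (hor D). \<forall>B\<in>Ob (hor D). \<forall>B'\<in>Ob (hor D).
      \<forall>u\<in>arrows (ver D) A B. \<forall>u'\<in>arrows (ver D) A' B'.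
      \<forall>h\<in>isos (hor D) A A'. \<forall>k\<in>isos (hor D) B B'.
        (cmp (ver D) u' (\<phi> h) = cmp (ver D) (\<phi> k) u \<longleftrightarrow> (\<exists>s. s \<in> squares D h u u' k)) \<and>
        (\<forall>s\<in>squares D h u u' k. \<forall>t\<in>squares D h u u' k. s = t)))"

definition natural_horizontal ::
  "('o, 'h, 'v, 's) dblcat \<Rightarrow> ('p, 'k, 'w, 't) dblcat \<Rightarrow>
   ('o, 'h, 'v, 's, 'p, 'k, 'w, 't) dfun \<Rightarrow> ('o, 'h, 'v, 's, 'p, 'k, 'w, 't) dfun \<Rightarrow>
   ('o \<Rightarrow> 'k) \<Rightarrow> bool" where
  "natural_horizontal C D F G \<theta> \<longleftrightarrow>
     (\<forall>A\<in>Ob (hor C). \<theta> A \<in> arrows (hor D) (on_ob F A) (on_ob G A)) \<and>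
     (\<forall>f\<in>Ar (hor C). cmp (hor D) (\<theta> (trg (hor C) f)) (on_hor F f) =
                     cmp (hor D) (on_hor G f) (\<theta> (src (hor C) f))) \<and>
     (\<exists>\<eta>. (\<forall>u\<in>Ar (ver C). \<eta> u \<in> squares D (\<theta> (src (ver C) u)) (on_ver F u) (on_ver G u)
                                     (\<theta> (trg (ver C) u))) \<and>
          (\<forall>A\<in>Ob (ver C). \<eta> (ident (ver C) A) = ident (vsq D) (\<theta> A)) \<and>
          (\<forall>u\<in>Ar (ver C). \<forall>w\<in>Ar (ver C). src (ver C) w = trg (ver C) u \<longrightarrow>
             \<eta> (cmp (ver C) w u) = cmp (vsq D) (\<eta> w) (\<eta> u)) \<and>
          (\<forall>\<sigma>\<in>Sq C. cmp (hsq D) (\<eta> (right_edge C \<sigma>)) (on_sq F \<sigma>) =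
                     cmp (hsq D) (on_sq G \<sigma>) (\<eta> (left_edge C \<sigma>))))"

definition natural_vertical ::
  "('o, 'h, 'v, 's) dblcat \<Rightarrow> ('p, 'k, 'w, 't) dblcat \<Rightarrow>
   ('o, 'h, 'v, 's, 'p, 'k, 'w, 't) dfun \<Rightarrow> ('o, 'h, 'v, 's, 'p, 'k, 'w, 't) dfun \<Rightarrow>
   ('o \<Rightarrow> 'w) \<Rightarrow> bool" where
  "natural_vertical C D F G \<theta> \<longleftrightarrow>
     (\<forall>A\<in>Ob (ver C). \<theta> A \<in> arrows (ver D) (on_ob F A) (on_ob G A)) \<and>
     (\<forall>u\<in>Ar (ver C). cmp (ver D) (\<theta> (trg (ver C) u)) (on_ver F u) =
                     cmp (ver D) (on_ver G u) (\<theta> (src (ver C) u))) \<and>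
     (\<exists>\<eta>. (\<forall>f\<in>Ar (hor C). \<eta> f \<in> squares D (on_hor F f) (\<theta> (src (hor C) f))
                                     (\<theta> (trg (hor C) f)) (on_hor G f)) \<and>
          (\<forall>A\<in>Ob (hor C). \<eta> (ident (hor C) A) = ident (hsq D) (\<theta> A)) \<and>
          (\<forall>f\<in>Ar (hor C). \<forall>g\<in>Ar (hor C). src (hor C) g = trg (hor C) f \<longrightarrow>
             \<eta> (cmp (hor C) g f) = cmp (hsq D) (\<eta> g) (\<eta> f)) \<and>
          (\<forall>\<sigma>\<in>Sq C. cmp (vsq D) (\<eta> (bottom_edge C \<sigma>)) (on_sq F \<sigma>) =
                     cmp (vsq D) (on_sq G \<sigma>) (\<eta> (top_edge C \<sigma>))))"

definition natural_shared_isos ::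
  "('o, 'h, 'v, 's) dblcat \<Rightarrow> ('p, 'k, 'w, 't) dblcat \<Rightarrow>
   ('o, 'h, 'v, 's, 'p, 'k, 'w, 't) dfun \<Rightarrow> ('o, 'h, 'v, 's, 'p, 'k, 'w, 't) dfun \<Rightarrow>
   (('o \<Rightarrow> 'k) \<times> ('o \<Rightarrow> 'w)) set" where
  "natural_shared_isos C D F G = {(\<theta>, \<theta>').
     \<theta> \<in> extensional (Ob (hor C)) \<and> \<theta>' \<in> extensional (Ob (hor C)) \<and>
     (\<forall>A\<in>Ob (hor C). shared_iso D (\<theta> A) (\<theta>' A)) \<and>
     natural_horizontal C D F G \<theta> \<and> natural_vertical C D F G \<theta>'}"

text \<open>An arrow of the groupoid of double functors carries its source and target.\<close>

type_synonym ('o, 'h, 'v, 's, 'p, 'k, 'w, 't) dfun_arrow =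
  "('o, 'h, 'v, 's, 'p, 'k, 'w, 't) dfun \<times> ('o, 'h, 'v, 's, 'p, 'k, 'w, 't) dfun \<times>
   ('o \<Rightarrow> 'k) \<times> ('o \<Rightarrow> 'w)"

definition dfun_groupoid ::
  "('o, 'h, 'v, 's) dblcat \<Rightarrow> ('p, 'k, 'w, 't) dblcat \<Rightarrow>
   (('o, 'h, 'v, 's, 'p, 'k, 'w, 't) dfun, ('o, 'h, 'v, 's, 'p, 'k, 'w, 't) dfun_arrow) cat" where
  "dfun_groupoid C D = \<lparr>
     Ob = double_functors C D,
     Ar = {(F, G, \<theta>). F \<in> double_functors C D \<and> G \<in> double_functors C D \<and>
                       \<theta> \<in> natural_shared_isos C D F G},
     src = (\<lambda>(F, G, \<theta>). F),
     trg = (\<lambda>(F, G, \<theta>). G),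
     ident = (\<lambda>F. (F, F, (\<lambda>A\<in>Ob (hor C). ident (hor D) (on_ob F A)),
                         (\<lambda>A\<in>Ob (hor C). ident (ver D) (on_ob F A)))),
     cmp = (\<lambda>(G, H, \<kappa>, \<kappa>') (F, G', \<theta>, \<theta>').
              (F, H, (\<lambda>A\<in>Ob (hor C). cmp (hor D) (\<kappa> A) (\<theta> A)),
                     (\<lambda>A\<in>Ob (hor C). cmp (ver D) (\<kappa>' A) (\<theta>' A))))\<rparr>"


section \<open>The grids\<close>

definition box_product :: "('a, 'f) cat \<Rightarrow> ('b, 'u) cat \<Rightarrow> ('a \<times> 'b, 'f \<times> 'b, 'a \<times> 'u, 'f \<times> 'u) dblcat" where
  "box_product C E = \<lparr>
     hor = \<lparr>Ob = Ob C \<times> Ob E, Ar = Ar C \<times> Ob E,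
            src = (\<lambda>(f, b). (src C f, b)), trg = (\<lambda>(f, b). (trg C f, b)),
            ident = (\<lambda>(a, b). (ident C a, b)), cmp = (\<lambda>(g, b) (f, b'). (cmp C g f, b))\<rparr>,
     ver = \<lparr>Ob = Ob C \<times> Ob E, Ar = Ob C \<times> Ar E,
            src = (\<lambda>(a, u). (a, src E u)), trg = (\<lambda>(a, u). (a, trg E u)),
            ident = (\<lambda>(a, b). (a, ident E b)), cmp = (\<lambda>(a, w) (a', u). (a, cmp E w u))\<rparr>,
     hsq = \<lparr>Ob = Ob C \<times> Ar E, Ar = Ar C \<times> Ar E,
            src = (\<lambda>(f, u). (src C f, u)), trg = (\<lambda>(f, u). (trg C f, u)),
            ident = (\<lambda>(a, u). (ident C a, u)), cmp = (\<lambda>(g, u) (f, u'). (cmp C g f, u))\<rparr>,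
     vsq = \<lparr>Ob = Ar C \<times> Ob E, Ar = Ar C \<times> Ar E,
            src = (\<lambda>(f, u). (f, src E u)), trg = (\<lambda>(f, u). (f, trg E u)),
            ident = (\<lambda>(f, b). (f, ident E b)), cmp = (\<lambda>(f, w) (f', u). (f, cmp E w u))\<rparr>\<rparr>"

text \<open>\<open>[m] \<boxtimes> [n]\<close>, the free double category on an \<open>m \<times> n\<close> grid of squares, in its explicit
  form: the squares freely composed from the generating ones are the subrectangles
  \<open>[i, i'] \<times> [j, j']\<close>. The object \<open>(i, j)\<close> lies in column \<open>i\<close> and row \<open>j\<close>, rows counted from
  the top.\<close>

type_synonym ('o, 'h, 'v, 's) grid_dfun =
  "(nat \<times> nat, (nat \<times> nat) \<times> nat, nat \<times> nat \<times> nat, (nat \<times> nat) \<times> nat \<times> nat, 'o, 'h, 'v, 's) dfun"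

type_synonym ('o, 'h, 'v, 's) grid_arrow =
  "(nat \<times> nat, (nat \<times> nat) \<times> nat, nat \<times> nat \<times> nat, (nat \<times> nat) \<times> nat \<times> nat, 'o, 'h, 'v, 's)
     dfun_arrow"

type_synonym grid_dblcat =
  "(nat \<times> nat, (nat \<times> nat) \<times> nat, nat \<times> nat \<times> nat, (nat \<times> nat) \<times> nat \<times> nat) dblcat"

definition grid :: "nat \<Rightarrow> nat \<Rightarrow> grid_dblcat" where
  "grid m n = box_product (ordinal m) (ordinal n)"

definition grid_map ::
  "nat \<Rightarrow> nat \<Rightarrow> (nat \<Rightarrow> nat) \<Rightarrow> (nat \<Rightarrow> nat) \<Rightarrow>
   (nat \<times> nat, (nat \<times> nat) \<times> nat, nat \<times> nat \<times> nat, (nat \<times> nat) \<times> nat \<times> nat) grid_dfun" where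
  "grid_map m n \<alpha> \<beta> = \<lparr>
     on_ob = restrict (map_prod \<alpha> \<beta>) (Ob (hor (grid m n))),
     on_hor = restrict (map_prod (map_prod \<alpha> \<alpha>) \<beta>) (Ar (hor (grid m n))),
     on_ver = restrict (map_prod \<alpha> (map_prod \<beta> \<beta>)) (Ar (ver (grid m n))),
     on_sq = restrict (map_prod (map_prod \<alpha> \<alpha>) (map_prod \<beta> \<beta>)) (Sq (grid m n))\<rparr>"

text \<open>The double functor \<open>[0] \<boxtimes> [0] \<rightarrow> D\<close> given by an object, and the double functor
  \<open>[1] \<boxtimes> [1] \<rightarrow> D\<close> given by a square.\<close>

definition object_dfun :: "('o, 'h, 'v, 's) dblcat \<Rightarrow> 'o \<Rightarrow> ('o, 'h, 'v, 's) grid_dfun" where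
  "object_dfun D A = \<lparr>
     on_ob = (\<lambda>_\<in>Ob (hor (grid 0 0)). A),
     on_hor = (\<lambda>_\<in>Ar (hor (grid 0 0)). ident (hor D) A),
     on_ver = (\<lambda>_\<in>Ar (ver (grid 0 0)). ident (ver D) A),
     on_sq = (\<lambda>_\<in>Sq (grid 0 0). ident (hsq D) (ident (ver D) A))\<rparr>"

definition square_dfun :: "('o, 'h, 'v, 's) dblcat \<Rightarrow> 's \<Rightarrow> ('o, 'h, 'v, 's) grid_dfun" where
  "square_dfun D s =
     (let row = (\<lambda>j. if j = (0::nat) then top_edge D s else bottom_edge D s);
          column = (\<lambda>i. if i = (0::nat) then left_edge D s else right_edge D s);
          corner = (\<lambda>(i, j). if i = (0::nat) then src (hor D) (row j) else trg (hor D) (row j))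
      in \<lparr>on_ob = restrict corner (Ob (hor (grid 1 1))),
          on_hor = (\<lambda>((i, i'), j)\<in>Ar (hor (grid 1 1)).
                      if i < i' then row j else ident (hor D) (corner (i, j))),
          on_ver = (\<lambda>(i, (j, j'))\<in>Ar (ver (grid 1 1)).
                      if j < j' then column i else ident (ver D) (corner (i, j))),
          on_sq = (\<lambda>((i, i'), (j, j'))\<in>Sq (grid 1 1).
                      if i < i' \<and> j < j' then s
                      else if i < i' then ident (vsq D) (row j)
                      else if j < j' then ident (hsq D) (column i)
                      else ident (hsq D) (ident (ver D) (corner (i, j))))\<rparr>)"


section \<open>Reverse CGW categories\<close>

definition zero_object :: "('o, 'h, 'v, 's) dblcat \<Rightarrow> 'o \<Rightarrow> bool" where
  "zero_object D A \<longleftrightarrow> initial (hor D) A \<and> terminal (ver D) A"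

definition pointed_dblcat :: "('o, 'h, 'v, 's) dblcat \<Rightarrow> bool" where
  "pointed_dblcat D \<longleftrightarrow> (\<exists>A. zero_object D A)"

definition monic_epic :: "('o, 'h, 'v, 's) dblcat \<Rightarrow> bool" where
  "monic_epic D \<longleftrightarrow>
     (\<forall>f\<in>Ar (hor D). monic (hor D) f) \<and> (\<forall>u\<in>Ar (ver D). epic (ver D) u)"

text \<open>Isomorphisms from the square \<open>s\<close> to the square \<open>t\<close> that are the identity at the corners in
  \<open>P\<close>.\<close>

definition square_isos_fixing ::
  "('o, 'h, 'v, 's) dblcat \<Rightarrow> (nat \<times> nat) set \<Rightarrow> 's \<Rightarrow> 's \<Rightarrow>
   ((nat \<times> nat \<Rightarrow> 'h) \<times> (nat \<times> nat \<Rightarrow> 'v)) set" where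
  "square_isos_fixing D P s t =
     {(\<theta>, \<theta>') \<in> natural_shared_isos (grid 1 1) D (square_dfun D s) (square_dfun D t).
        \<forall>p\<in>P. \<theta> p = ident (hor D) (on_ob (square_dfun D s) p) \<and>
              \<theta>' p = ident (ver D) (on_ob (square_dfun D s) p)}"

definition extends_uniquely ::
  "('o, 'h, 'v, 's) dblcat \<Rightarrow> (nat \<times> nat) set \<Rightarrow> 's set \<Rightarrow> bool" where
  "extends_uniquely D P X \<longleftrightarrow>
     X \<noteq> {} \<and> (\<forall>s\<in>X. \<forall>t\<in>X. \<exists>!\<theta>. \<theta> \<in> square_isos_fixing D P s t)"

definition square_extension :: "('o, 'h, 'v, 's) dblcat \<Rightarrow> bool" where
  "square_extension D \<longleftrightarrow>
     (\<forall>h\<in>Ar (ver D). \<forall>f\<in>Ar (hor D). src (ver D) h = src (hor D) f \<longrightarrow>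
        extends_uniquely D {(0, 0), (1, 0), (0, 1)}
          {s \<in> Sq D. left_edge D s = h \<and> top_edge D s = f}) \<and>
     (\<forall>g\<in>Ar (hor D). \<forall>k\<in>Ar (ver D). trg (hor D) g = trg (ver D) k \<longrightarrow>
        extends_uniquely D {(0, 1), (1, 1), (1, 0)}
          {s \<in> Sq D. bottom_edge D s = g \<and> right_edge D s = k})"

definition reverse_CGW :: "('o, 'h, 'v, 's) dblcat \<Rightarrow> bool" where
  "reverse_CGW D \<longleftrightarrow> double_category D \<and> has_shared_isos D \<and> monic_epic D \<and>
     pointed_dblcat D \<and> square_extension D"


section \<open>Simplicial sets and weak equivalences\<close>

definition Delta :: "nat \<Rightarrow> nat \<Rightarrow> (nat \<Rightarrow> nat) set" where
  "Delta m n = {\<alpha> \<in> {..m} \<rightarrow>\<^sub>E {..n}. mono_on {..m} \<alpha>}"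

definition Delta_id :: "nat \<Rightarrow> nat \<Rightarrow> nat" where
  "Delta_id n = (\<lambda>i\<in>{..n}. i)"

text \<open>\<open>restr X m n \<alpha>\<close> is the map \<open>X\<^sub>n \<rightarrow> X\<^sub>m\<close> induced by \<open>\<alpha> : [m] \<rightarrow> [n]\<close>.\<close>

record 'a sset =
  cells :: "nat \<Rightarrow> 'a set"
  restr :: "nat \<Rightarrow> nat \<Rightarrow> (nat \<Rightarrow> nat) \<Rightarrow> 'a \<Rightarrow> 'a"

definition simplicial_set :: "'a sset \<Rightarrow> bool" where
  "simplicial_set X \<longleftrightarrow>
     (\<forall>m n. \<forall>\<alpha>\<in>Delta m n. \<forall>x\<in>cells X n. restr X m n \<alpha> x \<in> cells X m) \<and>
     (\<forall>n. \<forall>x\<in>cells X n. restr X n n (Delta_id n) x = x) \<and>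
     (\<forall>l m n. \<forall>\<alpha>\<in>Delta l m. \<forall>\<beta>\<in>Delta m n. \<forall>x\<in>cells X n.
        restr X l n (compose {..l} \<beta> \<alpha>) x = restr X l m \<alpha> (restr X m n \<beta> x))"

definition simplicial_map :: "'a sset \<Rightarrow> 'b sset \<Rightarrow> (nat \<Rightarrow> 'a \<Rightarrow> 'b) \<Rightarrow> bool" where
  "simplicial_map X Y f \<longleftrightarrow>
     (\<forall>n. \<forall>x\<in>cells X n. f n x \<in> cells Y n) \<and>
     (\<forall>m n. \<forall>\<alpha>\<in>Delta m n. \<forall>x\<in>cells X n. f m (restr X m n \<alpha> x) = restr Y m n \<alpha> (f n x))"

text \<open>The geometric realization is the quotient of the topological sum of the simplices
  \<open>X\<^sub>n \<times> \<Delta>\<^sup>n\<close> by the equivalence relation generated by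
  \<open>(\<alpha>\<^sup>* x, t) \<sim> (x, \<alpha>\<^sub>* t)\<close>.\<close>

definition simplex_pushforward :: "nat \<Rightarrow> (nat \<Rightarrow> nat) \<Rightarrow> (nat \<Rightarrow> real) \<Rightarrow> nat \<Rightarrow> real" where
  "simplex_pushforward m \<alpha> t = (\<lambda>j. \<Sum>i | i \<le> m \<and> \<alpha> i = j. t i)"

definition simplex_sum :: "'a sset \<Rightarrow> ((nat \<times> 'a) \<times> (nat \<Rightarrow> real)) topology" where
  "simplex_sum X =
     sum_topology (\<lambda>(n, x). subtopology (powertop_real UNIV) (standard_simplex n))
       (SIGMA n:UNIV. cells X n)"

definition glue :: "'a sset \<Rightarrow> ((nat \<times> 'a) \<times> (nat \<Rightarrow> real)) rel" where
  "glue X = {(((m, restr X m n \<alpha> x), t), ((n, x), simplex_pushforward m \<alpha> t)) | m n \<alpha> x t.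
     \<alpha> \<in> Delta m n \<and> x \<in> cells X n \<and> t \<in> standard_simplex m}"

definition realization_point ::
  "'a sset \<Rightarrow> (nat \<times> 'a) \<times> (nat \<Rightarrow> real) \<Rightarrow> ((nat \<times> 'a) \<times> (nat \<Rightarrow> real)) set" where
  "realization_point X p = {q \<in> topspace (simplex_sum X). (p, q) \<in> (glue X \<union> (glue X)\<inverse>)\<^sup>*}"

definition realization :: "'a sset \<Rightarrow> ((nat \<times> 'a) \<times> (nat \<Rightarrow> real)) set topology" where
  "realization X = topology (\<lambda>U. U \<subseteq> realization_point X ` topspace (simplex_sum X) \<and>
     openin (simplex_sum X) {p \<in> topspace (simplex_sum X). realization_point X p \<in> U})"

lemma openin_realization:
  "openin (realization X) U \<longleftrightarrow> U \<subseteq> realization_point X ` topspace (simplex_sum X) \<and>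
     openin (simplex_sum X) {p \<in> topspace (simplex_sum X). realization_point X p \<in> U}"
proof -
  let ?S = "topspace (simplex_sum X)" and ?q = "realization_point X"
  have "istopology (\<lambda>U. U \<subseteq> ?q ` ?S \<and> openin (simplex_sum X) {p \<in> ?S. ?q p \<in> U})"
    unfolding istopology_def
  proof (rule conjI; intro allI impI conjI)
    fix S T
    assume S: "S \<subseteq> ?q ` ?S \<and> openin (simplex_sum X) {p \<in> ?S. ?q p \<in> S}"
      and T: "T \<subseteq> ?q ` ?S \<and> openin (simplex_sum X) {p \<in> ?S. ?q p \<in> T}"
    have "{p \<in> ?S. ?q p \<in> S \<inter> T} = {p \<in> ?S. ?q p \<in> S} \<inter> {p \<in> ?S. ?q p \<in> T}" by auto
    then show "openin (simplex_sum X) {p \<in> ?S. ?q p \<in> S \<inter> T}" using S T by auto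
    show "S \<inter> T \<subseteq> ?q ` ?S" using S by blast
  next
    fix K
    assume K: "\<forall>S\<in>K. S \<subseteq> ?q ` ?S \<and> openin (simplex_sum X) {p \<in> ?S. ?q p \<in> S}"
    have "{p \<in> ?S. ?q p \<in> \<Union> K} = (\<Union>S\<in>K. {p \<in> ?S. ?q p \<in> S})" by auto
    then show "openin (simplex_sum X) {p \<in> ?S. ?q p \<in> \<Union> K}" using K by auto
    show "\<Union> K \<subseteq> ?q ` ?S" using K by blast
  qed
  then show ?thesis
    by (simp add: realization_def)
qed

lemma quotient_map_realization:
  "quotient_map (simplex_sum X) (realization X) (realization_point X)"
proof -
  let ?P = "realization_point X ` topspace (simplex_sum X)"
  have "{p \<in> topspace (simplex_sum X). realization_point X p \<in> ?P} = topspace (simplex_sum X)"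
    by auto
  then have "openin (realization X) ?P"
    by (simp add: openin_realization)
  moreover have "topspace (realization X) \<subseteq> ?P"
    using openin_topspace[of "realization X"] unfolding openin_realization by (rule conjunct1)
  ultimately have "topspace (realization X) = ?P"
    by (intro subset_antisym openin_subset)
  then show ?thesis
    by (simp add: quotient_map_def openin_realization)
qed

text \<open>The union below is over equal sets when \<open>f\<close> is a simplicial map.\<close>

definition realization_map ::
  "'b sset \<Rightarrow> (nat \<Rightarrow> 'a \<Rightarrow> 'b) \<Rightarrow> ((nat \<times> 'a) \<times> (nat \<Rightarrow> real)) set \<Rightarrow>
   ((nat \<times> 'b) \<times> (nat \<Rightarrow> real)) set" where
  "realization_map Y f c = (\<Union>((n, x), t)\<in>c. realization_point Y ((n, f n x), t))"

definition homotopy_equivalence :: "'a topology \<Rightarrow> 'b topology \<Rightarrow> ('a \<Rightarrow> 'b) \<Rightarrow> bool" where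
  "homotopy_equivalence X Y f \<longleftrightarrow> continuous_map X Y f \<and>
     (\<exists>g. continuous_map Y X g \<and>
          homotopic_with (\<lambda>_. True) X X (g \<circ> f) id \<and>
          homotopic_with (\<lambda>_. True) Y Y (f \<circ> g) id)"

definition weak_equivalence :: "'a sset \<Rightarrow> 'b sset \<Rightarrow> (nat \<Rightarrow> 'a \<Rightarrow> 'b) \<Rightarrow> bool" where
  "weak_equivalence X Y f \<longleftrightarrow>
     simplicial_set X \<and> simplicial_set Y \<and> simplicial_map X Y f \<and>
     homotopy_equivalence (realization X) (realization Y) (realization_map Y f)"

text \<open>The library's \<open>contractible_space\<close> holds for the empty space.\<close>

definition contractible_sset :: "'a sset \<Rightarrow> bool" where
  "contractible_sset X \<longleftrightarrow>
     simplicial_set X \<and> topspace (realization X) \<noteq> {} \<and> contractible_space (realization X)"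

definition pullback_sset ::
  "'a sset \<Rightarrow> 'b sset \<Rightarrow> (nat \<Rightarrow> 'a \<Rightarrow> 'c) \<Rightarrow> (nat \<Rightarrow> 'b \<Rightarrow> 'c) \<Rightarrow> ('a \<times> 'b) sset" where
  "pullback_sset X Y p q = \<lparr>
     cells = (\<lambda>n. {(x, y). x \<in> cells X n \<and> y \<in> cells Y n \<and> p n x = q n y}),
     restr = (\<lambda>m n \<alpha>. map_prod (restr X m n \<alpha>) (restr Y m n \<alpha>))\<rparr>"

text \<open>The \<open>n\<close>-fold fiber product of copies of \<open>X\<close>, the target \<open>q\<close> of each entry matching the
  source \<open>p\<close> of the next.\<close>

definition chain_sset ::
  "nat \<Rightarrow> 'a sset \<Rightarrow> (nat \<Rightarrow> 'a \<Rightarrow> 'c) \<Rightarrow> (nat \<Rightarrow> 'a \<Rightarrow> 'c) \<Rightarrow> (nat \<Rightarrow> 'a) sset" where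
  "chain_sset n X p q = \<lparr>
     cells = (\<lambda>l. {x \<in> {..<n} \<rightarrow>\<^sub>E cells X l. \<forall>i. Suc i < n \<longrightarrow> q l (x i) = p l (x (Suc i))}),
     restr = (\<lambda>l' l \<alpha> x. \<lambda>i\<in>{..<n}. restr X l' l \<alpha> (x i))\<rparr>"


section \<open>Bisimplicial spaces\<close>

text \<open>\<open>bact Y m n m' n' \<alpha> \<beta>\<close> is the simplicial map \<open>Y\<^bsub>m',n'\<^esub> \<rightarrow> Y\<^bsub>m,n\<^esub>\<close> induced by
  \<open>\<alpha> : [m] \<rightarrow> [m']\<close> and \<open>\<beta> : [n] \<rightarrow> [n']\<close>.\<close>

record 'a bispace =
  level :: "nat \<Rightarrow> nat \<Rightarrow> 'a sset"
  bact :: "nat \<Rightarrow> nat \<Rightarrow> nat \<Rightarrow> nat \<Rightarrow> (nat \<Rightarrow> nat) \<Rightarrow> (nat \<Rightarrow> nat) \<Rightarrow> nat \<Rightarrow> 'a \<Rightarrow> 'a"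

record ('a, 'b) preaug_bispace = "'a bispace" +
  base :: "'b sset"
  augmentation :: "nat \<Rightarrow> 'b \<Rightarrow> 'a"

definition bisimplicial_space :: "('a, 'z) bispace_scheme \<Rightarrow> bool" where
  "bisimplicial_space Y \<longleftrightarrow>
     (\<forall>m n. simplicial_set (level Y m n)) \<and>
     (\<forall>m n m' n'. \<forall>\<alpha>\<in>Delta m m'. \<forall>\<beta>\<in>Delta n n'.
        simplicial_map (level Y m' n') (level Y m n) (bact Y m n m' n' \<alpha> \<beta>)) \<and>
     (\<forall>m n l. \<forall>x\<in>cells (level Y m n) l. bact Y m n m n (Delta_id m) (Delta_id n) l x = x) \<and>
     (\<forall>m n m' n' m'' n''. \<forall>\<alpha>\<in>Delta m m'. \<forall>\<beta>\<in>Delta n n'. \<forall>\<alpha>'\<in>Delta m' m''. \<forall>\<beta>'\<in>Delta n' n''.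
        \<forall>l. \<forall>x\<in>cells (level Y m'' n'') l.
          bact Y m n m'' n'' (compose {..m} \<alpha>' \<alpha>) (compose {..n} \<beta>' \<beta>) l x =
          bact Y m n m' n' \<alpha> \<beta> l (bact Y m' n' m'' n'' \<alpha>' \<beta>' l x))"

text \<open>\<open>vertex i : [0] \<rightarrow> [n]\<close> picks \<open>i\<close>, and \<open>edge i : [1] \<rightarrow> [n]\<close> picks \<open>i \<le> i + 1\<close>.\<close>

definition vertex :: "nat \<Rightarrow> nat \<Rightarrow> nat" where
  "vertex i = (\<lambda>_\<in>{..0}. i)"

definition edge :: "nat \<Rightarrow> nat \<Rightarrow> nat" where
  "edge i = (\<lambda>x\<in>{..1}. i + x)"

text \<open>The restriction of \<open>Y\<^bsub>1,k\<^esub>\<close> to its horizontal source (\<open>i = 0\<close>) or target (\<open>i = 1\<close>), and of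
  \<open>Y\<^bsub>l,1\<^esub>\<close> to its vertical source or target.\<close>

definition h_end :: "('a, 'z) bispace_scheme \<Rightarrow> nat \<Rightarrow> nat \<Rightarrow> nat \<Rightarrow> 'a \<Rightarrow> 'a" where
  "h_end Y k i = bact Y 0 k 1 k (vertex i) (Delta_id k)"

definition v_end :: "('a, 'z) bispace_scheme \<Rightarrow> nat \<Rightarrow> nat \<Rightarrow> nat \<Rightarrow> 'a \<Rightarrow> 'a" where
  "v_end Y l i = bact Y l 0 l 1 (Delta_id l) (vertex i)"

definition h_segal_map :: "('a, 'z) bispace_scheme \<Rightarrow> nat \<Rightarrow> nat \<Rightarrow> nat \<Rightarrow> 'a \<Rightarrow> nat \<Rightarrow> 'a" where
  "h_segal_map Y n k = (\<lambda>r x. \<lambda>i\<in>{..<n}. bact Y 1 k n k (edge i) (Delta_id k) r x)"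

definition v_segal_map :: "('a, 'z) bispace_scheme \<Rightarrow> nat \<Rightarrow> nat \<Rightarrow> nat \<Rightarrow> 'a \<Rightarrow> nat \<Rightarrow> 'a" where
  "v_segal_map Y l m = (\<lambda>r x. \<lambda>i\<in>{..<m}. bact Y l 1 l m (Delta_id l) (edge i) r x)"

definition double_segal_space :: "('a, 'z) bispace_scheme \<Rightarrow> bool" where
  "double_segal_space Y \<longleftrightarrow> bisimplicial_space Y \<and>
     (\<forall>n\<ge>2. \<forall>k. weak_equivalence (level Y n k)
        (chain_sset n (level Y 1 k) (h_end Y k 0) (h_end Y k 1)) (h_segal_map Y n k)) \<and>
     (\<forall>m\<ge>2. \<forall>l. weak_equivalence (level Y l m)
        (chain_sset m (level Y l 1) (v_end Y l 0) (v_end Y l 1)) (v_segal_map Y l m))"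

text \<open>In \<open>Y\<^bsub>1,1\<^esub>\<close>, the left and right edges are the horizontal ends \<open>0\<close> and \<open>1\<close>, lying in
  \<open>Y\<^bsub>0,1\<^esub>\<close>; the top and bottom edges are the vertical ends \<open>0\<close> and \<open>1\<close>, lying in \<open>Y\<^bsub>1,0\<^esub>\<close>.\<close>

definition stable_bispace :: "('a, 'z) bispace_scheme \<Rightarrow> bool" where
  "stable_bispace Y \<longleftrightarrow>
     weak_equivalence (level Y 1 1)
       (pullback_sset (level Y 0 1) (level Y 1 0) (v_end Y 0 0) (h_end Y 0 0))
       (\<lambda>r x. (h_end Y 1 0 r x, v_end Y 1 0 r x)) \<and>
     weak_equivalence (level Y 1 1)
       (pullback_sset (level Y 1 0) (level Y 0 1) (h_end Y 0 1) (v_end Y 0 1))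
       (\<lambda>r x. (v_end Y 1 1 r x, h_end Y 1 1 r x))"

definition preaugmented :: "('a, 'b) preaug_bispace \<Rightarrow> bool" where
  "preaugmented Y \<longleftrightarrow> bisimplicial_space Y \<and> simplicial_set (base Y) \<and>
     simplicial_map (base Y) (level Y 0 0) (augmentation Y)"

definition pointed_bispace :: "('a, 'b) preaug_bispace \<Rightarrow> bool" where
  "pointed_bispace Y \<longleftrightarrow> contractible_sset (base Y) \<and>
     weak_equivalence (pullback_sset (level Y 1 0) (base Y) (h_end Y 0 0) (augmentation Y))
       (level Y 0 0) (\<lambda>r (x, y). h_end Y 0 1 r x) \<and>
     weak_equivalence (pullback_sset (level Y 0 1) (base Y) (v_end Y 0 1) (augmentation Y))
       (level Y 0 0) (\<lambda>r (x, y). v_end Y 0 0 r x)"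

definition pointed_stable_double_segal_space :: "('a, 'b) preaug_bispace \<Rightarrow> bool" where
  "pointed_stable_double_segal_space Y \<longleftrightarrow>
     preaugmented Y \<and> pointed_bispace Y \<and> stable_bispace Y \<and> double_segal_space Y"


section \<open>The classifying diagram\<close>

type_synonym ('o, 'm) nerve_simplex = "(nat \<Rightarrow> 'o) \<times> (nat \<times> nat \<Rightarrow> 'm)"

definition nerve :: "('o, 'm) cat \<Rightarrow> ('o, 'm) nerve_simplex sset" where
  "nerve C = \<lparr>
     cells = (\<lambda>n. functors (ordinal n) C),
     restr = (\<lambda>m n \<alpha> (P, Q).
       (compose (Ob (ordinal m)) P \<alpha>, compose (Ar (ordinal m)) Q (map_prod \<alpha> \<alpha>)))\<rparr>"

text \<open>The map of nerves induced by the functor with object part \<open>p\<close> and arrow part \<open>q\<close>.\<close>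

definition nerve_map ::
  "('o \<Rightarrow> 'p) \<Rightarrow> ('m \<Rightarrow> 'n) \<Rightarrow> nat \<Rightarrow> ('o, 'm) nerve_simplex \<Rightarrow> ('p, 'n) nerve_simplex" where
  "nerve_map p q = (\<lambda>n (P, Q). (compose (Ob (ordinal n)) p P, compose (Ar (ordinal n)) q Q))"

definition zero_groupoid :: "('o, 'h, 'v, 's) dblcat \<Rightarrow> ('o, 'h \<times> 'v) cat" where
  "zero_groupoid D = \<lparr>
     Ob = {A. zero_object D A},
     Ar = {(f, f'). shared_iso D f f' \<and>
             zero_object D (src (hor D) f) \<and> zero_object D (trg (hor D) f)},
     src = (\<lambda>(f, f'). src (hor D) f),
     trg = (\<lambda>(f, f'). trg (hor D) f),
     ident = (\<lambda>A. (ident (hor D) A, ident (ver D) A)),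
     cmp = (\<lambda>(g, g') (f, f'). (cmp (hor D) g f, cmp (ver D) g' f'))\<rparr>"

definition classifying_diagram ::
  "('o, 'h, 'v, 's) dblcat \<Rightarrow>
   ((('o, 'h, 'v, 's) grid_dfun, ('o, 'h, 'v, 's) grid_arrow) nerve_simplex,
    ('o, 'h \<times> 'v) nerve_simplex) preaug_bispace" where
  "classifying_diagram D = \<lparr>
     level = (\<lambda>m n. nerve (dfun_groupoid (grid m n) D)),
     bact = (\<lambda>m n m' n' \<alpha> \<beta>.
       (let pre = (\<lambda>F. dfun_compose (grid m n) F (grid_map m n \<alpha> \<beta>));
            P = Ob (hor (grid m n))
        in nerve_map pre (\<lambda>(F, G, \<theta>, \<theta>').
             (pre F, pre G, compose P \<theta> (map_prod \<alpha> \<beta>), compose P \<theta>' (map_prod \<alpha> \<beta>))))),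
     base = nerve (zero_groupoid D),
     augmentation = nerve_map (object_dfun D)
       (\<lambda>(f, f'). (object_dfun D (src (hor D) f), object_dfun D (trg (hor D) f),
                   (\<lambda>_\<in>Ob (hor (grid 0 0)). f), (\<lambda>_\<in>Ob (hor (grid 0 0)). f')))\<rparr>"

end

theory Submission
  imports Defs "HOL-Analysis.Abstract_Topological_Spaces"
begin

text \<open>The nerve turns groupoids into spaces faithfully enough: a functor of groupoids induces a weak
equivalence of nerves if and only if it is essentially surjective and fully faithful. One direction
is a linear homotopy between realizations of naturally isomorphic functors. For the other, arrows out
of a fixed object form a covering of the realized nerve, whose path lifting recovers an arrow from a
path; only essential surjectivity and fullness are needed, since faithfulness follows here from
monic and epic morphisms. The Segal maps are then isomorphisms, because the grids are free on their
unit squares. Since squares can be transported along isomorphisms of their edges, stability says that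
spans and cospans extend to squares, and isomorphisms of spans and cospans to isomorphisms of squares,
which is the axiom on square extensions. Pointedness amounts to the existence of a zero object.\<close>

section \<open>Geometric realization\<close>

text \<open>A weak equivalence is a homotopy equivalence of realizations, so its inverse and its
  homotopies are merely continuous and need not respect simplices. This obstacle shapes the
  converse: arrows can only be recovered by lifting, and the covering must be trivialized by open
  conditions on barycentric coordinates that survive all face and degeneracy identifications. The
  polynomials \<open>mass\<close> survive them, because a product of pushed forward coordinates
  expands into a sum of such products. Different arrows match disjoint sets of nondegenerate faces,
  so a strict majority is an open condition and is won by at most one arrow; hence the factor 2 in
  \<open>sheet\<close>. On the side of double categories all fibre products are strict, and the
  nerve preserves them, so no homotopy pullback appears. For spans the corner opposite to the
  prescribed edges is controlled by an epic vertical edge, for cospans by a monic horizontal one;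
  this also gives the uniqueness in the extension axiom.\<close>

abbreviation "rp \<equiv> realization_point"
abbreviation "rmap \<equiv> realization_map"
abbreviation "std \<equiv> standard_simplex"
abbreviation "push \<equiv> simplex_pushforward"
abbreviation "simplex_top n \<equiv> subtopology (powertop_real UNIV) (std n)"
abbreviation "cpath \<equiv> continuous_map (top_of_set {0..1::real})"
abbreviation "BN C \<equiv> realization (nerve C)"

section \<open>Monotone maps and simplicial sets\<close>

lemma mono_on_compose:
 assumes "al \<in> Delta l m" "bt \<in> Delta m n"
 shows "compose {..l} bt al \<in> Delta l n"
 using assms unfolding Delta_def
 by (auto simp: compose_def mono_on_def PiE_iff Pi_iff)

lemma Delta_le: "al \<in> Delta m n ==> i <= m ==> al i <= n"
 by (auto simp: Delta_def)

lemma Delta_mono: "al \<in> Delta m n ==> i <= j ==> j <= m ==> al i <= al j"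
 by (auto simp: Delta_def mono_on_def)

lemma DeltaI:
 assumes "!!i. i <= m ==> al i <= n" "!!i j. i <= j ==> j <= m ==> al i <= al j"
  "!!i. i > m ==> al i = undefined"
 shows "al \<in> Delta m n"
 using assms by (auto simp: Delta_def mono_on_def PiE_iff extensional_def)

lemma Delta_eqI:
 assumes "al \<in> Delta m n" "bt \<in> Delta m n'" "!!i. i <= m ==> al i = bt i"
 shows "al = bt"
 by (rule extensionalityI[of _ "{..m}"]) (use assms in \<open>auto simp: Delta_def PiE_def\<close>)

lemma Delta_id_mem: "Delta_id n \<in> Delta n n"
 by (auto simp: Delta_def Delta_id_def mono_on_def)

lemma finite_Delta: "finite (Delta m n)"
proof -
 have "Delta m n \<subseteq> {..m} \<rightarrow>\<^sub>E {..n}" by (auto simp: Delta_def)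
 then show ?thesis by (rule finite_subset) (auto intro: finite_PiE)
qed

lemma simplicial_set_restr:
 "simplicial_set X ==> al \<in> Delta m n ==> x \<in> cells X n ==> restr X m n al x \<in> cells X m"
 by (simp add: simplicial_set_def)

lemma simplicial_set_id: "simplicial_set X ==> x \<in> cells X n ==> restr X n n (Delta_id n) x = x"
 by (simp add: simplicial_set_def)

lemma simplicial_set_comp:
 "simplicial_set X ==> al \<in> Delta l m ==> bt \<in> Delta m n ==> x \<in> cells X n ==>
  restr X l m al (restr X m n bt x) = restr X l n (compose {..l} bt al) x"
 by (simp add: simplicial_set_def)

lemma simplicial_map_cells:
 "simplicial_map X Y f ==> x \<in> cells X n ==> f n x \<in> cells Y n"
 by (simp add: simplicial_map_def)

lemma simplicial_map_restr:
 "simplicial_map X Y f ==> al \<in> Delta m n ==> x \<in> cells X n ==>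
  f m (restr X m n al x) = restr Y m n al (f n x)"
 by (simp add: simplicial_map_def)

section \<open>Points of the realization and maps out of it\<close>

lemma topspace_simplex_sum:
 "topspace (simplex_sum X) = {((n, x), t). x \<in> cells X n & t \<in> std n}"
 by (auto simp: simplex_sum_def)

text \<open>Coordinates are regrouped along the fibres of \<open>al\<close>, which keeps them
  nonnegative and keeps their sum; beyond index \<open>n\<close> all fibres are empty.\<close>

lemma simplex_pushforward_mem:
 assumes "al \<in> Delta m n" "t \<in> std m"
 shows "push m al t \<in> std n"
proof -
 have t: "!!i. 0 <= t i" "(\<Sum>i\<le>m. t i) = 1"
  using assms by (auto simp: standard_simplex_def)
 have nn: "0 <= push m al t j" for j
  by (auto simp: simplex_pushforward_def intro: sum_nonneg t)
 have "push m al t j = 0" if "j > n" for j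
  using that Delta_le[OF assms(1)] unfolding simplex_pushforward_def
  by (intro sum.neutral) force
 moreover have sm: "(\<Sum>j\<le>n. push m al t j) = 1"
 proof -
  have "(\<Sum>j\<le>n. push m al t j) = (\<Sum>j\<in>{..n}. sum t {i\<in>{..m}. al i = j})"
   by (simp add: simplex_pushforward_def)
  also have "\<dots> = sum t {..m}"
   using Delta_le[OF assms(1)] by (intro sum.group) auto
  finally show ?thesis using t by simp
 qed
 moreover have "push m al t j <= 1" for j
 proof -
  have "push m al t j <= sum t {..m}"
   unfolding simplex_pushforward_def by (rule sum_mono2) (auto intro: t)
  then show ?thesis using t by simp
 qed
 ultimately show ?thesis using nn by (auto simp: standard_simplex_def)
qed

lemma glue_topspace:
 assumes "simplicial_set X" "(p, q) \<in> glue X"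
 shows "p \<in> topspace (simplex_sum X)" "q \<in> topspace (simplex_sum X)"
 using assms by (auto simp: glue_def topspace_simplex_sum intro: simplex_pushforward_mem simplicial_set_restr)

text \<open>The reflexive transitive closure of a symmetric relation is an equivalence, and
  \<open>realization_point\<close> is its class.\<close>

lemma realization_point_eq_iff:
 assumes "p \<in> topspace (simplex_sum X)" "q \<in> topspace (simplex_sum X)"
 shows "rp X p = rp X q \<longleftrightarrow> (p, q) \<in> (glue X \<union> (glue X)\<inverse>)\<^sup>*"
proof -
 have sym: "sym ((glue X \<union> (glue X)\<inverse>)\<^sup>*)"
  by (intro sym_rtrancl sym_Un_converse)
 show ?thesis
  using assms unfolding realization_point_def
  by (auto dest: symD[OF sym] intro: rtrancl_trans)
qed

lemma realization_point_restr:
 assumes X: "simplicial_set X" and "al \<in> Delta m n" "x \<in> cells X n" "t \<in> std m"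
 shows "rp X ((m, restr X m n al x), t) =
     rp X ((n, x), push m al t)"
proof -
 have g: "(((m, restr X m n al x), t), ((n, x), push m al t)) \<in> glue X"
  using assms by (auto simp: glue_def)
 show ?thesis
  by (subst realization_point_eq_iff) (use glue_topspace[OF X g] g in auto)
qed

text \<open>Induction along a chain of gluing steps, each taken in either direction. With a boolean
  \<open>h\<close> it says that a property of representatives is a property of points of the
  realization; the covering arguments use it mostly in this form.\<close>

lemma realization_point_cong:
 assumes glued: "!!m n al x t. al \<in> Delta m n ==> x \<in> cells X n ==> t \<in> std m ==>
   h ((m, restr X m n al x), t) = h ((n, x), push m al t)"
  and "p \<in> topspace (simplex_sum X)" "q \<in> topspace (simplex_sum X)"
  and "rp X p = rp X q"
 shows "h p = h q"
proof -
 have "(p, q) \<in> (glue X \<union> (glue X)\<inverse>)\<^sup>*"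
  using assms by (simp add: realization_point_eq_iff)
 then show ?thesis
 proof induction
  case (step y z)
  then show ?case by (auto simp: glue_def glued)
 qed simp
qed

lemma topspace_realization:
 "topspace (realization X) = rp X ` topspace (simplex_sum X)"
 using quotient_imp_surjective_map[OF quotient_map_realization] by metis

lemma continuous_map_simplex_sum:
 "continuous_map (simplex_sum X) T h \<longleftrightarrow>
  (\<forall>n. \<forall>x\<in>cells X n. continuous_map (simplex_top n) T (%t. h ((n, x), t)))"
 (is "?l \<longleftrightarrow> ?r")
proof
 assume l: ?l
 show ?r
 proof (intro allI ballI)
  fix n x assume x: "x \<in> cells X n"
  have "continuous_map (simplex_top n) (simplex_sum X) (%t. ((n, x), t))"
   using continuous_map_component_injection[of "(n, x)" "SIGMA n:UNIV. cells X n"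
     "%(n, x). simplex_top n"] x
   by (simp add: simplex_sum_def)
  from continuous_map_compose[OF this l]
  show "continuous_map (simplex_top n) T (%t. h ((n, x), t))"
   by (simp add: o_def)
 qed
next
 assume r: ?r
 show ?l
  unfolding continuous_map_def
 proof (intro conjI allI impI)
  show "h \<in> topspace (simplex_sum X) \<rightarrow> topspace T"
   using r by (auto simp: topspace_simplex_sum continuous_map_def Pi_iff)
  fix U assume U: "openin T U"
  have "openin (simplex_top n)
       {t. ((n, x), t) \<in> {p \<in> topspace (simplex_sum X). h p \<in> U}}" if x: "x \<in> cells X n" for n x
  proof -
   have "{t. ((n, x), t) \<in> {p \<in> topspace (simplex_sum X). h p \<in> U}} =
      {t \<in> topspace (simplex_top n). h ((n, x), t) \<in> U}"
    using x by (auto simp: topspace_simplex_sum)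
   then show ?thesis
    using r x U openin_continuous_map_preimage by fastforce
  qed
  then show "openin (simplex_sum X) {p \<in> topspace (simplex_sum X). h p \<in> U}"
   unfolding simplex_sum_def openin_sum_topology
   by (auto simp: topspace_simplex_sum simplex_sum_def)
 qed
qed

lemma continuous_map_realization:
 "continuous_map (realization X) T h \<longleftrightarrow> continuous_map (simplex_sum X) T (h \<circ> rp X)"
 by (simp add: continuous_compose_quotient_map_eq[OF quotient_map_realization])

lemma continuous_map_realization_point_cell:
 assumes "x \<in> cells X n"
 shows "continuous_map (simplex_top n) (realization X)
      (%t. rp X ((n, x), t))"
 by (rule iffD1[OF continuous_map_simplex_sum quotient_imp_continuous_map[OF quotient_map_realization],
   rule_format, OF assms])

text \<open>The union in \<open>realization_map\<close> runs over the representatives of one class.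
  A simplicial map sends glued representatives to glued ones, so the sets united are all equal to
  the one for the given representative.\<close>

lemma realization_map_point:
 assumes X: "simplicial_set X" and Y: "simplicial_set Y" and f: "simplicial_map X Y f"
  and x: "x \<in> cells X n" and t: "t \<in> std n"
 shows "rmap Y f (rp X ((n, x), t)) = rp Y ((n, f n x), t)"
proof -
 let ?h = "%((n, x), t). rp Y ((n, f n x), t)"
 let ?c = "rp X ((n, x), t)"
 have p: "((n, x), t) \<in> topspace (simplex_sum X)"
  using x t by (simp add: topspace_simplex_sum)
 then have pc: "((n, x), t) \<in> ?c"
  by (simp add: realization_point_def)
 have "?h q = ?h ((n, x), t)" if "q \<in> ?c" for q
 proof -
  have q: "q \<in> topspace (simplex_sum X)" and "(((n, x), t), q) \<in> (glue X \<union> (glue X)\<inverse>)\<^sup>*"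
   using that unfolding realization_point_def by blast+
  then have c: "rp X q = ?c"
   using realization_point_eq_iff[OF p] by metis
  show ?thesis
   by (rule realization_point_cong[OF _ q p c])
    (auto simp: simplicial_map_restr[OF f] realization_point_restr[OF Y] simplicial_map_cells[OF f])
 qed
 then have "(\<Union>q\<in>?c. ?h q) = ?h ((n, x), t)"
  using pc by blast
 moreover have "rmap Y f ?c = (\<Union>q\<in>?c. ?h q)"
  by (simp add: realization_map_def split_beta)
 ultimately show ?thesis by simp
qed

lemma realization_cases:
 assumes "c \<in> topspace (realization X)"
 obtains n x t where "x \<in> cells X n" "t \<in> std n" "c = rp X ((n, x), t)"
 using assms by (auto simp: topspace_realization topspace_simplex_sum)

lemma realization_point_mem:
 "x \<in> cells X n ==> t \<in> std n ==> rp X ((n, x), t) \<in> topspace (realization X)"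
 by (auto simp: topspace_realization topspace_simplex_sum)

lemma continuous_map_realization_map:
 assumes "simplicial_set X" "simplicial_set Y" "simplicial_map X Y f"
 shows "continuous_map (realization X) (realization Y) (rmap Y f)"
 unfolding continuous_map_realization continuous_map_simplex_sum
proof (intro allI ballI)
 fix n x assume x: "x \<in> cells X n"
 show "continuous_map (simplex_top n) (realization Y)
     (%t. (rmap Y f \<circ> rp X) ((n, x), t))"
  by (rule continuous_map_eq[OF continuous_map_realization_point_cell[of "f n x" Y n]])
   (use x assms in \<open>auto simp: realization_map_point simplicial_map_cells[OF assms(3)]\<close>)
qed

lemma simplicial_map_comp:
 "simplicial_map X Y f ==> simplicial_map Y Z g ==> simplicial_map X Z (%n. g n \<circ> f n)"
 by (auto simp: simplicial_map_def)

lemma realization_map_comp: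
 assumes "simplicial_set X" "simplicial_set Y" "simplicial_set Z" "simplicial_map X Y f" "simplicial_map Y Z g"
  and "c \<in> topspace (realization X)"
 shows "rmap Z (%n. g n \<circ> f n) c = rmap Z g (rmap Y f c)"
proof (rule realization_cases[OF assms(6)])
 fix n x t
 assume x: "x \<in> cells X n" and t: "t \<in> std n" and c: "c = rp X ((n, x), t)"
 show ?thesis
  unfolding c
  by (simp add: realization_map_point[OF assms(1,2,4) x t] t
   realization_map_point[OF assms(2,3,5) simplicial_map_cells[OF assms(4) x]]
   realization_map_point[OF assms(1,3) simplicial_map_comp[OF assms(4,5)] x t])
qed

lemma realization_map_cong:
 assumes "simplicial_set X" "simplicial_set Y" "simplicial_map X Y f" "!!n x. x \<in> cells X n ==> f n x = g n x"
  and "c \<in> topspace (realization X)"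
 shows "rmap Y f c = rmap Y g c"
proof -
 have "simplicial_map X Y g"
  using assms(1,3,4) unfolding simplicial_map_def by (metis simplicial_set_restr)
 then show ?thesis
  using assms by (elim realization_cases) (simp add: realization_map_point)
qed

lemma realization_map_id:
 assumes "simplicial_set X" "!!n x. x \<in> cells X n ==> f n x = x" "c \<in> topspace (realization X)"
 shows "rmap X f c = c"
proof -
 have "simplicial_map X X f"
  using assms(1,2) by (auto simp: simplicial_map_def simplicial_set_restr)
 then show ?thesis
  using assms by (elim realization_cases) (simp add: realization_map_point)
qed

section \<open>Homotopy equivalences and weak equivalences\<close>

lemma homotopy_equivalence_compose:
 assumes "homotopy_equivalence X Y f" "homotopy_equivalence Y Z g"
 shows "homotopy_equivalence X Z (g \<circ> f)"
proof -
 obtain f' where f: "continuous_map X Y f" "continuous_map Y X f'"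
   "homotopic_with (%_. True) X X (f' \<circ> f) id" "homotopic_with (%_. True) Y Y (f \<circ> f') id"
  using assms by (auto simp: homotopy_equivalence_def)
 obtain g' where g: "continuous_map Y Z g" "continuous_map Z Y g'"
   "homotopic_with (%_. True) Y Y (g' \<circ> g) id" "homotopic_with (%_. True) Z Z (g \<circ> g') id"
  using assms by (auto simp: homotopy_equivalence_def)
 note left = homotopic_with_compose_continuous_map_left[where p="%_. True" and q="%_. True"]
 note right = homotopic_with_compose_continuous_map_right[where p="%_. True" and q="%_. True"]
 have "homotopic_with (%_. True) X X (f' \<circ> ((g' \<circ> g) \<circ> f)) (f' \<circ> (id \<circ> f))"
  by (rule left[OF right[OF g(3) f(1)] f(2)]) simp_all
 then have "homotopic_with (%_. True) X X (f' \<circ> g' \<circ> (g \<circ> f)) (f' \<circ> f)"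
  by (simp add: o_assoc)
 then have 1: "homotopic_with (%_. True) X X (f' \<circ> g' \<circ> (g \<circ> f)) id"
  using f(3) by (rule homotopic_with_trans)
 have "homotopic_with (%_. True) Z Z (g \<circ> ((f \<circ> f') \<circ> g')) (g \<circ> (id \<circ> g'))"
  by (rule left[OF right[OF f(4) g(2)] g(1)]) simp_all
 then have "homotopic_with (%_. True) Z Z (g \<circ> f \<circ> (f' \<circ> g')) (g \<circ> g')"
  by (simp add: o_assoc)
 then have 2: "homotopic_with (%_. True) Z Z (g \<circ> f \<circ> (f' \<circ> g')) id"
  using g(4) by (rule homotopic_with_trans)
 show ?thesis
  unfolding homotopy_equivalence_def
  using 1 2 continuous_map_compose[OF f(1) g(1)] continuous_map_compose[OF g(2) f(2)] by blast
qed

text \<open>Maps built from \<open>realization_map\<close> are compared only on points of the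
  realization, not as functions on the whole type; therefore equality is asked on
  \<open>topspace X\<close>.\<close>

lemma homotopy_equivalence_cong:
 assumes "homotopy_equivalence X Y f" "!!x. x \<in> topspace X ==> f x = g x"
 shows "homotopy_equivalence X Y g"
proof -
 obtain f' where f: "continuous_map X Y f" "continuous_map Y X f'"
   "homotopic_with (%_. True) X X (f' \<circ> f) id" "homotopic_with (%_. True) Y Y (f \<circ> f') id"
  using assms by (auto simp: homotopy_equivalence_def)
 have "continuous_map X Y g" using f(1) assms(2) continuous_map_eq by blast
 moreover have "homotopic_with (%_. True) X X (f' \<circ> g) id"
  by (rule homotopic_with_eq[OF f(3)]) (simp_all add: assms(2))
 moreover have "homotopic_with (%_. True) Y Y (g \<circ> f') id"
  by (rule homotopic_with_eq[OF f(4)])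
   (use assms(2) continuous_map_image_subset_topspace[OF f(2)] in \<open>auto\<close>)
 ultimately show ?thesis using f(2) unfolding homotopy_equivalence_def by blast
qed

lemma weak_equivalence_compose:
 assumes "weak_equivalence X Y f" "weak_equivalence Y Z g"
  and "!!n x. x \<in> cells X n ==> h n x = g n (f n x)"
 shows "weak_equivalence X Z h"
proof -
 have s: "simplicial_set X" "simplicial_set Y" "simplicial_set Z" "simplicial_map X Y f" "simplicial_map Y Z g"
  using assms by (auto simp: weak_equivalence_def)
 have gf: "simplicial_map X Z (%n. g n \<circ> f n)"
  by (rule simplicial_map_comp[OF s(4,5)])
 then have h: "simplicial_map X Z h"
  using s(1) assms(3) by (auto simp: simplicial_map_def simplicial_set_restr)
 have "homotopy_equivalence (realization X) (realization Z) (rmap Z g \<circ> rmap Y f)"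
  using assms by (intro homotopy_equivalence_compose) (auto simp: weak_equivalence_def)
 then have "homotopy_equivalence (realization X) (realization Z) (rmap Z h)"
 proof (rule homotopy_equivalence_cong)
  fix c assume c: "c \<in> topspace (realization X)"
  have "rmap Z (%n. g n \<circ> f n) c = rmap Z h c"
   by (rule realization_map_cong[OF s(1,3) gf _ c]) (simp add: assms(3))
  then show "(rmap Z g \<circ> rmap Y f) c = rmap Z h c"
   using realization_map_comp[OF s c] by simp
 qed
 then show ?thesis using s h by (simp add: weak_equivalence_def)
qed

lemma simplicial_map_inv_into:
 assumes X: "simplicial_set X" and Y: "simplicial_set Y" and f: "simplicial_map X Y f"
  and bij: "!!n. bij_betw (f n) (cells X n) (cells Y n)"
 shows "simplicial_map Y X (%n. inv_into (cells X n) (f n))"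
 unfolding simplicial_map_def
proof (intro conjI allI ballI)
 fix n y assume y: "y \<in> cells Y n"
 show g: "inv_into (cells X n) (f n) y \<in> cells X n"
  using bij_betw_imp_surj_on[OF bij] y by (metis inv_into_into)
 fix m al assume al: "al \<in> Delta m n"
 have "f m (restr X m n al (inv_into (cells X n) (f n) y)) = restr Y m n al y"
  using simplicial_map_restr[OF f al g] bij_betw_inv_into_right[OF bij y] by simp
 then show "inv_into (cells X m) (f m) (restr Y m n al y) = restr X m n al (inv_into (cells X n) (f n) y)"
  using bij_betw_inv_into_left[OF bij] simplicial_set_restr[OF X al g] by metis
qed

text \<open>An isomorphism of simplicial sets realizes to a homeomorphism, and both homotopies are
  constant.\<close>

lemma weak_equivalence_bij:
 assumes X: "simplicial_set X" and Y: "simplicial_set Y" and f: "simplicial_map X Y f"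
  and bij: "!!n. bij_betw (f n) (cells X n) (cells Y n)"
 shows "weak_equivalence X Y f"
proof -
 let ?g = "%n. inv_into (cells X n) (f n)"
 have g: "simplicial_map Y X ?g" by (rule simplicial_map_inv_into[OF assms])
 have 1: "rmap X ?g (rmap Y f c) = c" if c: "c \<in> topspace (realization X)" for c
  unfolding realization_map_comp[OF X Y X f g c, symmetric]
  by (rule realization_map_id[OF X _ c]) (simp add: bij_betw_inv_into_left[OF bij])
 have 2: "rmap Y f (rmap X ?g c) = c" if c: "c \<in> topspace (realization Y)" for c
  unfolding realization_map_comp[OF Y X Y g f c, symmetric]
  by (rule realization_map_id[OF Y _ c]) (simp add: bij_betw_inv_into_right[OF bij])
 have "homotopy_equivalence (realization X) (realization Y) (rmap Y f)"
  unfolding homotopy_equivalence_def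
  using continuous_map_realization_map[OF X Y f] continuous_map_realization_map[OF Y X g]
  by (intro conjI exI[of _ "rmap X ?g"] homotopic_with_equal)
   (simp_all add: 1 2 continuous_map_compose[where g="rmap X ?g"]
    continuous_map_compose[where g="rmap Y f"])
 then show ?thesis using X Y f by (simp add: weak_equivalence_def)
qed

lemma openin_simplex_cell:
 assumes x: "x \<in> cells X n" and U: "openin (simplex_top n) U"
 shows "openin (simplex_sum X) ({(n, x)} \<times> U)"
proof -
 have "open_map (simplex_top n) (simplex_sum X) (%t. ((n, x), t))"
  using open_map_component_injection[of "(n, x)" "SIGMA n:UNIV. cells X n"
     "%(n, x). simplex_top n"] x
  by (simp add: simplex_sum_def)
 then have "openin (simplex_sum X) ((%t. ((n, x), t)) ` U)"
  using U by (simp add: open_map_def)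
 moreover have "(%t. ((n, x), t)) ` U = {(n, x)} \<times> U" by auto
 ultimately show ?thesis by simp
qed

text \<open>Each cell is an open piece of the sum, so the products of \<open>I\<close> with the
  cells form an open cover on whose members continuity can be tested.\<close>

lemma continuous_map_prod_simplex_sum:
 assumes h: "!!n x. x \<in> cells X n ==>
   continuous_map (prod_topology I (simplex_top n)) T (%(s, t). h (s, ((n, x), t)))"
 shows "continuous_map (prod_topology I (simplex_sum X)) T h"
proof (rule pasting_lemma[where I = "SIGMA n:UNIV. cells X n" and f = "%_. h"
   and T = "%(n, x). topspace I \<times> ({(n, x)} \<times> std n)"])
 fix i assume "i \<in> (SIGMA n:UNIV. cells X n)"
 then obtain n x where i: "i = (n, x)" and x: "x \<in> cells X n" by auto
 let ?S = "simplex_top n"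
 have o: "openin (simplex_sum X) ({(n, x)} \<times> std n)"
  by (rule openin_simplex_cell[OF x]) (use openin_topspace[of ?S] in simp)
 then show "openin (prod_topology I (simplex_sum X)) (case i of (n, x) => topspace I \<times> ({(n, x)} \<times> std n))"
  by (simp add: i openin_prod_Times_iff)
 have eq: "subtopology (prod_topology I (simplex_sum X)) (topspace I \<times> ({(n, x)} \<times> std n)) =
    prod_topology I (subtopology (simplex_sum X) ({(n, x)} \<times> std n))"
  by (simp add: prod_topology_subtopology(2)[symmetric] subtopology_Times)
 have snd: "continuous_map (subtopology (simplex_sum X) ({(n, x)} \<times> std n)) ?S snd"
  unfolding continuous_map_def
 proof (intro conjI allI impI)
  show "snd \<in> topspace (subtopology (simplex_sum X) ({(n, x)} \<times> std n)) \<rightarrow> topspace ?S"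
   by auto
  fix U assume U: "openin ?S U"
  have "{p \<in> topspace (subtopology (simplex_sum X) ({(n, x)} \<times> std n)). snd p \<in> U} = {(n, x)} \<times> U"
   using openin_subset[OF U] x by (auto simp: topspace_simplex_sum)
  then show "openin (subtopology (simplex_sum X) ({(n, x)} \<times> std n))
    {p \<in> topspace (subtopology (simplex_sum X) ({(n, x)} \<times> std n)). snd p \<in> U}"
   using openin_simplex_cell[OF x U] openin_subset[OF U] openin_open_subtopology[OF o]
   by auto
 qed
 have "continuous_map (prod_topology I (subtopology (simplex_sum X) ({(n, x)} \<times> std n)))
     (prod_topology I ?S) (%(s, p). (s, snd p))"
  unfolding continuous_map_prod_top using snd by simp
 then have "continuous_map (prod_topology I (subtopology (simplex_sum X) ({(n, x)} \<times> std n))) T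
   ((%(s, t). h (s, ((n, x), t))) \<circ> (%(s, p). (s, snd p)))"
  by (rule continuous_map_compose[OF _ h[OF x]])
 then have "continuous_map (prod_topology I (subtopology (simplex_sum X) ({(n, x)} \<times> std n))) T h"
  by (rule continuous_map_eq) auto
 then show "continuous_map (subtopology (prod_topology I (simplex_sum X))
   (case i of (n, x) => topspace I \<times> ({(n, x)} \<times> std n))) T h"
  by (simp add: i eq)
qed (auto simp: topspace_simplex_sum)

section \<open>Linear homotopies\<close>

text \<open>The ordinal \<open>{..2 * m + 1}\<close> is the join of two copies of
  \<open>{..m}\<close>, the second shifted by \<open>Suc m\<close>; this is the join of
  \<open>al\<close> with itself.\<close>

definition join_map :: "nat => nat => (nat => nat) => nat => nat" where
 "join_map m n al = (\<lambda>i\<in>{..2 * m + 1}. if i <= m then al i else Suc n + al (i - Suc m))"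

definition join_inl :: "nat => nat => nat" where
 "join_inl n = (\<lambda>i\<in>{..n}. i)"

definition join_inr :: "nat => nat => nat" where
 "join_inr n = (\<lambda>i\<in>{..n}. Suc n + i)"

text \<open>The point at time \<open>s\<close> on the straight segment from \<open>t\<close> in the
  first copy of the simplex to \<open>t\<close> in the second, in barycentric coordinates of the
  join.\<close>

definition join_point :: "nat => (nat => real) => real => nat => real" where
 "join_point n t s = (%i. if i <= n then (1 - s) * t i else if i <= 2 * n + 1 then s * t (i - Suc n) else 0)"

lemma join_map_Delta: "al \<in> Delta m n ==> join_map m n al \<in> Delta (2 * m + 1) (2 * n + 1)"
proof (rule DeltaI)
 fix i assume a: "al \<in> Delta m n" and i: "i <= 2 * m + 1"
 then show "join_map m n al i <= 2 * n + 1"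
  using Delta_le[OF a, of i] Delta_le[OF a, of "i - Suc m"] by (auto simp: join_map_def)
next
 fix i j assume a: "al \<in> Delta m n" and ij: "i <= j" "j <= 2 * m + 1"
 then show "join_map m n al i <= join_map m n al j"
  using Delta_le[OF a, of i] Delta_mono[OF a, of i j] Delta_mono[OF a, of "i - Suc m" "j - Suc m"]
  by (auto simp: join_map_def)
qed (auto simp: join_map_def)

lemma join_inl_Delta: "join_inl n \<in> Delta n (2 * n + 1)"
 by (rule DeltaI) (auto simp: join_inl_def)

lemma join_inr_Delta: "join_inr n \<in> Delta n (2 * n + 1)"
 by (rule DeltaI) (auto simp: join_inr_def)

lemma sum_join: "(\<Sum>i\<le>2 * m + 1. g i) = (\<Sum>i\<le>m. g i) + (\<Sum>i\<le>m. g (Suc m + i))"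
 for g :: "nat => real"
proof -
 have e: "{..2 * m + 1} = {..m} \<union> (+) (Suc m) ` {..m}"
 proof (intro Set.set_eqI iffI)
  fix i assume "i \<in> {..2 * m + 1}"
  then show "i \<in> {..m} \<union> (+) (Suc m) ` {..m}"
   by (cases "i <= m") (auto intro!: image_eqI[of _ _ "i - Suc m"])
 qed auto
 show ?thesis
  unfolding e by (subst sum.union_disjoint) (auto simp: sum.reindex simp del: add_Suc)
qed

text \<open>Summation over the fixed set \<open>{..m}\<close> with a conditional makes pushforwards
  accessible to \<open>sum.cong\<close> and to the splitting of a join.\<close>

lemma simplex_pushforward_if: "push m al t j = (\<Sum>i\<le>m. if al i = j then t i else 0)"
proof -
 have "{i. i <= m & al i = j} = {..m} \<inter> {i. al i = j}" by auto
 then show ?thesis by (simp add: simplex_pushforward_def sum.If_cases)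
qed

lemma join_point_mem:
 assumes t: "t \<in> std n" and s: "0 <= s" "s <= 1"
 shows "join_point n t s \<in> std (2 * n + 1)"
proof -
 have t': "!!i. 0 <= t i" "!!i. t i <= 1" "(\<Sum>i\<le>n. t i) = 1"
  using t by (auto simp: standard_simplex_def)
 have "(\<Sum>i\<le>2 * n + 1. join_point n t s i) = (\<Sum>i\<le>n. (1 - s) * t i) + (\<Sum>i\<le>n. s * t i)"
  unfolding sum_join by (simp add: join_point_def)
 also have "\<dots> = 1" using t' by (simp flip: sum_distrib_left)
 finally have "(\<Sum>i\<le>2 * n + 1. join_point n t s i) = 1" .
 then show ?thesis
  using t' s by (auto simp: standard_simplex_def join_point_def mult_le_one)
qed

text \<open>Naturality of the join coordinates: because of it the formula for the homotopy, written
  on representatives, respects faces and degeneracies.\<close>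

lemma pushforward_join:
 assumes a: "al \<in> Delta m n"
 shows "push (2 * m + 1) (join_map m n al) (join_point m t s) =
  join_point n (push m al t) s"
proof
 fix j
 have "push (2 * m + 1) (join_map m n al) (join_point m t s) j =
   (\<Sum>i\<le>m. if al i = j then (1 - s) * t i else 0) + (\<Sum>i\<le>m. if Suc n + al i = j then s * t i else 0)"
  unfolding simplex_pushforward_if sum_join
  by (intro arg_cong2[where f = "(+)"] sum.cong) (auto simp: join_map_def join_point_def)
 also have "\<dots> = join_point n (push m al t) s j"
 proof (cases "j <= n")
  case True
  then have "(\<Sum>i\<le>m. if Suc n + al i = j then s * t i else 0) = 0" by (intro sum.neutral) auto
  then show ?thesis using True
   by (simp add: join_point_def simplex_pushforward_if sum_distrib_left if_distrib cong: if_cong)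
 next
  case False
  have 1: "(\<Sum>i\<le>m. if al i = j then (1 - s) * t i else 0) = 0"
   using False Delta_le[OF a] by (intro sum.neutral) auto
  have 2: "(\<Sum>i\<le>m. if Suc n + al i = j then s * t i else 0) = s * push m al t (j - Suc n)"
   unfolding simplex_pushforward_if sum_distrib_left using False by (intro sum.cong) auto
  have 3: "push m al t (j - Suc n) = 0" if "\<not> j <= 2 * n + 1"
   unfolding simplex_pushforward_if using that Delta_le[OF a] by (intro sum.neutral) force
  show ?thesis using False 1 2 3 by (simp add: join_point_def)
 qed
 finally show "push (2 * m + 1) (join_map m n al) (join_point m t s) j =
  join_point n (push m al t) s j" .
qed

lemma join_point_ends:
 assumes t: "t \<in> std n"
 shows "join_point n t 0 = push n (join_inl n) t"
  "join_point n t 1 = push n (join_inr n) t"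
proof -
 have z: "t i = 0" if "i > n" for i using t that by (simp add: standard_simplex_def)
 show "join_point n t 0 = push n (join_inl n) t"
 proof
  fix j
  have "push n (join_inl n) t j = (\<Sum>i\<le>n. if i = j then t i else 0)"
   unfolding simplex_pushforward_if by (intro sum.cong) (auto simp: join_inl_def)
  then show "join_point n t 0 j = push n (join_inl n) t j"
   by (simp add: join_point_def)
 qed
 show "join_point n t 1 = push n (join_inr n) t"
 proof
  fix j
  have "push n (join_inr n) t j = (\<Sum>i\<le>n. if Suc n + i = j then t i else 0)"
   unfolding simplex_pushforward_if by (intro sum.cong) (auto simp: join_inr_def)
  also have "\<dots> = (\<Sum>i\<le>n. if i = j - Suc n then (if n < j then t i else 0) else 0)"
   by (intro sum.cong) auto
  finally show "join_point n t 1 j = push n (join_inr n) t j"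
   by (auto simp: join_point_def)
 qed
qed

lemma continuous_map_join_point:
 "continuous_map (prod_topology (top_of_set {0..1}) (simplex_top n))
   (subtopology (powertop_real UNIV) (std (2 * n + 1))) (%(s, t). join_point n t s)"
proof -
 let ?P = "prod_topology (top_of_set {0..1::real}) (simplex_top n)"
 have s: "continuous_map ?P euclideanreal fst"
  using continuous_map_fst continuous_map_into_fulltopology by blast
 have t: "continuous_map ?P euclideanreal (%p. snd p k)" for k
 proof -
  have "continuous_map (simplex_top n) euclideanreal (%t. t k)"
   by (intro continuous_map_from_subtopology continuous_map_product_projection) simp
  from continuous_map_compose[OF continuous_map_snd this] show ?thesis by (simp add: o_def)
 qed
 have "continuous_map ?P euclideanreal (%p. join_point n (snd p) (fst p) i)" for i
  unfolding join_point_def by (auto intro!: continuous_intros s t)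
 then have "continuous_map ?P (powertop_real UNIV) (%p. join_point n (snd p) (fst p))"
  by (simp add: continuous_map_componentwise_UNIV)
 then show ?thesis
  using join_point_mem[of _ n, simplified]
  by (auto simp: continuous_map_in_subtopology case_prod_beta')
qed

text \<open>The join coordinates make the homotopy linear, so that no prism has to be triangulated.\<close>

lemma homotopic_join:
 assumes X: "simplicial_set X" and Y: "simplicial_set Y"
  and f: "simplicial_map X Y f" and g: "simplicial_map X Y g"
  and J: "!!n x. x \<in> cells X n ==> J n x \<in> cells Y (2 * n + 1)"
  and J_restr: "!!m n al x. al \<in> Delta m n ==> x \<in> cells X n ==>
    J m (restr X m n al x) = restr Y (2 * m + 1) (2 * n + 1) (join_map m n al) (J n x)"
  and J_inl: "!!n x. x \<in> cells X n ==> restr Y n (2 * n + 1) (join_inl n) (J n x) = f n x"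
  and J_inr: "!!n x. x \<in> cells X n ==> restr Y n (2 * n + 1) (join_inr n) (J n x) = g n x"
 shows "homotopic_with (%_. True) (realization X) (realization Y) (rmap Y f) (rmap Y g)"
proof -
 let ?I = "top_of_set {0..1::real}"
 \<comment> \<open>The simplex \<open>J n x\<close> restricts to \<open>f n x\<close> on its first
   half and to \<open>g n x\<close> on its second, so moving along the segments between the halves
   deforms one map into the other.\<close>
 define h where "h = (%(s, ((n, x), t)). rp Y ((2 * n + 1, J n x), join_point n t s))"
 have h: "continuous_map (prod_topology ?I (simplex_sum X)) (realization Y) h"
 proof (rule continuous_map_prod_simplex_sum)
  fix n x assume x: "x \<in> cells X n"
  have "continuous_map (prod_topology ?I (simplex_top n)) (realization Y)
    ((%t. rp Y ((2 * n + 1, J n x), t)) \<circ> (%(s, t). join_point n t s))"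
   by (rule continuous_map_compose[OF continuous_map_join_point continuous_map_realization_point_cell[OF J[OF x]]])
  then show "continuous_map (prod_topology ?I (simplex_top n)) (realization Y)
    (%(s, t). h (s, ((n, x), t)))"
   by (simp add: h_def o_def case_prod_beta')
 qed
 \<comment> \<open>The product of a quotient map with a locally compact Hausdorff space is again a
   quotient map; this allows the homotopy to be built on representatives.\<close>
 have q: "quotient_map (prod_topology ?I (simplex_sum X)) (prod_topology ?I (realization X))
   (%(s, p). (s, rp X p))"
  by (rule quotient_map_prod_right)
   (auto simp: quotient_map_realization locally_compact_space_euclidean Hausdorff_space_subtopology
    intro: locally_compact_space_closed_subset)
 have glue: "h (s, p) = h (s, q)"
  if s: "s \<in> {0..1}" and "p \<in> topspace (simplex_sum X)" "q \<in> topspace (simplex_sum X)"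
   "rp X p = rp X q" for s p q
 proof (rule realization_point_cong[OF _ that(2-4), of "%p. h (s, p)"])
  fix m n al x t assume a: "al \<in> Delta m n" and x: "x \<in> cells X n" and t: "t \<in> std m"
  have j: "join_point m t s \<in> std (2 * m + 1)"
   using join_point_mem t s by simp
  show "h (s, ((m, restr X m n al x), t)) = h (s, ((n, x), push m al t))"
   using realization_point_restr[OF Y join_map_Delta[OF a] J[OF x] j]
   by (simp add: h_def J_restr[OF a x] pushforward_join[OF a, simplified])
 qed
 obtain k where k: "continuous_map (prod_topology ?I (realization X)) (realization Y) k"
  and kh: "!!x. x \<in> topspace (prod_topology ?I (simplex_sum X)) ==> k ((%(s, p). (s, rp X p)) x) = h x"
 proof (rule quotient_map_lift_exists[OF q h])
  fix x y assume xy: "x \<in> topspace (prod_topology ?I (simplex_sum X))" "y \<in> topspace (prod_topology ?I (simplex_sum X))"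
   "(%(s, p). (s, rp X p)) x = (%(s, p). (s, rp X p)) y"
  obtain s p where x: "x = (s, p)" by (cases x)
  obtain s' q where y: "y = (s', q)" by (cases y)
  show "h x = h y" using glue[of s p q] xy unfolding x y by simp
 qed blast
 have kp: "k (s, rp X ((n, x), t)) = rp Y ((2 * n + 1, J n x), join_point n t s)"
  if "s \<in> {0..1}" "x \<in> cells X n" "t \<in> std n" for s n x t
  using kh[of "(s, ((n, x), t))"] that by (simp add: topspace_simplex_sum h_def)
 show ?thesis
 proof (rule iffD2[OF homotopic_with]; (intro exI[of _ k] conjI ballI)?)
  fix c assume c: "c \<in> topspace (realization X)"
  show "k (0, c) = rmap Y f c"
  proof (rule realization_cases[OF c])
   fix n x t assume x: "x \<in> cells X n" and t: "t \<in> std n" and c: "c = rp X ((n, x), t)"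
   show ?thesis
    using realization_point_restr[OF Y join_inl_Delta J[OF x] t]
    by (simp add: c kp[OF _ x t] join_point_ends[OF t] realization_map_point[OF X Y f x t] J_inl[OF x, simplified])
  qed
  show "k (1, c) = rmap Y g c"
  proof (rule realization_cases[OF c])
   fix n x t assume x: "x \<in> cells X n" and t: "t \<in> std n" and c: "c = rp X ((n, x), t)"
   show ?thesis
    using realization_point_restr[OF Y join_inr_Delta J[OF x] t]
    by (simp add: c kp[OF _ x t] join_point_ends[OF t] realization_map_point[OF X Y g x t] J_inr[OF x, simplified])
  qed
 qed (simp_all add: k)
qed

section \<open>Nerves of groupoids\<close>

definition groupoid :: "('o, 'm) cat => bool" where
 "groupoid C \<longleftrightarrow> category C & (\<forall>f\<in>Ar C. \<exists>g. inverses C f g)"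

definition inv_arrow :: "('o, 'm) cat => 'm => 'm" where
 "inv_arrow C f = (THE g. inverses C f g)"

lemma arrowsD:
 assumes "f \<in> arrows C A B"
 shows "f \<in> Ar C" "src C f = A" "trg C f = B"
 using assms by (auto simp: arrows_def)

context category begin

lemma arrows_Ob: "f \<in> arrows C A B ==> A \<in> Ob C" "f \<in> arrows C A B ==> B \<in> Ob C"
 by (auto simp: arrows_def src_closed trg_closed)

lemma cmp_arrows: "f \<in> arrows C A B ==> g \<in> arrows C B A' ==> cmp C g f \<in> arrows C A A'"
 using cmp_closed[of f g] by (simp add: arrows_def)

lemma assoc_arrows:
 "f \<in> arrows C A B ==> g \<in> arrows C B A' ==> h \<in> arrows C A' B' ==>
  cmp C h (cmp C g f) = cmp C (cmp C h g) f"
 using cmp_assoc[of f g h] by (simp add: arrows_def)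

lemma ident_right: "f \<in> arrows C A B ==> cmp C f (ident C A) = f"
 using cmp_ident_right[of f] by (auto simp: arrows_def)

lemma ident_left: "f \<in> arrows C A B ==> cmp C (ident C B) f = f"
 using cmp_ident_left[of f] by (auto simp: arrows_def)

lemma inverses_unique:
 assumes "inverses C f g" "inverses C f g'"
 shows "g = g'"
proof -
 have f: "f \<in> arrows C (src C f) (trg C f)" and g: "g \<in> arrows C (trg C f) (src C f)"
  and g': "g' \<in> arrows C (trg C f) (src C f)"
  using assms by (auto simp: inverses_def arrows_def)
 have "g = cmp C (cmp C g' f) g"
  using assms(2) ident_left[OF g] by (simp add: inverses_def)
 also have "\<dots> = cmp C g' (cmp C f g)"
  by (rule assoc_arrows[OF g f g', symmetric])
 also have "\<dots> = g'"
  using assms(1) ident_right[OF g'] by (simp add: inverses_def)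
 finally show ?thesis .
qed

lemma inv_arrow_eq: "inverses C f g ==> inv_arrow C f = g"
 unfolding inv_arrow_def by (rule the_equality) (simp_all add: inverses_unique)

lemma inverses_sym: "inverses C f g ==> inverses C g f"
 by (auto simp: inverses_def arrows_def)

lemma inversesI:
 "f \<in> arrows C A B ==> g \<in> arrows C B A ==> cmp C g f = ident C A ==> cmp C f g = ident C B ==> inverses C f g"
 by (auto simp: inverses_def arrows_def)

lemma inverses_ident: "A \<in> Ob C ==> inverses C (ident C A) (ident C A)"
 using ident_left[OF ident_closed, of A] by (intro inversesI[where A = A and B = A] ident_closed)

lemma inverses_cmp:
 assumes f: "f \<in> arrows C A B" and g: "g \<in> arrows C B A'" and "inverses C f f'" "inverses C g g'"
 shows "inverses C (cmp C g f) (cmp C f' g')"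
proof -
 have f': "f' \<in> arrows C B A" "cmp C f' f = ident C A" "cmp C f f' = ident C B"
  and g': "g' \<in> arrows C A' B" "cmp C g' g = ident C B" "cmp C g g' = ident C A'"
  using assms by (auto simp: inverses_def arrows_def)
 show ?thesis
 proof (rule inversesI[OF cmp_arrows[OF f g] cmp_arrows[OF g'(1) f'(1)]])
  have "cmp C (cmp C f' g') (cmp C g f) = cmp C f' (cmp C g' (cmp C g f))"
   by (rule assoc_arrows[OF cmp_arrows[OF f g] g'(1) f'(1), symmetric])
  also have "\<dots> = cmp C f' (cmp C (cmp C g' g) f)"
   by (simp add: assoc_arrows[OF f g g'(1)])
  finally show "cmp C (cmp C f' g') (cmp C g f) = ident C A"
   by (simp add: f' g' ident_left[OF f])
  have "cmp C (cmp C g f) (cmp C f' g') = cmp C g (cmp C f (cmp C f' g'))"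
   by (rule assoc_arrows[OF cmp_arrows[OF g'(1) f'(1)] f g, symmetric])
  also have "\<dots> = cmp C g (cmp C (cmp C f f') g')"
   by (simp add: assoc_arrows[OF g'(1) f'(1) f])
  finally show "cmp C (cmp C g f) (cmp C f' g') = ident C A'"
   by (simp add: f' g' ident_left[OF g'(1)])
 qed
qed

end

locale groupoid_cat = category C for C :: "('o, 'm) cat" +
 assumes invertible: "f \<in> Ar C ==> \<exists>g. inverses C f g"
begin

abbreviation iv where "iv \<equiv> inv_arrow C"

lemma inv_inverses: "f \<in> Ar C ==> inverses C f (iv f)"
 using invertible[of f] inv_arrow_eq[of f] by auto

lemma inv_arrows: "f \<in> arrows C A B ==> iv f \<in> arrows C B A"
 using inv_inverses[of f] by (auto simp: inverses_def arrows_def)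

lemma inv_left: "f \<in> arrows C A B ==> cmp C (iv f) f = ident C A"
 using inv_inverses[of f] by (auto simp: inverses_def arrows_def)

lemma inv_right: "f \<in> arrows C A B ==> cmp C f (iv f) = ident C B"
 using inv_inverses[of f] by (auto simp: inverses_def arrows_def)

lemma cancel_left_inv: "f \<in> arrows C A B ==> b \<in> arrows C A' A ==> cmp C (iv f) (cmp C f b) = b"
 using assoc_arrows[of b A' A f B "iv f" A] inv_arrows[of f A B] inv_left[of f A B] ident_left[of b A' A] by simp

lemma cancel_inv_left: "f \<in> arrows C A B ==> b \<in> arrows C A' B ==> cmp C f (cmp C (iv f) b) = b"
 using assoc_arrows[of b A' B "iv f" A f B] inv_arrows[of f A B] inv_right[of f A B] ident_left[of b A' B] by simp

lemma cancel_right_inv: "f \<in> arrows C A B ==> b \<in> arrows C B A' ==> cmp C (cmp C b f) (iv f) = b"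
 using assoc_arrows[of "iv f" B A f B b A'] inv_arrows[of f A B] inv_right[of f A B] ident_right[of b B A'] by simp

lemma cancel_inv_right: "f \<in> arrows C A B ==> b \<in> arrows C A A' ==> cmp C (cmp C b (iv f)) f = b"
 using assoc_arrows[of f A B "iv f" A b A'] inv_arrows[of f A B] inv_left[of f A B] ident_right[of b A A'] by simp

lemma right_cancel:
 "b \<in> arrows C A B ==> f \<in> arrows C B A' ==> g \<in> arrows C B A' ==> cmp C f b = cmp C g b ==> f = g"
 by (rule trans[OF cancel_right_inv[of b A B f A', symmetric] trans[OF _ cancel_right_inv[of b A B g A']]])
  simp_all

lemma left_cancel:
 "b \<in> arrows C A B ==> f \<in> arrows C A' A ==> g \<in> arrows C A' A ==> cmp C b f = cmp C b g ==> f = g"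
 by (rule trans[OF cancel_left_inv[of b A B f A', symmetric] trans[OF _ cancel_left_inv[of b A B g A']]])
  simp_all

end

section \<open>Functors from ordinals, nerves and maps of nerves\<close>

lemma Ar_ordinal: "Ar (ordinal n) = {(i, j). i <= j & j <= n}"
 and Ob_ordinal: "Ob (ordinal n) = {..n}"
 by (simp_all add: ordinal_def)

lemma functors_ordinalD:
 assumes "(P, Q) \<in> functors (ordinal n) C"
 shows "i <= n ==> P i \<in> Ob C"
  "i <= j ==> j <= n ==> Q (i, j) \<in> arrows C (P i) (P j)"
  "i <= n ==> Q (i, i) = ident C (P i)"
  "i <= j ==> j <= k ==> k <= n ==> cmp C (Q (j, k)) (Q (i, j)) = Q (i, k)"
  "P \<in> extensional {..n}" "Q \<in> extensional {(i, j). i <= j & j <= n}"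
proof -
 have P: "P \<in> {..n} \<rightarrow>\<^sub>E Ob C" and Q: "Q \<in> {(i, j). i <= j & j <= n} \<rightarrow>\<^sub>E Ar C"
  and st: "\<forall>f\<in>{(i, j). i <= j & j <= n}. src C (Q f) = P (fst f) & trg C (Q f) = P (snd f)"
  and id: "\<forall>i\<in>{..n}. Q (i, i) = ident C (P i)"
  and c: "\<forall>f\<in>{(i, j). i <= j & j <= n}. \<forall>g\<in>{(i, j). i <= j & j <= n}.
     fst g = snd f --> Q (fst f, snd g) = cmp C (Q g) (Q f)"
  using assms unfolding functors_def ordinal_def mem_Collect_eq prod.case cat.select_convs by blast+
 show "i <= n ==> P i \<in> Ob C" using PiE_mem[OF P] by simp
 show "Q (i, j) \<in> arrows C (P i) (P j)" if "i <= j" "j <= n"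
  using PiE_mem[OF Q, of "(i, j)"] st[rule_format, of "(i, j)"] that by (simp add: arrows_def)
 show "i <= n ==> Q (i, i) = ident C (P i)" using id by simp
 show "cmp C (Q (j, k)) (Q (i, j)) = Q (i, k)" if "i <= j" "j <= k" "k <= n"
  using c[rule_format, of "(i, j)" "(j, k)"] that by simp
 show "P \<in> extensional {..n}" "Q \<in> extensional {(i, j). i <= j & j <= n}"
  using P Q by (simp_all add: PiE_def)
qed

lemma functors_ordinalI:
 assumes "P \<in> extensional {..n}" "Q \<in> extensional {(i, j). i <= j & j <= n}"
  and "!!i. i <= n ==> P i \<in> Ob C"
  and "!!i j. i <= j ==> j <= n ==> Q (i, j) \<in> arrows C (P i) (P j)"
  and "!!i. i <= n ==> Q (i, i) = ident C (P i)"
  and "!!i j k. i <= j ==> j <= k ==> k <= n ==> cmp C (Q (j, k)) (Q (i, j)) = Q (i, k)"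
 shows "(P, Q) \<in> functors (ordinal n) C"
 unfolding functors_def mem_Collect_eq prod.case Ob_ordinal Ar_ordinal
proof (intro conjI ballI impI)
 show "P \<in> {..n} \<rightarrow>\<^sub>E Ob C" using assms(1,3) by (auto simp: PiE_iff)
 show "Q \<in> {(i, j). i <= j & j <= n} \<rightarrow>\<^sub>E Ar C"
  using assms(2) arrowsD(1)[OF assms(4)] by (auto simp: PiE_iff)
next
 fix f :: "nat \<times> nat" assume f': "f \<in> {(i, j). i <= j & j <= n}"
 obtain i j where "f = (i, j)" by (cases f)
 with f' have f: "f = (i, j)" "i <= j" "j <= n" by simp_all
 show "src C (Q f) = P (src (ordinal n) f)" "trg C (Q f) = P (trg (ordinal n) f)"
  using assms(4)[OF f(2,3)] by (simp_all add: f(1) ordinal_def arrows_def)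
 fix g :: "nat \<times> nat" assume g': "g \<in> {(i, j). i <= j & j <= n}" "src (ordinal n) g = trg (ordinal n) f"
 obtain j' k where "g = (j', k)" by (cases g)
 with g' f have g: "g = (j, k)" "j <= k" "k <= n" by (simp_all add: ordinal_def)
 show "Q (cmp (ordinal n) g f) = cmp C (Q g) (Q f)"
  using assms(6)[OF f(2) g(2,3)] by (simp add: f(1) g(1) ordinal_def)
qed (simp add: assms(5) ordinal_def)

text \<open>Only values and extensionality enter, so the two functors may be known as functors into
  different categories.\<close>

lemma functors_ordinal_eqI:
 assumes "(P, Q) \<in> functors (ordinal n) C" "(P', Q') \<in> functors (ordinal n) C'"
  "!!i. i <= n ==> P i = P' i" "!!i j. i <= j ==> j <= n ==> Q (i, j) = Q' (i, j)"
 shows "P = P'" "Q = Q'"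
proof -
 show "P = P'"
  by (rule extensionalityI[of _ "{..n}"]) (use functors_ordinalD(5,6)[OF assms(1)] functors_ordinalD(5,6)[OF assms(2)] assms(3,4) in auto)
 show "Q = Q'"
  by (rule extensionalityI[of _ "{(i, j). i <= j & j <= n}"]) (use functors_ordinalD(5,6)[OF assms(1)] functors_ordinalD(5,6)[OF assms(2)] assms(3,4) in auto)
qed

lemma restr_nerve:
 "restr (nerve C) m n al (P, Q) =
  ((\<lambda>i\<in>{..m}. P (al i)), (\<lambda>(i, j)\<in>{(i, j). i <= j & j <= m}. Q (al i, al j)))"
 by (auto simp: nerve_def compose_def Ar_ordinal Ob_ordinal fun_eq_iff restrict_def)

lemma cells_nerve: "cells (nerve C) n = functors (ordinal n) C"
 by (simp add: nerve_def)

lemma restr_nerve_closed: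
 assumes a: "al \<in> Delta m n" and x: "x \<in> functors (ordinal n) C"
 shows "restr (nerve C) m n al x \<in> functors (ordinal m) C"
proof -
 obtain P Q where x': "x = (P, Q)" by (cases x)
 note F = functors_ordinalD[OF x[unfolded x']]
 show ?thesis
  unfolding x' restr_nerve
  by (rule functors_ordinalI) (use F(1-4) Delta_le[OF a] Delta_mono[OF a] in simp_all)
qed

lemma simplicial_set_nerve: "simplicial_set (nerve C)"
proof -
 have id: "restr (nerve C) n n (Delta_id n) x = x" if "x \<in> functors (ordinal n) C" for n x
 proof -
  obtain P Q where x: "x = (P, Q)" by (cases x)
  have 1: "restr (nerve C) n n (Delta_id n) (P, Q) \<in> functors (ordinal n) C"
   using that Delta_id_mem restr_nerve_closed x by metis
  show ?thesis
   using functors_ordinal_eqI[OF 1[unfolded restr_nerve] that[unfolded x]]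
   by (simp add: x restr_nerve Delta_id_def)
 qed
 show ?thesis
  unfolding simplicial_set_def cells_nerve
 proof (intro conjI allI ballI)
  fix l m n al bt x
  assume a: "al \<in> Delta l m" and b: "bt \<in> Delta m n" and x: "x \<in> functors (ordinal n) C"
  obtain P Q where x': "x = (P, Q)" by (cases x)
  show "restr (nerve C) l n (compose {..l} bt al) x = restr (nerve C) l m al (restr (nerve C) m n bt x)"
   using Delta_le[OF a] Delta_mono[OF a]
   by (auto simp: x' restr_nerve compose_def fun_eq_iff restrict_def)
 qed (simp_all add: id restr_nerve_closed)
qed

lemma functors_Ob: "(P, Q) \<in> functors C D ==> A \<in> Ob C ==> P A \<in> Ob D"
 by (auto simp: functors_def)

lemma functors_arrows: "(P, Q) \<in> functors C D ==> f \<in> arrows C A B ==> Q f \<in> arrows D (P A) (P B)"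
 by (auto simp: functors_def arrows_def)

lemma functors_ident: "(P, Q) \<in> functors C D ==> A \<in> Ob C ==> Q (ident C A) = ident D (P A)"
 by (simp add: functors_def)

lemma functors_cmp: "(P, Q) \<in> functors C D ==> f \<in> arrows C A B ==> g \<in> arrows C B A' ==>
 Q (cmp C g f) = cmp D (Q g) (Q f)"
 by (auto simp: functors_def arrows_def)

lemma functorsI:
 assumes "category C"
  and "P \<in> extensional (Ob C)" "Q \<in> extensional (Ar C)" "!!A. A \<in> Ob C ==> P A \<in> Ob D"
  and "!!f. f \<in> Ar C ==> Q f \<in> arrows D (P (src C f)) (P (trg C f))"
  and "!!A. A \<in> Ob C ==> Q (ident C A) = ident D (P A)"
  and "!!f g. f \<in> Ar C ==> g \<in> Ar C ==> src C g = trg C f ==> Q (cmp C g f) = cmp D (Q g) (Q f)"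
 shows "(P, Q) \<in> functors C D"
 using assms(2-) by (auto simp: functors_def PiE_iff arrows_def)

lemma nerve_map_eq:
 "nerve_map p q n (P, Q) = ((\<lambda>i\<in>{..n}. p (P i)), (\<lambda>(i, j)\<in>{(i, j). i <= j & j <= n}. q (Q (i, j))))"
 by (auto simp: nerve_map_def compose_def Ar_ordinal Ob_ordinal fun_eq_iff restrict_def)

lemma simplicial_map_nerve_map:
 assumes F: "(p, q) \<in> functors C D"
 shows "simplicial_map (nerve C) (nerve D) (nerve_map p q)"
 unfolding simplicial_map_def cells_nerve
proof (intro conjI allI ballI)
 fix n x assume x: "x \<in> functors (ordinal n) C"
 obtain P Q where x': "x = (P, Q)" by (cases x)
 note G = functors_ordinalD[OF x[unfolded x']]
 have c: "cmp D (q (Q (j, k))) (q (Q (i, j))) = q (Q (i, k))" if "i <= j" "j <= k" "k <= n" for i j k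
  using functors_cmp[OF F G(2)[of i j] G(2)[of j k]] G(4)[of i j k] that by simp
 show "nerve_map p q n x \<in> functors (ordinal n) D"
  unfolding x' nerve_map_eq
  by (rule functors_ordinalI)
   (use G(1-3) functors_Ob[OF F] functors_arrows[OF F] functors_ident[OF F] c in simp_all)
 fix m al assume a: "al \<in> Delta m n"
 show "nerve_map p q m (restr (nerve C) m n al x) = restr (nerve D) m n al (nerve_map p q n x)"
  unfolding x' restr_nerve nerve_map_eq using Delta_le[OF a] Delta_mono[OF a]
  by (auto simp: fun_eq_iff restrict_def)
qed

context groupoid_cat begin

text \<open>Every simplex of the nerve of a groupoid is given by spokes issuing from one object, which
 may be changed freely.\<close>

definition spokes :: "nat => (nat => 'o) => (nat => 'm) => ('o, 'm) nerve_simplex" where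
 "spokes n p b = ((\<lambda>i\<in>{..n}. p i), (\<lambda>(i, j)\<in>{(i, j). i <= j & j <= n}. cmp C (b j) (iv (b i))))"

text \<open>Telescoping: in a composite of two quotients of spokes the middle spoke cancels against
  its inverse.\<close>

lemma spokes_functor:
 assumes b: "!!i. i <= n ==> b i \<in> arrows C a (p i)"
 shows "spokes n p b \<in> functors (ordinal n) C"
 unfolding spokes_def
proof (rule functors_ordinalI)
 fix i assume i: "i <= n"
 show "(\<lambda>i\<in>{..n}. p i) i \<in> Ob C" using i arrows_Ob(2)[OF b[OF i]] by simp
 show "(\<lambda>(i, j)\<in>{(i, j). i <= j & j <= n}. cmp C (b j) (iv (b i))) (i, i) = ident C ((\<lambda>i\<in>{..n}. p i) i)"
  using i inv_right[OF b[OF i]] by simp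
next
 fix i j assume ij: "i <= j" "j <= n"
 then have "cmp C (b j) (iv (b i)) \<in> arrows C (p i) (p j)"
  by (intro cmp_arrows[OF inv_arrows[OF b] b]) simp_all
 then show "(\<lambda>(i, j)\<in>{(i, j). i <= j & j <= n}. cmp C (b j) (iv (b i))) (i, j)
   \<in> arrows C ((\<lambda>i\<in>{..n}. p i) i) ((\<lambda>i\<in>{..n}. p i) j)"
  using ij by simp
next
 fix i j k assume ij: "i <= j" "j <= k" "k <= n"
 then have bi: "b i \<in> arrows C a (p i)" and bj: "b j \<in> arrows C a (p j)" and bk: "b k \<in> arrows C a (p k)"
  using b by simp_all
 have "cmp C (cmp C (b k) (iv (b j))) (cmp C (b j) (iv (b i))) =
   cmp C (cmp C (cmp C (b k) (iv (b j))) (b j)) (iv (b i))"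
  by (rule assoc_arrows[OF inv_arrows[OF bi] bj cmp_arrows[OF inv_arrows[OF bj] bk]])
 also have "\<dots> = cmp C (b k) (iv (b i))"
  by (simp add: cancel_inv_right[OF bj bk])
 finally show "cmp C ((\<lambda>(i, j)\<in>{(i, j). i <= j & j <= n}. cmp C (b j) (iv (b i))) (j, k))
   ((\<lambda>(i, j)\<in>{(i, j). i <= j & j <= n}. cmp C (b j) (iv (b i))) (i, j)) =
   (\<lambda>(i, j)\<in>{(i, j). i <= j & j <= n}. cmp C (b j) (iv (b i))) (i, k)"
  using ij by simp
qed (simp_all)

lemma spoke_unique:
 assumes "b \<in> arrows C a p" "f \<in> arrows C p p'"
 shows "cmp C (cmp C f b) (iv b) = f"
 using cancel_right_inv[OF assms] .

text \<open>The factor \<open>c\<close> cancels in the quotient. Restricting a simplex changes its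
  first vertex, from which the spokes issue, and this lemma absorbs the change.\<close>

lemma spoke_rebase:
 assumes c: "c \<in> arrows C a' a" and b: "b \<in> arrows C a p" and b': "b' \<in> arrows C a p'"
 shows "cmp C (cmp C b' c) (iv (cmp C b c)) = cmp C b' (iv b)"
proof -
 let ?f = "cmp C b' (iv b)"
 have f: "?f \<in> arrows C p p'" by (rule cmp_arrows[OF inv_arrows[OF b] b'])
 have "cmp C ?f (cmp C b c) = cmp C (cmp C ?f b) c"
  by (rule assoc_arrows[OF c b f])
 also have "\<dots> = cmp C b' c" by (simp add: cancel_inv_right[OF b b'])
 finally show ?thesis using spoke_unique[OF cmp_arrows[OF c b] f] by simp
qed

end

text \<open>The simplex of the join over \<open>x\<close> is given by spokes from \<open>P\<close>
  of the first vertex of \<open>x\<close>: images under \<open>Q\<close> lead to the first copy, and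
  \<open>et\<close> followed by images under \<open>Q'\<close> leads to the second. Spokes spare a
  case distinction over pairs of vertices in different copies.\<close>

lemma homotopic_nerve_maps:
 fixes C :: "('o, 'm) cat"
 assumes E: "groupoid_cat E" and F: "(P, Q) \<in> functors C E" and G: "(P', Q') \<in> functors C E"
  and et: "!!c. c \<in> Ob C ==> et c \<in> arrows E (P c) (P' c)"
  and nat: "!!f c c'. f \<in> arrows C c c' ==> cmp E (et c') (Q f) = cmp E (Q' f) (et c)"
 shows "homotopic_with (%_. True) (BN C) (BN E)
   (rmap (nerve E) (nerve_map P Q)) (rmap (nerve E) (nerve_map P' Q'))"
proof -
 interpret E: groupoid_cat E by (rule E)
 define p where "p = (%n (x :: ('o, 'm) nerve_simplex) i. if i <= n then P (fst x i) else P' (fst x (i - Suc n)))"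
 define b where "b = (%n (x :: ('o, 'm) nerve_simplex) i. if i <= n then Q (snd x (0, i)) else cmp E (Q' (snd x (0, i - Suc n))) (et (fst x 0)))"
 define J where "J = (%n x. E.spokes (2 * n + 1) (p n x) (b n x))"
 have bm: "b n x i \<in> arrows E (P (fst x 0)) (p n x i)"
  if x: "x \<in> functors (ordinal n) C" and i: "i <= 2 * n + 1" for n x i
 proof -
  have x': "(fst x, snd x) \<in> functors (ordinal n) C" using x by simp
  note X = functors_ordinalD[OF x']
  show ?thesis
  proof (cases "i <= n")
   case True
   then show ?thesis using functors_arrows[OF F X(2)[of 0 i]] by (simp add: b_def p_def)
  next
   case False
   then have i': "i - Suc n <= n" using i by simp
   show ?thesis
    using False E.cmp_arrows[OF et[OF X(1)[of 0]] functors_arrows[OF G X(2)[OF _ i', of 0]]]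
    by (simp add: b_def p_def)
  qed
 qed
 have Jm: "J n x \<in> functors (ordinal (2 * n + 1)) E" if "x \<in> functors (ordinal n) C" for n x
  unfolding J_def by (rule E.spokes_functor) (rule bm[OF that])
 show ?thesis
 proof (rule homotopic_join[where J = J])
  show "simplicial_map (nerve C) (nerve E) (nerve_map P Q)" "simplicial_map (nerve C) (nerve E) (nerve_map P' Q')"
   using F G by (simp_all add: simplicial_map_nerve_map)
  show "J n x \<in> cells (nerve E) (2 * n + 1)" if "x \<in> cells (nerve C) n" for n x
   using Jm that unfolding cells_nerve .
 next
  fix m n al x assume a: "al \<in> Delta m n" and "x \<in> cells (nerve C) n"
  then have x: "x \<in> functors (ordinal n) C" by (simp add: cells_nerve)
  then have x': "(fst x, snd x) \<in> functors (ordinal n) C" by simp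
  note X = functors_ordinalD[OF x']
  let ?y = "restr (nerve C) m n al x"
  have y: "?y \<in> functors (ordinal m) C" by (rule restr_nerve_closed[OF a x])
  have y1: "fst ?y i = fst x (al i)" if "i <= m" for i
   using that restr_nerve[of C m n al "fst x" "snd x"] by simp
  have y2: "snd ?y (i, j) = snd x (al i, al j)" if "i <= j" "j <= m" for i j
   using that restr_nerve[of C m n al "fst x" "snd x"] by simp
  let ?k = "join_map m n al"
  \<comment> \<open>After restriction along \<open>al\<close> the first vertex is
    \<open>fst x (al 0)\<close>; the old spokes are the new ones precomposed with
    \<open>?c\<close>.\<close>
  let ?c = "Q (snd x (0, al 0))"
  have c: "?c \<in> arrows E (P (fst x 0)) (P (fst ?y 0))"
   using functors_arrows[OF F X(2)[of 0 "al 0"]] Delta_le[OF a, of 0] by (simp add: y1)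
  have pk: "p n x (?k i) = p m ?y i" if i: "i <= 2 * m + 1" for i
  proof (cases "i <= m")
   case True
   then show ?thesis using Delta_le[OF a True] by (simp add: p_def join_map_def y1)
  next
   case False
   then have "i - Suc m <= m" using i by simp
   then show ?thesis using False i by (simp add: p_def join_map_def y1)
  qed
  have bk: "b n x (?k i) = cmp E (b m ?y i) ?c" if i: "i <= 2 * m + 1" for i
  proof (cases "i <= m")
   case True
   have "al 0 <= al i" using Delta_mono[OF a, of 0 i] True by simp
   then have "cmp E (Q (snd x (al 0, al i))) ?c = Q (snd x (0, al i))"
    using functors_cmp[OF F X(2)[of 0 "al 0"] X(2)[of "al 0" "al i"]] X(4)[of 0 "al 0" "al i"]
     Delta_le[OF a True] by simp
   then show ?thesis using Delta_le[OF a True] True by (simp add: b_def join_map_def y2)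
  next
   case False
   then have i': "i - Suc m <= m" using i by simp
   let ?i = "al (i - Suc m)"
   have le: "al 0 <= ?i" "?i <= n" using Delta_mono[OF a _ i', of 0] Delta_le[OF a i'] by simp_all
   have A: "snd x (0, al 0) \<in> arrows C (fst x 0) (fst x (al 0))"
    "snd x (al 0, ?i) \<in> arrows C (fst x (al 0)) (fst x ?i)"
    using X(2)[of 0 "al 0"] X(2)[of "al 0" ?i] le by simp_all
   have e: "et (fst x 0) \<in> arrows E (P (fst x 0)) (P' (fst x 0))"
    "et (fst x (al 0)) \<in> arrows E (P (fst x (al 0))) (P' (fst x (al 0)))"
    using et[OF X(1)[of 0]] et[OF X(1)[of "al 0"]] le by simp_all
   \<comment> \<open>Factor the spoke through the vertex \<open>al 0\<close> and move
     \<open>et\<close> across by naturality; the rightmost factor that remains is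
     \<open>?c\<close>.\<close>
   have "cmp E (Q' (snd x (0, ?i))) (et (fst x 0)) =
     cmp E (cmp E (Q' (snd x (al 0, ?i))) (Q' (snd x (0, al 0)))) (et (fst x 0))"
    using functors_cmp[OF G A] X(4)[of 0 "al 0" ?i] le by simp
   also have "\<dots> = cmp E (Q' (snd x (al 0, ?i))) (cmp E (Q' (snd x (0, al 0))) (et (fst x 0)))"
    by (rule E.assoc_arrows[OF e(1) functors_arrows[OF G A(1)] functors_arrows[OF G A(2)], symmetric])
   also have "\<dots> = cmp E (Q' (snd x (al 0, ?i))) (cmp E (et (fst x (al 0))) ?c)"
    by (simp add: nat[OF A(1)])
   also have "\<dots> = cmp E (cmp E (Q' (snd x (al 0, ?i))) (et (fst x (al 0)))) ?c"
    by (rule E.assoc_arrows[OF functors_arrows[OF F A(1)] e(2) functors_arrows[OF G A(2)]])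
   finally show ?thesis using False i i' by (simp add: b_def join_map_def y1 y2)
  qed
  have "J m ?y \<in> functors (ordinal (2 * m + 1)) E" by (rule Jm[OF y])
  moreover have "restr (nerve E) (2 * m + 1) (2 * n + 1) ?k (J n x) \<in> functors (ordinal (2 * m + 1)) E"
   by (rule restr_nerve_closed[OF join_map_Delta[OF a] Jm[OF x]])
  moreover have "(\<lambda>i\<in>{..2 * m + 1}. p m ?y i) i = (\<lambda>i\<in>{..2 * m + 1}. (\<lambda>i\<in>{..2 * n + 1}. p n x i) (?k i)) i"
   if "i <= 2 * m + 1" for i
   using that Delta_le[OF join_map_Delta[OF a] that] by (simp add: pk)
  moreover have "cmp E (b n x (?k j)) (E.iv (b n x (?k i))) = cmp E (b m ?y j) (E.iv (b m ?y i))"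
   if ij: "i <= j" "j <= 2 * m + 1" for i j
   using ij bk[of i] bk[of j] E.spoke_rebase[OF c bm[OF y, of i] bm[OF y, of j]] by simp
  ultimately show "J m ?y = restr (nerve E) (2 * m + 1) (2 * n + 1) ?k (J n x)"
   unfolding J_def E.spokes_def restr_nerve
   using Delta_le[OF join_map_Delta[OF a]] Delta_mono[OF join_map_Delta[OF a]]
   by (auto dest: functors_ordinal_eqI simp: fun_eq_iff restrict_def pk)
 next
  fix n x assume "x \<in> cells (nerve C) n"
  then have x: "x \<in> functors (ordinal n) C" by (simp add: cells_nerve)
  then have x': "(fst x, snd x) \<in> functors (ordinal n) C" by simp
  note X = functors_ordinalD[OF x']
  have 1: "cmp E (Q (snd x (0, j))) (E.iv (Q (snd x (0, i)))) = Q (snd x (i, j))" if "i <= j" "j <= n" for i j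
  proof -
   have "cmp E (Q (snd x (i, j))) (Q (snd x (0, i))) = Q (snd x (0, j))"
    using functors_cmp[OF F X(2)[of 0 i] X(2)[of i j]] X(4)[of 0 i j] that by simp
   then show ?thesis
    using E.spoke_unique[OF functors_arrows[OF F X(2)[of 0 i]] functors_arrows[OF F X(2)[of i j]]] that by simp
  qed
  show "restr (nerve E) n (2 * n + 1) (join_inl n) (J n x) = nerve_map P Q n x"
   using 1 unfolding J_def E.spokes_def restr_nerve nerve_map_eq[of P Q n "fst x" "snd x", simplified]
   by (auto simp: fun_eq_iff restrict_def join_inl_def p_def b_def)
  have 2: "cmp E (cmp E (Q' (snd x (0, j))) (et (fst x 0))) (E.iv (cmp E (Q' (snd x (0, i))) (et (fst x 0)))) = Q' (snd x (i, j))"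
   if "i <= j" "j <= n" for i j
  proof -
   have "cmp E (Q' (snd x (i, j))) (Q' (snd x (0, i))) = Q' (snd x (0, j))"
    using functors_cmp[OF G X(2)[of 0 i] X(2)[of i j]] X(4)[of 0 i j] that by simp
   moreover have "cmp E (cmp E (Q' (snd x (0, j))) (et (fst x 0))) (E.iv (cmp E (Q' (snd x (0, i))) (et (fst x 0))))
     = cmp E (Q' (snd x (0, j))) (E.iv (Q' (snd x (0, i))))"
    using that by (intro E.spoke_rebase[OF et[OF X(1)] functors_arrows[OF G X(2)] functors_arrows[OF G X(2)]]) auto
   ultimately show ?thesis
    using E.spoke_unique[OF functors_arrows[OF G X(2)[of 0 i]] functors_arrows[OF G X(2)[of i j]]] that by simp
  qed
  show "restr (nerve E) n (2 * n + 1) (join_inr n) (J n x) = nerve_map P' Q' n x"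
   using 2 unfolding J_def E.spokes_def restr_nerve nerve_map_eq[of P' Q' n "fst x" "snd x", simplified]
   by (auto simp: fun_eq_iff restrict_def join_inr_def p_def b_def)
 qed (simp_all add: simplicial_set_nerve)
qed

lemma functors_comp:
 assumes "category C" and F: "(P, Q) \<in> functors C D" and G: "(R, S) \<in> functors D E"
 shows "(compose (Ob C) R P, compose (Ar C) S Q) \<in> functors C E"
proof -
 interpret C: category C by (rule assms)
 have o: "src C f \<in> Ob C" "trg C f \<in> Ob C" if "f \<in> Ar C" for f
  using that by (simp_all add: C.src_closed C.trg_closed)
 have ar: "f \<in> arrows C (src C f) (trg C f)" if "f \<in> Ar C" for f
  using that by (simp add: arrows_def)
 show ?thesis
 proof (rule functorsI[OF assms(1)])
  fix f assume f: "f \<in> Ar C"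
  show "compose (Ar C) S Q f \<in> arrows E (compose (Ob C) R P (src C f)) (compose (Ob C) R P (trg C f))"
   using functors_arrows[OF G functors_arrows[OF F ar[OF f]]] f o[OF f] by (simp add: compose_def)
  fix g assume g: "g \<in> Ar C" "src C g = trg C f"
  have gf: "cmp C g f \<in> Ar C" using C.cmp_closed[OF f g] by (simp add: arrows_def)
  have g': "g \<in> arrows C (trg C f) (trg C g)" using g by (simp add: arrows_def)
  show "compose (Ar C) S Q (cmp C g f) = cmp E (compose (Ar C) S Q g) (compose (Ar C) S Q f)"
   using functors_cmp[OF F ar[OF f] g'] functors_cmp[OF G functors_arrows[OF F ar[OF f]] functors_arrows[OF F g']]
    f g gf by (simp add: compose_def)
 next
  fix A assume A: "A \<in> Ob C"
  show "compose (Ob C) R P A \<in> Ob E"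
   using A functors_Ob[OF G functors_Ob[OF F A]] by (simp add: compose_def)
  show "compose (Ar C) S Q (ident C A) = ident E (compose (Ob C) R P A)"
   using A C.ident_closed[OF A] functors_ident[OF F A] functors_ident[OF G functors_Ob[OF F A]]
   by (simp add: compose_def arrows_def)
 qed (simp_all)
qed

lemma functors_id: "category C ==> ((\<lambda>A\<in>Ob C. A), (\<lambda>f\<in>Ar C. f)) \<in> functors C C"
 using category.src_closed[of C] category.trg_closed[of C] category.ident_closed[of C] category.cmp_closed[of C]
 by (intro functorsI) (auto simp: arrows_def)

lemma nerve_map_comp:
 assumes x: "x \<in> functors (ordinal n) C"
 shows "nerve_map R S n (nerve_map P Q n x) = nerve_map (compose (Ob C) R P) (compose (Ar C) S Q) n x"
proof -
 obtain p q where x': "x = (p, q)" by (cases x)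
 note X = functors_ordinalD[OF x[unfolded x']]
 show ?thesis
  unfolding x' nerve_map_eq using X(1) arrowsD(1)[OF X(2)]
  by (auto simp: fun_eq_iff restrict_def compose_def)
qed

lemma nerve_map_id:
 assumes x: "x \<in> functors (ordinal n) C"
 shows "nerve_map (\<lambda>A\<in>Ob C. A) (\<lambda>f\<in>Ar C. f) n x = x"
proof -
 obtain p q where x': "x = (p, q)" by (cases x)
 note X = functors_ordinalD[OF x[unfolded x']]
 show ?thesis
  unfolding x' nerve_map_eq using X(1) arrowsD(1)[OF X(2)] extensional_arb[OF X(5)] extensional_arb[OF X(6)]
  by (auto simp: fun_eq_iff restrict_def)
qed

lemma realization_map_nerve_id:
 assumes "c \<in> topspace (BN C)"
 shows "rmap (nerve C) (nerve_map (\<lambda>A\<in>Ob C. A) (\<lambda>f\<in>Ar C. f)) c = c"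
 by (rule realization_map_id[OF simplicial_set_nerve _ assms]) (simp add: nerve_map_id cells_nerve)

text \<open>One half of a homotopy equivalence; it is applied to both composites of a functor with
  its quasi-inverse.\<close>

lemma homotopic_id_nerve_map:
 assumes C: "groupoid_cat C" and F: "(P, Q) \<in> functors C D" and G: "(R, S) \<in> functors D C"
  and et: "!!c. c \<in> Ob C ==> et c \<in> arrows C (R (P c)) c"
  and nat: "!!f c c'. f \<in> arrows C c c' ==> cmp C (et c') (S (Q f)) = cmp C f (et c)"
 shows "homotopic_with (%_. True) (BN C) (BN C)
   (rmap (nerve C) (nerve_map R S) \<circ> rmap (nerve D) (nerve_map P Q)) id"
proof -
 interpret C: groupoid_cat C by (rule C)
 have cat: "category C" by unfold_locales
 note s = simplicial_set_nerve and FG = functors_comp[OF cat F G]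
 have "homotopic_with (%_. True) (BN C) (BN C)
   (rmap (nerve C) (nerve_map (compose (Ob C) R P) (compose (Ar C) S Q)))
   (rmap (nerve C) (nerve_map (\<lambda>A\<in>Ob C. A) (\<lambda>f\<in>Ar C. f)))"
 proof (rule homotopic_nerve_maps[OF C FG functors_id[OF cat], of et])
  show "et c \<in> arrows C (compose (Ob C) R P c) ((\<lambda>A\<in>Ob C. A) c)" if "c \<in> Ob C" for c
   using et[OF that] that by (simp add: compose_def)
  show "cmp C (et c') (compose (Ar C) S Q f) = cmp C ((\<lambda>f\<in>Ar C. f) f) (et c)" if "f \<in> arrows C c c'" for f c c'
   using nat[OF that] arrowsD(1)[OF that] by (simp add: compose_def)
 qed
 then show ?thesis
 proof (rule homotopic_with_eq)
  fix c assume c: "c \<in> topspace (BN C)"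
  note F' = simplicial_map_nerve_map[OF F] and G' = simplicial_map_nerve_map[OF G]
  have "rmap (nerve C) (%n. nerve_map R S n \<circ> nerve_map P Q n) c =
    rmap (nerve C) (nerve_map (compose (Ob C) R P) (compose (Ar C) S Q)) c"
   by (rule realization_map_cong[OF s s simplicial_map_comp[OF F' G'] _ c])
    (simp add: nerve_map_comp cells_nerve)
  then show "(rmap (nerve C) (nerve_map R S) \<circ> rmap (nerve D) (nerve_map P Q)) c =
    rmap (nerve C) (nerve_map (compose (Ob C) R P) (compose (Ar C) S Q)) c"
   using realization_map_comp[OF s s s F' G' c] by simp
  show "id c = rmap (nerve C) (nerve_map (\<lambda>A\<in>Ob C. A) (\<lambda>f\<in>Ar C. f)) c"
   by (simp add: realization_map_nerve_id[OF c])
 qed simp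
qed

text \<open>Construction of a quasi-inverse: choose for each \<open>e\<close> an object
  \<open>R e\<close> and an arrow \<open>es e\<close> from its image to \<open>e\<close>, conjugate
  arrows of \<open>E\<close> by \<open>es\<close>, and lift the result along \<open>Q\<close>.
  Fullness gives the lift, faithfulness makes it functorial.\<close>

lemma weak_equivalence_nerve:
 assumes C: "groupoid_cat C" and E: "groupoid_cat E" and F: "(P, Q) \<in> functors C E"
  and eso: "!!e. e \<in> Ob E ==> \<exists>c\<in>Ob C. \<exists>g. g \<in> arrows E (P c) e"
  and full: "!!c c' g. c \<in> Ob C ==> c' \<in> Ob C ==> g \<in> arrows E (P c) (P c') ==> \<exists>f\<in>arrows C c c'. Q f = g"
  and faithful: "!!c c' f f'. f \<in> arrows C c c' ==> f' \<in> arrows C c c' ==> Q f = Q f' ==> f = f'"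
 shows "weak_equivalence (nerve C) (nerve E) (nerve_map P Q)"
proof -
 interpret C: groupoid_cat C by (rule C)
 interpret E: groupoid_cat E by (rule E)
 have catE: "category E" by unfold_locales
 obtain R where R: "!!e. e \<in> Ob E ==> R e \<in> Ob C & (\<exists>g. g \<in> arrows E (P (R e)) e)"
  using eso by metis
 obtain es where es: "!!e. e \<in> Ob E ==> es e \<in> arrows E (P (R e)) e"
  using R by metis
 define conj where "conj g = cmp E (E.iv (es (trg E g))) (cmp E g (es (src E g)))" for g
 have conj: "conj g \<in> arrows E (P (R e)) (P (R e'))" "conj g = cmp E (E.iv (es e')) (cmp E g (es e))"
  if g: "g \<in> arrows E e e'" for g e e'
 proof -
  note o = E.arrows_Ob[OF g]
  show "conj g = cmp E (E.iv (es e')) (cmp E g (es e))"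
   using arrowsD[OF g] by (simp add: conj_def)
  then show "conj g \<in> arrows E (P (R e)) (P (R e'))"
   using E.cmp_arrows[OF E.cmp_arrows[OF es[OF o(1)] g] E.inv_arrows[OF es[OF o(2)]]] by simp
 qed
 have "\<exists>f. f \<in> arrows C (R (src E g)) (R (trg E g)) & Q f = conj g" if "g \<in> Ar E" for g
 proof -
  have g: "g \<in> arrows E (src E g) (trg E g)" using that by (simp add: arrows_def)
  show ?thesis
   using full[OF _ _ conj(1)[OF g]] R E.arrows_Ob[OF g] by blast
 qed
 then obtain S where S: "!!g. g \<in> Ar E ==> S g \<in> arrows C (R (src E g)) (R (trg E g)) & Q (S g) = conj g"
  by metis
 have Sa: "S g \<in> arrows C (R e) (R e')" "Q (S g) = conj g" if "g \<in> arrows E e e'" for g e e'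
  using S[of g] arrowsD[OF that] by simp_all
 have G: "((\<lambda>e\<in>Ob E. R e), (\<lambda>g\<in>Ar E. S g)) \<in> functors E C"
 proof (rule functorsI[OF catE])
  fix e assume e: "e \<in> Ob E"
  show "(\<lambda>e\<in>Ob E. R e) e \<in> Ob C" using R[OF e] e by simp
  note i = E.ident_closed[OF e]
  have "conj (ident E e) = ident E (P (R e))"
   using conj(2)[OF i] E.ident_left[OF es[OF e]] E.inv_left[OF es[OF e]] by simp
  then have "Q (S (ident E e)) = Q (ident C (R e))"
   using Sa(2)[OF i] functors_ident[OF F] R[OF e] by simp
  then have "S (ident E e) = ident C (R e)"
   using faithful[OF Sa(1)[OF i] C.ident_closed] R[OF e] by simp
  then show "(\<lambda>g\<in>Ar E. S g) (ident E e) = ident C ((\<lambda>e\<in>Ob E. R e) e)"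
   using e arrowsD(1)[OF i] by simp
 next
  fix g assume gA: "g \<in> Ar E"
  then have g: "g \<in> arrows E (src E g) (trg E g)" by (simp add: arrows_def)
  note o = E.arrows_Ob[OF g]
  show "(\<lambda>g\<in>Ar E. S g) g \<in> arrows C ((\<lambda>e\<in>Ob E. R e) (src E g)) ((\<lambda>e\<in>Ob E. R e) (trg E g))"
   using Sa(1)[OF g] gA o by simp
  fix h assume hA: "h \<in> Ar E" "src E h = trg E g"
  then have h: "h \<in> arrows E (trg E g) (trg E h)" by (simp add: arrows_def)
  note hg = E.cmp_arrows[OF g h] and e = es[OF o(1)] es[OF o(2)] es[OF E.arrows_Ob(2)[OF h]]
  have "cmp E (conj h) (conj g) = cmp E (cmp E (E.iv (es (trg E h))) (cmp E h (es (trg E g)))) (conj g)"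
   by (simp add: conj(2)[OF h])
  also have "\<dots> = cmp E (E.iv (es (trg E h))) (cmp E (cmp E h (es (trg E g))) (conj g))"
   by (rule E.assoc_arrows[OF conj(1)[OF g] E.cmp_arrows[OF e(2) h] E.inv_arrows[OF e(3)], symmetric])
  also have "cmp E (cmp E h (es (trg E g))) (conj g) = cmp E h (cmp E (es (trg E g)) (conj g))"
   by (rule E.assoc_arrows[OF conj(1)[OF g] e(2) h, symmetric])
  also have "cmp E (es (trg E g)) (conj g) = cmp E g (es (src E g))"
   unfolding conj(2)[OF g] by (rule E.cancel_inv_left[OF e(2) E.cmp_arrows[OF e(1) g]])
  also have "cmp E h (cmp E g (es (src E g))) = cmp E (cmp E h g) (es (src E g))"
   by (rule E.assoc_arrows[OF e(1) g h])
  finally have "conj (cmp E h g) = cmp E (conj h) (conj g)"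
   using conj(2)[OF hg] by simp
  then have "Q (S (cmp E h g)) = Q (cmp C (S h) (S g))"
   using functors_cmp[OF F Sa(1)[OF g] Sa(1)[OF h]] Sa(2)[OF g] Sa(2)[OF h] Sa(2)[OF hg] by simp
  then have "S (cmp E h g) = cmp C (S h) (S g)"
   by (rule faithful[OF Sa(1)[OF hg] C.cmp_arrows[OF Sa(1)[OF g] Sa(1)[OF h]]])
  then show "(\<lambda>g\<in>Ar E. S g) (cmp E h g) = cmp C ((\<lambda>g\<in>Ar E. S g) h) ((\<lambda>g\<in>Ar E. S g) g)"
   using gA hA(1) arrowsD(1)[OF hg] by simp
 qed simp_all
 \<comment> \<open>The lift \<open>ka c\<close> of \<open>es (P c)\<close> is the second natural
   isomorphism; faithfulness transfers its naturality from that of \<open>es\<close>.\<close>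
 have "\<exists>f. f \<in> arrows C (R (P c)) c & Q f = es (P c)" if "c \<in> Ob C" for c
  using full[OF _ that es[OF functors_Ob[OF F that]]] R[OF functors_Ob[OF F that]] by blast
 then obtain ka where ka: "!!c. c \<in> Ob C ==> ka c \<in> arrows C (R (P c)) c & Q (ka c) = es (P c)"
  by metis
 let ?R = "\<lambda>e\<in>Ob E. R e" and ?S = "\<lambda>g\<in>Ar E. S g"
 have 1: "homotopic_with (%_. True) (BN C) (BN C)
   (rmap (nerve C) (nerve_map ?R ?S) \<circ> rmap (nerve E) (nerve_map P Q)) id"
 proof (rule homotopic_id_nerve_map[OF C F G, of ka])
  show "ka c \<in> arrows C (?R (P c)) c" if "c \<in> Ob C" for c
   using ka[OF that] functors_Ob[OF F that] by simp
  fix f c c' assume f: "f \<in> arrows C c c'"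
  note o = C.arrows_Ob[OF f] and Qf = functors_arrows[OF F f]
  have k: "ka c \<in> arrows C (R (P c)) c" "ka c' \<in> arrows C (R (P c')) c'" "Q (ka c) = es (P c)" "Q (ka c') = es (P c')"
   using ka o by simp_all
  have "Q (cmp C (ka c') (S (Q f))) = cmp E (es (P c')) (conj (Q f))"
   using functors_cmp[OF F Sa(1)[OF Qf] k(2)] Sa(2)[OF Qf] k by simp
  also have "\<dots> = cmp E (Q f) (es (P c))"
   unfolding conj(2)[OF Qf]
   by (rule E.cancel_inv_left[OF es[OF E.arrows_Ob(2)[OF Qf]] E.cmp_arrows[OF es[OF E.arrows_Ob(1)[OF Qf]] Qf]])
  also have "\<dots> = Q (cmp C f (ka c))"
   using functors_cmp[OF F k(1) f] k by simp
  finally have "cmp C (ka c') (S (Q f)) = cmp C f (ka c)"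
   by (rule faithful[OF C.cmp_arrows[OF Sa(1)[OF Qf] k(2)] C.cmp_arrows[OF k(1) f]])
  then show "cmp C (ka c') (?S (Q f)) = cmp C f (ka c)"
   using arrowsD(1)[OF Qf] by simp
 qed
 have 2: "homotopic_with (%_. True) (BN E) (BN E)
   (rmap (nerve E) (nerve_map P Q) \<circ> rmap (nerve C) (nerve_map ?R ?S)) id"
 proof (rule homotopic_id_nerve_map[OF E G F, of es])
  show "es e \<in> arrows E (P (?R e)) e" if "e \<in> Ob E" for e
   using es[OF that] that by simp
  fix g e e' assume g: "g \<in> arrows E e e'"
  note o = E.arrows_Ob[OF g]
  have "cmp E (es e') (conj g) = cmp E g (es e)"
   unfolding conj(2)[OF g] by (rule E.cancel_inv_left[OF es[OF o(2)] E.cmp_arrows[OF es[OF o(1)] g]])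
  then show "cmp E (es e') (Q (?S g)) = cmp E g (es e)"
   using Sa(2)[OF g] arrowsD(1)[OF g] by simp
 qed
 note s = simplicial_set_nerve and F' = simplicial_map_nerve_map[OF F] and G' = simplicial_map_nerve_map[OF G]
 show ?thesis
  unfolding weak_equivalence_def homotopy_equivalence_def
  using s[of C] s[of E] F' continuous_map_realization_map[OF s s F'] continuous_map_realization_map[OF s s G'] 1 2
  by blast
qed

text \<open>The unique arrows out of \<open>z\<close> form a natural isomorphism from the constant
  functor at \<open>z\<close> to the identity, and the constant functor realizes to a constant
  map.\<close>

lemma contractible_nerve:
 assumes C: "groupoid_cat C" and z: "z \<in> Ob C"
  and uniq: "!!a b. a \<in> Ob C ==> b \<in> Ob C ==> \<exists>!f. f \<in> arrows C a b"
 shows "contractible_sset (nerve C)"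
proof -
 interpret C: groupoid_cat C by (rule C)
 have cat: "category C" by unfold_locales
 let ?P = "\<lambda>a\<in>Ob C. z" and ?Q = "\<lambda>f\<in>Ar C. ident C z"
 note zz = C.ident_closed[OF z]
 have K: "(?P, ?Q) \<in> functors C C"
  by (rule functorsI[OF cat])
   (use z zz C.ident_left[OF zz] arrowsD(1)[OF C.ident_closed] arrowsD(1)[OF C.cmp_closed]
    in \<open>simp_all add: C.src_closed C.trg_closed\<close>)
 define et where "et c = (THE f. f \<in> arrows C z c)" for c
 have et: "et c \<in> arrows C z c" if "c \<in> Ob C" for c
  unfolding et_def by (rule theI'[OF uniq[OF z that]])
 note s = simplicial_set_nerve and K' = simplicial_map_nerve_map[OF K]
 have h: "homotopic_with (%_. True) (BN C) (BN C)
   (rmap (nerve C) (nerve_map ?P ?Q)) (rmap (nerve C) (nerve_map (\<lambda>A\<in>Ob C. A) (\<lambda>f\<in>Ar C. f)))"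
 proof (rule homotopic_nerve_maps[OF C K functors_id[OF cat], of et])
  show "et c \<in> arrows C (?P c) ((\<lambda>A\<in>Ob C. A) c)" if "c \<in> Ob C" for c
   using et[OF that] that by simp
  fix f c c' assume f: "f \<in> arrows C c c'"
  note o = C.arrows_Ob[OF f]
  have "cmp C (et c') (ident C z) = cmp C f (et c)"
   using uniq[OF z o(2)] C.cmp_arrows[OF zz et[OF o(2)]] C.cmp_arrows[OF et[OF o(1)] f] by blast
  then show "cmp C (et c') (?Q f) = cmp C ((\<lambda>f\<in>Ar C. f) f) (et c)"
   using arrowsD(1)[OF f] by simp
 qed
 define p where "p = ((\<lambda>i\<in>{..0::nat}. z), (\<lambda>(i, j)\<in>{(i, j). i <= j & j <= (0::nat)}. ident C z))"
 have p: "p \<in> cells (nerve C) 0"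
  unfolding p_def cells_nerve by (rule functors_ordinalI) (use z zz C.ident_left[OF zz] in auto)
 obtain t where t: "t \<in> std 0" using nonempty_standard_simplex by blast
 have const: "rmap (nerve C) (nerve_map ?P ?Q) c = rp (nerve C) ((0, p), t)"
  if "c \<in> topspace (BN C)" for c
 proof (rule realization_cases[OF that])
  fix n x u assume x: "x \<in> cells (nerve C) n" and u: "u \<in> std n"
   and c: "c = rp (nerve C) ((n, x), u)"
  \<comment> \<open>A constant simplex is the degeneracy of the vertex \<open>p\<close> along the
    collapse to \<open>{..0}\<close>, hence glued to that vertex.\<close>
  let ?al = "\<lambda>i\<in>{..n}. 0::nat"
  have a: "?al \<in> Delta n 0" by (rule DeltaI) auto
  obtain X Y where xy: "x = (X, Y)" by (cases x)
  note X = functors_ordinalD[OF x[unfolded cells_nerve xy]]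
  have "nerve_map ?P ?Q n x = restr (nerve C) n 0 ?al p"
   unfolding xy nerve_map_eq restr_nerve p_def
   using X(1) arrowsD(1)[OF X(2)] by (auto simp: fun_eq_iff restrict_def)
  then have "rmap (nerve C) (nerve_map ?P ?Q) c = rp (nerve C) ((n, restr (nerve C) n 0 ?al p), u)"
   by (simp add: c realization_map_point[OF s s K' x u])
  also have "\<dots> = rp (nerve C) ((0, p), push n ?al u)"
   by (rule realization_point_restr[OF s a p u])
  also have "push n ?al u = t"
   using simplex_pushforward_mem[OF a u] t by (simp add: standard_simplex_0)
  finally show ?thesis .
 qed
 have "homotopic_with (%_. True) (BN C) (BN C)
   (%_. rp (nerve C) ((0, p), t)) id"
 proof (rule homotopic_with_eq[OF h])
  fix c assume c: "c \<in> topspace (BN C)"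
  show "rp (nerve C) ((0, p), t) = rmap (nerve C) (nerve_map ?P ?Q) c"
   using const[OF c] by simp
  show "id c = rmap (nerve C) (nerve_map (\<lambda>A\<in>Ob C. A) (\<lambda>f\<in>Ar C. f)) c"
   by (simp add: realization_map_nerve_id[OF c])
 qed simp
 then have "contractible_space (BN C)"
  unfolding contractible_space_def using homotopic_with_symD by blast
 then show ?thesis
  using realization_point_mem[OF p t] s unfolding contractible_sset_def by blast
qed

section \<open>Coverings of nerves\<close>

text \<open>Formulated with arbitrary monotone maps rather than elementary degeneracies, so that a
  face with nondegenerate restriction is injective by definition.\<close>

definition nondegenerate :: "'a sset => nat => 'a => bool" where
 "nondegenerate X n x \<longleftrightarrow> x \<in> cells X n &
   (\<forall>m si y. si \<in> Delta n m --> y \<in> cells X m --> x = restr X n m si y --> inj_on si {..n})"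

text \<open>Monotonicity forces all values between two equal ones to be equal, in particular those
  at neighbouring indices.\<close>

lemma Delta_not_inj:
 assumes si: "si \<in> Delta n m" and "\<not> inj_on si {..n}"
 obtains i where "i < n" "si i = si (Suc i)"
proof -
 obtain k l where kl: "k <= n" "l <= n" "k < l" "si k = si l"
  using assms(2) unfolding inj_on_def by (metis atMost_iff linorder_neqE_nat)
 have "si k <= si (Suc k)" "si (Suc k) <= si l"
  using kl Delta_mono[OF si, of k "Suc k"] Delta_mono[OF si, of "Suc k" l] by simp_all
 then show ?thesis using that[of k] kl by simp
qed

text \<open>A representative of least dimension has both properties, since a vanishing coordinate or
  a degeneracy would yield one in a smaller dimension. Both cases exhibit the point through an
  endomorphism \<open>ro i j\<close> of \<open>{..n}\<close> that factors through a smaller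
  ordinal.\<close>

lemma interior_representative:
 assumes X: "simplicial_set X" and c: "c \<in> topspace (realization X)"
 obtains n x t where "nondegenerate X n x" "t \<in> std n" "!!i. i <= n ==> 0 < t i"
  "c = rp X ((n, x), t)"
proof -
 let ?rep = "%n. \<exists>x\<in>cells X n. \<exists>t\<in>std n. c = rp X ((n, x), t)"
 define n where "n = (LEAST n. ?rep n)"
 have "\<exists>n. ?rep n" by (rule realization_cases[OF c]) blast
 then have "?rep n" unfolding n_def by (rule LeastI_ex)
 then obtain x t where x: "x \<in> cells X n" and t: "t \<in> std n"
  and ct: "c = rp X ((n, x), t)" by blast
 have least: "\<not> ?rep k" if "k < n" for k
  using that unfolding n_def by (rule not_less_Least)
 \<comment> \<open>The composite of the face that misses \<open>j\<close> after the degeneracy that identifies \<open>i\<close> and \<open>i + 1\<close>.\<close>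
 define ro where "ro i j = (\<lambda>k\<in>{..n}. if k \<noteq> i & k \<noteq> Suc i then k else if j = i then Suc i else i)" for i j
 have ro: "c \<noteq> rp X ((n, restr X n n (ro i j) x), t)" and roD: "ro i j \<in> Delta n n"
  if i: "i < n" and j: "j = i \<or> j = Suc i" for i j
 proof -
  obtain n' where n': "n = Suc n'" using i by (cases n) auto
  let ?si = "\<lambda>k\<in>{..n}. if k <= i then k else k - 1"
  let ?de = "\<lambda>k\<in>{..n'}. if k < j then k else Suc k"
  have s: "?si \<in> Delta n n'" and d: "?de \<in> Delta n' n"
   using i by (auto simp: n' intro!: DeltaI)
  have comp: "ro i j = compose {..n} ?de ?si"
   using i j by (auto simp: ro_def compose_def fun_eq_iff restrict_def n')
  then show "ro i j \<in> Delta n n" using mono_on_compose[OF s d] by simp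
  have "rp X ((n, restr X n n (ro i j) x), t) =
    rp X ((n, restr X n n' ?si (restr X n' n ?de x)), t)"
   by (simp only: comp simplicial_set_comp[OF X s d x])
  also have "\<dots> = rp X ((n', restr X n' n ?de x), push n ?si t)"
   by (rule realization_point_restr[OF X s simplicial_set_restr[OF X d x] t])
  finally show "c \<noteq> rp X ((n, restr X n n (ro i j) x), t)"
   using least[of n'] simplicial_set_restr[OF X d x] simplex_pushforward_mem[OF s t] by (auto simp: n')
 qed
 have "0 < t i" if i: "i <= n" for i
 proof (rule ccontr)
  assume "\<not> 0 < t i"
  then have ti: "t i = 0" using t by (auto simp: standard_simplex_def less_le)
  have n0: "n \<noteq> 0" using t ti i by (cases n) (auto simp: standard_simplex_0)
  \<comment> \<open>The collapse needs a right neighbour, which the last index lacks; there it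
    identifies the index with its predecessor. Dimension 0 is excluded because its only coordinate
    is 1.\<close>
  define a where "a = (if i < n then i else n - 1)"
  have a: "a < n" "i = a \<or> i = Suc a" using n0 i by (auto simp: a_def)
  have "push n (ro a i) t = t"
  proof
   fix j
   have "push n (ro a i) t j = (\<Sum>k\<le>n. if k = j then t k else 0)"
    unfolding simplex_pushforward_if using a ti by (intro sum.cong) (auto simp: ro_def)
   also have "\<dots> = t j" using t by (auto simp: standard_simplex_def)
   finally show "push n (ro a i) t j = t j" .
  qed
  then have "rp X ((n, restr X n n (ro a i) x), t) = c"
   using realization_point_restr[OF X roD[OF a] x t] ct by simp
  then show False using ro[OF a] by simp
 qed
 moreover have "nondegenerate X n x"
  unfolding nondegenerate_def
 proof (intro conjI allI impI x)
  fix m si y assume s: "si \<in> Delta n m" and y: "y \<in> cells X m" and xy: "x = restr X n m si y"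
  show "inj_on si {..n}"
  proof (rule ccontr)
   assume "\<not> inj_on si {..n}"
   then obtain i where i: "i < n" "si i = si (Suc i)" by (rule Delta_not_inj[OF s])
   \<comment> \<open>Since \<open>si\<close> takes the same value at \<open>i\<close> and
     \<open>Suc i\<close>, composing it with \<open>ro i i\<close> changes nothing, and
     \<open>x\<close> would be its own restriction along a map through a smaller ordinal.\<close>
   have r: "ro i i \<in> Delta n n" using roD[of i i] i by simp
   have "compose {..n} si (ro i i) = si"
    by (rule Delta_eqI[OF mono_on_compose[OF r s] s]) (use i in \<open>auto simp: compose_def ro_def\<close>)
   then have "restr X n n (ro i i) x = x"
    using simplicial_set_comp[OF X r s y] by (simp add: xy)
   then show False using ro[of i i] i ct by simp
  qed
 qed
 ultimately show ?thesis using that t ct by blast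
qed

text \<open>With \<open>t\<close> read as a probability distribution on vertices, this is the
  probability that \<open>Suc n\<close> independent draws form, in the order drawn, a face
  satisfying \<open>Ph\<close>.\<close>

definition mass :: "nat => nat => ((nat => nat) => bool) => (nat => real) => real" where
 "mass n m Ph t = (\<Sum>i\<in>{i \<in> Delta n m. Ph i}. \<Prod>k\<le>n. t (i k))"

text \<open>Draws from the pushed forward distribution are images under \<open>al\<close> of draws
  from \<open>t\<close>. Injectivity of \<open>j\<close> ensures that a sequence of vertices whose
  image is \<open>j\<close> is itself increasing, so that the sequences counted on the right are
  exactly the preimages.\<close>

lemma mass_pushforward:
 assumes a: "al \<in> Delta m m'" and inj: "!!j. j \<in> Delta n m' ==> Ph j ==> inj_on j {..n}"
 shows "mass n m' Ph (push m al t) = mass n m (%i. Ph (compose {..n} al i)) t"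
proof -
 let ?I = "{i \<in> Delta n m. Ph (compose {..n} al i)}" and ?J = "{j \<in> Delta n m'. Ph j}"
 have fib: "(\<Pi>\<^sub>E k\<in>{..n}. {i. i <= m & al i = j k}) = {i \<in> ?I. compose {..n} al i = j}" if j: "j \<in> ?J" for j
 proof (intro Set.set_eqI iffI)
  fix i assume i: "i \<in> (\<Pi>\<^sub>E k\<in>{..n}. {i. i <= m & al i = j k})"
  have i': "i k <= m" "al (i k) = j k" if "k <= n" for k using i that by (auto simp: PiE_iff)
  have "i \<in> Delta n m"
  proof (rule DeltaI)
   fix k l assume kl: "k <= l" "l <= n"
   show "i k <= i l"
   proof (rule ccontr)
    assume lt: "\<not> i k <= i l"
    have "al (i l) <= al (i k)" using Delta_mono[OF a, of "i l" "i k"] i'(1)[of k] lt kl by simp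
    moreover have "j k <= j l" using j Delta_mono[of j n m' k l] kl by simp
    ultimately have "j k = j l" using i'(2) kl by simp
    then have "k = l" using inj[of j] j kl by (auto simp: inj_on_def)
    then show False using lt by simp
   qed
  qed (use i i' in \<open>auto simp: PiE_iff extensional_def\<close>)
  moreover have "compose {..n} al i = j"
   by (rule Delta_eqI[OF mono_on_compose[OF calculation a]]) (use j i' in \<open>auto simp: compose_def\<close>)
  ultimately show "i \<in> {i \<in> ?I. compose {..n} al i = j}" using j by simp
 next
  fix i assume i: "i \<in> {i \<in> ?I. compose {..n} al i = j}"
  then have d: "i \<in> Delta n m" and e: "compose {..n} al i = j" by auto
  have "al (i k) = j k" if "k <= n" for k using e that by (auto simp: compose_def)
  then show "i \<in> (\<Pi>\<^sub>E k\<in>{..n}. {i. i <= m & al i = j k})"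
   using d Delta_le[OF d] by (auto simp: PiE_iff Delta_def)
 qed
 have "mass n m' Ph (push m al t) = (\<Sum>j\<in>?J. \<Prod>k\<in>{..n}. \<Sum>i\<in>{i. i <= m & al i = j k}. t i)"
  by (simp add: mass_def simplex_pushforward_def)
 also have "\<dots> = (\<Sum>j\<in>?J. \<Sum>i\<in>{i \<in> ?I. compose {..n} al i = j}. \<Prod>k\<in>{..n}. t (i k))"
 proof (rule sum.cong[OF refl])
  fix j assume j: "j \<in> ?J"
  have "(\<Prod>k\<in>{..n}. \<Sum>i\<in>{i. i <= m & al i = j k}. t i) =
    (\<Sum>i\<in>(\<Pi>\<^sub>E k\<in>{..n}. {i. i <= m & al i = j k}). \<Prod>k\<in>{..n}. t (i k))"
   by (rule prod_sum_PiE) auto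
  then show "(\<Prod>k\<in>{..n}. \<Sum>i\<in>{i. i <= m & al i = j k}. t i) =
    (\<Sum>i\<in>{i \<in> ?I. compose {..n} al i = j}. \<Prod>k\<in>{..n}. t (i k))"
   by (simp only: fib[OF j])
 qed
 also have "\<dots> = (\<Sum>i\<in>?I. \<Prod>k\<in>{..n}. t (i k))"
  by (rule sum.group) (use finite_Delta mono_on_compose[OF _ a] in auto)
 finally show ?thesis by (simp add: mass_def)
qed

lemma mass_mono:
 assumes "t \<in> std m" "!!i. i \<in> Delta n m ==> Ph i ==> \<Psi> i"
 shows "mass n m Ph t <= mass n m \<Psi> t"
 unfolding mass_def
 by (rule sum_mono2) (use assms finite_Delta in \<open>auto simp: standard_simplex_def intro!: prod_nonneg\<close>)

lemma mass_disj:
 assumes "!!i. i \<in> Delta n m ==> \<not> (Ph i & \<Psi> i)"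
 shows "mass n m (%i. Ph i \<or> \<Psi> i) t = mass n m Ph t + mass n m \<Psi> t"
proof -
 have "{i \<in> Delta n m. Ph i \<or> \<Psi> i} = {i \<in> Delta n m. Ph i} \<union> {i \<in> Delta n m. \<Psi> i}" by auto
 then show ?thesis
  unfolding mass_def using assms finite_Delta by (simp add: sum.union_disjoint disjoint_iff)
qed

lemma mass_cong:
 "(!!i. i \<in> Delta n m ==> Ph i = \<Psi> i) ==> mass n m Ph t = mass n m \<Psi> t"
 unfolding mass_def by (rule sum.cong) auto

lemma continuous_map_mass:
 "continuous_map (subtopology (powertop_real UNIV) S) euclideanreal (mass n m Ph)"
 unfolding mass_def
 by (intro continuous_map_sum continuous_map_prod continuous_map_from_subtopology
   continuous_map_product_projection) (auto intro: finite_subset[OF _ finite_Delta])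

text \<open>The identity is the only injective monotone self-map of \<open>{..n}\<close>: induction
  upwards bounds such a map from below, induction downwards bounds it from above.\<close>

lemma mass_top:
 assumes nd: "!!i. i \<in> Delta n n ==> Ph i ==> inj_on i {..n}"
 shows "mass n n Ph t = (if Ph (Delta_id n) then (\<Prod>k\<le>n. t k) else 0)"
proof -
 have "i = Delta_id n" if i: "i \<in> Delta n n" and "Ph i" for i
 proof -
  have inj: "inj_on i {..n}" using nd[OF that] .
  have le: "k <= i k" if "k <= n" for k
   using that
  proof (induction k)
   case (Suc k)
   have "i k \<noteq> i (Suc k)" using inj_onD[OF inj, of k "Suc k"] Suc.prems by auto
   then have "i k < i (Suc k)" using Delta_mono[OF i, of k "Suc k"] Suc.prems by simp
   then show ?case using Suc by simp
  qed simp
  have ge: "i (n - d) <= n - d" if "d <= n" for d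
   using that
  proof (induction d)
   case 0
   then show ?case using Delta_le[OF i, of n] by simp
  next
   case (Suc d)
   then have e: "n - d = Suc (n - Suc d)" by simp
   have "i (n - Suc d) \<noteq> i (n - d)" using inj_onD[OF inj, of "n - Suc d" "n - d"] Suc.prems by auto
   then have "i (n - Suc d) < i (n - d)" using Delta_mono[OF i, of "n - Suc d" "n - d"] diff_le_mono2[of d "Suc d" n] by simp
   then show ?case using Suc e by simp
  qed
  have "i k = k" if "k <= n" for k
   using le[OF that] ge[of "n - k"] that by simp
  then show ?thesis by (intro Delta_eqI[OF i Delta_id_mem]) (simp add: Delta_id_def)
 qed
 then have "{i \<in> Delta n n. Ph i} = (if Ph (Delta_id n) then {Delta_id n} else {})"
  using Delta_id_mem by auto
 then show ?thesis by (simp add: mass_def Delta_id_def)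
qed

lemma openin_simplex_sum:
 "openin (simplex_sum X) S \<longleftrightarrow> S \<subseteq> topspace (simplex_sum X) &
   (\<forall>n. \<forall>x\<in>cells X n. openin (simplex_top n) {t. ((n, x), t) \<in> S})"
 unfolding simplex_sum_def openin_sum_topology by (auto simp: simplex_sum_def)

text \<open>The sheets are given by sections over \<open>V\<close> with open, pairwise disjoint
  images; composing with a section is how maps are lifted locally.\<close>

definition evenly_covered :: "'e topology => 'b topology => ('e => 'b) => 'b set => bool" where
 "evenly_covered E B p V \<longleftrightarrow> openin B V &
   (\<exists>S. (\<forall>s\<in>S. continuous_map (subtopology B V) E s & (\<forall>b\<in>V. p (s b) = b) & openin E (s ` V)) &
     (\<forall>s\<in>S. \<forall>s'\<in>S. s \<noteq> s' --> s ` V \<inter> s' ` V = {}) &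
     (\<forall>e\<in>topspace E. p e \<in> V --> (\<exists>s\<in>S. e = s (p e))))"

definition covering :: "'e topology => 'b topology => ('e => 'b) => bool" where
 "covering E B p \<longleftrightarrow> continuous_map E B p & (\<forall>b\<in>topspace B. \<exists>V. b \<in> V & evenly_covered E B p V)"

text \<open>The nerve of the category of objects under \<open>a\<close>: the arrow to the first
  vertex determines those to the other vertices, so it alone is stored and restriction transports it
  to the new first vertex.\<close>

definition slice :: "('o, 'm) cat => 'o => (('o, 'm) nerve_simplex \<times> 'm) sset" where
 "slice C a = \<lparr>
   cells = (%n. {(x, u). x \<in> cells (nerve C) n & u \<in> arrows C a (fst x 0)}),
   restr = (%m n al (x, u). (restr (nerve C) m n al x, cmp C (snd x (0, al 0)) u))\<rparr>"

lemma cells_slice: "cells (slice C a) n = {(x, u). x \<in> cells (nerve C) n & u \<in> arrows C a (fst x 0)}"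
 and restr_slice: "restr (slice C a) m n al (x, u) = (restr (nerve C) m n al x, cmp C (snd x (0, al 0)) u)"
 by (simp_all add: slice_def)

lemma fst_restr_nerve: "i <= m ==> fst (restr (nerve C) m n al x) i = fst x (al i)"
 and snd_restr_nerve: "i <= j ==> j <= m ==> snd (restr (nerve C) m n al x) (i, j) = snd x (al i, al j)"
 using restr_nerve[of C m n al "fst x" "snd x"] by simp_all

lemma cells_nerveD:
 assumes "x \<in> cells (nerve C) n"
 shows "i <= n ==> fst x i \<in> Ob C"
  "i <= j ==> j <= n ==> snd x (i, j) \<in> arrows C (fst x i) (fst x j)"
  "i <= n ==> snd x (i, i) = ident C (fst x i)"
  "i <= j ==> j <= k ==> k <= n ==> cmp C (snd x (j, k)) (snd x (i, j)) = snd x (i, k)"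
 using functors_ordinalD(1-4)[of "fst x" "snd x" n C] assms by (simp_all add: cells_nerve)

context category begin

lemma restr_slice_closed:
 assumes a: "al \<in> Delta m n" and xu: "(x, u) \<in> cells (slice C a) n"
 shows "(restr (nerve C) m n al x, cmp C (snd x (0, al 0)) u) \<in> cells (slice C a) m"
proof -
 have x: "x \<in> cells (nerve C) n" and u: "u \<in> arrows C a (fst x 0)"
  using xu by (auto simp: cells_slice)
 show ?thesis
  using simplicial_set_restr[OF simplicial_set_nerve a x] cmp_arrows[OF u cells_nerveD(2)[OF x, of 0 "al 0"]]
   Delta_le[OF a, of 0]
  by (simp add: cells_slice fst_restr_nerve)
qed

lemma simplicial_set_slice: "simplicial_set (slice C a)"
 unfolding simplicial_set_def
proof (intro conjI allI ballI)
 fix m n al z assume a: "al \<in> Delta m n" and z: "z \<in> cells (slice C a) n"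
 obtain x u where xu: "z = (x, u)" by (cases z)
 show "restr (slice C a) m n al z \<in> cells (slice C a) m"
  using restr_slice_closed[OF a z[unfolded xu]] by (simp add: xu restr_slice)
next
 fix n z assume z: "z \<in> cells (slice C a) n"
 obtain x u where xu: "z = (x, u)" by (cases z)
 have x: "x \<in> cells (nerve C) n" and u: "u \<in> arrows C a (fst x 0)"
  using z by (auto simp: cells_slice xu)
 have "Delta_id n 0 = 0" by (simp add: Delta_id_def)
 then show "restr (slice C a) n n (Delta_id n) z = z"
  using simplicial_set_id[OF simplicial_set_nerve x] cells_nerveD(3)[OF x, of 0] ident_left[OF u]
  by (simp add: xu restr_slice)
next
 fix l m n al bt z assume a: "al \<in> Delta l m" and b: "bt \<in> Delta m n" and z: "z \<in> cells (slice C a) n"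
 obtain x u where xu: "z = (x, u)" by (cases z)
 have x: "x \<in> cells (nerve C) n" and u: "u \<in> arrows C a (fst x 0)"
  using z by (auto simp: cells_slice xu)
 have le: "bt 0 <= bt (al 0)" "bt (al 0) <= n" "al 0 <= m"
  using Delta_le[OF a, of 0] Delta_le[OF b, of "al 0"] Delta_mono[OF b, of 0 "al 0"] by simp_all
 have "cmp C (snd x (bt 0, bt (al 0))) (cmp C (snd x (0, bt 0)) u) = cmp C (snd x (0, bt (al 0))) u"
  using assoc_arrows[OF u cells_nerveD(2)[OF x, of 0 "bt 0"] cells_nerveD(2)[OF x, of "bt 0" "bt (al 0)"]]
   cells_nerveD(4)[OF x, of 0 "bt 0" "bt (al 0)"] le by simp
 then show "restr (slice C a) l n (compose {..l} bt al) z = restr (slice C a) l m al (restr (slice C a) m n bt z)"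
  using simplicial_set_comp[OF simplicial_set_nerve a b x] le
  by (simp add: xu restr_slice compose_eq snd_restr_nerve)
qed

lemma simplicial_map_slice: "simplicial_map (slice C a) (nerve C) (%n. fst)"
 by (auto simp: simplicial_map_def cells_slice restr_slice)

end

abbreviation slice_map where
 "slice_map C \<equiv> rmap (nerve C) (%n. fst)"

context groupoid_cat begin

text \<open>Near an interior point of a nondegenerate simplex \<open>x\<close>, the faces of a point that agree with
 \<open>x\<close> carry more than half of the weight of all nondegenerate faces of the same dimension, and
 hence single out one arrow \<open>v\<close> from the first vertex of \<open>x\<close>, the local trivialization.\<close>

definition matching :: "nat => ('o, 'm) nerve_simplex => nat => ('o, 'm) nerve_simplex => 'm => (nat => nat) => bool" where
 "matching n x m y v i \<longleftrightarrow> restr (nerve C) n m i y = x & cmp C (snd y (0, i 0)) v = ident C (fst x 0)"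

definition sheet :: "nat => ('o, 'm) nerve_simplex => (nat \<times> ('o, 'm) nerve_simplex) \<times> (nat => real) => 'm => bool" where
 "sheet n x = (%((m, y), t) v. v \<in> arrows C (fst x 0) (fst y 0) &
   mass n m (%i. nondegenerate (nerve C) n (restr (nerve C) n m i y)) t < 2 * mass n m (matching n x m y v) t)"

lemma inj_nondegenerate_restr:
 assumes "y \<in> cells (nerve C) m" "i \<in> Delta n m" "nondegenerate (nerve C) n (restr (nerve C) n m i y)"
 shows "inj_on i {..n}"
 using assms unfolding nondegenerate_def by blast

text \<open>Both masses push forward along \<open>al\<close>, and the arrow to the first vertex
  moves along with the restriction; thus membership in a sheet is compatible with gluing.\<close>

lemma sheet_restr:
 assumes x: "nondegenerate (nerve C) n x" and a: "al \<in> Delta m m'" and y: "y \<in> cells (nerve C) m'"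
  and v: "v \<in> arrows C (fst x 0) (fst y 0)"
 shows "sheet n x ((m, restr (nerve C) m m' al y), t) (cmp C (snd y (0, al 0)) v) \<longleftrightarrow>
     sheet n x ((m', y), push m al t) v"
proof -
 let ?y = "restr (nerve C) m m' al y"
 have a0: "al 0 <= m'" using Delta_le[OF a, of 0] by simp
 have y0: "snd y (0, al 0) \<in> arrows C (fst y 0) (fst y (al 0))" using cells_nerveD(2)[OF y, of 0 "al 0"] a0 by simp
 have comp: "restr (nerve C) n m i ?y = restr (nerve C) n m' (compose {..n} al i) y" if "i \<in> Delta n m" for i
  using simplicial_set_comp[OF simplicial_set_nerve that a y] .
 have "mass n m' (%i. nondegenerate (nerve C) n (restr (nerve C) n m' i y)) (push m al t) =
   mass n m (%i. nondegenerate (nerve C) n (restr (nerve C) n m' (compose {..n} al i) y)) t"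
  by (rule mass_pushforward[OF a]) (rule inj_nondegenerate_restr[OF y])
 also have "\<dots> = mass n m (%i. nondegenerate (nerve C) n (restr (nerve C) n m i ?y)) t"
  by (rule mass_cong) (simp add: comp)
 finally have 1: "mass n m' (%i. nondegenerate (nerve C) n (restr (nerve C) n m' i y)) (push m al t) =
  mass n m (%i. nondegenerate (nerve C) n (restr (nerve C) n m i ?y)) t" .
 have "mass n m' (matching n x m' y v) (push m al t) =
   mass n m (%i. matching n x m' y v (compose {..n} al i)) t"
  by (rule mass_pushforward[OF a]) (use x inj_nondegenerate_restr[OF y] in \<open>auto simp: matching_def\<close>)
 also have "\<dots> = mass n m (matching n x m ?y (cmp C (snd y (0, al 0)) v)) t"
 proof (rule mass_cong)
  fix i assume i: "i \<in> Delta n m"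
  have le: "i 0 <= m" "al 0 <= al (i 0)" "al (i 0) <= m'"
   using Delta_le[OF i, of 0] Delta_mono[OF a, of 0 "i 0"] Delta_le[OF a, of "i 0"] by simp_all
  have "cmp C (snd y (al 0, al (i 0))) (cmp C (snd y (0, al 0)) v) = cmp C (snd y (0, al (i 0))) v"
   using assoc_arrows[OF v y0 cells_nerveD(2)[OF y, of "al 0" "al (i 0)"]]
    cells_nerveD(4)[OF y, of 0 "al 0" "al (i 0)"] le by simp
  then show "matching n x m' y v (compose {..n} al i) = matching n x m ?y (cmp C (snd y (0, al 0)) v) i"
   using le by (simp add: matching_def comp[OF i] compose_eq snd_restr_nerve)
 qed
 finally show ?thesis
  using v cmp_arrows[OF v y0] by (simp add: sheet_def 1 fst_restr_nerve)
qed

text \<open>A face matching both arrows would make them equal by left cancellation. The faces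
  matching \<open>v\<close> and those matching \<open>v'\<close> are therefore disjoint sets of
  nondegenerate faces, and both cannot carry more than half of the mass.\<close>

lemma sheet_unique:
 assumes x: "nondegenerate (nerve C) n x" and y: "y \<in> cells (nerve C) m" and t: "t \<in> std m"
  and v: "sheet n x ((m, y), t) v" and v': "sheet n x ((m, y), t) v'"
 shows "v = v'"
proof (rule ccontr)
 assume ne: "v \<noteq> v'"
 have va: "v \<in> arrows C (fst x 0) (fst y 0)" and va': "v' \<in> arrows C (fst x 0) (fst y 0)"
  using v v' by (auto simp: sheet_def)
 have "\<not> (matching n x m y v i & matching n x m y v' i)" if i: "i \<in> Delta n m" for i
  using ne left_cancel[OF cells_nerveD(2)[OF y, of 0 "i 0"] va va'] Delta_le[OF i, of 0]
  by (auto simp: matching_def)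
 then have "mass n m (matching n x m y v) t + mass n m (matching n x m y v') t =
   mass n m (%i. matching n x m y v i \<or> matching n x m y v' i) t"
  by (intro mass_disj[symmetric])
 also have "\<dots> <= mass n m (%i. nondegenerate (nerve C) n (restr (nerve C) n m i y)) t"
  by (rule mass_mono[OF t]) (use x in \<open>auto simp: matching_def\<close>)
 finally show False using v v' by (simp add: sheet_def)
qed

text \<open>In the top dimension only the identity face contributes, so both masses equal the
  product of the coordinates, which is positive in the interior.\<close>

lemma sheet_self:
 assumes x: "nondegenerate (nerve C) n x" and t: "!!i. i <= n ==> 0 < t i"
 shows "sheet n x ((n, x), t) (ident C (fst x 0))"
proof -
 have xc: "x \<in> cells (nerve C) n" using x by (simp add: nondegenerate_def)
 note i = ident_closed[OF cells_nerveD(1)[OF xc, of 0]]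
 have id: "restr (nerve C) n n (Delta_id n) x = x"
  by (rule simplicial_set_id[OF simplicial_set_nerve xc])
 have "mass n n (%i. nondegenerate (nerve C) n (restr (nerve C) n n i x)) t = (\<Prod>k\<le>n. t k)"
  by (subst mass_top) (use inj_nondegenerate_restr[OF xc] x id in auto)
 moreover have "mass n n (matching n x n x (ident C (fst x 0))) t = (\<Prod>k\<le>n. t k)"
  by (subst mass_top) (use inj_nondegenerate_restr[OF xc] x id cells_nerveD(3)[OF xc, of 0] ident_left[OF i]
    in \<open>auto simp: matching_def Delta_id_def\<close>)
 moreover have "0 < (\<Prod>k\<le>n. t k)" by (rule prod_pos) (simp add: t)
 ultimately show ?thesis using i by (simp add: sheet_def)
qed

text \<open>A strict inequality between polynomials in the coordinates; the set is empty if
  \<open>v\<close> has the wrong source or target.\<close>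

lemma openin_sheet:
 "openin (simplex_top m) {t \<in> std m. sheet n x ((m, y), t) v}"
proof (cases "v \<in> arrows C (fst x 0) (fst y 0)")
 case True
 let ?T = "simplex_top m"
 let ?g = "%t. 2 * mass n m (matching n x m y v) t - mass n m (%i. nondegenerate (nerve C) n (restr (nerve C) n m i y)) t"
 have "continuous_map ?T euclideanreal ?g"
  by (intro continuous_intros continuous_map_mass)
 then have "openin ?T {t \<in> topspace ?T. ?g t \<in> {0<..}}"
  by (rule openin_continuous_map_preimage) simp
 moreover have "{t \<in> topspace ?T. ?g t \<in> {0<..}} = {t \<in> std m. sheet n x ((m, y), t) v}"
  using True by (auto simp: sheet_def)
 ultimately show ?thesis by simp
next
 case False
 then show ?thesis by (simp add: sheet_def)
qed

text \<open>Composition with the arrow from the old to the new first vertex is a bijection in a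
  groupoid, so an existential statement about arrows to the first vertex is insensitive to
  gluing.\<close>

lemma ex_arrow_restr:
 assumes a: "al \<in> Delta m n" and y: "y \<in> cells (nerve C) n"
 shows "(\<exists>w\<in>arrows C b (fst y (al 0)). Ph w) \<longleftrightarrow> (\<exists>v\<in>arrows C b (fst y 0). Ph (cmp C (snd y (0, al 0)) v))"
proof -
 have y0: "snd y (0, al 0) \<in> arrows C (fst y 0) (fst y (al 0))"
  using cells_nerveD(2)[OF y, of 0 "al 0"] Delta_le[OF a, of 0] by simp
 show ?thesis
 proof
  assume "\<exists>w\<in>arrows C b (fst y (al 0)). Ph w"
  then obtain w where w: "w \<in> arrows C b (fst y (al 0))" "Ph w" by blast
  show "\<exists>v\<in>arrows C b (fst y 0). Ph (cmp C (snd y (0, al 0)) v)"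
   by (rule bexI[OF _ cmp_arrows[OF w(1) inv_arrows[OF y0]]]) (simp add: cancel_inv_left[OF y0 w(1)] w(2))
 next
  assume "\<exists>v\<in>arrows C b (fst y 0). Ph (cmp C (snd y (0, al 0)) v)"
  then show "\<exists>w\<in>arrows C b (fst y (al 0)). Ph w" using cmp_arrows[OF _ y0] by blast
 qed
qed

text \<open>Which arrow wins the majority depends on the representative, but that one wins does not;
  this makes the trivializing neighbourhood a saturated set.\<close>

lemma ex_sheet_cong:
 assumes x: "nondegenerate (nerve C) n x"
  and p: "p \<in> topspace (simplex_sum (nerve C))" and q: "q \<in> topspace (simplex_sum (nerve C))"
  and eq: "rp (nerve C) p = rp (nerve C) q"
 shows "(\<exists>v. sheet n x p v) \<longleftrightarrow> (\<exists>v. sheet n x q v)"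
proof (rule realization_point_cong[OF _ p q eq])
 fix m m' al y t assume a: "al \<in> Delta m m'" and y: "y \<in> cells (nerve C) m'" and t: "t \<in> std m"
 have "(\<exists>v. sheet n x ((m, restr (nerve C) m m' al y), t) v) \<longleftrightarrow>
   (\<exists>w\<in>arrows C (fst x 0) (fst y (al 0)). sheet n x ((m, restr (nerve C) m m' al y), t) w)"
  by (auto simp: sheet_def fst_restr_nerve)
 also have "\<dots> \<longleftrightarrow> (\<exists>v\<in>arrows C (fst x 0) (fst y 0). sheet n x ((m', y), push m al t) v)"
  by (simp add: ex_arrow_restr[OF a y] sheet_restr[OF x a y])
 also have "\<dots> \<longleftrightarrow> (\<exists>v. sheet n x ((m', y), push m al t) v)"
  by (auto simp: sheet_def)
 finally show "(\<exists>v. sheet n x ((m, restr (nerve C) m m' al y), t) v) \<longleftrightarrow>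
   (\<exists>v. sheet n x ((m', y), push m al t) v)" .
qed

text \<open>A point of the slice carries its own arrow \<open>w\<close>; dividing it by
  \<open>u\<close> tests whether the point lies on the sheet labelled by \<open>u\<close>, and the
  answer must not depend on the representative.\<close>

lemma slice_sheet_cong:
 assumes x: "nondegenerate (nerve C) n x" and u: "u \<in> arrows C a (fst x 0)"
  and p: "((m, y, w), t) \<in> topspace (simplex_sum (slice C a))"
  and q: "((m', y', w'), t') \<in> topspace (simplex_sum (slice C a))"
  and eq: "rp (slice C a) ((m, y, w), t) = rp (slice C a) ((m', y', w'), t')"
 shows "sheet n x ((m, y), t) (cmp C w (iv u)) \<longleftrightarrow> sheet n x ((m', y'), t') (cmp C w' (iv u))"
proof -
 let ?h = "%((m, (y, w)), t). sheet n x ((m, y), t) (cmp C w (iv u))"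
 have "?h ((m, y, w), t) = ?h ((m', y', w'), t')"
 proof (rule realization_point_cong[OF _ p q eq])
  fix m m' al z t assume a: "al \<in> Delta m m'" and z: "z \<in> cells (slice C a) m'" and t: "t \<in> std m"
  obtain y w where yw: "z = (y, w)" by (cases z)
  have y: "y \<in> cells (nerve C) m'" and w: "w \<in> arrows C a (fst y 0)" using z by (auto simp: yw cells_slice)
  have y0: "snd y (0, al 0) \<in> arrows C (fst y 0) (fst y (al 0))"
   using cells_nerveD(2)[OF y, of 0 "al 0"] Delta_le[OF a, of 0] by simp
  show "?h ((m, restr (slice C a) m m' al z), t) = ?h ((m', z), push m al t)"
   using sheet_restr[OF x a y cmp_arrows[OF inv_arrows[OF u] w]] assoc_arrows[OF inv_arrows[OF u] w y0]
   by (simp add: yw restr_slice)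
 qed
 then show ?thesis by simp
qed

end

context groupoid_cat begin

text \<open>Choose an interior representative over a nondegenerate \<open>x\<close>. Over the points
  that admit a winning arrow \<open>v\<close> from the first vertex of \<open>x\<close>, each arrow
  \<open>u\<close> from \<open>a\<close> to that vertex defines a section, which equips the point
  with \<open>cmp C v u\<close>.\<close>

lemma covering_slice: "covering (realization (slice C a)) (BN C) (slice_map C)"
 unfolding covering_def
proof (intro conjI ballI)
 let ?N = "nerve C" and ?A = "slice C a"
 note sN = simplicial_set_nerve[of C] and sA = simplicial_set_slice[of a] and sf = simplicial_map_slice[of a]
 show "continuous_map (realization ?A) (realization ?N) (slice_map C)"
  by (rule continuous_map_realization_map[OF sA sN sf])
 fix c assume c: "c \<in> topspace (realization ?N)"
 obtain n x t0 where x: "nondegenerate ?N n x" and t0: "t0 \<in> std n" "!!i. i <= n ==> 0 < t0 i"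
  and ct: "c = rp ?N ((n, x), t0)"
  by (rule interior_representative[OF sN c]) blast
 have xN: "x \<in> cells ?N n" using x by (simp add: nondegenerate_def)
 define U where "U = {p \<in> topspace (simplex_sum ?N). \<exists>v. sheet n x p v}"
 define V where "V = rp ?N ` U"
 have UV: "{p \<in> topspace (simplex_sum ?N). rp ?N p \<in> V} = U"
 proof
  show "{p \<in> topspace (simplex_sum ?N). rp ?N p \<in> V} \<subseteq> U"
  proof
   fix p assume "p \<in> {p \<in> topspace (simplex_sum ?N). rp ?N p \<in> V}"
   then obtain q where p: "p \<in> topspace (simplex_sum ?N)" and q: "q \<in> U" "rp ?N p = rp ?N q"
    by (auto simp: V_def)
   then show "p \<in> U" using ex_sheet_cong[OF x p _ q(2)] by (auto simp: U_def)
  qed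
 qed (auto simp: V_def U_def)
 have openU: "openin (simplex_sum ?N) U"
  unfolding openin_simplex_sum
 proof (intro conjI allI ballI)
  show "U \<subseteq> topspace (simplex_sum ?N)" by (auto simp: U_def)
  fix m y assume y: "y \<in> cells ?N m"
  have "{t. ((m, y), t) \<in> U} = (\<Union>v. {t \<in> std m. sheet n x ((m, y), t) v})"
   using y by (auto simp: U_def topspace_simplex_sum)
  then show "openin (simplex_top m) {t. ((m, y), t) \<in> U}"
   by (auto intro!: openin_Union openin_sheet)
 qed
 have openV: "openin (realization ?N) V"
  unfolding openin_realization UV using openU by (auto simp: V_def U_def)
 have q: "quotient_map (subtopology (simplex_sum ?N) U) (subtopology (realization ?N) V) (rp ?N)"
  using quotient_map_restriction[OF quotient_map_realization UV] openV by blast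
 have "sheet n x ((n, x), t0) (ident C (fst x 0))" by (rule sheet_self[OF x t0(2)])
 then have "((n, x), t0) \<in> U" using xN t0(1) unfolding U_def topspace_simplex_sum by blast
 then have cV: "c \<in> V" unfolding V_def ct by (rule imageI)
 define h where "h u = (%((m, y), t). rp ?A ((m, (y, cmp C (THE v. sheet n x ((m, y), t) v) u)), t))" for u
 have h_eq: "h u ((m, y), t) = rp ?A ((m, (y, cmp C v u)), t)"
  if "y \<in> cells ?N m" "t \<in> std m" "sheet n x ((m, y), t) v" for u m y t v
 proof -
  have "(THE v. sheet n x ((m, y), t) v) = v"
   by (rule the_equality, rule that(3)) (use sheet_unique[OF x that(1,2)] that(3) in blast)
  then show ?thesis by (simp add: h_def)
 qed
 have sheetD: "v \<in> arrows C (fst x 0) (fst y 0)" if "sheet n x ((m, y), t) v" for m y t v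
  using that by (simp add: sheet_def)
 have cellA: "(y, cmp C v u) \<in> cells ?A m"
  if "y \<in> cells ?N m" "sheet n x ((m, y), t) v" "u \<in> arrows C a (fst x 0)" for m y t v u
  using that cmp_arrows[OF that(3) sheetD[OF that(2)]] by (simp add: cells_slice)
 \<comment> \<open>On a cell, the winning arrow \<open>v\<close> is constant on each of the open
   sets \<open>?W v\<close>, and there \<open>h u\<close> is the map of a single cell of the slice;
   a preimage is thus a union of open sets.\<close>
 have openinA: "openin (simplex_sum ?N) {p \<in> U. h u p \<in> W}" if W: "openin (realization ?A) W" and u: "u \<in> arrows C a (fst x 0)" for u W
  unfolding openin_simplex_sum
 proof (intro conjI allI ballI)
  show "{p \<in> U. h u p \<in> W} \<subseteq> topspace (simplex_sum ?N)" by (auto simp: U_def)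
  fix m y assume y: "y \<in> cells ?N m"
  let ?T = "simplex_top m"
  let ?W = "%v. {t \<in> std m. sheet n x ((m, y), t) v}"
  have "openin ?T (?W v \<inter> {t \<in> topspace ?T. rp ?A ((m, (y, cmp C v u)), t) \<in> W})"
   if "?W v \<noteq> {}" for v
  proof -
   have "(y, cmp C v u) \<in> cells ?A m" using that cellA[OF y _ u] by blast
   then show ?thesis
    by (intro openin_Int openin_sheet openin_continuous_map_preimage[OF continuous_map_realization_point_cell W])
  qed
  then have "openin ?T (\<Union>v\<in>{v. ?W v \<noteq> {}}. ?W v \<inter> {t \<in> topspace ?T. rp ?A ((m, (y, cmp C v u)), t) \<in> W})"
   by (intro openin_Union) blast
  moreover have "{t. ((m, y), t) \<in> {p \<in> U. h u p \<in> W}} =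
    (\<Union>v\<in>{v. ?W v \<noteq> {}}. ?W v \<inter> {t \<in> topspace ?T. rp ?A ((m, (y, cmp C v u)), t) \<in> W})"
   using y by (auto simp: U_def topspace_simplex_sum h_eq)
  ultimately show "openin ?T {t. ((m, y), t) \<in> {p \<in> U. h u p \<in> W}}" by simp
 qed
 have hcont: "continuous_map (subtopology (simplex_sum ?N) U) (realization ?A) (h u)" if u: "u \<in> arrows C a (fst x 0)" for u
  unfolding continuous_map_def
 proof (intro conjI allI impI)
  show "h u \<in> topspace (subtopology (simplex_sum ?N) U) \<rightarrow> topspace (realization ?A)"
  proof
   fix p assume "p \<in> topspace (subtopology (simplex_sum ?N) U)"
   then obtain m y t v where p: "p = ((m, y), t)" "y \<in> cells ?N m" "t \<in> std m" "sheet n x ((m, y), t) v"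
    by (auto simp: U_def topspace_simplex_sum)
   then show "h u p \<in> topspace (realization ?A)"
    using realization_point_mem[OF cellA[OF p(2,4) u] p(3)] by (simp add: h_eq)
  qed
  fix W assume W: "openin (realization ?A) W"
  have "{p \<in> topspace (subtopology (simplex_sum ?N) U). h u p \<in> W} = {p \<in> U. h u p \<in> W}"
   using openin_subset[OF openU] by auto
  then show "openin (subtopology (simplex_sum ?N) U) {p \<in> topspace (subtopology (simplex_sum ?N) U). h u p \<in> W}"
   using openinA[OF W u] openin_open_subtopology[OF openU] by auto
 qed
 have hglue: "h u p = h u q'" if u: "u \<in> arrows C a (fst x 0)"
  and p: "p \<in> U" and q: "q' \<in> U" and eq: "rp ?N p = rp ?N q'" for u p q'
 proof -
  \<comment> \<open>A chain of gluings passes through arbitrary representatives, so the map is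
    totalized by a default value where no sheet exists.\<close>
  let ?g = "%p. if \<exists>v. sheet n x p v then h u p else undefined"
  have "?g p = ?g q'"
  proof (rule realization_point_cong[OF _ _ _ eq])
   fix m m' al y t assume a: "al \<in> Delta m m'" and y: "y \<in> cells ?N m'" and t: "t \<in> std m"
   let ?y = "restr ?N m m' al y" and ?t = "push m al t"
   have y': "?y \<in> cells ?N m" by (rule simplicial_set_restr[OF sN a y])
   have t': "?t \<in> std m'" by (rule simplex_pushforward_mem[OF a t])
   have ex: "(\<exists>v. sheet n x ((m, ?y), t) v) \<longleftrightarrow> (\<exists>v. sheet n x ((m', y), ?t) v)"
    by (rule ex_sheet_cong[OF x _ _ realization_point_restr[OF sN a y t]])
     (use y y' t t' in \<open>auto simp: topspace_simplex_sum\<close>)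
   show "?g ((m, ?y), t) = ?g ((m', y), ?t)"
   proof (cases "\<exists>v. sheet n x ((m', y), ?t) v")
    case True
    then obtain v where v: "sheet n x ((m', y), ?t) v" by blast
    have y0: "snd y (0, al 0) \<in> arrows C (fst y 0) (fst y (al 0))"
     using cells_nerveD(2)[OF y, of 0 "al 0"] Delta_le[OF a, of 0] by simp
    have v': "sheet n x ((m, ?y), t) (cmp C (snd y (0, al 0)) v)"
     using sheet_restr[OF x a y sheetD[OF v]] v by blast
    have "h u ((m, ?y), t) = rp ?A ((m, restr ?A m m' al (y, cmp C v u)), t)"
     using h_eq[OF y' t v', of u] assoc_arrows[OF u sheetD[OF v] y0] by (simp add: restr_slice)
    also have "\<dots> = h u ((m', y), ?t)"
     using realization_point_restr[OF sA a cellA[OF y v u] t] h_eq[OF y t' v, of u] by simp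
    finally show ?thesis using True ex by simp
   next
    case False
    then show ?thesis using ex by simp
   qed
  qed (use p q in \<open>auto simp: U_def\<close>)
  then show ?thesis using p q by (auto simp: U_def)
 qed
 have "\<exists>s. continuous_map (subtopology (realization ?N) V) (realization ?A) s & (\<forall>p\<in>U. s (rp ?N p) = h u p)"
  if u: "u \<in> arrows C a (fst x 0)" for u
 proof (rule quotient_map_lift_exists[OF q hcont[OF u]])
  fix p q' assume "p \<in> topspace (subtopology (simplex_sum ?N) U)" "q' \<in> topspace (subtopology (simplex_sum ?N) U)"
   "rp ?N p = rp ?N q'"
  then show "h u p = h u q'" using hglue[OF u] by auto
 next
  fix s assume s: "continuous_map (subtopology (realization ?N) V) (realization ?A) s"
   "!!p. p \<in> topspace (subtopology (simplex_sum ?N) U) ==> s (rp ?N p) = h u p"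
  have "topspace (subtopology (simplex_sum ?N) U) = U" using openin_subset[OF openU] by auto
  then show ?thesis using s by auto
 qed
 then obtain s where s: "!!u. u \<in> arrows C a (fst x 0) ==>
    continuous_map (subtopology (realization ?N) V) (realization ?A) (s u)"
  and sh: "!!u p. u \<in> arrows C a (fst x 0) ==> p \<in> U ==> s u (rp ?N p) = h u p"
  by metis
 have sV: "s u b \<in> topspace (realization ?A)" if "u \<in> arrows C a (fst x 0)" "b \<in> V" for u b
 proof -
  have "b \<in> topspace (subtopology (realization ?N) V)" using openin_subset[OF openV] that(2) by auto
  then show ?thesis using s[OF that(1)] unfolding continuous_map_def by blast
 qed
 have Ucases: "\<exists>m y t v. y \<in> cells ?N m & t \<in> std m & sheet n x ((m, y), t) v &
   b = rp ?N ((m, y), t) & ((m, y), t) \<in> U" if bV: "b \<in> V" for b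
 proof -
  obtain p where p: "p \<in> U" "b = rp ?N p" using bV unfolding V_def by blast
  obtain m y t where "p = ((m, y), t)" by (metis prod.collapse)
  with p show ?thesis unfolding U_def topspace_simplex_sum by blast
 qed
 \<comment> \<open>This test for lying on the sheet of \<open>u\<close> yields openness of the
   sheets and, with \<open>sheet_unique\<close>, their disjointness.\<close>
 have image: "rp ?A ((m, (y, w)), t) \<in> s u ` V \<longleftrightarrow> sheet n x ((m, y), t) (cmp C w (iv u))"
  if u: "u \<in> arrows C a (fst x 0)" and yw: "(y, w) \<in> cells ?A m" and t: "t \<in> std m" for u m y w t
 proof
  have y: "y \<in> cells ?N m" and w: "w \<in> arrows C a (fst y 0)" using yw by (auto simp: cells_slice)
  assume "rp ?A ((m, (y, w)), t) \<in> s u ` V"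
  then obtain b where b: "b \<in> V" "rp ?A ((m, (y, w)), t) = s u b" by blast
  obtain m' y' t' v' where y': "y' \<in> cells ?N m'" "t' \<in> std m'" "sheet n x ((m', y'), t') v'"
   "b = rp ?N ((m', y'), t')" "((m', y'), t') \<in> U"
   using Ucases[OF b(1)] by blast
  have "rp ?A ((m, (y, w)), t) = rp ?A ((m', (y', cmp C v' u)), t')"
   using b(2) sh[OF u y'(5)] h_eq[OF y'(1-3), of u] y'(4) by simp
  then have "sheet n x ((m, y), t) (cmp C w (iv u)) \<longleftrightarrow> sheet n x ((m', y'), t') (cmp C (cmp C v' u) (iv u))"
   by (intro slice_sheet_cong[OF x u]) (use yw t cellA[OF y'(1,3) u] y'(2) in \<open>auto simp: topspace_simplex_sum\<close>)
  then show "sheet n x ((m, y), t) (cmp C w (iv u))"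
   using y'(3) by (simp add: cancel_right_inv[OF u sheetD[OF y'(3)]])
 next
  have y: "y \<in> cells ?N m" and w: "w \<in> arrows C a (fst y 0)" using yw by (auto simp: cells_slice)
  assume v: "sheet n x ((m, y), t) (cmp C w (iv u))"
  then have yU: "((m, y), t) \<in> U" using y t by (auto simp: U_def topspace_simplex_sum)
  have "s u (rp ?N ((m, y), t)) = rp ?A ((m, (y, w)), t)"
   using sh[OF u yU] h_eq[OF y t v, of u] by (simp add: cancel_inv_right[OF u w])
  then show "rp ?A ((m, (y, w)), t) \<in> s u ` V"
   using yU by (metis V_def image_eqI)
 qed
 have "evenly_covered (realization ?A) (realization ?N) (slice_map C) V"
  unfolding evenly_covered_def
 proof (intro conjI exI[of _ "s ` arrows C a (fst x 0)"] ballI openV; (elim imageE)?)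
  fix s' u assume s': "s' = s u" and u: "u \<in> arrows C a (fst x 0)"
  show "continuous_map (subtopology (realization ?N) V) (realization ?A) s'" using s[OF u] by (simp add: s')
  show "slice_map C (s' b) = b" if b: "b \<in> V" for b
  proof -
   obtain m y t v where y: "y \<in> cells ?N m" "t \<in> std m" "sheet n x ((m, y), t) v"
    "b = rp ?N ((m, y), t)" "((m, y), t) \<in> U"
    using Ucases[OF b] by blast
   show ?thesis
    using sh[OF u y(5)] h_eq[OF y(1-3), of u] realization_map_point[OF sA sN sf cellA[OF y(1,3) u] y(2)]
    by (simp add: y(4) s')
  qed
  show "openin (realization ?A) (s' ` V)"
   unfolding openin_realization
  proof
   show "s' ` V \<subseteq> rp ?A ` topspace (simplex_sum ?A)"
    using sV[OF u] unfolding s' topspace_realization by blast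
   show "openin (simplex_sum ?A) {p \<in> topspace (simplex_sum ?A). rp ?A p \<in> s' ` V}"
    unfolding openin_simplex_sum
   proof (intro conjI allI ballI)
    fix m z assume z: "z \<in> cells ?A m"
    obtain y w where yw: "z = (y, w)" by (cases z)
    have "{t. ((m, z), t) \<in> {p \<in> topspace (simplex_sum ?A). rp ?A p \<in> s' ` V}} =
     {t \<in> std m. sheet n x ((m, y), t) (cmp C w (iv u))}"
     using z image[OF u, of y w m] by (auto simp: topspace_simplex_sum yw s')
    then show "openin (simplex_top m)
      {t. ((m, z), t) \<in> {p \<in> topspace (simplex_sum ?A). rp ?A p \<in> s' ` V}}"
     by (simp add: openin_sheet)
   qed auto
  qed
 next
  fix s1 s2 u1 u2 assume s1: "s1 = s u1" "u1 \<in> arrows C a (fst x 0)" and s2: "s2 = s u2" "u2 \<in> arrows C a (fst x 0)"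
  show "s1 \<noteq> s2 --> s1 ` V \<inter> s2 ` V = {}"
  proof (rule impI, rule ccontr)
   assume ne: "s1 \<noteq> s2" and "s1 ` V \<inter> s2 ` V \<noteq> {}"
   then obtain e where e: "e \<in> s u1 ` V" "e \<in> s u2 ` V" using s1 s2 by blast
   have "e \<in> topspace (realization ?A)"
    using e(1) sV[OF s1(2)] by blast
   then obtain m z t where z: "z \<in> cells ?A m" "t \<in> std m" "e = rp ?A ((m, z), t)"
    by (rule realization_cases)
   obtain y w where yw: "z = (y, w)" by (cases z)
   have y: "y \<in> cells ?N m" and w: "w \<in> arrows C a (fst y 0)" using z(1) by (auto simp: cells_slice yw)
   have "cmp C w (iv u1) = cmp C w (iv u2)"
    using image[OF s1(2) z(1)[unfolded yw] z(2)] image[OF s2(2) z(1)[unfolded yw] z(2)] e z(3) yw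
     sheet_unique[OF x y z(2)] by simp
   then have "iv u1 = iv u2" by (rule left_cancel[OF w inv_arrows[OF s1(2)] inv_arrows[OF s2(2)]])
   moreover have "cmp C u1 (iv u1) = cmp C u2 (iv u2)"
    by (simp add: inv_right[OF s1(2)] inv_right[OF s2(2)])
   ultimately have "u1 = u2" using right_cancel[OF inv_arrows[OF s1(2)] s1(2) s2(2)] by simp
   then show False using ne s1 s2 by simp
  qed
 next
  fix e assume e: "e \<in> topspace (realization ?A)"
  show "slice_map C e \<in> V --> (\<exists>s\<in>s ` arrows C a (fst x 0). e = s (slice_map C e))"
  proof
   assume eV: "slice_map C e \<in> V"
   obtain m z t where z: "z \<in> cells ?A m" "t \<in> std m" "e = rp ?A ((m, z), t)"
    using e by (rule realization_cases)
   obtain y w where yw: "z = (y, w)" by (cases z)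
   have y: "y \<in> cells ?N m" and w: "w \<in> arrows C a (fst y 0)" using z(1) by (auto simp: cells_slice yw)
   have pe: "slice_map C e = rp ?N ((m, y), t)"
    using realization_map_point[OF sA sN sf z(1,2)] by (simp add: z(3) yw)
   then have yU: "((m, y), t) \<in> U"
    using eV UV y z(2) by (auto simp: topspace_simplex_sum)
   then obtain v where v: "sheet n x ((m, y), t) v" by (auto simp: U_def)
   \<comment> \<open>The label of the sheet through \<open>e\<close>: its arrow \<open>w\<close>
     carried back along the winning arrow \<open>v\<close> to the first vertex of
     \<open>x\<close>.\<close>
   let ?u = "cmp C (iv v) w"
   have u: "?u \<in> arrows C a (fst x 0)" by (rule cmp_arrows[OF w inv_arrows[OF sheetD[OF v]]])
   have "s ?u (slice_map C e) = e"
    unfolding pe using sh[OF u yU] h_eq[OF y z(2) v, of ?u] cancel_inv_left[OF sheetD[OF v] w]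
    by (simp add: z(3) yw)
   then show "\<exists>s\<in>s ` arrows C a (fst x 0). e = s (slice_map C e)" using u by auto
  qed
 qed
 then show "\<exists>V. c \<in> V & evenly_covered (realization ?A) (realization ?N) (slice_map C) V"
  using cV by blast
qed

end

section \<open>Unique lifting and the lifting of paths and squares\<close>

lemma evenly_coveredE:
 assumes "evenly_covered E B p V"
 obtains S where "!!s. s \<in> S ==> continuous_map (subtopology B V) E s" "!!s b. s \<in> S ==> b \<in> V ==> p (s b) = b"
  "!!s. s \<in> S ==> openin E (s ` V)" "!!s s'. s \<in> S ==> s' \<in> S ==> s \<noteq> s' ==> s ` V \<inter> s' ` V = {}"
  "!!e. e \<in> topspace E ==> p e \<in> V ==> \<exists>s\<in>S. e = s (p e)"
proof -
 from assms obtain S where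
  S: "(\<forall>s\<in>S. continuous_map (subtopology B V) E s & (\<forall>b\<in>V. p (s b) = b) & openin E (s ` V)) &
    (\<forall>s\<in>S. \<forall>s'\<in>S. s \<noteq> s' --> s ` V \<inter> s' ` V = {}) &
    (\<forall>e\<in>topspace E. p e \<in> V --> (\<exists>s\<in>S. e = s (p e)))"
  unfolding evenly_covered_def by (elim conjE exE) (rule that, intro conjI)
 show ?thesis by (rule that[of S]) (use S in simp_all)
qed

text \<open>Near every point each of the lifts stays on one sheet, and the lifts agree there exactly
  if the two sheets coincide. Hence the set of agreement is open and closed.\<close>

lemma covering_lift_unique:
 assumes cov: "covering E B p" and T: "connected_space T"
  and L: "continuous_map T E L" and L': "continuous_map T E L'"
  and eq: "!!q. q \<in> topspace T ==> p (L q) = p (L' q)"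
  and r: "r \<in> topspace T" "L r = L' r" and q: "q \<in> topspace T"
 shows "L q = L' q"
proof -
 have LE: "L q \<in> topspace E" "L' q \<in> topspace E" if "q \<in> topspace T" for q
  using L L' that by (auto simp: continuous_map_def)
 have nbhd: "\<exists>N. openin T N & q \<in> N & (\<forall>r\<in>N. L r = L' r \<longleftrightarrow> L q = L' q)" if q: "q \<in> topspace T" for q
 proof -
  have "p (L q) \<in> topspace B"
   using cov LE[OF q] by (auto simp: covering_def continuous_map_def)
  then obtain V where V: "p (L q) \<in> V" "evenly_covered E B p V"
   using cov unfolding covering_def by blast
  obtain S where S: "!!s. s \<in> S ==> continuous_map (subtopology B V) E s" "!!s b. s \<in> S ==> b \<in> V ==> p (s b) = b"
  "!!s. s \<in> S ==> openin E (s ` V)" "!!s s'. s \<in> S ==> s' \<in> S ==> s \<noteq> s' ==> s ` V \<inter> s' ` V = {}"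
  "!!e. e \<in> topspace E ==> p e \<in> V ==> \<exists>s\<in>S. e = s (p e)"
   by (rule evenly_coveredE[OF V(2)]) (rule that)
  have V': "p (L' q) \<in> V" using V(1) eq[OF q] by simp
  obtain s where s: "s \<in> S" "L q = s (p (L q))" using S(5)[of "L q"] LE[OF q] V(1) by blast
  obtain s' where s': "s' \<in> S" "L' q = s' (p (L' q))" using S(5)[of "L' q"] LE[OF q] V' by blast
  let ?N = "{r \<in> topspace T. L r \<in> s ` V} \<inter> {r \<in> topspace T. L' r \<in> s' ` V}"
  have "openin T ?N"
   by (intro openin_Int openin_continuous_map_preimage[OF L S(3)[OF s(1)]] openin_continuous_map_preimage[OF L' S(3)[OF s'(1)]])
  moreover have "q \<in> ?N" using q s(2) s'(2) V(1) V' by blast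
  moreover have "L r = L' r \<longleftrightarrow> s = s'" if r: "r \<in> ?N" for r
  proof
   assume "L r = L' r"
   then have "s ` V \<inter> s' ` V \<noteq> {}" using r by auto
   then show "s = s'" using S(4)[OF s(1) s'(1)] by blast
  next
   assume ss: "s = s'"
   obtain b b' where b: "b \<in> V" "L r = s b" "b' \<in> V" "L' r = s b'" using r ss by blast
   have "p (L r) = b" "p (L' r) = b'" using S(2)[OF s(1)] b by simp_all
   moreover have "r \<in> topspace T" using r by simp
   ultimately show "L r = L' r" using eq[of r] b by simp
  qed
  ultimately show ?thesis by blast
 qed
 let ?A = "{q \<in> topspace T. L q = L' q}"
 have "openin T ?A"
 proof (subst openin_subopen, intro ballI)
  fix q assume "q \<in> ?A"
  then obtain N where "openin T N" "q \<in> N" "\<forall>r\<in>N. L r = L' r" using nbhd[of q] by auto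
  then show "\<exists>N. openin T N & q \<in> N & N \<subseteq> ?A" using openin_subset by blast
 qed
 moreover have "openin T (topspace T - ?A)"
 proof (subst openin_subopen, intro ballI)
  fix q assume "q \<in> topspace T - ?A"
  then obtain N where "openin T N" "q \<in> N" "\<forall>r\<in>N. L r \<noteq> L' r" using nbhd[of q] by auto
  then show "\<exists>N. openin T N & q \<in> N & N \<subseteq> topspace T - ?A" using openin_subset by blast
 qed
 ultimately have "?A = {} \<or> ?A = topspace T"
  using T unfolding connected_space_clopen_in closedin_def by blast
 then show ?thesis using r q by auto
qed

text \<open>A lift is demanded through every point of the fibre over every point of
  \<open>R\<close>, so that lifts over adjacent rectangles can be continued from either one.\<close>

definition liftable :: "'e topology => ('e => 'b) => (real \<times> real => 'b) => (real \<times> real) set => bool" where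
 "liftable E p K R \<longleftrightarrow> (\<forall>q\<in>R. \<forall>e\<in>topspace E. p e = K q -->
   (\<exists>L. continuous_map (top_of_set R) E L & (\<forall>r\<in>R. p (L r) = K r) & L q = e))"

lemma liftable_local:
 assumes cov: "evenly_covered E B p V" and K: "continuous_map euclidean B K" and R: "K ` R \<subseteq> V"
 shows "liftable E p K R"
 unfolding liftable_def
proof (intro ballI impI)
 fix q e assume q: "q \<in> R" and e: "e \<in> topspace E" "p e = K q"
 obtain S where S: "!!s. s \<in> S ==> continuous_map (subtopology B V) E s" "!!s b. s \<in> S ==> b \<in> V ==> p (s b) = b"
  "!!s. s \<in> S ==> openin E (s ` V)" "!!s s'. s \<in> S ==> s' \<in> S ==> s \<noteq> s' ==> s ` V \<inter> s' ` V = {}"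
  "!!e. e \<in> topspace E ==> p e \<in> V ==> \<exists>s\<in>S. e = s (p e)"
  by (rule evenly_coveredE[OF cov]) (rule that)
 have KV: "K r \<in> V" if "r \<in> R" for r using R that by blast
 obtain s where s: "s \<in> S" "e = s (K q)" using S(5)[OF e(1)] e(2) KV[OF q] by auto
 have "continuous_map (top_of_set R) (subtopology B V) K"
  using R continuous_map_from_subtopology[OF K] by (auto simp: continuous_map_in_subtopology)
 then have "continuous_map (top_of_set R) E (s \<circ> K)"
  by (rule continuous_map_compose[OF _ S(1)[OF s(1)]])
 moreover have "\<forall>r\<in>R. p ((s \<circ> K) r) = K r" using S(2)[OF s(1)] KV by simp
 ultimately show "\<exists>L. continuous_map (top_of_set R) E L & (\<forall>r\<in>R. p (L r) = K r) & L q = e"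
  using s(2) by (intro exI[of _ "s \<circ> K"]) simp
qed

text \<open>Lift over the part containing \<open>q\<close>, then lift over the other part starting
  from a common point. Connectedness of the intersection makes the lifts agree there, and closedness
  of the parts allows pasting.\<close>

lemma liftable_Un:
 assumes cov: "covering E B p" and R: "closed R1" "closed R2" "connected (R1 \<inter> R2)" "R1 \<inter> R2 \<noteq> {}"
  and l1: "liftable E p K R1" and l2: "liftable E p K R2"
 shows "liftable E p K (R1 \<union> R2)"
proof -
 \<comment> \<open>The sets are generalized here because the starting point may lie in either of
   them.\<close>
 have half: "\<exists>L. continuous_map (top_of_set (R1 \<union> R2)) E L & (\<forall>r\<in>R1 \<union> R2. p (L r) = K r) & L q = e"
  if R: "closed R1" "closed R2" "connected (R1 \<inter> R2)" "R1 \<inter> R2 \<noteq> {}"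
   and l1: "liftable E p K R1" and l2: "liftable E p K R2"
   and q: "q \<in> R1" and e: "e \<in> topspace E" "p e = K q" for R1 R2 q e
 proof -
  obtain L1 where L1: "continuous_map (top_of_set R1) E L1" "\<forall>r\<in>R1. p (L1 r) = K r" "L1 q = e"
   using l1 q e unfolding liftable_def by blast
  obtain r where r: "r \<in> R1" "r \<in> R2" using R(4) by blast
  have "L1 r \<in> topspace E" using L1(1) r by (auto simp: continuous_map_def)
  then obtain L2 where L2: "continuous_map (top_of_set R2) E L2" "\<forall>r\<in>R2. p (L2 r) = K r" "L2 r = L1 r"
   using l2 r L1(2) unfolding liftable_def by metis
  have agree: "L1 x = L2 x" if x: "x \<in> R1 \<inter> R2" for x
  proof (rule covering_lift_unique[OF cov, of "top_of_set (R1 \<inter> R2)" L1 L2 r x])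
   show "connected_space (top_of_set (R1 \<inter> R2))" using R(3) by (simp add: connected_space_subtopology)
   show "continuous_map (top_of_set (R1 \<inter> R2)) E L1"
    using continuous_map_from_subtopology_mono[OF L1(1)] by blast
   show "continuous_map (top_of_set (R1 \<inter> R2)) E L2"
    using continuous_map_from_subtopology_mono[OF L2(1)] by blast
  qed (use L1 L2 r x in auto)
  let ?L = "%x. if x \<in> R1 then L1 x else L2 x"
  have sub: "subtopology (top_of_set (R1 \<union> R2)) R1 = top_of_set R1" "subtopology (top_of_set (R1 \<union> R2)) R2 = top_of_set R2"
   by (simp_all add: subtopology_subtopology Int_absorb1)
  have "continuous_map (top_of_set (R1 \<union> R2)) E ?L"
  proof (rule pasting_lemma_closed[where I = UNIV and T = "%b. if b then R1 else R2" and f = "%b. if b then L1 else L2"])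
   show "closedin (top_of_set (R1 \<union> R2)) (if b then R1 else R2)" for b
    using R(1,2) by (auto intro: closed_subset)
   show "continuous_map (subtopology (top_of_set (R1 \<union> R2)) (if b then R1 else R2)) E (if b then L1 else L2)" for b
    using L1(1) L2(1) by (simp add: sub)
   show "(if b then L1 else L2) x = (if b' then L1 else L2) x"
    if "x \<in> topspace (top_of_set (R1 \<union> R2)) \<inter> (if b then R1 else R2) \<inter> (if b' then R1 else R2)" for b b' x
    using that agree[of x] by (auto split: if_splits)
   show "\<exists>j. j \<in> UNIV & x \<in> (if j then R1 else R2) & ?L x = (if j then L1 else L2) x"
    if "x \<in> topspace (top_of_set (R1 \<union> R2))" for x
    using that by (cases "x \<in> R1") (auto intro: exI[of _ True] exI[of _ False])
  qed simp
  moreover have "\<forall>r\<in>R1 \<union> R2. p (?L r) = K r" using L1(2) L2(2) by auto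
  ultimately show ?thesis using L1(3) q by (intro exI[of _ ?L]) simp
 qed
 show ?thesis
  unfolding liftable_def
 proof (intro ballI impI)
  fix q e assume q: "q \<in> R1 \<union> R2" and e: "e \<in> topspace E" "p e = K q"
  show "\<exists>L. continuous_map (top_of_set (R1 \<union> R2)) E L & (\<forall>r\<in>R1 \<union> R2. p (L r) = K r) & L q = e"
  proof (cases "q \<in> R1")
   case True
   show ?thesis by (rule half[OF R l1 l2 True e])
  next
   case False
   then have q2: "q \<in> R2" using q by simp
   show ?thesis
    using half[OF R(2,1) _ _ l2 l1 q2 e] R(3,4) by (simp add: Int_commute Un_commute)
  qed
 qed
qed

text \<open>Bolzano's bisection principle, applied to one coordinate at a time, replaces a Lebesgue
 number argument.\<close>

lemma liftable_square:
 assumes cov: "covering E B p" and K: "continuous_map euclidean B (K :: real \<times> real => 'b)"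
 shows "liftable E p K ({0..1} \<times> {0..1})"
proof -
 let ?P = "%a b. liftable E p K ({a..b} \<times> {0..1})"
 have "?P 0 1"
 proof (rule Bolzano[of 0 1 ?P])
  fix a b c :: real assume ab: "?P a b" "?P b c" "a <= b" "b <= c"
  have i: "({a..b} \<times> {0..1::real}) \<inter> ({b..c} \<times> {0..1}) = {b} \<times> {0..1}" using ab by auto
  have u: "({a..b} \<times> {0..1::real}) \<union> ({b..c} \<times> {0..1}) = {a..c} \<times> {0..1}" using ab by auto
  have "liftable E p K (({a..b} \<times> {0..1}) \<union> ({b..c} \<times> {0..1}))"
   by (rule liftable_Un[OF cov _ _ _ _ ab(1,2)]; (unfold i)?) (auto intro!: closed_Times connected_Times)
  then show "?P a c" by (simp only: u)
 next
  fix x :: real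
  \<comment> \<open>For fixed \<open>x\<close>, bisection of the second coordinate produces a width
    \<open>de\<close> that works for a strip of full height; this is the local hypothesis for the
    bisection of the first coordinate.\<close>
  let ?Q = "%c d. \<exists>de>0. \<forall>a b. a <= x & x <= b & b - a < de --> liftable E p K ({a..b} \<times> {c..d})"
  have "?Q 0 1"
  proof (rule Bolzano[of 0 1 ?Q])
   fix c d e :: real assume cd: "?Q c d" "?Q d e" "c <= d" "d <= e"
   obtain de1 where d1: "de1 > 0" "!!a b. a <= x ==> x <= b ==> b - a < de1 ==> liftable E p K ({a..b} \<times> {c..d})"
    using cd(1) by blast
   obtain de2 where d2: "de2 > 0" "!!a b. a <= x ==> x <= b ==> b - a < de2 ==> liftable E p K ({a..b} \<times> {d..e})"
    using cd(2) by blast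
   have "liftable E p K ({a..b} \<times> {c..e})" if ab: "a <= x" "x <= b" "b - a < min de1 de2" for a b
   proof -
    have i: "({a..b} \<times> {c..d}) \<inter> ({a..b} \<times> {d..e}) = {a..b} \<times> {d}" using cd by auto
    have u: "({a..b} \<times> {c..d}) \<union> ({a..b} \<times> {d..e}) = {a..b} \<times> {c..e}" using cd by auto
    have "liftable E p K (({a..b} \<times> {c..d}) \<union> ({a..b} \<times> {d..e}))"
     by (rule liftable_Un[OF cov _ _ _ _ d1(2) d2(2)]; (unfold i)?)
      (use ab in \<open>auto intro!: closed_Times connected_Times\<close>)
    then show ?thesis by (simp only: u)
   qed
   then show "?Q c e" using d1(1) d2(1) by (intro exI[of _ "min de1 de2"]) simp
  next
   fix y :: real
   have "K (x, y) \<in> topspace B" using K by (auto simp: continuous_map_def)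
   then obtain V where V: "K (x, y) \<in> V" "evenly_covered E B p V" using cov unfolding covering_def by blast
   have "open {q. K q \<in> V}"
    using openin_continuous_map_preimage[OF K, of V] V(2) by (simp add: evenly_covered_def)
   moreover have "(x, y) \<in> {q. K q \<in> V}" using V(1) by simp
   ultimately obtain A A' where A': "open A" "open A'" "(x, y) \<in> A \<times> A'" "A \<times> A' \<subseteq> {q. K q \<in> V}"
    by (rule open_prod_elim)
   then have A: "x \<in> A" "y \<in> A'" by auto
   obtain es where e: "es > 0" "ball x es \<subseteq> A" using A'(1) A(1) unfolding open_contains_ball by blast
   obtain es' where e': "es' > 0" "ball y es' \<subseteq> A'" using A'(2) A(2) unfolding open_contains_ball by blast
   have "liftable E p K ({a..b} \<times> {c..d})"
    if "a <= x" "x <= b" "b - a < es" "c <= y" "y <= d" "d - c < es'" for a b c d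
   proof (rule liftable_local[OF V(2) K])
    have "{a..b} \<subseteq> ball x es" "{c..d} \<subseteq> ball y es'" using that by (auto simp: dist_real_def)
    then show "K ` ({a..b} \<times> {c..d}) \<subseteq> V" using e(2) e'(2) A'(4) by blast
   qed
   then show "\<exists>de>0. \<forall>c d. c <= y & y <= d & d - c < de --> ?Q c d"
    using e(1) e'(1) by (intro exI[of _ es'] conjI allI impI exI[of _ es]) auto
  qed simp
  then show "\<exists>de>0. \<forall>a b. a <= x & x <= b & b - a < de --> ?P a b" .
 qed simp
 then show ?thesis .
qed

lemma covering_lift_square:
 assumes cov: "covering E B p" and K: "continuous_map (top_of_set ({0..1} \<times> {0..1})) B (K :: real \<times> real => 'b)"
  and q: "q \<in> {0..1} \<times> {0..1}" and e: "e \<in> topspace E" "p e = K q"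
 obtains L where "continuous_map (top_of_set ({0..1} \<times> {0..1})) E L"
  "!!r. r \<in> {0..1} \<times> {0..1} ==> p (L r) = K r" "L q = e"
proof -
 \<comment> \<open>Clamping both coordinates retracts the plane onto the square, since
   \<open>liftable_square\<close> takes a map on the whole plane.\<close>
 let ?c = "%x::real. max 0 (min 1 x)"
 have "continuous_map euclidean (top_of_set ({0..1} \<times> {0..1})) (%(a, b). (?c a, ?c b))"
  by (auto simp: continuous_map_in_subtopology case_prod_beta' intro!: continuous_intros)
 from continuous_map_compose[OF this K]
 have "continuous_map euclidean B (K \<circ> (%(a, b). (?c a, ?c b)))" .
 from liftable_square[OF cov this]
 obtain L where L: "continuous_map (top_of_set ({0..1} \<times> {0..1})) E L"
  "\<forall>r\<in>{0..1} \<times> {0..1}. p (L r) = (K \<circ> (%(a, b). (?c a, ?c b))) r" "L q = e"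
  unfolding liftable_def using q e by (auto dest!: bspec[of _ _ q] bspec[of _ _ e])
 have "p (L r) = K r" if "r \<in> {0..1} \<times> {0..1}" for r using L(2) that by auto
 then show ?thesis using that L by blast
qed

abbreviation unit_square :: "(real \<times> real) set" where
 "unit_square \<equiv> {0..1} \<times> {0..1}"

lemma continuous_map_square_edge:
 assumes "continuous_map (top_of_set unit_square) T L" "b \<in> {0..1}"
 shows "cpath T (%a. L (a, b))" "cpath T (%a. L (b, a))"
proof -
 have "cpath (top_of_set unit_square) (%a. (a, b))"
  "cpath (top_of_set unit_square) (%a. (b, a))"
  using assms(2) by (auto simp: continuous_map_in_subtopology intro!: continuous_intros)
 from this[THEN continuous_map_compose, OF assms(1)]
 show "cpath T (%a. L (a, b))" "cpath T (%a. L (b, a))"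
  by (simp_all add: o_def)
qed

text \<open>A path is treated as a map of the square that is constant in the second
  coordinate.\<close>

lemma covering_lift_path:
 assumes cov: "covering E B p" and g: "cpath B (gm :: real => 'b)"
  and q: "q \<in> {0..1}" and e: "e \<in> topspace E" "p e = gm q"
 obtains L where "cpath E L" "!!r. r \<in> {0..1} ==> p (L r) = gm r" "L q = e"
proof -
 have "continuous_map (top_of_set unit_square) (top_of_set {0..1}) fst"
  by (auto simp: continuous_map_in_subtopology intro!: continuous_intros)
 from continuous_map_compose[OF this g]
 have K: "continuous_map (top_of_set unit_square) B (%x. gm (fst x))" by (simp add: o_def)
 obtain L where L: "continuous_map (top_of_set unit_square) E L"
  "!!r. r \<in> unit_square ==> p (L r) = gm (fst r)" "L (q, 0) = e"
  using covering_lift_square[OF cov K, of "(q, 0)" e] q e by auto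
 show ?thesis
  by (rule that[OF continuous_map_square_edge(1)[OF L(1), of 0]]) (use L(2,3) in auto)
qed

lemma covering_path_unique:
 assumes "covering E B p" "cpath E L" "cpath E L'"
  and "!!q. q \<in> {0..1} ==> p (L q) = p (L' q)" "r \<in> {0..1}" "L r = L' r" "q \<in> {0..1}"
 shows "L (q :: real) = L' q"
proof -
 have "connected_space (top_of_set {0..1::real})"
  using connected_Icc[of "0::real" 1] by (simp only: connected_space_subtopology connectedin_iff_connected)
 then show ?thesis
  by (rule covering_lift_unique[OF assms(1) _ assms(2,3), of r q]) (use assms(4-) in auto)
qed

section \<open>Vertices and arrows as points and paths\<close>

definition base_point :: "nat => real" where
 "base_point = (%j. if j = 0 then 1 else 0)"

definition edge_point :: "real => nat => real" where
 "edge_point tu = (%i. if i = 0 then 1 - tu else if i = 1 then tu else 0)"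

lemma base_point_mem: "base_point \<in> std 0"
 by (simp add: base_point_def standard_simplex_0)

lemma edge_point_mem: "tu \<in> {0..1} ==> edge_point tu \<in> std 1"
 by (auto simp: edge_point_def standard_simplex_def)

lemma continuous_map_edge_point:
 "cpath (subtopology (powertop_real UNIV) (std 1)) edge_point"
proof -
 have "cpath euclideanreal (%tu. edge_point tu i)" for i
  unfolding edge_point_def by (cases "i = 0"; cases "i = 1") (auto intro!: continuous_intros)
 then have "cpath (powertop_real UNIV) edge_point"
  by (simp add: continuous_map_componentwise_UNIV)
 then show ?thesis using edge_point_mem by (auto simp: continuous_map_in_subtopology)
qed

definition vertex_cell :: "('o, 'm) cat => 'o => ('o, 'm) nerve_simplex" where
 "vertex_cell C c = ((\<lambda>i\<in>{..0}. c), (\<lambda>(i, j)\<in>{(i, j). i <= j & j <= 0}. ident C c))"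

definition arrow_cell :: "('o, 'm) cat => 'm => ('o, 'm) nerve_simplex" where
 "arrow_cell C f = ((\<lambda>i\<in>{..1}. if i = 0 then src C f else trg C f),
   (\<lambda>(i, j)\<in>{(i, j). i <= j & j <= 1}. if i < j then f else ident C (if i = 0 then src C f else trg C f)))"

lemma vertex_Delta: "i <= n ==> vertex i \<in> Delta 0 n"
 by (rule DeltaI) (auto simp: vertex_def)

lemma restr_arrow_cell:
 "restr (nerve C) 0 1 (vertex 0) (arrow_cell C f) = vertex_cell C (src C f)"
 "restr (nerve C) 0 1 (vertex 1) (arrow_cell C f) = vertex_cell C (trg C f)"
 by (auto simp: arrow_cell_def vertex_cell_def restr_nerve vertex_def fun_eq_iff restrict_def)

lemma pushforward_vertex:
 "push 0 (vertex 0) base_point = edge_point 0"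
 "push 0 (vertex 1) base_point = edge_point 1"
 by (auto simp: simplex_pushforward_if vertex_def base_point_def edge_point_def fun_eq_iff)

lemma fst_vertex_cell: "fst (vertex_cell C c) 0 = c"
 by (simp add: vertex_cell_def)

lemma fst_arrow_cell: "fst (arrow_cell C f) 0 = src C f"
 and snd_arrow_cell: "snd (arrow_cell C f) (0, 0) = ident C (src C f)" "snd (arrow_cell C f) (0, 1) = f"
 by (simp_all add: arrow_cell_def)

context category begin

lemma vertex_cell_mem: "c \<in> Ob C ==> vertex_cell C c \<in> cells (nerve C) 0"
 unfolding vertex_cell_def cells_nerve
 by (rule functors_ordinalI) (use ident_closed[of c] ident_left[OF ident_closed, of c] in auto)

lemma arrow_cell_mem:
 assumes f: "f \<in> Ar C"
 shows "arrow_cell C f \<in> cells (nerve C) 1"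
proof -
 have fa: "f \<in> arrows C (src C f) (trg C f)" using f by (simp add: arrows_def)
 note o = arrows_Ob[OF fa] and i = ident_closed[OF arrows_Ob(1)[OF fa]] ident_closed[OF arrows_Ob(2)[OF fa]]
 show ?thesis
  unfolding arrow_cell_def cells_nerve
 proof (rule functors_ordinalI)
  fix i j k :: nat assume "i <= j" "j <= k" "k <= 1"
  then consider "i = 0" "j = 0" "k = 0" | "i = 0" "j = 0" "k = 1" | "i = 0" "j = 1" "k = 1" | "i = 1" "j = 1" "k = 1"
   by linarith
  then show "cmp C ((\<lambda>(i, j)\<in>{(i, j). i <= j & j <= 1}. if i < j then f else ident C (if i = 0 then src C f else trg C f)) (j, k))
   ((\<lambda>(i, j)\<in>{(i, j). i <= j & j <= 1}. if i < j then f else ident C (if i = 0 then src C f else trg C f)) (i, j)) =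
   (\<lambda>(i, j)\<in>{(i, j). i <= j & j <= 1}. if i < j then f else ident C (if i = 0 then src C f else trg C f)) (i, k)"
   by cases (simp_all add: ident_left[OF fa] ident_right[OF fa] ident_left[OF i(1)] ident_left[OF i(2)])
 qed (use o i fa in \<open>auto simp: le_Suc_eq\<close>)
qed

end

definition vertex_point :: "('o, 'm) cat => 'o => ((nat \<times> ('o, 'm) nerve_simplex) \<times> (nat => real)) set" where
 "vertex_point C c = rp (nerve C) ((0, vertex_cell C c), base_point)"

definition arrow_path :: "('o, 'm) cat => 'm => real => ((nat \<times> ('o, 'm) nerve_simplex) \<times> (nat => real)) set" where
 "arrow_path C f tu = rp (nerve C) ((1, arrow_cell C f), edge_point tu)"

definition slice_point where
 "slice_point C a c u = rp (slice C a) ((0, (vertex_cell C c, u)), base_point)"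

definition slice_path where
 "slice_path C a f u tu = rp (slice C a) ((1, (arrow_cell C f, u)), edge_point tu)"

context groupoid_cat begin

lemma arrow_path_ends:
 assumes f: "f \<in> arrows C c c'"
 shows "arrow_path C f 0 = vertex_point C c" "arrow_path C f 1 = vertex_point C c'"
proof -
 note r = realization_point_restr[OF simplicial_set_nerve vertex_Delta arrow_cell_mem[OF arrowsD(1)[OF f]] base_point_mem]
 show "arrow_path C f 0 = vertex_point C c"
  using r[of 0] unfolding arrow_path_def vertex_point_def
  by (simp only: restr_arrow_cell arrowsD(2)[OF f] pushforward_vertex le0)
 show "arrow_path C f 1 = vertex_point C c'"
  using r[of 1] unfolding arrow_path_def vertex_point_def
  by (simp only: restr_arrow_cell arrowsD(3)[OF f] pushforward_vertex le_refl)
qed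

lemma continuous_arrow_path:
 assumes f: "f \<in> Ar C"
 shows "cpath (BN C) (arrow_path C f)"
 using continuous_map_compose[OF continuous_map_edge_point continuous_map_realization_point_cell[OF arrow_cell_mem[OF f]]]
 by (simp add: arrow_path_def[abs_def] o_def)

lemma slice_vertex_mem: "u \<in> arrows C a c ==> (vertex_cell C c, u) \<in> cells (slice C a) 0"
 using vertex_cell_mem[of c] arrows_Ob(2)[of u] by (simp add: cells_slice fst_vertex_cell)

lemma slice_point_mem: "u \<in> arrows C a c ==> slice_point C a c u \<in> topspace (realization (slice C a))"
 unfolding slice_point_def by (rule realization_point_mem[OF slice_vertex_mem base_point_mem])

lemma slice_arrow_mem: "f \<in> arrows C c c' ==> u \<in> arrows C a c ==> (arrow_cell C f, u) \<in> cells (slice C a) 1"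
 using arrow_cell_mem[of f] by (simp add: cells_slice fst_arrow_cell arrows_def)

lemma slice_path_ends:
 assumes f: "f \<in> arrows C c c'" and u: "u \<in> arrows C a c"
 shows "slice_path C a f u 0 = slice_point C a c u" "slice_path C a f u 1 = slice_point C a c' (cmp C f u)"
proof -
 note r = realization_point_restr[OF simplicial_set_slice vertex_Delta slice_arrow_mem[OF f u] base_point_mem]
 have v: "vertex 0 0 = 0" "vertex 1 0 = 1" by (simp_all add: vertex_def)
 have 0: "restr (slice C a) 0 1 (vertex 0) (arrow_cell C f, u) = (vertex_cell C c, u)"
  using ident_left[OF u] arrowsD(2)[OF f] by (simp only: restr_slice restr_arrow_cell v snd_arrow_cell)
 have 1: "restr (slice C a) 0 1 (vertex 1) (arrow_cell C f, u) = (vertex_cell C c', cmp C f u)"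
  using arrowsD(3)[OF f] by (simp only: restr_slice restr_arrow_cell v snd_arrow_cell)
 show "slice_path C a f u 0 = slice_point C a c u"
  using r[of 0] unfolding slice_path_def slice_point_def by (simp only: 0 pushforward_vertex le0)
 show "slice_path C a f u 1 = slice_point C a c' (cmp C f u)"
  using r[of 1] unfolding slice_path_def slice_point_def by (simp only: 1 pushforward_vertex le_refl)
qed

lemma continuous_slice_path:
 assumes f: "f \<in> arrows C c c'" and u: "u \<in> arrows C a c"
 shows "cpath (realization (slice C a)) (slice_path C a f u)"
 using continuous_map_compose[OF continuous_map_edge_point continuous_map_realization_point_cell[OF slice_arrow_mem[OF f u]]]
 by (simp add: slice_path_def[abs_def] o_def)

lemma slice_map_point: "u \<in> arrows C a c ==> slice_map C (slice_point C a c u) = vertex_point C c"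
 unfolding slice_point_def vertex_point_def
 by (subst realization_map_point[OF simplicial_set_slice simplicial_set_nerve simplicial_map_slice slice_vertex_mem base_point_mem])
  simp_all

lemma slice_map_path:
 assumes "f \<in> arrows C c c'" "u \<in> arrows C a c" "tu \<in> {0..1}"
 shows "slice_map C (slice_path C a f u tu) = arrow_path C f tu"
 unfolding slice_path_def arrow_path_def
 by (subst realization_map_point[OF simplicial_set_slice simplicial_set_nerve simplicial_map_slice slice_arrow_mem[OF assms(1,2)]
   edge_point_mem[OF assms(3)]]) simp

text \<open>The predicate \<open>h\<close> says of a representative below that some arrow over it
  yields a point other than every \<open>slice_point C a c u\<close>. It is invariant under gluing
  and fails at the vertex cell itself, hence at every representative of the vertex.\<close>

lemma slice_fibre:
 assumes c: "c \<in> Ob C" and e: "e \<in> topspace (realization (slice C a))" and pe: "slice_map C e = vertex_point C c"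
 obtains u where "u \<in> arrows C a c" "e = slice_point C a c u"
proof -
 obtain m z t where z: "z \<in> cells (slice C a) m" and t: "t \<in> std m" and ez: "e = rp (slice C a) ((m, z), t)"
  by (rule realization_cases[OF e])
 obtain y w where yw: "z = (y, w)" by (cases z)
 have y: "y \<in> cells (nerve C) m" and w: "w \<in> arrows C a (fst y 0)" using z by (auto simp: cells_slice yw)
 have py: "rp (nerve C) ((m, y), t) = rp (nerve C) ((0, vertex_cell C c), base_point)"
  using pe realization_map_point[OF simplicial_set_slice simplicial_set_nerve simplicial_map_slice z t]
  by (simp add: ez yw vertex_point_def)
 define h where "h = (%((m, y), t). \<exists>w\<in>arrows C a (fst y 0). \<forall>u\<in>arrows C a c.
   rp (slice C a) ((m, (y, w)), t) \<noteq> slice_point C a c u)"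
 have "h ((m, y), t) = h ((0, vertex_cell C c), base_point)"
 proof (rule realization_point_cong[OF _ _ _ py])
  fix m n al y t assume a: "al \<in> Delta m n" and y: "y \<in> cells (nerve C) n" and t: "t \<in> std m"
  have "rp (slice C a) ((m, (restr (nerve C) m n al y, cmp C (snd y (0, al 0)) v)), t) =
    rp (slice C a) ((n, (y, v)), push m al t)" if "v \<in> arrows C a (fst y 0)" for v
   using realization_point_restr[OF simplicial_set_slice[of a] a, of "(y, v)"] that y t by (simp add: restr_slice cells_slice)
  then show "h ((m, restr (nerve C) m n al y), t) = h ((n, y), push m al t)"
   unfolding h_def by (simp add: fst_restr_nerve ex_arrow_restr[OF a y])
 qed (use y t vertex_cell_mem[OF c] base_point_mem in \<open>auto simp: topspace_simplex_sum\<close>)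
 moreover have "\<not> h ((0, vertex_cell C c), base_point)"
  by (auto simp: h_def slice_point_def fst_vertex_cell)
 ultimately have "\<not> h ((m, y), t)" by simp
 then show ?thesis using that w unfolding h_def by (auto simp: ez yw)
qed

text \<open>Measured against \<open>u\<close>, the two points have the labels
  \<open>cmp C u (iv u)\<close> and \<open>cmp C u' (iv u)\<close>. Equal points lie on the same
  sheets around the vertex, so both labels are the identity.\<close>

lemma slice_point_inject:
 assumes u: "u \<in> arrows C a c" and u': "u' \<in> arrows C a c" and eq: "slice_point C a c u = slice_point C a c u'"
 shows "u = u'"
proof -
 have c: "c \<in> Ob C" by (rule arrows_Ob(2)[OF u])
 have nd: "nondegenerate (nerve C) 0 (vertex_cell C c)"
  using vertex_cell_mem[OF c] by (simp add: nondegenerate_def)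
 have self: "sheet 0 (vertex_cell C c) ((0, vertex_cell C c), base_point) (ident C c)"
  using sheet_self[OF nd, of base_point] by (simp add: base_point_def fst_vertex_cell)
 have "sheet 0 (vertex_cell C c) ((0, vertex_cell C c), base_point) (cmp C u (iv u)) \<longleftrightarrow>
   sheet 0 (vertex_cell C c) ((0, vertex_cell C c), base_point) (cmp C u' (iv u))"
  by (rule slice_sheet_cong[OF nd _ _ _ eq[unfolded slice_point_def]])
   (use u u' slice_vertex_mem base_point_mem in \<open>auto simp: topspace_simplex_sum fst_vertex_cell\<close>)
 then have "cmp C u' (iv u) = ident C c"
  using sheet_unique[OF nd vertex_cell_mem[OF c] base_point_mem self] self inv_right[OF u] by metis
 then have "cmp C u' (iv u) = cmp C u (iv u)" by (simp add: inv_right[OF u])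
 then show ?thesis using right_cancel[OF inv_arrows[OF u] u' u] by simp
qed

text \<open>The monodromy along the path of an arrow is composition with that arrow:
  \<open>slice_path\<close> is an explicit lift, and lifts are unique.\<close>

lemma covering_arrow_path_end:
 assumes f: "f \<in> arrows C c c'" and u: "u \<in> arrows C a c"
  and L: "cpath (realization (slice C a)) L"
  and p: "!!tu. tu \<in> {0..1} ==> slice_map C (L tu) = arrow_path C f tu"
  and L0: "L 0 = slice_point C a c u"
 shows "L 1 = slice_point C a c' (cmp C f u)"
proof -
 have "L 1 = slice_path C a f u 1"
  by (rule covering_path_unique[OF covering_slice[of a] L continuous_slice_path[OF f u], of 0 1])
   (use p slice_map_path[OF f u] L0 slice_path_ends[OF f u] in auto)
 then show ?thesis by (simp add: slice_path_ends[OF f u])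
qed

end

section \<open>Recovering arrows from a homotopy inverse\<close>

lemma nerve_map_cells:
 assumes F: "(P, Q) \<in> functors C E"
 shows "c \<in> Ob C ==> nerve_map P Q 0 (vertex_cell C c) = vertex_cell E (P c)"
  "f \<in> arrows C c c' ==> c \<in> Ob C ==> c' \<in> Ob C ==> nerve_map P Q 1 (arrow_cell C f) = arrow_cell E (Q f)"
proof -
 show "nerve_map P Q 0 (vertex_cell C c) = vertex_cell E (P c)" if "c \<in> Ob C"
  using functors_ident[OF F that] by (auto simp: vertex_cell_def nerve_map_eq fun_eq_iff restrict_def)
 show "nerve_map P Q 1 (arrow_cell C f) = arrow_cell E (Q f)" if f: "f \<in> arrows C c c'" and o: "c \<in> Ob C" "c' \<in> Ob C"
  using functors_ident[OF F] o arrowsD(2,3)[OF f] arrowsD(2,3)[OF functors_arrows[OF F f]]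
  by (auto simp: arrow_cell_def nerve_map_eq fun_eq_iff restrict_def)
qed

lemma simplicial_map_slice_functor:
 assumes C: "category C" and F: "(P, Q) \<in> functors C E"
 shows "simplicial_map (slice C a) (slice E (P a)) (%n (x, u). (nerve_map P Q n x, Q u))"
 unfolding simplicial_map_def
proof (intro conjI allI ballI)
 fix n z assume z: "z \<in> cells (slice C a) n"
 obtain x u where xu: "z = (x, u)" by (cases z)
 have x: "x \<in> cells (nerve C) n" and u: "u \<in> arrows C a (fst x 0)" using z by (auto simp: cells_slice xu)
 have e: "nerve_map P Q n x = nerve_map P Q n (fst x, snd x)" by simp
 have x0: "fst (nerve_map P Q n x) 0 = P (fst x 0)" unfolding e nerve_map_eq by simp
 show "(case z of (x, u) => (nerve_map P Q n x, Q u)) \<in> cells (slice E (P a)) n"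
  using simplicial_map_cells[OF simplicial_map_nerve_map[OF F] x] functors_arrows[OF F u]
  by (simp add: xu cells_slice x0)
 fix m al assume a: "al \<in> Delta m n"
 have x01: "snd x (0, al 0) \<in> arrows C (fst x 0) (fst x (al 0))"
  using cells_nerveD(2)[OF x, of 0 "al 0"] Delta_le[OF a, of 0] by simp
 have "snd (nerve_map P Q n x) (0, al 0) = Q (snd x (0, al 0))"
  unfolding e nerve_map_eq using Delta_le[OF a, of 0] by simp
 then show "(case restr (slice C a) m n al z of (x, u) => (nerve_map P Q m x, Q u)) =
   restr (slice E (P a)) m n al (case z of (x, u) => (nerve_map P Q n x, Q u))"
  using functors_cmp[OF F u x01] simplicial_map_restr[OF simplicial_map_nerve_map[OF F] a x]
  by (simp add: xu restr_slice)
qed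

text \<open>The first coordinate of the square is the time of the homotopy, the second runs along
  the path.\<close>

lemma unit_homotopy_edges:
 assumes h: "continuous_map (prod_topology (top_of_set {0..1}) X) Y h"
  and g: "cpath X gm"
 shows "continuous_map (top_of_set unit_square) Y (%(a, b). h (a, gm b))"
proof -
 have "continuous_map (prod_topology (top_of_set {0..1::real}) (top_of_set {0..1::real})) (prod_topology (top_of_set {0..1}) X)
   (%(a, b). (a, gm b))"
  unfolding continuous_map_prod_top using g by simp
 from continuous_map_compose[OF this h]
 have "continuous_map (prod_topology (top_of_set {0..1::real}) (top_of_set {0..1::real})) Y (%(a, b). h (a, gm b))"
  by (simp add: o_def case_prod_beta')
 moreover have "prod_topology (top_of_set {0..1::real}) (top_of_set {0..1::real}) = top_of_set unit_square"
  by (simp flip: subtopology_Times)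
 ultimately show ?thesis by simp
qed

text \<open>The data of a homotopy equivalence whose forward map comes from a functor. The inverse
  \<open>G\<close> is only continuous; \<open>h\<close> and \<open>k\<close> run from the composites
  with \<open>G\<close> at time 0 to the identities at time 1.\<close>

locale nerve_equivalence =
 C: groupoid_cat C + E: groupoid_cat E
 for C :: "('o, 'm) cat" and E :: "('p, 'n) cat" +
 fixes P Q G h k
 assumes F: "(P, Q) \<in> functors C E"
  and G: "continuous_map (BN E) (BN C) G"
  and h: "continuous_map (prod_topology (top_of_set {0..1}) (BN C)) (BN C) h"
  and h0: "!!c. c \<in> topspace (BN C) ==> h (0::real, c) = G (rmap (nerve E) (nerve_map P Q) c)"
  and h1: "!!c. c \<in> topspace (BN C) ==> h (1, c) = c"
  and k: "continuous_map (prod_topology (top_of_set {0..1}) (BN E)) (BN E) k"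
  and k0: "!!c. c \<in> topspace (BN E) ==> k (0::real, c) = rmap (nerve E) (nerve_map P Q) (G c)"
  and k1: "!!c. c \<in> topspace (BN E) ==> k (1, c) = c"
begin

abbreviation "FF \<equiv> rmap (nerve E) (nerve_map P Q)"
abbreviation "FS a \<equiv> rmap (slice E (P a)) (%n (x, u). (nerve_map P Q n x, Q u))"

lemmas sC = simplicial_set_nerve[of C] and sE = simplicial_set_nerve[of E] and sF = simplicial_map_nerve_map[OF F]

lemma FF_arrow_path:
 assumes f: "f \<in> arrows C c c'" and t: "tu \<in> {0..1}"
 shows "FF (arrow_path C f tu) = arrow_path E (Q f) tu"
 unfolding arrow_path_def
 by (simp only: realization_map_point[OF sC sE sF C.arrow_cell_mem[OF arrowsD(1)[OF f]] edge_point_mem[OF t]]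
   nerve_map_cells(2)[OF F f C.arrows_Ob[OF f]])

lemma FF_vertex: "c \<in> Ob C ==> FF (vertex_point C c) = vertex_point E (P c)"
 unfolding vertex_point_def
 by (simp only: realization_map_point[OF sC sE sF C.vertex_cell_mem base_point_mem] nerve_map_cells(1)[OF F])

lemma FS_continuous: "continuous_map (realization (slice C a)) (realization (slice E (P a))) (FS a)"
 by (rule continuous_map_realization_map[OF C.simplicial_set_slice E.simplicial_set_slice
    simplicial_map_slice_functor[OF C.category_axioms F]])

text \<open>The functor induces a map of coverings over \<open>FF\<close>, so \<open>FS\<close>
  turns lifts in a slice of \<open>C\<close> into lifts in the corresponding slice of
  \<open>E\<close>.\<close>

lemma FS_over: "e \<in> topspace (realization (slice C a)) ==> slice_map E (FS a e) = FF (slice_map C e)"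
proof (erule realization_cases)
 fix n z t assume z: "z \<in> cells (slice C a) n" and t: "t \<in> std n" and e: "e = rp (slice C a) ((n, z), t)"
 obtain x u where xu: "z = (x, u)" by (cases z)
 note sl = simplicial_map_slice_functor[OF C.category_axioms F, of a]
 have x: "x \<in> cells (nerve C) n" using z by (auto simp: xu cells_slice)
 show ?thesis
  unfolding e
  using realization_map_point[OF C.simplicial_set_slice E.simplicial_set_slice sl z t]
   realization_map_point[OF E.simplicial_set_slice sE E.simplicial_map_slice simplicial_map_cells[OF sl z] t]
   realization_map_point[OF C.simplicial_set_slice sC C.simplicial_map_slice z t]
   realization_map_point[OF sC sE sF x t]
  by (simp add: xu)
qed

lemma vertex_point_mem: "c \<in> Ob C ==> vertex_point C c \<in> topspace (BN C)"
 "e \<in> Ob E ==> vertex_point E e \<in> topspace (BN E)"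
 unfolding vertex_point_def
 by (rule realization_point_mem[OF C.vertex_cell_mem base_point_mem], assumption)
  (rule realization_point_mem[OF E.vertex_cell_mem base_point_mem], assumption)

lemma arrow_path_mem:
 "f \<in> Ar C ==> tu \<in> {0..1} ==> arrow_path C f tu \<in> topspace (BN C)"
 "g \<in> Ar E ==> tu \<in> {0..1} ==> arrow_path E g tu \<in> topspace (BN E)"
 unfolding arrow_path_def
 by (rule realization_point_mem[OF C.arrow_cell_mem edge_point_mem], assumption+)
  (rule realization_point_mem[OF E.arrow_cell_mem edge_point_mem], assumption+)

lemma lift_mem:
 "continuous_map (top_of_set S) T L ==> q \<in> S ==> L q \<in> topspace T"
 by (auto simp: continuous_map_def)

text \<open>Lifting the homotopy \<open>k\<close> along an arrow shows that the arrow is determined by the lift of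
 its image under \<open>G\<close>.\<close>

lemma arrow_determined:
 assumes g: "g \<in> arrows E (P s) e'" and g': "g' \<in> arrows E (P s) e'"
  and L: "cpath (realization (slice E (P s))) L"
  and pL: "!!tu. tu \<in> {0..1} ==> slice_map E (L tu) = FF (G (arrow_path E g tu))"
  and L': "cpath (realization (slice E (P s))) L'"
  and pL': "!!tu. tu \<in> {0..1} ==> slice_map E (L' tu) = FF (G (arrow_path E g' tu))"
  and eq0: "L 0 = L' 0" and eq1: "L 1 = L' 1"
 shows "g = g'"
proof -
 let ?A = "realization (slice E (P s))" and ?p = "slice_map E"
 note cov = E.covering_slice[of "P s"]
 \<comment> \<open>The lift of \<open>k\<close> along the path of \<open>f\<close>: at time 0 it
   runs along \<open>N\<close>, at time 1 it lies over the path of \<open>f\<close> itself.\<close>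
 have one: "\<exists>M. continuous_map (top_of_set unit_square) ?A M &
   (\<forall>r\<in>unit_square. ?p (M r) = k (fst r, arrow_path E f (snd r))) & M (0, 0) = N 0 & M (0, 1) = N 1"
  if f: "f \<in> arrows E (P s) e'" and N: "cpath ?A N"
   and pN: "!!tu. tu \<in> {0..1} ==> ?p (N tu) = FF (G (arrow_path E f tu))" for f N
 proof -
  note fA = arrowsD(1)[OF f]
  have kk: "continuous_map (top_of_set unit_square) (BN E) (%(a, b). k (a, arrow_path E f b))"
   by (rule unit_homotopy_edges[OF k E.continuous_arrow_path[OF fA]])
  have N0: "N 0 \<in> topspace ?A" by (rule lift_mem[OF N]) simp
  obtain M where M: "continuous_map (top_of_set unit_square) ?A M"
   "!!r. r \<in> unit_square ==> ?p (M r) = (%(a, b). k (a, arrow_path E f b)) r" "M (0, 0) = N 0"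
   by (rule covering_lift_square[OF cov kk, of "(0, 0)" "N 0"])
    (use N0 pN[of 0] k0 arrow_path_mem(2)[OF fA, of 0] in auto)
  have "M (0, 1) = N 1"
   by (rule covering_path_unique[OF cov continuous_map_square_edge(2)[OF M(1), of 0] N, of 0 1])
    (use M(2,3) pN k0 arrow_path_mem(2)[OF fA] in auto)
  then show ?thesis using M by (intro exI[of _ M]) (auto simp: case_prod_beta')
 qed
 obtain M where M: "continuous_map (top_of_set unit_square) ?A M"
  "\<forall>r\<in>unit_square. ?p (M r) = k (fst r, arrow_path E g (snd r))" "M (0, 0) = L 0" "M (0, 1) = L 1"
  using one[OF g L pL] by blast
 obtain M' where M': "continuous_map (top_of_set unit_square) ?A M'"
  "\<forall>r\<in>unit_square. ?p (M' r) = k (fst r, arrow_path E g' (snd r))" "M' (0, 0) = L' 0" "M' (0, 1) = L' 1"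
  using one[OF g' L' pL'] by blast
 note ends = E.arrow_path_ends[OF g] E.arrow_path_ends[OF g']
 \<comment> \<open>The arrows have the same ends, so along the tracks of these ends both squares
   lift the same path from the same point. By monodromy the corner at \<open>(1, 1)\<close> is then
   \<open>g\<close>, and also \<open>g'\<close>, applied to one arrow \<open>w\<close>.\<close>
 have b: "M (1, 0) = M' (1, 0)"
  by (rule covering_path_unique[OF cov continuous_map_square_edge(1)[OF M(1), of 0] continuous_map_square_edge(1)[OF M'(1), of 0], of 0 1])
   (use M(2,3) M'(2,3) eq0 ends in auto)
 have t: "M (1, 1) = M' (1, 1)"
  by (rule covering_path_unique[OF cov continuous_map_square_edge(1)[OF M(1), of 1] continuous_map_square_edge(1)[OF M'(1), of 1], of 0 1])
   (use M(2,4) M'(2,4) eq1 ends in auto)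
 have o: "P s \<in> Ob E" by (rule E.arrows_Ob(1)[OF g])
 have "?p (M (1, 0)) = vertex_point E (P s)"
  using M(2) k1[OF vertex_point_mem(2)[OF o]] ends by simp
 then obtain w where w: "w \<in> arrows E (P s) (P s)" "M (1, 0) = slice_point E (P s) (P s) w"
  using E.slice_fibre[OF o lift_mem[OF M(1)]] by (metis mem_Sigma_iff atLeastAtMost_iff zero_le_one order_refl)
 have "M (1, 1) = slice_point E (P s) e' (cmp E g w)"
  by (rule E.covering_arrow_path_end[OF g w(1) continuous_map_square_edge(2)[OF M(1), of 1]])
   (use M(2) w(2) k1 arrow_path_mem(2)[OF arrowsD(1)[OF g]] in auto)
 moreover have "M' (1, 1) = slice_point E (P s) e' (cmp E g' w)"
  by (rule E.covering_arrow_path_end[OF g' w(1) continuous_map_square_edge(2)[OF M'(1), of 1]])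
   (use M'(2) w(2) b k1 arrow_path_mem(2)[OF arrowsD(1)[OF g']] in auto)
 ultimately have "cmp E g w = cmp E g' w"
  using t E.slice_point_inject[OF E.cmp_arrows[OF w(1) g] E.cmp_arrows[OF w(1) g']] by simp
 then show ?thesis by (rule E.right_cancel[OF w(1) g g'])
qed

text \<open>The arrow \<open>f\<close> is read off from the end of a lifted path. To compare
  \<open>Q f\<close> with \<open>g\<close>, their images under \<open>G\<close> are lifted in the
  slice of \<open>C\<close> with common ends, and \<open>FS\<close> carries these lifts to the slice
  of \<open>E\<close>, where \<open>arrow_determined\<close> applies.\<close>

lemma full:
 assumes s: "s \<in> Ob C" and t: "t \<in> Ob C" and g: "g \<in> arrows E (P s) (P t)"
 shows "\<exists>f\<in>arrows C s t. Q f = g"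
proof -
 let ?A = "realization (slice C s)" and ?p = "slice_map C"
 note cov = C.covering_slice[of s] and i = C.ident_closed[OF s]
 have hp: "cpath (BN C) (%a. h (a, vertex_point C c))" if c: "c \<in> Ob C" for c
 proof -
  have "cpath (prod_topology (top_of_set {0..1}) (BN C)) (%a. (a, vertex_point C c))"
   using vertex_point_mem(1)[OF c] by (auto simp: continuous_map_pairwise o_def)
  from continuous_map_compose[OF this h] show ?thesis by (simp add: o_def)
 qed
 \<comment> \<open>The arrow \<open>f\<close> is the monodromy of \<open>G\<close> applied to \<open>g\<close>, transported along the homotopy \<open>h\<close>.\<close>
 obtain L1 where L1: "cpath ?A L1"
  "!!r. r \<in> {0..1} ==> ?p (L1 r) = h (r, vertex_point C s)" "L1 1 = slice_point C s s (ident C s)"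
  by (rule covering_lift_path[OF cov hp[OF s], of 1 "slice_point C s s (ident C s)"])
   (use C.slice_point_mem[OF i] C.slice_map_point[OF i] h1 vertex_point_mem(1)[OF s] in auto)
 note gA = arrowsD(1)[OF g] and gends = E.arrow_path_ends[OF g]
 have Gg: "cpath (BN C) (%tu. G (arrow_path E g tu))"
  using continuous_map_compose[OF E.continuous_arrow_path[OF gA] G] by (simp add: o_def)
 obtain L2 where L2: "cpath ?A L2"
  "!!r. r \<in> {0..1} ==> ?p (L2 r) = G (arrow_path E g r)" "L2 0 = L1 0"
  by (rule covering_lift_path[OF cov Gg, of 0 "L1 0"])
   (use lift_mem[OF L1(1), of 0] L1(2)[of 0] h0 vertex_point_mem(1)[OF s] gends FF_vertex[OF s] in auto)
 obtain L3 where L3: "cpath ?A L3"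
  "!!r. r \<in> {0..1} ==> ?p (L3 r) = h (r, vertex_point C t)" "L3 0 = L2 1"
  by (rule covering_lift_path[OF cov hp[OF t], of 0 "L2 1"])
   (use lift_mem[OF L2(1), of 1] L2(2)[of 1] h0 vertex_point_mem(1)[OF t] gends FF_vertex[OF t] in auto)
 have "?p (L3 1) = vertex_point C t" using L3(2)[of 1] h1 vertex_point_mem(1)[OF t] by simp
 then obtain f where f: "f \<in> arrows C s t" and L31: "L3 1 = slice_point C s t f"
  using C.slice_fibre[OF t lift_mem[OF L3(1)]] by (metis atLeastAtMost_iff zero_le_one order_refl)
 note fA = arrowsD(1)[OF f] and fends = C.arrow_path_ends[OF f]
 have hf: "continuous_map (top_of_set unit_square) (BN C) (%(a, b). h (a, arrow_path C f b))"
  by (rule unit_homotopy_edges[OF h C.continuous_arrow_path[OF fA]])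
 \<comment> \<open>The lift of \<open>h\<close> along the path of \<open>f\<close>. Its tracks over
   the two ends of \<open>f\<close> are \<open>L1\<close> and \<open>L3\<close>, so its edge at time
   0 has the same ends as \<open>L2\<close>.\<close>
 obtain M where M: "continuous_map (top_of_set unit_square) ?A M"
  "!!r. r \<in> unit_square ==> ?p (M r) = (%(a, b). h (a, arrow_path C f b)) r" "M (0, 0) = L1 0"
  by (rule covering_lift_square[OF cov hf, of "(0, 0)" "L1 0"])
   (use lift_mem[OF L1(1), of 0] L1(2)[of 0] fends in auto)
 have "M (1, 0) = L1 1"
  by (rule covering_path_unique[OF cov continuous_map_square_edge(1)[OF M(1), of 0] L1(1), of 0 1])
   (use M(2,3) L1(2) fends in auto)
 then have "M (1, 1) = slice_point C s t (cmp C f (ident C s))"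
  by (intro C.covering_arrow_path_end[OF f i continuous_map_square_edge(2)[OF M(1), of 1]])
   (use M(2) L1(3) h1 arrow_path_mem(1)[OF fA] in auto)
 then have M11: "M (1, 1) = L3 1" by (simp add: L31 C.ident_right[OF f])
 have M01: "M (0, 1) = L2 1"
  using covering_path_unique[OF cov continuous_map_square_edge(1)[OF M(1), of 1] L3(1), of 1 0] M(2) L3(2,3) fends M11
  by auto
 have FFp: "slice_map E (FS s e) = FF (?p e)" if "e \<in> topspace ?A" for e by (rule FS_over[OF that])
 have "Q f = g"
 proof (rule arrow_determined[OF functors_arrows[OF F f] g])
  show "cpath (realization (slice E (P s))) (%tu. FS s (M (0, tu)))"
   using continuous_map_compose[OF continuous_map_square_edge(2)[OF M(1), of 0] FS_continuous] by (simp add: o_def)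
  show "cpath (realization (slice E (P s))) (%tu. FS s (L2 tu))"
   using continuous_map_compose[OF L2(1) FS_continuous] by (simp add: o_def)
  fix tu :: real assume tu: "tu \<in> {0..1}"
  show "slice_map E (FS s (M (0, tu))) = FF (G (arrow_path E (Q f) tu))"
   using FFp[OF lift_mem[OF M(1), of "(0, tu)"]] tu M(2)[of "(0, tu)"] h0[OF arrow_path_mem(1)[OF fA tu]]
    FF_arrow_path[OF f tu] by simp
  show "slice_map E (FS s (L2 tu)) = FF (G (arrow_path E g tu))"
   using FFp[OF lift_mem[OF L2(1) tu]] L2(2)[OF tu] by simp
 qed (simp_all add: M(3) L2(3) M01)
 then show ?thesis using f by blast
qed

text \<open>The track of the vertex \<open>e\<close> under \<open>k\<close> leads to a point in the
  image of \<open>FF\<close>. Its lift ends in an arrow from \<open>e\<close> to the first vertex of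
  some representative of that point, and gluing passes this on to a representative coming from
  \<open>C\<close>.\<close>

lemma essentially_surjective:
 assumes e: "e \<in> Ob E"
 shows "\<exists>c\<in>Ob C. \<exists>g. g \<in> arrows E (P c) e"
proof -
 note i = E.ident_closed[OF e] and v = vertex_point_mem(2)[OF e]
 have kp: "cpath (BN E) (%a. k (a, vertex_point E e))"
 proof -
  have "cpath (prod_topology (top_of_set {0..1}) (BN E)) (%a. (a, vertex_point E e))"
   using v by (auto simp: continuous_map_pairwise o_def)
  from continuous_map_compose[OF this k] show ?thesis by (simp add: o_def)
 qed
 obtain L where L: "cpath (realization (slice E e)) L"
  "!!r. r \<in> {0..1} ==> slice_map E (L r) = k (r, vertex_point E e)" "L 1 = slice_point E e e (ident E e)"
  by (rule covering_lift_path[OF E.covering_slice kp, of 1 "slice_point E e e (ident E e)"])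
   (use E.slice_point_mem[OF i] E.slice_map_point[OF i] k1[OF v] in auto)
 have "G (vertex_point E e) \<in> topspace (BN C)"
  using G v by (auto simp: continuous_map_def)
 then obtain n x t where x: "x \<in> cells (nerve C) n" "t \<in> std n" "G (vertex_point E e) = rp (nerve C) ((n, x), t)"
  by (rule realization_cases)
 have "L 0 \<in> topspace (realization (slice E e))" by (rule lift_mem[OF L(1)]) simp
 then obtain m z t' where z: "z \<in> cells (slice E e) m" "t' \<in> std m" "L 0 = rp (slice E e) ((m, z), t')"
  by (rule realization_cases)
 obtain y w where yw: "z = (y, w)" by (cases z)
 have y: "y \<in> cells (nerve E) m" and w: "w \<in> arrows E e (fst y 0)" using z(1) by (auto simp: cells_slice yw)
 let ?x = "nerve_map P Q n x"
 have x': "?x \<in> cells (nerve E) n" by (rule simplicial_map_cells[OF sF x(1)])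
 have "rp (nerve E) ((m, y), t') = slice_map E (L 0)"
  using realization_map_point[OF E.simplicial_set_slice sE E.simplicial_map_slice z(1,2)] by (simp add: z(3) yw)
 also have "\<dots> = FF (G (vertex_point E e))" using L(2)[of 0] k0[OF v] by simp
 also have "\<dots> = rp (nerve E) ((n, ?x), t)"
  by (simp add: x(3) realization_map_point[OF sC sE sF x(1,2)])
 finally have eq: "rp (nerve E) ((m, y), t') = rp (nerve E) ((n, ?x), t)" .
 \<comment> \<open>Whether \<open>e\<close> has an arrow to the first vertex does not depend on the
   representative of the point.\<close>
 let ?r = "%((m, y), t :: nat => real). \<exists>w\<in>arrows E e (fst y 0). True"
 have "?r ((m, y), t') = ?r ((n, ?x), t)"
 proof (rule realization_point_cong[OF _ _ _ eq])
  fix m n al y and t :: "nat => real" assume a: "al \<in> Delta m n" and y: "y \<in> cells (nerve E) n"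
  show "?r ((m, restr (nerve E) m n al y), t) = ?r ((n, y), push m al t)"
   using E.ex_arrow_restr[OF a y, of e "%_. True"] by (simp add: fst_restr_nerve)
 qed (use y z(2) x' x(2) in \<open>auto simp: topspace_simplex_sum\<close>)
 then obtain w' where w': "w' \<in> arrows E e (fst ?x 0)" using w by auto
 have "fst ?x 0 = P (fst x 0)" using nerve_map_eq[of P Q n "fst x" "snd x"] by simp
 then show ?thesis using E.inv_arrows[OF w'] cells_nerveD(1)[OF x(1), of 0] by auto
qed

end

lemma weak_equivalence_nerveD:
 assumes C: "groupoid_cat C" and E: "groupoid_cat E" and F: "(P, Q) \<in> functors C E"
  and w: "weak_equivalence (nerve C) (nerve E) (nerve_map P Q)"
 shows "e \<in> Ob E ==> \<exists>c\<in>Ob C. \<exists>g. g \<in> arrows E (P c) e"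
  "s \<in> Ob C ==> t \<in> Ob C ==> g \<in> arrows E (P s) (P t) ==> \<exists>f\<in>arrows C s t. Q f = g"
proof -
 interpret C: groupoid_cat C by (rule C)
 interpret E: groupoid_cat E by (rule E)
 let ?F = "rmap (nerve E) (nerve_map P Q)"
 obtain G where G: "continuous_map (BN E) (BN C) G"
  and h: "homotopic_with (%_. True) (BN C) (BN C) (G \<circ> ?F) id"
  and k: "homotopic_with (%_. True) (BN E) (BN E) (?F \<circ> G) id"
  using w unfolding weak_equivalence_def homotopy_equivalence_def by blast
 obtain h where h: "continuous_map (prod_topology (top_of_set {0..1}) (BN C)) (BN C) h"
  "!!c. h (0::real, c) = (G \<circ> ?F) c" "!!c. h (1, c) = id c"
  using h unfolding homotopic_with_def by blast
 obtain k where k: "continuous_map (prod_topology (top_of_set {0..1}) (BN E)) (BN E) k"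
  "!!c. k (0::real, c) = (?F \<circ> G) c" "!!c. k (1, c) = id c"
  using k unfolding homotopic_with_def by blast
 interpret nerve_equivalence C E P Q G h k
  by unfold_locales (use F G h k in auto)
 show "e \<in> Ob E ==> \<exists>c\<in>Ob C. \<exists>g. g \<in> arrows E (P c) e" by (rule essentially_surjective)
 show "s \<in> Ob C ==> t \<in> Ob C ==> g \<in> arrows E (P s) (P t) ==> \<exists>f\<in>arrows C s t. Q f = g" by (rule full)
qed

section \<open>Shared isomorphisms\<close>

context category begin

lemma isos_arrows: "f \<in> isos C A B ==> f \<in> arrows C A B"
 by (simp add: isos_def)

lemma isosI: "f \<in> arrows C A B ==> inverses C f g ==> f \<in> isos C A B"
 by (auto simp: isos_def)

lemma isos_inverses:
 assumes "f \<in> isos C A B"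
 shows "inverses C f (inv_arrow C f)"
proof -
 obtain g where g: "inverses C f g" using assms by (auto simp: isos_def)
 then show ?thesis using inv_arrow_eq[OF g] by simp
qed

lemma isos_inv:
 assumes "f \<in> isos C A B"
 shows "inv_arrow C f \<in> isos C B A" "cmp C (inv_arrow C f) f = ident C A" "cmp C f (inv_arrow C f) = ident C B"
 using isos_inverses[OF assms] inverses_sym[OF isos_inverses[OF assms]] isos_arrows[OF assms]
 by (auto simp: inverses_def isos_def arrows_def)

lemma isos_ident: "A \<in> Ob C ==> ident C A \<in> isos C A A"
 by (rule isosI[OF ident_closed inverses_ident])

lemma isos_cmp: "f \<in> isos C A B ==> g \<in> isos C B A' ==> cmp C g f \<in> isos C A A'"
 by (rule isosI[OF cmp_arrows inverses_cmp[OF isos_arrows isos_arrows isos_inverses isos_inverses]])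
  (auto intro: isos_arrows)

lemma iso_cancel_right:
 assumes b: "b \<in> isos C A B" and f: "f \<in> arrows C B A'" and g: "g \<in> arrows C B A'" and "cmp C f b = cmp C g b"
 shows "f = g"
proof -
 note i = isos_inv[OF b] and ba = isos_arrows[OF b]
 have "cmp C (cmp C f b) (inv_arrow C b) = cmp C (cmp C g b) (inv_arrow C b)" using assms by simp
 then show ?thesis
  using assoc_arrows[OF isos_arrows[OF i(1)] ba f] assoc_arrows[OF isos_arrows[OF i(1)] ba g] ident_right[OF f] ident_right[OF g] i(3)
  by simp
qed

text \<open>Pasting of two commutative squares, used for morphisms in both directions and for
  squares regarded as arrows of \<open>hsq D\<close>.\<close>

lemma natural_cmp:
 assumes a: "a \<in> arrows C X Y" "a' \<in> arrows C Y Z" and b: "b \<in> arrows C X' Y'" "b' \<in> arrows C Y' Z'"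
  and t: "p \<in> arrows C X X'" "q \<in> arrows C Y Y'" "r \<in> arrows C Z Z'"
  and e: "cmp C q a = cmp C b p" "cmp C r a' = cmp C b' q"
 shows "cmp C r (cmp C a' a) = cmp C (cmp C b' b) p"
 using assoc_arrows[OF a t(3)] assoc_arrows[OF a(1) t(2) b(2)] assoc_arrows[OF t(1) b] e by simp

lemma natural_inv:
 assumes a: "a \<in> arrows C X Y" and b: "b \<in> arrows C X' Y'" and p: "p \<in> arrows C X X'" "p' \<in> arrows C X' X"
  and q: "q \<in> arrows C Y Y'" "q' \<in> arrows C Y' Y" and i: "cmp C p p' = ident C X'" "cmp C q' q = ident C Y"
  and e: "cmp C q a = cmp C b p"
 shows "cmp C q' b = cmp C a p'"
proof -
 have "cmp C q' b = cmp C q' (cmp C (cmp C b p) p')"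
  using assoc_arrows[OF p(2,1) b] ident_right[OF b] i(1) by simp
 also have "\<dots> = cmp C a p'"
  unfolding e[symmetric] using assoc_arrows[OF p(2) cmp_arrows[OF a q(1)] q(2)] assoc_arrows[OF a q] ident_left[OF a] i(2) by simp
 finally show ?thesis .
qed

end

context double_category begin

sublocale H: category "hor D" by (rule category_hor)
sublocale V: category "ver D" by (rule category_ver)
sublocale HS: category "hsq D" by (rule category_hsq)
sublocale VS: category "vsq D" by (rule category_vsq)

abbreviation hcmp (infixl "\<circ>h" 70) where "g \<circ>h f \<equiv> cmp (hor D) g f"
abbreviation vcmp (infixl "\<circ>v" 70) where "w \<circ>v u \<equiv> cmp (ver D) w u"
abbreviation hsq_cmp (infixl "\<bullet>h" 70) where "t \<bullet>h s \<equiv> cmp (hsq D) t s"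
abbreviation vsq_cmp (infixl "\<bullet>v" 70) where "t \<bullet>v s \<equiv> cmp (vsq D) t s"
abbreviation "idh \<equiv> ident (hor D)"
abbreviation "idv \<equiv> ident (ver D)"
abbreviation "idhs \<equiv> ident (hsq D)"
abbreviation "idvs \<equiv> ident (vsq D)"
abbreviation "OB \<equiv> Ob (hor D)"
abbreviation "hm \<equiv> arrows (hor D)"
abbreviation "vm \<equiv> arrows (ver D)"
abbreviation "sq \<equiv> squares D"

lemma sqD:
 assumes "s \<in> sq f u v g"
 shows "s \<in> Sq D" "s \<in> arrows (hsq D) u v" "s \<in> arrows (vsq D) f g"
  "f \<in> hm (src (ver D) u) (src (ver D) v)" "g \<in> hm (trg (ver D) u) (trg (ver D) v)"
  "u \<in> vm (src (hor D) f) (src (hor D) g)" "v \<in> vm (trg (hor D) f) (trg (hor D) g)"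
 using assms HS.src_closed[of s] HS.trg_closed[of s] VS.src_closed[of s] VS.trg_closed[of s] same_squares hsq_objects vsq_objects
  corner_top_left[of s] corner_top_right[of s] corner_bottom_left[of s] corner_bottom_right[of s]
 by (auto simp: squares_def arrows_def)

lemma sqI: "s \<in> arrows (hsq D) u v ==> s \<in> arrows (vsq D) f g ==> s \<in> sq f u v g"
 by (simp add: squares_def arrows_def)

lemma sq_hcmp:
 assumes "s \<in> sq f u v g" "t \<in> sq f' v w g'"
 shows "t \<bullet>h s \<in> sq (f' \<circ>h f) u w (g' \<circ>h g)"
 using boundary_hcmp[of s t] HS.cmp_arrows[OF sqD(2)[OF assms(1)] sqD(2)[OF assms(2)]] assms
 by (auto simp: squares_def arrows_def)

lemma sq_vcmp:
 assumes "s \<in> sq f u v g" "t \<in> sq g u' v' g'"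
 shows "t \<bullet>v s \<in> sq f (u' \<circ>v u) (v' \<circ>v v) g'"
 using boundary_vcmp[of s t] VS.cmp_arrows[OF sqD(3)[OF assms(1)] sqD(3)[OF assms(2)]] assms same_squares
 by (auto simp: squares_def arrows_def)

lemma sq_idhs: "u \<in> vm A B ==> idhs u \<in> sq (idh A) u u (idh B)"
 using boundary_hident[of u] HS.ident_closed[of u] hsq_objects by (auto simp: squares_def arrows_def)

lemma sq_idvs: "f \<in> hm A B ==> idvs f \<in> sq f (idv A) (idv B) f"
 using boundary_vident[of f] VS.ident_closed[of f] vsq_objects same_squares by (auto simp: squares_def arrows_def)

lemma exchange:
 assumes "s \<in> sq f u v g" "t \<in> sq f' v w g'" "s' \<in> sq g u' v' k" "t' \<in> sq g' v' w' k'"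
 shows "(t' \<bullet>h s') \<bullet>v (t \<bullet>h s) = (t' \<bullet>v t) \<bullet>h (s' \<bullet>v s)"
 by (rule interchange) (use assms in \<open>auto simp: squares_def\<close>)

lemma hsq_unit:
 assumes "s \<in> sq f u v g"
 shows "s \<bullet>h idhs u = s" "idhs v \<bullet>h s = s"
 using HS.ident_right[OF sqD(2)[OF assms]] HS.ident_left[OF sqD(2)[OF assms]] by simp_all

lemma vsq_unit:
 assumes "s \<in> sq f u v g"
 shows "s \<bullet>v idvs f = s" "idvs g \<bullet>v s = s"
 using VS.ident_right[OF sqD(3)[OF assms]] VS.ident_left[OF sqD(3)[OF assms]] by simp_all

lemma hsq_assoc:
 assumes "s \<in> sq f u v g" "t \<in> sq f' v w g'" "r \<in> sq f'' w x g''"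
 shows "r \<bullet>h (t \<bullet>h s) = (r \<bullet>h t) \<bullet>h s"
 by (rule HS.assoc_arrows[OF assms[THEN sqD(2)]])

end

text \<open>The bijections of \<open>has_shared_isos\<close>, normalized by
  \<open>phi_ident\<close>; from this \<open>phi_cmp\<close> derives that \<open>ph\<close>
  preserves composition.\<close>

locale shared_dblcat = double_category D for D :: "('o, 'h, 'v, 's) dblcat" +
 fixes ph :: "'h => 'v"
 assumes phi_bij: "A \<in> OB ==> B \<in> OB ==> bij_betw ph (isos (hor D) A B) (isos (ver D) A B)"
  and phi_ident: "A \<in> OB ==> ph (idh A) = idv A"
  and sq_hor: "f \<in> hm A A' ==> g \<in> hm B B' ==> h \<in> isos (hor D) A B ==> k \<in> isos (hor D) A' B' ==>
    k \<circ>h f = g \<circ>h h \<longleftrightarrow> (\<exists>s. s \<in> sq f (ph h) (ph k) g)"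
  and sq_hor_unique: "h \<in> isos (hor D) A B ==> k \<in> isos (hor D) A' B' ==>
    s \<in> sq f (ph h) (ph k) g ==> t \<in> sq f (ph h) (ph k) g ==> s = t"
  and sq_ver: "u \<in> vm A B ==> u' \<in> vm A' B' ==> h \<in> isos (hor D) A A' ==> k \<in> isos (hor D) B B' ==>
    u' \<circ>v ph h = ph k \<circ>v u \<longleftrightarrow> (\<exists>s. s \<in> sq h u u' k)"
  and sq_ver_unique: "h \<in> isos (hor D) A A' ==> k \<in> isos (hor D) B B' ==>
    s \<in> sq h u u' k ==> t \<in> sq h u u' k ==> s = t"

text \<open>The bijections of \<open>has_shared_isos\<close> need not preserve identities, hence need not assign to an
 isomorphism the one it is shared with: they may be twisted by an automorphism of the identity
 functor. Untwisting them by the automorphisms \<open>e\<close> that they send to identities repairs this.\<close>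

lemma (in double_category) ex_shared:
 assumes "has_shared_isos D"
 shows "\<exists>ph. shared_dblcat D ph"
proof -
 let ?I = "isos (hor D)"
 obtain ph where bij': "\<forall>A\<in>OB. \<forall>B\<in>OB. bij_betw ph (?I A B) (isos (ver D) A B)"
  and a': "\<forall>A\<in>OB. \<forall>A'\<in>OB. \<forall>B\<in>OB. \<forall>B'\<in>OB. \<forall>f\<in>hm A A'. \<forall>g\<in>hm B B'. \<forall>h\<in>?I A B. \<forall>k\<in>?I A' B'.
    (k \<circ>h f = g \<circ>h h \<longleftrightarrow> (\<exists>s. s \<in> sq f (ph h) (ph k) g)) &
    (\<forall>s\<in>sq f (ph h) (ph k) g. \<forall>t\<in>sq f (ph h) (ph k) g. s = t)"
  and b': "\<forall>A\<in>OB. \<forall>A'\<in>OB. \<forall>B\<in>OB. \<forall>B'\<in>OB. \<forall>u\<in>vm A B. \<forall>u'\<in>vm A' B'. \<forall>h\<in>?I A A'. \<forall>k\<in>?I B B'.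
    (u' \<circ>v ph h = ph k \<circ>v u \<longleftrightarrow> (\<exists>s. s \<in> sq h u u' k)) &
    (\<forall>s\<in>sq h u u' k. \<forall>t\<in>sq h u u' k. s = t)"
  using assms unfolding has_shared_isos_def by (elim exE conjE) (rule that)
 note bij = bij'[rule_format]
 have iO: "A \<in> OB & B \<in> OB" if "h \<in> ?I A B" for h A B
  using H.arrows_Ob[OF H.isos_arrows[OF that]] by simp
 have a: "k \<circ>h f = g \<circ>h h \<longleftrightarrow> (\<exists>s. s \<in> sq f (ph h) (ph k) g)"
  and a_unique: "!!s t. s \<in> sq f (ph h) (ph k) g ==> t \<in> sq f (ph h) (ph k) g ==> s = t"
  if "f \<in> hm A A'" "g \<in> hm B B'" "h \<in> ?I A B" "k \<in> ?I A' B'" for f g h k A A' B B'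
  using a'[rule_format, of A A' B B' f g h k] iO that by blast+
 have b: "u' \<circ>v ph h = ph k \<circ>v u \<longleftrightarrow> (\<exists>s. s \<in> sq h u u' k)"
  and b_unique: "!!s t. s \<in> sq h u u' k ==> t \<in> sq h u u' k ==> s = t"
  if "u \<in> vm A B" "u' \<in> vm A' B'" "h \<in> ?I A A'" "k \<in> ?I B B'" for u u' h k A A' B B'
  using b'[rule_format, of A A' B B' u u' h k] iO that by blast+
 have phiI: "ph h \<in> isos (ver D) A B" if "h \<in> ?I A B" for h A B
  using bij_betwE[OF bij] iO[OF that] that by blast
 define e where "e A = inv_into (?I A A) ph (idv A)" for A
 have e: "e A \<in> ?I A A" "ph (e A) = idv A" if A: "A \<in> OB" for A
 proof -
  have "idv A \<in> ph ` ?I A A"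
   using V.isos_ident[of A] A same_objects bij_betw_imp_surj_on[OF bij[OF A A]] by simp
  then show "e A \<in> ?I A A" "ph (e A) = idv A"
   unfolding e_def by (auto intro: inv_into_into f_inv_into_f)
 qed
 \<comment> \<open>The vertical edges of the identity square of \<open>f\<close> are images of
   \<open>e A\<close> and \<open>e A'\<close>, so the clause for horizontal morphisms reads its
   existence as naturality of \<open>e\<close>.\<close>
 have central: "e A' \<circ>h f = f \<circ>h e A" if f: "f \<in> hm A A'" for f A A'
  using a[OF f f e(1) e(1)] sq_idvs[OF f] H.arrows_Ob[OF f] e(2) by auto
 \<comment> \<open>A square whose four edges come from isomorphisms can be read by either clause,
   and both readings must hold together.\<close>
 have transp: "ph q \<circ>v ph h = ph k \<circ>v ph p \<longleftrightarrow> q \<circ>h h = k \<circ>h p"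
  if "p \<in> ?I A B" "q \<in> ?I A' B'" "h \<in> ?I A A'" "k \<in> ?I B B'" for p q h k A B A' B'
  using b[OF V.isos_arrows[OF phiI[OF that(1)]] V.isos_arrows[OF phiI[OF that(2)]] that(3,4)]
   a[OF H.isos_arrows[OF that(3)] H.isos_arrows[OF that(4)] that(1,2)] by simp
 define \<psi> where "\<psi> h = ph (h \<circ>h e (src (hor D) h))" for h
 have psi: "\<psi> h = ph (h \<circ>h e A)" "h \<circ>h e A \<in> ?I A B" if h: "h \<in> ?I A B" for h A B
  using arrowsD(2)[OF H.isos_arrows[OF h]] H.isos_cmp[OF e(1) h] iO[OF h] by (simp_all add: \<psi>_def)
 have psiI: "\<psi> h \<in> isos (ver D) A B" if h: "h \<in> ?I A B" for h A B
  using phiI[OF psi(2)[OF h]] psi(1)[OF h] by simp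
 \<comment> \<open>Naturality of \<open>e\<close> at \<open>h\<close>, read through
   \<open>transp\<close>, writes \<open>ph\<close> as the untwisted map after a fixed automorphism
   of the source.\<close>
 have phi_psi: "ph h = \<psi> h \<circ>v ph (idh A)" if h: "h \<in> ?I A B" for h A B
 proof -
  have A: "A \<in> OB" "B \<in> OB" using iO[OF h] by simp_all
  have "ph (h \<circ>h e A) \<circ>v ph (idh A) = ph (e B) \<circ>v ph h"
   using transp[OF h psi(2)[OF h] H.isos_ident[OF A(1)] e(1)[OF A(2)]]
    H.ident_right[OF H.isos_arrows[OF psi(2)[OF h]]] central[OF H.isos_arrows[OF h]] by simp
  then show ?thesis
   using psi(1)[OF h] e(2)[OF A(2)] V.ident_left[OF V.isos_arrows[OF phiI[OF h]]] by simp
 qed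
 have "shared_dblcat D \<psi>"
 proof (unfold_locales)
  fix A B assume A: "A \<in> OB" and B: "B \<in> OB"
  have "bij_betw (%h. h \<circ>h e A) (?I A B) (?I A B)"
  proof (rule bij_betwI[where g = "%h. h \<circ>h inv_arrow (hor D) (e A)"])
   note i = H.isos_inv[OF e(1)[OF A]] and ea = H.isos_arrows[OF e(1)[OF A]]
   note ia = H.isos_arrows[OF i(1)]
   show "(%h. h \<circ>h e A) \<in> ?I A B \<rightarrow> ?I A B" "(%h. h \<circ>h inv_arrow (hor D) (e A)) \<in> ?I A B \<rightarrow> ?I A B"
    using H.isos_cmp e(1)[OF A] i(1) by auto
   show "h \<circ>h e A \<circ>h inv_arrow (hor D) (e A) = h" "h \<circ>h inv_arrow (hor D) (e A) \<circ>h e A = h" if "h \<in> ?I A B" for h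
    using H.isos_arrows[OF that] H.assoc_arrows[OF ia ea] H.assoc_arrows[OF ea ia] i(2,3) H.ident_right by metis+
  qed
  from bij_betw_trans[OF this bij[OF A B]]
  have "bij_betw (%h. ph (h \<circ>h e A)) (?I A B) (isos (ver D) A B)" by (simp add: o_def)
  then show "bij_betw \<psi> (?I A B) (isos (ver D) A B)"
   by (rule bij_betw_cong[THEN iffD1, rotated]) (simp add: psi)
 next
  fix A assume A: "A \<in> OB"
  show "\<psi> (idh A) = idv A"
   using psi(1)[OF H.isos_ident[OF A]] H.ident_left[OF H.isos_arrows[OF e(1)[OF A]]] e(2)[OF A] by simp
 next
  fix f A A' g B B' h k
  assume f: "f \<in> hm A A'" and g: "g \<in> hm B B'" and h: "h \<in> ?I A B" and k: "k \<in> ?I A' B'"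
  note fa = f H.isos_arrows[OF k] H.isos_arrows[OF h] g
  have A: "e A \<in> ?I A A" "e A' \<in> ?I A' A'" using e(1) iO h k by blast+
  note ea = A[THEN H.isos_arrows]
  have "k \<circ>h f = g \<circ>h h \<longleftrightarrow> k \<circ>h f \<circ>h e A = g \<circ>h h \<circ>h e A"
   using H.iso_cancel_right[OF A(1) H.cmp_arrows[OF f fa(2)] H.cmp_arrows[OF fa(3) g]] by auto
  also have "k \<circ>h f \<circ>h e A = k \<circ>h e A' \<circ>h f"
   using H.assoc_arrows[OF ea(1) f fa(2)] H.assoc_arrows[OF f ea(2) fa(2)] central[OF f] by simp
  also have "g \<circ>h h \<circ>h e A = g \<circ>h (h \<circ>h e A)"
   using H.assoc_arrows[OF ea(1) fa(3) g] by simp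
  finally show "k \<circ>h f = g \<circ>h h \<longleftrightarrow> (\<exists>s. s \<in> sq f (\<psi> h) (\<psi> k) g)"
   using a[OF f g psi(2)[OF h] psi(2)[OF k]] psi(1)[OF h] psi(1)[OF k] by simp
 next
  fix h A B k A' B' s f g t
  assume h: "h \<in> ?I A B" and k: "k \<in> ?I A' B'" and s: "s \<in> sq f (\<psi> h) (\<psi> k) g" and t: "t \<in> sq f (\<psi> h) (\<psi> k) g"
  have "f \<in> hm A A'" "g \<in> hm B B'"
   using sqD(4,5)[OF s] V.isos_arrows[OF psiI[OF h]] V.isos_arrows[OF psiI[OF k]] by (auto simp: arrows_def)
  then show "s = t"
   using a_unique[OF _ _ psi(2)[OF h] psi(2)[OF k]] s t psi(1)[OF h] psi(1)[OF k] by simp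
 next
  fix u A B u' A' B' h k
  assume u: "u \<in> vm A B" and u': "u' \<in> vm A' B'" and h: "h \<in> ?I A A'" and k: "k \<in> ?I B B'"
  have o: "A \<in> OB" "B \<in> OB" using iO h k by blast+
  note d = phiI[OF H.isos_ident[OF o(1)]] phiI[OF H.isos_ident[OF o(2)]]
  note da = d[THEN V.isos_arrows] and pa = V.isos_arrows[OF psiI[OF h]] V.isos_arrows[OF psiI[OF k]]
  \<comment> \<open>Dually, the identity square of \<open>u\<close> shows that the automorphisms
    \<open>ph (idh A)\<close> are natural for vertical morphisms; they can then be cancelled from
    the vertical clause.\<close>
  have c: "u \<circ>v ph (idh A) = ph (idh B) \<circ>v u"
   using b[OF u u H.isos_ident[OF o(1)] H.isos_ident[OF o(2)]] sq_idhs[OF u] by blast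
  have "u' \<circ>v ph h = u' \<circ>v \<psi> h \<circ>v ph (idh A)"
   using phi_psi[OF h] V.assoc_arrows[OF da(1) pa(1) u'] by simp
  moreover have "ph k \<circ>v u = \<psi> k \<circ>v u \<circ>v ph (idh A)"
   using phi_psi[OF k] V.assoc_arrows[OF u da(2) pa(2)] V.assoc_arrows[OF da(1) u pa(2)] c by simp
  ultimately have "u' \<circ>v ph h = ph k \<circ>v u \<longleftrightarrow> u' \<circ>v \<psi> h = \<psi> k \<circ>v u"
   using V.iso_cancel_right[OF d(1) V.cmp_arrows[OF pa(1) u'] V.cmp_arrows[OF u pa(2)]] by auto
  then show "u' \<circ>v \<psi> h = \<psi> k \<circ>v u \<longleftrightarrow> (\<exists>s. s \<in> sq h u u' k)"
   using b[OF u u' h k] by simp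
 next
  fix h A A' k B B' s u u' t
  assume h: "h \<in> ?I A A'" and k: "k \<in> ?I B B'" and s: "s \<in> sq h u u' k" and t: "t \<in> sq h u u' k"
  have "u \<in> vm A B" "u' \<in> vm A' B'"
   using sqD(6,7)[OF s] H.isos_arrows[OF h] H.isos_arrows[OF k] by (auto simp: arrows_def)
  then show "s = t" using b_unique[OF _ _ h k] s t by simp
 qed
 then show ?thesis by blast
qed

context shared_dblcat begin

abbreviation "hi \<equiv> isos (hor D)"
abbreviation "hinv \<equiv> inv_arrow (hor D)"

lemma hi_Ob: "h \<in> hi A B ==> A \<in> OB" "h \<in> hi A B ==> B \<in> OB"
 using H.arrows_Ob H.isos_arrows by blast+

lemma phi_iso: "h \<in> hi A B ==> ph h \<in> isos (ver D) A B"
 using bij_betwE[OF phi_bij[OF hi_Ob]] by blast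

lemma phi_arrow: "h \<in> hi A B ==> ph h \<in> vm A B"
 using phi_iso V.isos_arrows by blast

lemma phi_inj: "h \<in> hi A B ==> k \<in> hi A B ==> ph h = ph k ==> h = k"
 using bij_betw_imp_inj_on[OF phi_bij[OF hi_Ob(1,2)]] by (auto simp: inj_on_def)

lemma phi_surj:
 assumes "w \<in> isos (ver D) A B"
 obtains h where "h \<in> hi A B" "w = ph h"
proof -
 have "A \<in> OB" "B \<in> OB" using V.arrows_Ob[OF V.isos_arrows[OF assms]] same_objects by simp_all
 then show ?thesis using bij_betw_imp_surj_on[OF phi_bij] assms that by blast
qed

text \<open>The horizontal clause provides a square with top \<open>h\<close>, bottom an identity
  and vertical edges \<open>ph (q \<circ>h h)\<close> and \<open>ph q\<close>; the vertical clause
  reads off the equation from it.\<close>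

lemma phi_cmp:
 assumes h: "h \<in> hi A B" and q: "q \<in> hi B B'"
 shows "ph (q \<circ>h h) = ph q \<circ>v ph h"
proof -
 note qh = H.isos_cmp[OF h q] and i = H.isos_ident[OF hi_Ob(2)[OF q]]
 have "q \<circ>h h = idh B' \<circ>h (q \<circ>h h)" using H.ident_left[OF H.isos_arrows[OF qh]] by simp
 then have "\<exists>s. s \<in> sq h (ph (q \<circ>h h)) (ph q) (idh B')"
  using sq_hor[OF H.isos_arrows[OF h] H.isos_arrows[OF i] qh q] by simp
 then have "ph q \<circ>v ph h = ph (idh B') \<circ>v ph (q \<circ>h h)"
  using sq_ver[OF phi_arrow[OF qh] phi_arrow[OF q] h i] by simp
 then show ?thesis
  using phi_ident[OF hi_Ob(2)[OF q]] V.ident_left[OF phi_arrow[OF qh]] by simp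
qed

lemma phi_inv:
 assumes h: "h \<in> hi A B"
 shows "inverses (ver D) (ph h) (ph (hinv h))"
proof -
 note i = H.isos_inv[OF h]
 show ?thesis
  using phi_cmp[OF h i(1)] phi_cmp[OF i(1) h] phi_ident[OF hi_Ob(1)[OF h]] phi_ident[OF hi_Ob(2)[OF h]] i(2,3)
  by (intro V.inversesI[OF phi_arrow[OF h] phi_arrow[OF i(1)]]) simp_all
qed

text \<open>The vertical part of a shared isomorphism is \<open>ph h\<close> for some
  \<open>h\<close>, and its first square forces \<open>h = f\<close>. Conversely,
  \<open>sq_hor\<close> supplies all four squares.\<close>

lemma shared_iso_iff: "shared_iso D f f' \<longleftrightarrow> (\<exists>A B. f \<in> hi A B & f' = ph f)"
proof
 assume "shared_iso D f f'"
 then obtain A B g g' where A: "A \<in> OB" "B \<in> OB" and f: "f \<in> hm A B" and f': "f' \<in> vm A B"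
  and i: "inverses (hor D) f g" "inverses (ver D) f' g'" and s: "sq f f' (idv B) (idh B) \<noteq> {}"
  unfolding shared_iso_def by blast
 have fi: "f \<in> hi A B" by (rule H.isosI[OF f i(1)])
 obtain h where h: "h \<in> hi A B" "f' = ph h" by (rule phi_surj[OF V.isosI[OF f' i(2)]])
 note iB = H.isos_ident[OF A(2)]
 have "\<exists>s. s \<in> sq f (ph h) (ph (idh B)) (idh B)"
  using s phi_ident[OF A(2)] h(2) by auto
 then have "idh B \<circ>h f = idh B \<circ>h h"
  using sq_hor[OF f H.isos_arrows[OF iB] h(1) iB] by blast
 then have "f = h" using H.ident_left[OF f] H.ident_left[OF H.isos_arrows[OF h(1)]] by simp
 then show "\<exists>A B. f \<in> hi A B & f' = ph f" using fi h by blast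
next
 assume "\<exists>A B. f \<in> hi A B & f' = ph f"
 then obtain A B where f: "f \<in> hi A B" and f': "f' = ph f" by blast
 note fa = H.isos_arrows[OF f] and i = H.isos_inv[OF f] and o = hi_Ob[OF f]
 note ia = H.isos_ident[OF o(1)] H.isos_ident[OF o(2)] and inv = H.isos_arrows[OF i(1)]
 note iaa = ia[THEN H.isos_arrows] and p = phi_ident[OF o(1)] phi_ident[OF o(2)]
 have "f' \<in> vm A B" "inverses (hor D) f (hinv f)" "inverses (ver D) f' (ph (hinv f))"
  using phi_arrow[OF f] H.isos_inverses[OF f] phi_inv[OF f] by (simp_all add: f')
 moreover have "sq f f' (idv B) (idh B) \<noteq> {}"
  using sq_hor[OF fa iaa(2) f ia(2)] by (auto simp: p f')
 moreover have "sq (idh A) (idv A) f' f \<noteq> {}"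
  using sq_hor[OF iaa(1) fa ia(1) f] by (auto simp: p f')
 moreover have "sq f (idv A) (ph (hinv f)) (idh A) \<noteq> {}"
  using sq_hor[OF fa iaa(1) ia(1) i(1)] i(2) H.ident_left[OF iaa(1)] by (auto simp: p)
 moreover have "sq (idh A) f' (idv A) (hinv f) \<noteq> {}"
  using sq_hor[OF iaa(1) inv f ia(1)] i(2) H.ident_left[OF iaa(1)] by (auto simp: p f')
 ultimately show "shared_iso D f f'"
  unfolding shared_iso_def using o fa by blast
qed

text \<open>Pasting the companion squares of the isomorphisms \<open>bt\<close> and \<open>gm\<close> above and below turns the two
 sides of the horizontal naturality condition into those of the vertical one.\<close>

lemma natural_square_transpose:
 assumes si: "si \<in> sq f u w g" and tu: "tu \<in> sq f1 u1 w1 g1"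
  and al: "al \<in> hi A A1" and bt: "bt \<in> hi B B1" and gm: "gm \<in> hi C C1" and de: "de \<in> hi E E1"
  and etu: "etu \<in> sq al u u1 gm" and etw: "etw \<in> sq bt w w1 de"
  and etf: "etf \<in> sq f (ph al) (ph bt) f1" and etg: "etg \<in> sq g (ph gm) (ph de) g1"
  and h: "etw \<bullet>h si = tu \<bullet>h etu"
 shows "etg \<bullet>v si = tu \<bullet>v etf"
proof -
 note ar = al[THEN H.isos_arrows] bt[THEN H.isos_arrows] gm[THEN H.isos_arrows] de[THEN H.isos_arrows]
 note arD = ar[THEN arrowsD(2)] ar[THEN arrowsD(3)]
 note pv = arrowsD[OF phi_arrow[OF al]] arrowsD[OF phi_arrow[OF bt]] arrowsD[OF phi_arrow[OF gm]] arrowsD[OF phi_arrow[OF de]]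
 have u: "u \<in> vm A C" "u1 \<in> vm A1 C1" "w \<in> vm B E" "w1 \<in> vm B1 E1"
  using sqD(6,7)[OF etu] sqD(6,7)[OF etw] arD by simp_all
 have f: "f \<in> hm A B" "f1 \<in> hm A1 B1" "g \<in> hm C E" "g1 \<in> hm C1 E1"
  using sqD(4,5)[OF etf] sqD(4,5)[OF etg] pv by simp_all
 note o = hi_Ob[OF al] hi_Ob[OF bt] hi_Ob[OF gm] hi_Ob[OF de]
 have comp_top: "\<exists>s. s \<in> sq (idh X) (idv X) (ph x) x" and comp_bot: "\<exists>s. s \<in> sq x (ph x) (idv Y) (idh Y)"
  if x: "x \<in> hi X Y" for x X Y
  using sq_hor[OF H.ident_closed H.isos_arrows[OF x] H.isos_ident x] phi_ident
   sq_hor[OF H.isos_arrows[OF x] H.ident_closed x H.isos_ident] hi_Ob[OF x] by auto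
 obtain \<iota>al where \<iota>al: "\<iota>al \<in> sq (idh A) (idv A) (ph al) al" using comp_top[OF al] by blast
 obtain \<iota>bt where \<iota>bt: "\<iota>bt \<in> sq (idh B) (idv B) (ph bt) bt" using comp_top[OF bt] by blast
 obtain esgm where esgm: "esgm \<in> sq gm (ph gm) (idv C1) (idh C1)" using comp_bot[OF gm] by blast
 obtain esde where esde: "esde \<in> sq de (ph de) (idv E1) (idh E1)" using comp_bot[OF de] by blast
 note iu = V.ident_left V.ident_right H.ident_left H.ident_right
 have nf: "bt \<circ>h f = f1 \<circ>h al" using sq_hor[OF f(1,2) al bt] etf by blast
 have ng: "de \<circ>h g = g1 \<circ>h gm" using sq_hor[OF f(3,4) gm de] etg by blast
 have nu: "u1 \<circ>v ph al = ph gm \<circ>v u" using sq_ver[OF u(1,2) al gm] etu by blast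
 have nw: "w1 \<circ>v ph bt = ph de \<circ>v w" using sq_ver[OF u(3,4) bt de] etw by blast
 have T: "\<iota>bt \<bullet>h idvs f = etf \<bullet>h \<iota>al"
  using sq_hcmp[OF sq_idvs[OF f(1)] \<iota>bt] sq_hcmp[OF \<iota>al etf] nf iu(3)[OF f(1)] iu(4)[OF f(1)] phi_ident[OF o(1)]
  by (intro sq_hor_unique[OF H.isos_ident[OF o(1)] bt, of _ f "bt \<circ>h f"]) simp_all
 have Bt: "idvs g1 \<bullet>h esgm = esde \<bullet>h etg"
  using sq_hcmp[OF esgm sq_idvs[OF f(4)]] sq_hcmp[OF etg esde] ng iu(3)[OF f(4)] iu(4)[OF f(4)] phi_ident[OF o(8)]
  by (intro sq_hor_unique[OF gm H.isos_ident[OF o(8)], of _ "de \<circ>h g" g1]) simp_all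
 note va = phi_arrow[OF al] phi_arrow[OF bt] phi_arrow[OF gm] phi_arrow[OF de]
 have wt: "etw \<bullet>v \<iota>bt \<in> sq (idh B) w (w1 \<circ>v ph bt) de" using sq_vcmp[OF \<iota>bt etw] iu(2)[OF u(3)] by simp
 have ut: "etu \<bullet>v \<iota>al \<in> sq (idh A) u (u1 \<circ>v ph al) gm" using sq_vcmp[OF \<iota>al etu] iu(2)[OF u(1)] by simp
 \<comment> \<open>The column of the companion of \<open>bt\<close>, \<open>etw\<close> and the
   companion of \<open>de\<close> has identities at top and bottom, so uniqueness makes it an
   identity square; likewise on the other side.\<close>
 have wc: "esde \<bullet>v (etw \<bullet>v \<iota>bt) = idhs (ph de \<circ>v w)"
  using sq_vcmp[OF wt esde] sq_idhs[OF V.cmp_arrows[OF u(3) va(4)]] nw iu(1)[OF V.cmp_arrows[OF u(3) va(4)]]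
  by (intro sq_ver_unique[OF H.isos_ident[OF o(3)] H.isos_ident[OF o(8)]]) simp_all
 have uc: "esgm \<bullet>v (etu \<bullet>v \<iota>al) = idhs (ph gm \<circ>v u)"
  using sq_vcmp[OF ut esgm] sq_idhs[OF V.cmp_arrows[OF u(1) va(3)]] nu iu(1)[OF V.cmp_arrows[OF u(1) va(3)]]
  by (intro sq_ver_unique[OF H.isos_ident[OF o(1)] H.isos_ident[OF o(6)]]) simp_all
 have gs: "etg \<bullet>v si \<in> sq f (ph gm \<circ>v u) (ph de \<circ>v w) g1" by (rule sq_vcmp[OF si etg])
 have tf: "tu \<bullet>v etf \<in> sq f (ph gm \<circ>v u) (w1 \<circ>v ph bt) g1" using sq_vcmp[OF etf tu] nu by simp
 \<comment> \<open>Insert the identity column at the right, interchange, apply the horizontal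
   condition in the middle, interchange back, and remove the identity column at the left.\<close>
 have "etg \<bullet>v si = (esde \<bullet>v (etw \<bullet>v \<iota>bt)) \<bullet>h (etg \<bullet>v si)"
  by (simp add: wc hsq_unit(2)[OF gs])
 also have "\<dots> = (esde \<bullet>h etg) \<bullet>v ((etw \<bullet>v \<iota>bt) \<bullet>h si)"
  by (rule exchange[OF si wt etg esde, symmetric])
 also have "(etw \<bullet>v \<iota>bt) \<bullet>h si = (etw \<bullet>v \<iota>bt) \<bullet>h (si \<bullet>v idvs f)" by (simp add: vsq_unit(1)[OF si])
 also have "\<dots> = (etw \<bullet>h si) \<bullet>v (\<iota>bt \<bullet>h idvs f)"
  by (rule exchange[OF sq_idvs[OF f(1)] \<iota>bt si etw, symmetric])
 also have "\<dots> = (tu \<bullet>h etu) \<bullet>v (etf \<bullet>h \<iota>al)" by (simp add: h T)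
 also have "\<dots> = (tu \<bullet>v etf) \<bullet>h (etu \<bullet>v \<iota>al)"
  by (rule exchange[OF \<iota>al etf etu tu])
 also have "esde \<bullet>h etg = idvs g1 \<bullet>h esgm" by (simp add: Bt)
 also have "(idvs g1 \<bullet>h esgm) \<bullet>v ((tu \<bullet>v etf) \<bullet>h (etu \<bullet>v \<iota>al)) = (idvs g1 \<bullet>v (tu \<bullet>v etf)) \<bullet>h (esgm \<bullet>v (etu \<bullet>v \<iota>al))"
  using exchange[OF ut sq_vcmp[OF etf tu] esgm sq_idvs[OF f(4)]] by simp
 also have "\<dots> = tu \<bullet>v etf"
  by (simp add: uc vsq_unit(2)[OF tf] hsq_unit(1)[OF tf])
 finally show ?thesis .
qed

end

section \<open>Natural isomorphisms of double functors\<close>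

lemma double_functorsD:
 assumes F: "F \<in> double_functors C D"
 shows "(on_ob F, on_hor F) \<in> functors (hor C) (hor D)" "(on_ob F, on_ver F) \<in> functors (ver C) (ver D)"
  "(on_ver F, on_sq F) \<in> functors (hsq C) (hsq D)" "(on_hor F, on_sq F) \<in> functors (vsq C) (vsq D)"
 using F by (auto simp: double_functors_def)

lemma double_functors_sq:
 assumes C: "double_category C" and D: "double_category D" and F: "F \<in> double_functors C D" and s: "s \<in> squares C f u v g"
 shows "on_sq F s \<in> squares D (on_hor F f) (on_ver F u) (on_ver F v) (on_hor F g)"
 using functors_arrows[OF double_functorsD(3)[OF F] double_category.sqD(2)[OF C s]]
  functors_arrows[OF double_functorsD(4)[OF F] double_category.sqD(3)[OF C s]]
 by (rule double_category.sqI[OF D])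

lemma double_functors_compose:
 assumes B: "double_category B" and C: "double_category C" and K: "K \<in> double_functors B C" and F: "F \<in> double_functors C D"
 shows "dfun_compose B F K \<in> double_functors B D"
proof -
 interpret B: double_category B by (rule B)
 interpret C: double_category C by (rule C)
 note c = functors_comp[OF B.category_hor double_functorsD(1)[OF K] double_functorsD(1)[OF F]]
  functors_comp[OF B.category_ver double_functorsD(2)[OF K] double_functorsD(2)[OF F]]
  functors_comp[OF B.category_hsq double_functorsD(3)[OF K] double_functorsD(3)[OF F]]
  functors_comp[OF B.category_vsq double_functorsD(4)[OF K] double_functorsD(4)[OF F]]
 show ?thesis
  using c by (simp add: double_functors_def dfun_compose_def B.same_objects B.hsq_objects B.vsq_objects B.same_squares)
qed

text \<open>Squares between isomorphisms are determined by their boundaries, so the condition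
  quantifies over all squares with the right boundary instead of carrying a family of component
  squares.\<close>

definition (in shared_dblcat) hcond where
 "hcond C F G te si \<longleftrightarrow>
  (\<forall>s\<in>sq (te (src (ver C) (left_edge C si))) (on_ver F (left_edge C si)) (on_ver G (left_edge C si)) (te (trg (ver C) (left_edge C si))).
   \<forall>t\<in>sq (te (src (ver C) (right_edge C si))) (on_ver F (right_edge C si)) (on_ver G (right_edge C si)) (te (trg (ver C) (right_edge C si))).
    t \<bullet>h on_sq F si = on_sq G si \<bullet>h s)"

text \<open>A natural shared isomorphism reduced to its horizontal components; the vertical
  components are their images under \<open>ph\<close>.\<close>

definition (in shared_dblcat) hnatural where
 "hnatural C F G te \<longleftrightarrow>
   (\<forall>A\<in>Ob (hor C). te A \<in> hi (on_ob F A) (on_ob G A)) &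
   (\<forall>f\<in>Ar (hor C). te (trg (hor C) f) \<circ>h on_hor F f = on_hor G f \<circ>h te (src (hor C) f)) &
   (\<forall>u\<in>Ar (ver C). ph (te (trg (ver C) u)) \<circ>v on_ver F u = on_ver G u \<circ>v ph (te (src (ver C) u))) &
   (\<forall>si\<in>Sq C. hcond C F G te si)"

locale dfun_target = shared_dblcat D ph + C: double_category C
 for D :: "('o, 'h, 'v, 's) dblcat" and ph and C :: "('p, 'k, 'w, 't) dblcat"
begin

abbreviation "DF \<equiv> double_functors C D"
abbreviation "COb \<equiv> Ob (hor C)"

lemma C_sq: "si \<in> Sq C ==> si \<in> squares C (top_edge C si) (left_edge C si) (right_edge C si) (bottom_edge C si)"
 by (simp add: squares_def)

lemma C_ver: "u \<in> Ar (ver C) ==> u \<in> arrows (ver C) (src (ver C) u) (trg (ver C) u)"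
 and C_hor: "f \<in> Ar (hor C) ==> f \<in> arrows (hor C) (src (hor C) f) (trg (hor C) f)"
 by (simp_all add: arrows_def)

lemma hnaturalD:
 assumes n: "hnatural C F G te"
 shows "A \<in> COb ==> te A \<in> hi (on_ob F A) (on_ob G A)"
  "f \<in> arrows (hor C) A B ==> te B \<circ>h on_hor F f = on_hor G f \<circ>h te A"
  "u \<in> arrows (ver C) A B ==> ph (te B) \<circ>v on_ver F u = on_ver G u \<circ>v ph (te A)"
  "si \<in> squares C f u v g ==> u \<in> arrows (ver C) A A' ==> v \<in> arrows (ver C) B B' ==>
    s \<in> sq (te A) (on_ver F u) (on_ver G u) (te A') ==> t \<in> sq (te B) (on_ver F v) (on_ver G v) (te B') ==>
    t \<bullet>h on_sq F si = on_sq G si \<bullet>h s"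
proof -
 note n' = n[unfolded hnatural_def]
 show "A \<in> COb ==> te A \<in> hi (on_ob F A) (on_ob G A)" using n' by blast
 show "f \<in> arrows (hor C) A B ==> te B \<circ>h on_hor F f = on_hor G f \<circ>h te A"
  using n' by (auto simp: arrows_def)
 show "u \<in> arrows (ver C) A B ==> ph (te B) \<circ>v on_ver F u = on_ver G u \<circ>v ph (te A)"
  using n' by (auto simp: arrows_def)
 assume si: "si \<in> squares C f u v g" and "u \<in> arrows (ver C) A A'" "v \<in> arrows (ver C) B B'"
  and "s \<in> sq (te A) (on_ver F u) (on_ver G u) (te A')" "t \<in> sq (te B) (on_ver F v) (on_ver G v) (te B')"
 moreover have "hcond C F G te si" using n' si by (auto simp: squares_def)
 ultimately show "t \<bullet>h on_sq F si = on_sq G si \<bullet>h s"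
  unfolding hcond_def by (simp add: squares_def arrows_def)
qed

lemma hnaturalI:
 assumes "!!A. A \<in> COb ==> te A \<in> hi (on_ob F A) (on_ob G A)"
  and "!!f. f \<in> Ar (hor C) ==> te (trg (hor C) f) \<circ>h on_hor F f = on_hor G f \<circ>h te (src (hor C) f)"
  and "!!u. u \<in> Ar (ver C) ==> ph (te (trg (ver C) u)) \<circ>v on_ver F u = on_ver G u \<circ>v ph (te (src (ver C) u))"
  and "!!si u v A A' B B' s t. si \<in> squares C (top_edge C si) u v (bottom_edge C si) ==> u \<in> arrows (ver C) A A' ==>
    v \<in> arrows (ver C) B B' ==>
    s \<in> sq (te A) (on_ver F u) (on_ver G u) (te A') ==> t \<in> sq (te B) (on_ver F v) (on_ver G v) (te B') ==>
    t \<bullet>h on_sq F si = on_sq G si \<bullet>h s"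
 shows "hnatural C F G te"
proof -
 have "hcond C F G te si" if "si \<in> Sq C" for si
  unfolding hcond_def
 proof (intro ballI)
  note l = C.sqD(6,7)[OF C_sq[OF that]]
  fix s t
  assume "s \<in> sq (te (src (ver C) (left_edge C si))) (on_ver F (left_edge C si)) (on_ver G (left_edge C si)) (te (trg (ver C) (left_edge C si)))"
   "t \<in> sq (te (src (ver C) (right_edge C si))) (on_ver F (right_edge C si)) (on_ver G (right_edge C si)) (te (trg (ver C) (right_edge C si)))"
  then show "t \<bullet>h on_sq F si = on_sq G si \<bullet>h s"
   by (rule assms(4)[OF C_sq[OF that] C_ver[OF arrowsD(1)[OF l(1)]] C_ver[OF arrowsD(1)[OF l(2)]]])
 qed
 then show ?thesis using assms(1-3) by (simp add: hnatural_def)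
qed

lemma hnatural_restrict: "hnatural C F G (restrict te COb) \<longleftrightarrow> hnatural C F G te"
 using C.H.src_closed C.H.trg_closed C.V.src_closed C.V.trg_closed C.same_objects C.HS.src_closed C.HS.trg_closed C.hsq_objects
 by (simp add: hnatural_def hcond_def)

lemma ver_Ob:
 assumes "u \<in> arrows (ver C) A B"
 shows "A \<in> COb" "B \<in> COb"
 using C.V.arrows_Ob[OF assms] C.same_objects by simp_all

lemma hnatural_square:
 assumes F: "F \<in> DF" and G: "G \<in> DF" and n: "hnatural C F G te" and u: "u \<in> arrows (ver C) A B"
 obtains s where "s \<in> sq (te A) (on_ver F u) (on_ver G u) (te B)"
proof -
 have A: "A \<in> COb" "B \<in> COb" using C.V.arrows_Ob[OF u] C.same_objects by simp_all
 show ?thesis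
  using sq_ver[OF functors_arrows[OF double_functorsD(2)[OF F] u] functors_arrows[OF double_functorsD(2)[OF G] u]
    hnaturalD(1)[OF n A(1)] hnaturalD(1)[OF n A(2)]] hnaturalD(3)[OF n u] that by auto
qed

text \<open>Given component squares are the only ones with their boundaries, which yields
  \<open>hcond\<close>. Conversely, chosen squares are compatible with identities and composition by
  uniqueness, and \<open>natural_square_transpose\<close> derives the vertical compatibility from
  the horizontal one.\<close>

lemma natural_shared_isos_iff:
 assumes F: "F \<in> DF" and G: "G \<in> DF"
 shows "(te, te') \<in> natural_shared_isos C D F G \<longleftrightarrow>
  te \<in> extensional COb & te' = (\<lambda>A\<in>COb. ph (te A)) & hnatural C F G te"
proof
 assume l: "(te, te') \<in> natural_shared_isos C D F G"
 then have ext: "te \<in> extensional COb" "te' \<in> extensional COb" and sh: "!!A. A \<in> COb ==> shared_iso D (te A) (te' A)"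
  and nh: "natural_horizontal C D F G te" and nv: "natural_vertical C D F G te'"
  by (auto simp: natural_shared_isos_def)
 have hi: "te A \<in> hi (on_ob F A) (on_ob G A)" and p: "te' A = ph (te A)" if A: "A \<in> COb" for A
 proof -
  obtain X Y where XY: "te A \<in> hi X Y" and p: "te' A = ph (te A)" using sh[OF A] shared_iso_iff by blast
  have "te A \<in> hm (on_ob F A) (on_ob G A)" using nh A by (auto simp: natural_horizontal_def)
  then show "te A \<in> hi (on_ob F A) (on_ob G A)"
   using XY H.isos_arrows[OF XY] by (auto simp: arrows_def)
  show "te' A = ph (te A)" by (rule p)
 qed
 obtain et where et: "\<forall>u\<in>Ar (ver C). et u \<in> sq (te (src (ver C) u)) (on_ver F u) (on_ver G u) (te (trg (ver C) u))"
  and etsi: "\<forall>si\<in>Sq C. et (right_edge C si) \<bullet>h on_sq F si = on_sq G si \<bullet>h et (left_edge C si)"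
  using nh unfolding natural_horizontal_def by blast
 have "hnatural C F G te"
 proof (rule hnaturalI)
  show "te (trg (hor C) f) \<circ>h on_hor F f = on_hor G f \<circ>h te (src (hor C) f)" if "f \<in> Ar (hor C)" for f
   using nh that unfolding natural_horizontal_def by blast
  show "ph (te (trg (ver C) u)) \<circ>v on_ver F u = on_ver G u \<circ>v ph (te (src (ver C) u))" if "u \<in> Ar (ver C)" for u
  proof -
   have "te' (trg (ver C) u) \<circ>v on_ver F u = on_ver G u \<circ>v te' (src (ver C) u)"
    using nv that unfolding natural_vertical_def by blast
   then show ?thesis
    using p C.V.src_closed[OF that] C.V.trg_closed[OF that] C.same_objects by simp
  qed
  fix si u v A A' B B' s t
  assume si: "si \<in> squares C (top_edge C si) u v (bottom_edge C si)" and u: "u \<in> arrows (ver C) A A'" and v: "v \<in> arrows (ver C) B B'"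
   and s: "s \<in> sq (te A) (on_ver F u) (on_ver G u) (te A')" and t: "t \<in> sq (te B) (on_ver F v) (on_ver G v) (te B')"
  note o = ver_Ob[OF u] ver_Ob[OF v]
  have "s = et u" by (rule sq_ver_unique[OF hi[OF o(1)] hi[OF o(2)] s]) (use et arrowsD[OF u] in auto)
  moreover have "t = et v" by (rule sq_ver_unique[OF hi[OF o(3)] hi[OF o(4)] t]) (use et arrowsD[OF v] in auto)
  ultimately show "t \<bullet>h on_sq F si = on_sq G si \<bullet>h s" using etsi si by (auto simp: squares_def)
 qed (rule hi)
 moreover have "te' = (\<lambda>A\<in>COb. ph (te A))"
  by (rule extensionalityI[OF ext(2)]) (auto simp: p)
 ultimately show "te \<in> extensional COb & te' = (\<lambda>A\<in>COb. ph (te A)) & hnatural C F G te" using ext by blast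
next
 assume r: "te \<in> extensional COb & te' = (\<lambda>A\<in>COb. ph (te A)) & hnatural C F G te"
 then have n: "hnatural C F G te" by simp
 note hi = hnaturalD(1)[OF n] and F' = double_functorsD[OF F] and G' = double_functorsD[OF G]
 have p: "te' A = ph (te A)" if "A \<in> COb" for A using r that by simp
 define et where "et u = (SOME s. s \<in> sq (te (src (ver C) u)) (on_ver F u) (on_ver G u) (te (trg (ver C) u)))" for u
 have et: "et u \<in> sq (te A) (on_ver F u) (on_ver G u) (te B)" if u: "u \<in> arrows (ver C) A B" for u A B
  unfolding et_def arrowsD(2,3)[OF u] by (rule hnatural_square[OF F G n u]) (rule someI)
 define et' where "et' f = (SOME s. s \<in> sq (on_hor F f) (ph (te (src (hor C) f))) (ph (te (trg (hor C) f))) (on_hor G f))" for f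
 have et': "et' f \<in> sq (on_hor F f) (ph (te A)) (ph (te B)) (on_hor G f)" if f: "f \<in> arrows (hor C) A B" for f A B
 proof -
  note o = C.H.arrows_Ob[OF f]
  have "\<exists>s. s \<in> sq (on_hor F f) (ph (te A)) (ph (te B)) (on_hor G f)"
   using sq_hor[OF functors_arrows[OF F'(1) f] functors_arrows[OF G'(1) f] hi[OF o(1)] hi[OF o(2)]] hnaturalD(2)[OF n f] by blast
  then show ?thesis unfolding et'_def arrowsD(2,3)[OF f] by (rule someI_ex)
 qed
 have "natural_horizontal C D F G te"
  unfolding natural_horizontal_def
 proof (intro conjI ballI impI exI[of _ et])
  show "te A \<in> hm (on_ob F A) (on_ob G A)" if "A \<in> COb" for A by (rule H.isos_arrows[OF hi[OF that]])
  show "te (trg (hor C) f) \<circ>h on_hor F f = on_hor G f \<circ>h te (src (hor C) f)" if "f \<in> Ar (hor C)" for f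
   by (rule hnaturalD(2)[OF n C_hor[OF that]])
  show "et u \<in> sq (te (src (ver C) u)) (on_ver F u) (on_ver G u) (te (trg (ver C) u))" if "u \<in> Ar (ver C)" for u
   by (rule et[OF C_ver[OF that]])
  show "et (ident (ver C) A) = idvs (te A)" if A: "A \<in> Ob (ver C)" for A
  proof -
   have A': "A \<in> COb" using A C.same_objects by simp
   show ?thesis
    using et[OF C.V.ident_closed[OF A]] sq_idvs[OF H.isos_arrows[OF hi[OF A']]] functors_ident[OF F'(2) A] functors_ident[OF G'(2) A]
    by (intro sq_ver_unique[OF hi[OF A'] hi[OF A']]) simp_all
  qed
  show "et (cmp (ver C) w u) = et w \<bullet>v et u"
   if "u \<in> Ar (ver C)" "w \<in> Ar (ver C)" "src (ver C) w = trg (ver C) u" for u w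
  proof -
   have u: "u \<in> arrows (ver C) (src (ver C) u) (trg (ver C) u)" and w: "w \<in> arrows (ver C) (trg (ver C) u) (trg (ver C) w)"
    using that by (simp_all add: arrows_def)
   show ?thesis
    using et[OF C.V.cmp_arrows[OF u w]] sq_vcmp[OF et[OF u] et[OF w]] functors_cmp[OF F'(2) u w] functors_cmp[OF G'(2) u w]
    by (intro sq_ver_unique[OF hi[OF ver_Ob(1)[OF u]] hi[OF ver_Ob(2)[OF w]]]) simp_all
  qed
  show "et (right_edge C si) \<bullet>h on_sq F si = on_sq G si \<bullet>h et (left_edge C si)" if si: "si \<in> Sq C" for si
   using hnaturalD(4)[OF n C_sq[OF si] _ _ et et] C.sqD(6,7)[OF C_sq[OF si]] by blast
 qed
 moreover have "natural_vertical C D F G te'"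
  unfolding natural_vertical_def
 proof (intro conjI ballI impI exI[of _ et'])
  show "te' A \<in> vm (on_ob F A) (on_ob G A)" if "A \<in> Ob (ver C)" for A
   using phi_arrow[OF hi] p that C.same_objects by simp
  show "te' (trg (ver C) u) \<circ>v on_ver F u = on_ver G u \<circ>v te' (src (ver C) u)" if u: "u \<in> Ar (ver C)" for u
   using hnaturalD(3)[OF n C_ver[OF u]] p ver_Ob[OF C_ver[OF u]] by simp
  show "et' f \<in> sq (on_hor F f) (te' (src (hor C) f)) (te' (trg (hor C) f)) (on_hor G f)" if f: "f \<in> Ar (hor C)" for f
   using et'[OF C_hor[OF f]] p C.H.src_closed[OF f] C.H.trg_closed[OF f] by simp
  show "et' (ident (hor C) A) = idhs (te' A)" if A: "A \<in> COb" for A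
   using et'[OF C.H.ident_closed[OF A]] sq_idhs[OF phi_arrow[OF hi[OF A]]] functors_ident[OF F'(1) A] functors_ident[OF G'(1) A] p[OF A]
   by (intro sq_hor_unique[OF hi[OF A] hi[OF A]]) simp_all
  show "et' (cmp (hor C) g f) = et' g \<bullet>h et' f"
   if "f \<in> Ar (hor C)" "g \<in> Ar (hor C)" "src (hor C) g = trg (hor C) f" for f g
  proof -
   have f: "f \<in> arrows (hor C) (src (hor C) f) (trg (hor C) f)" and g: "g \<in> arrows (hor C) (trg (hor C) f) (trg (hor C) g)"
    using that by (simp_all add: arrows_def)
   show ?thesis
    using et'[OF C.H.cmp_arrows[OF f g]] sq_hcmp[OF et'[OF f] et'[OF g]] functors_cmp[OF F'(1) f g] functors_cmp[OF G'(1) f g]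
    by (intro sq_hor_unique[OF hi[OF C.H.arrows_Ob(1)[OF f]] hi[OF C.H.arrows_Ob(2)[OF g]]]) simp_all
  qed
  show "et' (bottom_edge C si) \<bullet>v on_sq F si = on_sq G si \<bullet>v et' (top_edge C si)" if si: "si \<in> Sq C" for si
  proof -
   note s = C_sq[OF si] and C' = C.double_category_axioms and D' = double_category_axioms
   have t: "top_edge C si \<in> arrows (hor C) (src (ver C) (left_edge C si)) (src (ver C) (right_edge C si))"
    and b: "bottom_edge C si \<in> arrows (hor C) (trg (ver C) (left_edge C si)) (trg (ver C) (right_edge C si))"
    by (rule C.sqD(4)[OF s], rule C.sqD(5)[OF s])
   have l: "left_edge C si \<in> arrows (ver C) (src (ver C) (left_edge C si)) (trg (ver C) (left_edge C si))"
    and r: "right_edge C si \<in> arrows (ver C) (src (ver C) (right_edge C si)) (trg (ver C) (right_edge C si))"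
    using C_ver[OF arrowsD(1)[OF C.sqD(6)[OF s]]] C_ver[OF arrowsD(1)[OF C.sqD(7)[OF s]]] by simp_all
   show ?thesis
    by (rule natural_square_transpose[OF double_functors_sq[OF C' D' F s] double_functors_sq[OF C' D' G s]
      hi[OF ver_Ob(1)[OF l]] hi[OF ver_Ob(1)[OF r]] hi[OF ver_Ob(2)[OF l]] hi[OF ver_Ob(2)[OF r]] et[OF l] et[OF r] et'[OF t] et'[OF b]
      hnaturalD(4)[OF n s l r et[OF l] et[OF r]]])
  qed
 qed
 moreover have "shared_iso D (te A) (te' A)" if "A \<in> COb" for A
  using hi[OF that] p[OF that] shared_iso_iff by blast
 ultimately show "(te, te') \<in> natural_shared_isos C D F G"
  using r by (simp add: natural_shared_isos_def)
qed

lemma hnatural_ident: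
 assumes F: "F \<in> DF"
 shows "hnatural C F F (\<lambda>A\<in>COb. idh (on_ob F A))"
 unfolding hnatural_restrict
proof (rule hnaturalI)
 note F' = double_functorsD[OF F]
 note i = functors_Ob[OF F'(1), THEN H.isos_ident]
 show "idh (on_ob F A) \<in> hi (on_ob F A) (on_ob F A)" if "A \<in> COb" for A by (rule i[OF that])
 show "idh (on_ob F (trg (hor C) f)) \<circ>h on_hor F f = on_hor F f \<circ>h idh (on_ob F (src (hor C) f))" if f: "f \<in> Ar (hor C)" for f
  using functors_arrows[OF F'(1) C_hor[OF f]] H.ident_left H.ident_right by simp
 show "ph (idh (on_ob F (trg (ver C) u))) \<circ>v on_ver F u = on_ver F u \<circ>v ph (idh (on_ob F (src (ver C) u)))" if u: "u \<in> Ar (ver C)" for u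
  using functors_arrows[OF F'(2) C_ver[OF u]] V.ident_left V.ident_right ver_Ob[OF C_ver[OF u]] phi_ident functors_Ob[OF F'(1)] by simp
 fix si u v A A' B B' s t
 assume si: "si \<in> squares C (top_edge C si) u v (bottom_edge C si)" and u: "u \<in> arrows (ver C) A A'" and v: "v \<in> arrows (ver C) B B'"
  and s: "s \<in> sq (idh (on_ob F A)) (on_ver F u) (on_ver F u) (idh (on_ob F A'))"
  and t: "t \<in> sq (idh (on_ob F B)) (on_ver F v) (on_ver F v) (idh (on_ob F B'))"
 have "s = idhs (on_ver F u)" "t = idhs (on_ver F v)"
  by (rule sq_ver_unique[OF i[OF ver_Ob(1)[OF u]] i[OF ver_Ob(2)[OF u]] s sq_idhs[OF functors_arrows[OF F'(2) u]]])
   (rule sq_ver_unique[OF i[OF ver_Ob(1)[OF v]] i[OF ver_Ob(2)[OF v]] t sq_idhs[OF functors_arrows[OF F'(2) v]]])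
 then show "t \<bullet>h on_sq F si = on_sq F si \<bullet>h s"
  using hsq_unit[OF double_functors_sq[OF C.double_category_axioms double_category_axioms F si]] by simp
qed

text \<open>By uniqueness, component squares of the composite are horizontal composites of component
  squares; the rest is pasting in \<open>hor D\<close>, \<open>ver D\<close> and
  \<open>hsq D\<close>.\<close>

lemma hnatural_comp:
 assumes F: "F \<in> DF" and G: "G \<in> DF" and K: "K \<in> DF" and n: "hnatural C F G te" and n': "hnatural C G K ka"
 shows "hnatural C F K (\<lambda>A\<in>COb. ka A \<circ>h te A)"
 unfolding hnatural_restrict
proof (rule hnaturalI)
 note F' = double_functorsD[OF F] and G' = double_functorsD[OF G] and K' = double_functorsD[OF K]
 note hi = hnaturalD(1)[OF n] hnaturalD(1)[OF n']
 note ha = hi[THEN H.isos_arrows] and pa = hi[THEN phi_arrow]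
 have c: "ka A \<circ>h te A \<in> hi (on_ob F A) (on_ob K A)" if "A \<in> COb" for A by (rule H.isos_cmp[OF hi(1)[OF that] hi(2)[OF that]])
 then show "ka A \<circ>h te A \<in> hi (on_ob F A) (on_ob K A)" if "A \<in> COb" for A using that .
 show "(ka (trg (hor C) f) \<circ>h te (trg (hor C) f)) \<circ>h on_hor F f = on_hor K f \<circ>h (ka (src (hor C) f) \<circ>h te (src (hor C) f))"
  if "f \<in> Ar (hor C)" for f
 proof -
  note f = C_hor[OF that] and o = C.H.arrows_Ob[OF C_hor[OF that]]
  show ?thesis
   using H.natural_cmp[OF ha(1)[OF o(1)] ha(2)[OF o(1)] ha(1)[OF o(2)] ha(2)[OF o(2)] functors_arrows[OF F'(1) f] functors_arrows[OF G'(1) f]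
     functors_arrows[OF K'(1) f] hnaturalD(2)[OF n f, symmetric] hnaturalD(2)[OF n' f, symmetric]] by simp
 qed
 show "ph (ka (trg (ver C) u) \<circ>h te (trg (ver C) u)) \<circ>v on_ver F u = on_ver K u \<circ>v ph (ka (src (ver C) u) \<circ>h te (src (ver C) u))"
  if "u \<in> Ar (ver C)" for u
 proof -
  note u = C_ver[OF that] and o = ver_Ob[OF C_ver[OF that]]
  show ?thesis
   using V.natural_cmp[OF pa(1)[OF o(1)] pa(2)[OF o(1)] pa(1)[OF o(2)] pa(2)[OF o(2)] functors_arrows[OF F'(2) u] functors_arrows[OF G'(2) u]
     functors_arrows[OF K'(2) u] hnaturalD(3)[OF n u, symmetric] hnaturalD(3)[OF n' u, symmetric]]
    phi_cmp[OF hi(1)[OF o(1)] hi(2)[OF o(1)]] phi_cmp[OF hi(1)[OF o(2)] hi(2)[OF o(2)]] by simp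
 qed
 fix si u v A A' B B' s t
 assume si: "si \<in> squares C (top_edge C si) u v (bottom_edge C si)" and u: "u \<in> arrows (ver C) A A'" and v: "v \<in> arrows (ver C) B B'"
  and s: "s \<in> sq (ka A \<circ>h te A) (on_ver F u) (on_ver K u) (ka A' \<circ>h te A')" and t: "t \<in> sq (ka B \<circ>h te B) (on_ver F v) (on_ver K v) (ka B' \<circ>h te B')"
 obtain s1 where s1: "s1 \<in> sq (te A) (on_ver F u) (on_ver G u) (te A')" by (rule hnatural_square[OF F G n u])
 obtain s2 where s2: "s2 \<in> sq (ka A) (on_ver G u) (on_ver K u) (ka A')" by (rule hnatural_square[OF G K n' u])
 obtain t1 where t1: "t1 \<in> sq (te B) (on_ver F v) (on_ver G v) (te B')" by (rule hnatural_square[OF F G n v])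
 obtain t2 where t2: "t2 \<in> sq (ka B) (on_ver G v) (on_ver K v) (ka B')" by (rule hnatural_square[OF G K n' v])
 have st: "s = s2 \<bullet>h s1" "t = t2 \<bullet>h t1"
  by (rule sq_ver_unique[OF c[OF ver_Ob(1)[OF u]] c[OF ver_Ob(2)[OF u]] s sq_hcmp[OF s1 s2]])
   (rule sq_ver_unique[OF c[OF ver_Ob(1)[OF v]] c[OF ver_Ob(2)[OF v]] t sq_hcmp[OF t1 t2]])
 note sg = double_functors_sq[OF C.double_category_axioms double_category_axioms _ si, THEN sqD(2)]
 show "t \<bullet>h on_sq F si = on_sq K si \<bullet>h s"
  unfolding st using HS.natural_cmp[OF sqD(2)[OF s1] sqD(2)[OF s2] sqD(2)[OF t1] sqD(2)[OF t2] sg[OF F] sg[OF G] sg[OF K]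
   hnaturalD(4)[OF n si u v s1 t1, symmetric] hnaturalD(4)[OF n' si u v s2 t2, symmetric]] by simp
qed

text \<open>A component square composed with one for the inverse has identities at top and bottom,
  hence is an identity square; naturality is then inverted as in any category.\<close>

lemma hnatural_inv:
 assumes F: "F \<in> DF" and G: "G \<in> DF" and n: "hnatural C F G te"
 shows "hnatural C G F (\<lambda>A\<in>COb. hinv (te A))"
 unfolding hnatural_restrict
proof (rule hnaturalI)
 note F' = double_functorsD[OF F] and G' = double_functorsD[OF G]
 note hi = hnaturalD(1)[OF n]
 note ha = hi[THEN H.isos_arrows] and i = H.isos_inv[OF hi]
 note ia = i(1)[THEN H.isos_arrows]
 show "hinv (te A) \<in> hi (on_ob G A) (on_ob F A)" if "A \<in> COb" for A by (rule i(1)[OF that])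
 show "hinv (te (trg (hor C) f)) \<circ>h on_hor G f = on_hor F f \<circ>h hinv (te (src (hor C) f))" if "f \<in> Ar (hor C)" for f
 proof -
  note f = C_hor[OF that] and o = C.H.arrows_Ob[OF C_hor[OF that]]
  show ?thesis
   by (rule H.natural_inv[OF functors_arrows[OF F'(1) f] functors_arrows[OF G'(1) f] ha[OF o(1)] ia[OF o(1)] ha[OF o(2)] ia[OF o(2)]
     i(3)[OF o(1)] i(2)[OF o(2)] hnaturalD(2)[OF n f]])
 qed
 have inv: "ph (hinv (te A)) \<circ>v ph (te A) = idv (on_ob F A)" "ph (te A) \<circ>v ph (hinv (te A)) = idv (on_ob G A)" if "A \<in> COb" for A
  using phi_cmp[OF hi[OF that] i(1)[OF that]] phi_cmp[OF i(1)[OF that] hi[OF that]] i(2,3)[OF that] phi_ident hi_Ob[OF hi[OF that]] by simp_all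
 show "ph (hinv (te (trg (ver C) u))) \<circ>v on_ver G u = on_ver F u \<circ>v ph (hinv (te (src (ver C) u)))" if "u \<in> Ar (ver C)" for u
 proof -
  note u = C_ver[OF that] and o = ver_Ob[OF C_ver[OF that]]
  show ?thesis
   by (rule V.natural_inv[OF functors_arrows[OF F'(2) u] functors_arrows[OF G'(2) u] phi_arrow[OF hi[OF o(1)]] phi_arrow[OF i(1)[OF o(1)]]
     phi_arrow[OF hi[OF o(2)]] phi_arrow[OF i(1)[OF o(2)]] inv(2)[OF o(1)] inv(1)[OF o(2)] hnaturalD(3)[OF n u]])
 qed
 fix si u v A A' B B' s t
 assume si: "si \<in> squares C (top_edge C si) u v (bottom_edge C si)" and u: "u \<in> arrows (ver C) A A'" and v: "v \<in> arrows (ver C) B B'"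
  and s: "s \<in> sq (hinv (te A)) (on_ver G u) (on_ver F u) (hinv (te A'))" and t: "t \<in> sq (hinv (te B)) (on_ver G v) (on_ver F v) (hinv (te B'))"
 note o = ver_Ob[OF u] ver_Ob[OF v]
 obtain s1 where s1: "s1 \<in> sq (te A) (on_ver F u) (on_ver G u) (te A')" by (rule hnatural_square[OF F G n u])
 obtain t1 where t1: "t1 \<in> sq (te B) (on_ver F v) (on_ver G v) (te B')" by (rule hnatural_square[OF F G n v])
 note Go = o[THEN functors_Ob[OF G'(1)], THEN H.isos_ident] and Fo = o[THEN functors_Ob[OF F'(1)], THEN H.isos_ident]
 have ss: "s1 \<bullet>h s = idhs (on_ver G u)"
  by (rule sq_ver_unique[OF Go(1,2)]) (use sq_hcmp[OF s s1] i(3)[OF o(1)] i(3)[OF o(2)] sq_idhs[OF functors_arrows[OF G'(2) u]] in simp_all)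
 have tt: "t \<bullet>h t1 = idhs (on_ver F v)"
  by (rule sq_ver_unique[OF Fo(3,4)]) (use sq_hcmp[OF t1 t] i(2)[OF o(3)] i(2)[OF o(4)] sq_idhs[OF functors_arrows[OF F'(2) v]] in simp_all)
 note sg = double_functors_sq[OF C.double_category_axioms double_category_axioms _ si, THEN sqD(2)]
 show "t \<bullet>h on_sq G si = on_sq F si \<bullet>h s"
  by (rule HS.natural_inv[OF sg[OF F] sg[OF G] sqD(2)[OF s1] sqD(2)[OF s] sqD(2)[OF t1] sqD(2)[OF t] ss tt hnaturalD(4)[OF n si u v s1 t1]])
qed

section \<open>The groupoid of double functors\<close>

abbreviation "DG \<equiv> dfun_groupoid C D"

lemma DG_simps:
 "Ob DG = DF" "src DG (F, G, te, te') = F" "trg DG (F, G, te, te') = G"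
 "ident DG F = (F, F, (\<lambda>A\<in>COb. idh (on_ob F A)), (\<lambda>A\<in>COb. idv (on_ob F A)))"
 "cmp DG (G, K, ka, ka') (F, G', te, te') = (F, K, (\<lambda>A\<in>COb. ka A \<circ>h te A), (\<lambda>A\<in>COb. ka' A \<circ>v te' A))"
 by (simp_all add: dfun_groupoid_def)

lemma DG_Ar: "(F, G, te, te') \<in> Ar DG \<longleftrightarrow> F \<in> DF & G \<in> DF & te \<in> extensional COb &
  te' = (\<lambda>A\<in>COb. ph (te A)) & hnatural C F G te"
 by (auto simp: dfun_groupoid_def natural_shared_isos_iff)

lemma DG_arrows: "(F', G', te, te') \<in> arrows DG F G \<longleftrightarrow> F' = F & G' = G & F \<in> DF & G \<in> DF & te \<in> extensional COb &
  te' = (\<lambda>A\<in>COb. ph (te A)) & hnatural C F G te"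
 by (auto simp: arrows_def DG_Ar DG_simps)

lemma DG_arrowE:
 assumes "x \<in> arrows DG F G"
 obtains te where "x = (F, G, te, \<lambda>A\<in>COb. ph (te A))" "F \<in> DF" "G \<in> DF" "te \<in> extensional COb" "hnatural C F G te"
proof -
 obtain F' G' te te' where x: "x = (F', G', te, te')" by (cases x)
 show ?thesis using assms that[of te] unfolding x DG_arrows by auto
qed

lemma DG_arrowI:
 "F \<in> DF ==> G \<in> DF ==> te \<in> extensional COb ==> hnatural C F G te ==> (F, G, te, \<lambda>A\<in>COb. ph (te A)) \<in> arrows DG F G"
 by (simp add: DG_arrows)

lemma DG_cmp:
 assumes F: "F \<in> DF" and G: "G \<in> DF" and K: "K \<in> DF" and n: "hnatural C F G te" and n': "hnatural C G K ka"
 shows "cmp DG (G, K, ka, \<lambda>A\<in>COb. ph (ka A)) (F, G, te, \<lambda>A\<in>COb. ph (te A)) =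
  (F, K, (\<lambda>A\<in>COb. ka A \<circ>h te A), \<lambda>A\<in>COb. ph ((\<lambda>A\<in>COb. ka A \<circ>h te A) A))"
 using phi_cmp[OF hnaturalD(1)[OF n] hnaturalD(1)[OF n']] by (auto simp: DG_simps fun_eq_iff restrict_def)

lemma DG_ident:
 assumes F: "F \<in> DF"
 shows "ident DG F = (F, F, (\<lambda>A\<in>COb. idh (on_ob F A)), \<lambda>A\<in>COb. ph ((\<lambda>A\<in>COb. idh (on_ob F A)) A))"
 using phi_ident functors_Ob[OF double_functorsD(1)[OF F]] by (auto simp: DG_simps fun_eq_iff restrict_def)

text \<open>An arrow between given double functors is determined by its horizontal components, so
  the laws reduce to those of isomorphisms in \<open>hor D\<close>.\<close>

lemma groupoid_DG: "groupoid_cat DG"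
proof -
 have arr: "x \<in> arrows DG (src DG x) (trg DG x)" if "x \<in> Ar DG" for x
  using that by (simp add: arrows_def)
 have id: "ident DG F \<in> arrows DG F F" if "F \<in> Ob DG" for F
  using that DG_arrowI[OF _ _ _ hnatural_ident] by (simp add: DG_ident DG_simps(1))
 have cat: "category DG"
 proof (unfold_locales)
  fix x assume x: "x \<in> Ar DG"
  obtain te where e: "x = (src DG x, trg DG x, te, \<lambda>A\<in>COb. ph (te A))" "src DG x \<in> DF" "trg DG x \<in> DF" "te \<in> extensional COb"
   "hnatural C (src DG x) (trg DG x) te" by (rule DG_arrowE[OF arr[OF x]])
  note hi = hnaturalD(1)[OF e(5)] and ha = hnaturalD(1)[OF e(5), THEN H.isos_arrows]
  show "src DG x \<in> Ob DG" "trg DG x \<in> Ob DG" using e by (simp_all add: DG_simps)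
  have "(\<lambda>A\<in>COb. te A \<circ>h (\<lambda>A\<in>COb. idh (on_ob (src DG x) A)) A) = te"
   by (rule extensionalityI[OF _ e(4)]) (auto simp: H.ident_right[OF ha])
  then show "cmp DG x (ident DG (src DG x)) = x"
   using DG_cmp[OF e(2,2,3) hnatural_ident[OF e(2)] e(5)] e(1) DG_ident[OF e(2)] by simp
  have "(\<lambda>A\<in>COb. (\<lambda>A\<in>COb. idh (on_ob (trg DG x) A)) A \<circ>h te A) = te"
   by (rule extensionalityI[OF _ e(4)]) (auto simp: H.ident_left[OF ha])
  then show "cmp DG (ident DG (trg DG x)) x = x"
   using DG_cmp[OF e(2,3,3) e(5) hnatural_ident[OF e(3)]] e(1) DG_ident[OF e(3)] by simp
  fix y assume y: "y \<in> Ar DG" "src DG y = trg DG x"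
  obtain ka where f: "y = (trg DG x, trg DG y, ka, \<lambda>A\<in>COb. ph (ka A))" "trg DG y \<in> DF" "ka \<in> extensional COb"
   "hnatural C (trg DG x) (trg DG y) ka" by (rule DG_arrowE[OF arr[OF y(1)]]) (use y in auto)
  note n = hnatural_comp[OF e(2,3) f(2) e(5) f(4)]
  have c: "cmp DG y x = (src DG x, trg DG y, (\<lambda>A\<in>COb. ka A \<circ>h te A), \<lambda>A\<in>COb. ph ((\<lambda>A\<in>COb. ka A \<circ>h te A) A))"
   using DG_cmp[OF e(2,3) f(2) e(5) f(4)] e(1) f(1) by simp
  show "cmp DG y x \<in> arrows DG (src DG x) (trg DG y)"
   unfolding c by (rule DG_arrowI[OF e(2) f(2) _ n]) simp
  fix z assume z: "z \<in> Ar DG" "src DG z = trg DG y"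
  obtain mm where g: "z = (trg DG y, trg DG z, mm, \<lambda>A\<in>COb. ph (mm A))" "trg DG z \<in> DF" "mm \<in> extensional COb"
   "hnatural C (trg DG y) (trg DG z) mm" by (rule DG_arrowE[OF arr[OF z(1)]]) (use z in auto)
  have zy: "cmp DG z y = (trg DG x, trg DG z, (\<lambda>A\<in>COb. mm A \<circ>h ka A), \<lambda>A\<in>COb. ph ((\<lambda>A\<in>COb. mm A \<circ>h ka A) A))"
   using DG_cmp[OF e(3) f(2) g(2) f(4) g(4)] f(1) g(1) by simp
  have "(\<lambda>A\<in>COb. mm A \<circ>h (\<lambda>A\<in>COb. ka A \<circ>h te A) A) = (\<lambda>A\<in>COb. (\<lambda>A\<in>COb. mm A \<circ>h ka A) A \<circ>h te A)"
   using H.assoc_arrows[OF ha hnaturalD(1)[OF f(4), THEN H.isos_arrows] hnaturalD(1)[OF g(4), THEN H.isos_arrows]]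
   by (auto simp: fun_eq_iff restrict_def)
  then show "cmp DG z (cmp DG y x) = cmp DG (cmp DG z y) x"
   using DG_cmp[OF e(2) f(2) g(2) n g(4)] DG_cmp[OF e(2,3) g(2) e(5) hnatural_comp[OF e(3) f(2) g(2) f(4) g(4)]] c zy e(1) g(1)
   by simp
 qed (rule id)
 then interpret G: category DG .
 have "\<exists>y. inverses DG x y" if x: "x \<in> Ar DG" for x
 proof -
  obtain te where e: "x = (src DG x, trg DG x, te, \<lambda>A\<in>COb. ph (te A))" "src DG x \<in> DF" "trg DG x \<in> DF" "te \<in> extensional COb"
   "hnatural C (src DG x) (trg DG x) te" by (rule DG_arrowE[OF arr[OF x]])
  let ?i = "\<lambda>A\<in>COb. hinv (te A)"
  note n = hnatural_inv[OF e(2,3,5)] and i = H.isos_inv[OF hnaturalD(1)[OF e(5)]]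
  let ?y = "(trg DG x, src DG x, ?i, \<lambda>A\<in>COb. ph (?i A))"
  have "inverses DG x ?y"
  proof (rule G.inversesI[OF arr[OF x]])
   show "?y \<in> arrows DG (trg DG x) (src DG x)" by (rule DG_arrowI[OF e(3,2) _ n]) simp
   have "(\<lambda>A\<in>COb. ?i A \<circ>h te A) = (\<lambda>A\<in>COb. idh (on_ob (src DG x) A))" "(\<lambda>A\<in>COb. te A \<circ>h ?i A) = (\<lambda>A\<in>COb. idh (on_ob (trg DG x) A))"
    using i(2,3) by (auto simp: fun_eq_iff restrict_def)
   then show "cmp DG ?y x = ident DG (src DG x)" "cmp DG x ?y = ident DG (trg DG x)"
    using DG_cmp[OF e(2,3,2) e(5) n] DG_cmp[OF e(3,2,3) n e(5)] e(1) DG_ident[OF e(2)] DG_ident[OF e(3)] by simp_all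
  qed
  then show ?thesis ..
 qed
 then show ?thesis using cat by (simp add: groupoid_cat_def groupoid_cat_axioms_def)
qed

end

section \<open>Grids\<close>

lemma functors_restrictI:
 assumes "category C" and "!!A. A \<in> Ob C ==> p A \<in> Ob D"
  and q: "!!f A B. f \<in> arrows C A B ==> q f \<in> arrows D (p A) (p B)"
  and i: "!!A. A \<in> Ob C ==> q (ident C A) = ident D (p A)"
  and c: "!!f g A B A'. f \<in> arrows C A B ==> g \<in> arrows C B A' ==> q (cmp C g f) = cmp D (q g) (q f)"
 shows "(restrict p (Ob C), restrict q (Ar C)) \<in> functors C D"
proof -
 interpret C: category C by (rule assms)
 show ?thesis
 proof (rule functorsI[OF assms(1)])
  fix f assume f: "f \<in> Ar C"
  then have fa: "f \<in> arrows C (src C f) (trg C f)" by (simp add: arrows_def)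
  show "restrict q (Ar C) f \<in> arrows D (restrict p (Ob C) (src C f)) (restrict p (Ob C) (trg C f))"
   using q[OF fa] f C.src_closed[OF f] C.trg_closed[OF f] by simp
  fix g assume g: "g \<in> Ar C" "src C g = trg C f"
  then have ga: "g \<in> arrows C (trg C f) (trg C g)" by (simp add: arrows_def)
  show "restrict q (Ar C) (cmp C g f) = cmp D (restrict q (Ar C) g) (restrict q (Ar C) f)"
   using c[OF fa ga] f g arrowsD(1)[OF C.cmp_arrows[OF fa ga]] by simp
 qed (use assms arrowsD(1)[OF C.ident_closed] in simp_all)
qed

context dfun_target begin

text \<open>The separate map \<open>k\<close> on objects serves the form of \<open>bact\<close>,
  which composes components with an unrestricted \<open>map_prod\<close> rather than with the object
  part of the grid map.\<close>

lemma precompose_functor: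
 assumes B: "double_category B" and K: "K \<in> double_functors B C"
  and k: "!!A. A \<in> Ob (hor B) ==> k A = on_ob K A"
 defines "pre \<equiv> %F. dfun_compose B F K"
 shows "(restrict pre DF, restrict (%(F, G, te, te'). (pre F, pre G, compose (Ob (hor B)) te k, compose (Ob (hor B)) te' k)) (Ar DG))
  \<in> functors DG (dfun_groupoid B D)"
proof -
 interpret B: dfun_target D ph B
  using B by (simp add: dfun_target_def shared_dblcat_axioms)
 interpret G: groupoid_cat DG by (rule groupoid_DG)
 let ?o = "Ob (hor B)"
 note K' = double_functorsD[OF K]
 have pre: "pre F \<in> B.DF" if "F \<in> DF" for F
  unfolding pre_def by (rule double_functors_compose[OF B C.double_category_axioms K that])
 have vals: "!!A. A \<in> ?o ==> on_ob (pre F) A = on_ob F (k A)" "!!f. f \<in> Ar (hor B) ==> on_hor (pre F) f = on_hor F (on_hor K f)"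
  "!!u. u \<in> Ar (ver B) ==> on_ver (pre F) u = on_ver F (on_ver K u)" "!!s. s \<in> Sq B ==> on_sq (pre F) s = on_sq F (on_sq K s)" for F
  by (simp_all add: pre_def dfun_compose_def compose_def k)
 have ko: "k A \<in> COb" if "A \<in> ?o" for A using functors_Ob[OF K'(1) that] k[OF that] by simp
 have nat: "hnatural B (pre F) (pre G) (compose ?o te k)" if n: "hnatural C F G te" for F G te
 proof (rule B.hnaturalI)
  show "compose ?o te k A \<in> hi (on_ob (pre F) A) (on_ob (pre G) A)" if "A \<in> ?o" for A
   using hnaturalD(1)[OF n ko[OF that]] that by (simp add: vals compose_eq)
  show "compose ?o te k (trg (hor B) f) \<circ>h on_hor (pre F) f = on_hor (pre G) f \<circ>h compose ?o te k (src (hor B) f)"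
   if f: "f \<in> Ar (hor B)" for f
   using hnaturalD(2)[OF n functors_arrows[OF K'(1) B.C_hor[OF f]]] f B.C.H.src_closed[OF f] B.C.H.trg_closed[OF f]
   by (simp add: vals compose_eq k)
  show "ph (compose ?o te k (trg (ver B) u)) \<circ>v on_ver (pre F) u = on_ver (pre G) u \<circ>v ph (compose ?o te k (src (ver B) u))"
   if u: "u \<in> Ar (ver B)" for u
   using hnaturalD(3)[OF n functors_arrows[OF K'(2) B.C_ver[OF u]]] u B.C.V.src_closed[OF u] B.C.V.trg_closed[OF u] B.C.same_objects
   by (simp add: vals compose_eq k)
  fix si u v A A' E E' s t
  assume si: "si \<in> squares B (top_edge B si) u v (bottom_edge B si)" and u: "u \<in> arrows (ver B) A A'" and v: "v \<in> arrows (ver B) E E'"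
   and s: "s \<in> sq (compose ?o te k A) (on_ver (pre F) u) (on_ver (pre G) u) (compose ?o te k A')"
   and t: "t \<in> sq (compose ?o te k E) (on_ver (pre F) v) (on_ver (pre G) v) (compose ?o te k E')"
  have o: "A \<in> ?o" "A' \<in> ?o" "E \<in> ?o" "E' \<in> ?o"
   using B.C.V.arrows_Ob[OF u] B.C.V.arrows_Ob[OF v] B.C.same_objects by simp_all
  show "t \<bullet>h on_sq (pre F) si = on_sq (pre G) si \<bullet>h s"
   using hnaturalD(4)[OF n double_functors_sq[OF B C.double_category_axioms K si] functors_arrows[OF K'(2) u] functors_arrows[OF K'(2) v], of s t]
    s t o B.C.sqD(1)[OF si] arrowsD(1)[OF u] arrowsD(1)[OF v] by (simp add: vals compose_eq k)
 qed
 let ?q = "%(F, G, te, te'). (pre F, pre G, compose ?o te k, compose ?o te' k)"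
 have comp_phi: "compose ?o (\<lambda>A\<in>COb. ph (te A)) k = (\<lambda>A\<in>?o. ph (compose ?o te k A))" for te
  using ko by (auto simp: compose_def fun_eq_iff restrict_def)
 have "(restrict pre (Ob DG), restrict ?q (Ar DG)) \<in> functors DG B.DG"
 proof (rule functors_restrictI[OF G.category_axioms])
  show "pre F \<in> Ob B.DG" if "F \<in> Ob DG" for F using pre that by (simp add: DG_simps B.DG_simps)
  show "?q x \<in> arrows B.DG (pre F) (pre G)" if "x \<in> arrows DG F G" for x F G
  proof (rule DG_arrowE[OF that])
   fix te assume x: "x = (F, G, te, \<lambda>A\<in>COb. ph (te A))" "F \<in> DF" "G \<in> DF" "hnatural C F G te"
   show ?thesis
    unfolding x(1) prod.case comp_phi
    by (rule B.DG_arrowI[OF pre[OF x(2)] pre[OF x(3)] compose_extensional nat[OF x(4)]])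
  qed
  show "?q (ident DG F) = ident B.DG (pre F)" if "F \<in> Ob DG" for F
   using that ko by (auto simp: DG_simps B.DG_simps vals compose_def fun_eq_iff restrict_def)
  show "?q (cmp DG g f) = cmp B.DG (?q g) (?q f)" if f: "f \<in> arrows DG X Y" and g: "g \<in> arrows DG Y Z" for f g X Y Z
  proof (rule DG_arrowE[OF f], rule DG_arrowE[OF g])
   fix te ka assume "f = (X, Y, te, \<lambda>A\<in>COb. ph (te A))" "g = (Y, Z, ka, \<lambda>A\<in>COb. ph (ka A))"
   then show ?thesis
    using ko by (auto simp: DG_simps B.DG_simps compose_def fun_eq_iff restrict_def)
  qed
 qed
 then show ?thesis by (simp add: DG_simps)
qed

end

section \<open>Double functors on grids\<close>

abbreviation "GO m n \<equiv> Ob (hor (grid m n))"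

lemma grid_simps:
 "GO m n = {..m} \<times> {..n}" "Ob (ver (grid m n)) = {..m} \<times> {..n}"
 "Ar (hor (grid m n)) = {(i, i'). i <= i' & i' <= m} \<times> {..n}" "Ar (ver (grid m n)) = {..m} \<times> {(j, j'). j <= j' & j' <= n}"
 "Ob (hsq (grid m n)) = {..m} \<times> {(j, j'). j <= j' & j' <= n}" "Ob (vsq (grid m n)) = {(i, i'). i <= i' & i' <= m} \<times> {..n}"
 "Ar (hsq (grid m n)) = {(i, i'). i <= i' & i' <= m} \<times> {(j, j'). j <= j' & j' <= n}"
 "Ar (vsq (grid m n)) = {(i, i'). i <= i' & i' <= m} \<times> {(j, j'). j <= j' & j' <= n}"
 "src (hor (grid m n)) = (%(f, b). (fst f, b))" "trg (hor (grid m n)) = (%(f, b). (snd f, b))"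
 "src (ver (grid m n)) = (%(a, u). (a, fst u))" "trg (ver (grid m n)) = (%(a, u). (a, snd u))"
 "src (hsq (grid m n)) = (%(f, u). (fst f, u))" "trg (hsq (grid m n)) = (%(f, u). (snd f, u))"
 "src (vsq (grid m n)) = (%(f, u). (f, fst u))" "trg (vsq (grid m n)) = (%(f, u). (f, snd u))"
 "ident (hor (grid m n)) = (%(a, b). ((a, a), b))" "ident (ver (grid m n)) = (%(a, b). (a, (b, b)))"
 "ident (hsq (grid m n)) = (%(a, u). ((a, a), u))" "ident (vsq (grid m n)) = (%(f, b). (f, (b, b)))"
 "cmp (hor (grid m n)) = (%(g, b) (f, b'). ((fst f, snd g), b))" "cmp (ver (grid m n)) = (%(a, w) (a', u). (a, (fst u, snd w)))"
 "cmp (hsq (grid m n)) = (%(g, u) (f, u'). ((fst f, snd g), u))" "cmp (vsq (grid m n)) = (%(f, w) (f', u). (f, (fst u, snd w)))"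
 by (simp_all add: grid_def box_product_def ordinal_def)

lemma double_category_grid: "double_category (grid m n)"
 by unfold_locales (auto simp: grid_simps arrows_def)

context double_category begin

abbreviation "GDF m n \<equiv> double_functors (grid m n) D"

lemma grid_dfunD:
 assumes F: "F \<in> GDF m n"
 shows "i <= m ==> j <= n ==> on_ob F (i, j) \<in> OB"
  "i <= i' ==> i' <= m ==> j <= n ==> on_hor F ((i, i'), j) \<in> hm (on_ob F (i, j)) (on_ob F (i', j))"
  "i <= m ==> j <= n ==> on_hor F ((i, i), j) = idh (on_ob F (i, j))"
  "i <= i' ==> i' <= i'' ==> i'' <= m ==> j <= n ==> on_hor F ((i', i''), j) \<circ>h on_hor F ((i, i'), j) = on_hor F ((i, i''), j)"
  "i <= m ==> j <= j' ==> j' <= n ==> on_ver F (i, j, j') \<in> vm (on_ob F (i, j)) (on_ob F (i, j'))"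
  "i <= m ==> j <= n ==> on_ver F (i, j, j) = idv (on_ob F (i, j))"
  "i <= m ==> j <= j' ==> j' <= j'' ==> j'' <= n ==> on_ver F (i, j', j'') \<circ>v on_ver F (i, j, j') = on_ver F (i, j, j'')"
  "i <= i' ==> i' <= m ==> j <= j' ==> j' <= n ==>
   on_sq F ((i, i'), j, j') \<in> sq (on_hor F ((i, i'), j)) (on_ver F (i, j, j')) (on_ver F (i', j, j')) (on_hor F ((i, i'), j'))"
  "i <= m ==> j <= j' ==> j' <= n ==> on_sq F ((i, i), j, j') = idhs (on_ver F (i, j, j'))"
  "i <= i' ==> i' <= m ==> j <= n ==> on_sq F ((i, i'), j, j) = idvs (on_hor F ((i, i'), j))"
  "i <= i' ==> i' <= i'' ==> i'' <= m ==> j <= j' ==> j' <= n ==>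
   on_sq F ((i', i''), j, j') \<bullet>h on_sq F ((i, i'), j, j') = on_sq F ((i, i''), j, j')"
  "i <= i' ==> i' <= m ==> j <= j' ==> j' <= j'' ==> j'' <= n ==>
   on_sq F ((i, i'), j', j'') \<bullet>v on_sq F ((i, i'), j, j') = on_sq F ((i, i'), j, j'')"
proof -
 note F' = double_functorsD[OF F] and g = grid_simps arrows_def
 show "i <= m ==> j <= n ==> on_ob F (i, j) \<in> OB" using functors_Ob[OF F'(1), of "(i, j)"] by (simp add: g)
 show "i <= i' ==> i' <= m ==> j <= n ==> on_hor F ((i, i'), j) \<in> hm (on_ob F (i, j)) (on_ob F (i', j))"
  by (rule functors_arrows[OF F'(1)]) (simp add: g)
 show "i <= m ==> j <= n ==> on_hor F ((i, i), j) = idh (on_ob F (i, j))"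
  using functors_ident[OF F'(1), of "(i, j)"] by (simp add: g)
 show "i <= i' ==> i' <= i'' ==> i'' <= m ==> j <= n ==> on_hor F ((i', i''), j) \<circ>h on_hor F ((i, i'), j) = on_hor F ((i, i''), j)"
  using functors_cmp[OF F'(1), of "((i, i'), j)" "(i, j)" "(i', j)" "((i', i''), j)" "(i'', j)"] by (simp add: g)
 show "i <= m ==> j <= j' ==> j' <= n ==> on_ver F (i, j, j') \<in> vm (on_ob F (i, j)) (on_ob F (i, j'))"
  by (rule functors_arrows[OF F'(2)]) (simp add: g)
 show "i <= m ==> j <= n ==> on_ver F (i, j, j) = idv (on_ob F (i, j))"
  using functors_ident[OF F'(2), of "(i, j)"] by (simp add: g)
 show "i <= m ==> j <= j' ==> j' <= j'' ==> j'' <= n ==> on_ver F (i, j', j'') \<circ>v on_ver F (i, j, j') = on_ver F (i, j, j'')"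
  using functors_cmp[OF F'(2), of "(i, j, j')" "(i, j)" "(i, j')" "(i, j', j'')" "(i, j'')"] by (simp add: g)
 show "i <= i' ==> i' <= m ==> j <= j' ==> j' <= n ==>
   on_sq F ((i, i'), j, j') \<in> sq (on_hor F ((i, i'), j)) (on_ver F (i, j, j')) (on_ver F (i', j, j')) (on_hor F ((i, i'), j'))"
  by (rule double_functors_sq[OF double_category_grid double_category_axioms F]) (simp add: g squares_def)
 show "i <= m ==> j <= j' ==> j' <= n ==> on_sq F ((i, i), j, j') = idhs (on_ver F (i, j, j'))"
  using functors_ident[OF F'(3), of "(i, j, j')"] by (simp add: g)
 show "i <= i' ==> i' <= m ==> j <= n ==> on_sq F ((i, i'), j, j) = idvs (on_hor F ((i, i'), j))"
  using functors_ident[OF F'(4), of "((i, i'), j)"] by (simp add: g)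
 show "i <= i' ==> i' <= i'' ==> i'' <= m ==> j <= j' ==> j' <= n ==>
   on_sq F ((i', i''), j, j') \<bullet>h on_sq F ((i, i'), j, j') = on_sq F ((i, i''), j, j')"
  using functors_cmp[OF F'(3), of "((i, i'), j, j')" "(i, j, j')" "(i', j, j')" "((i', i''), j, j')" "(i'', j, j')"] by (simp add: g)
 show "i <= i' ==> i' <= m ==> j <= j' ==> j' <= j'' ==> j'' <= n ==>
   on_sq F ((i, i'), j', j'') \<bullet>v on_sq F ((i, i'), j, j') = on_sq F ((i, i'), j, j'')"
  using functors_cmp[OF F'(4), of "((i, i'), j, j')" "((i, i'), j)" "((i, i'), j')" "((i, i'), j', j'')" "((i, i'), j'')"] by (simp add: g)
qed

lemma grid_dfunI:
 assumes "!!i j. i <= m ==> j <= n ==> ob (i, j) \<in> OB"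
  and "!!i i' j. i <= i' ==> i' <= m ==> j <= n ==> hr ((i, i'), j) \<in> hm (ob (i, j)) (ob (i', j))"
  and "!!i j. i <= m ==> j <= n ==> hr ((i, i), j) = idh (ob (i, j))"
  and "!!i i' i'' j. i <= i' ==> i' <= i'' ==> i'' <= m ==> j <= n ==> hr ((i', i''), j) \<circ>h hr ((i, i'), j) = hr ((i, i''), j)"
  and "!!i j j'. i <= m ==> j <= j' ==> j' <= n ==> vr (i, j, j') \<in> vm (ob (i, j)) (ob (i, j'))"
  and "!!i j. i <= m ==> j <= n ==> vr (i, j, j) = idv (ob (i, j))"
  and "!!i j j' j''. i <= m ==> j <= j' ==> j' <= j'' ==> j'' <= n ==> vr (i, j', j'') \<circ>v vr (i, j, j') = vr (i, j, j'')"
  and "!!i i' j j'. i <= i' ==> i' <= m ==> j <= j' ==> j' <= n ==>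
   s ((i, i'), j, j') \<in> sq (hr ((i, i'), j)) (vr (i, j, j')) (vr (i', j, j')) (hr ((i, i'), j'))"
  and "!!i j j'. i <= m ==> j <= j' ==> j' <= n ==> s ((i, i), j, j') = idhs (vr (i, j, j'))"
  and "!!i i' j. i <= i' ==> i' <= m ==> j <= n ==> s ((i, i'), j, j) = idvs (hr ((i, i'), j))"
  and "!!i i' i'' j j'. i <= i' ==> i' <= i'' ==> i'' <= m ==> j <= j' ==> j' <= n ==>
   s ((i', i''), j, j') \<bullet>h s ((i, i'), j, j') = s ((i, i''), j, j')"
  and "!!i i' j j' j''. i <= i' ==> i' <= m ==> j <= j' ==> j' <= j'' ==> j'' <= n ==>
   s ((i, i'), j', j'') \<bullet>v s ((i, i'), j, j') = s ((i, i'), j, j'')"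
 shows "\<lparr>on_ob = restrict ob (GO m n), on_hor = restrict hr (Ar (hor (grid m n))),
  on_ver = restrict vr (Ar (ver (grid m n))), on_sq = restrict s (Sq (grid m n))\<rparr> \<in> GDF m n"
proof -
 interpret G: double_category "grid m n" by (rule double_category_grid)
 have "(restrict ob (GO m n), restrict hr (Ar (hor (grid m n)))) \<in> functors (hor (grid m n)) (hor D)"
  by (rule functors_restrictI[OF G.category_hor]) (use assms(1-4) in \<open>auto simp: grid_simps arrows_def\<close>)
 moreover have "(restrict ob (Ob (ver (grid m n))), restrict vr (Ar (ver (grid m n)))) \<in> functors (ver (grid m n)) (ver D)"
  by (rule functors_restrictI[OF G.category_ver]) (use assms(1,5-7) same_objects in \<open>auto simp: grid_simps arrows_def\<close>)
 moreover have "(restrict vr (Ob (hsq (grid m n))), restrict s (Ar (hsq (grid m n)))) \<in> functors (hsq (grid m n)) (hsq D)"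
  by (rule functors_restrictI[OF G.category_hsq])
   (use assms(5)[THEN arrowsD(1)] assms(8)[THEN sqD(2)] assms(9,11) hsq_objects in \<open>auto simp: grid_simps arrows_def\<close>)
 moreover have "(restrict hr (Ob (vsq (grid m n))), restrict s (Ar (vsq (grid m n)))) \<in> functors (vsq (grid m n)) (vsq D)"
  by (rule functors_restrictI[OF G.category_vsq])
   (use assms(2)[THEN arrowsD(1)] assms(8)[THEN sqD(3)] assms(10,12) vsq_objects in \<open>auto simp: grid_simps arrows_def\<close>)
 ultimately show ?thesis
  by (simp add: double_functors_def G.same_objects G.hsq_objects G.vsq_objects G.same_squares)
qed

lemma grid_dfun_ext:
 assumes F: "F \<in> GDF m n"
 shows "on_ob F \<in> extensional (GO m n)" "on_hor F \<in> extensional (Ar (hor (grid m n)))"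
  "on_ver F \<in> extensional (Ar (ver (grid m n)))" "on_sq F \<in> extensional (Sq (grid m n))"
 using double_functorsD[OF F] by (auto simp: functors_def PiE_def)

end

lemma grid_map_dfun:
 assumes a: "al \<in> Delta m m'" and b: "bt \<in> Delta n n'"
 shows "grid_map m n al bt \<in> double_functors (grid m n) (grid m' n')"
 unfolding grid_map_def
 by (rule double_category.grid_dfunI[OF double_category_grid])
  (use Delta_le[OF a] Delta_mono[OF a] Delta_le[OF b] Delta_mono[OF b] in \<open>auto simp: grid_simps arrows_def squares_def\<close>)

lemma grid_pre_simps:
 "i <= m ==> j <= n ==> on_ob (dfun_compose (grid m n) F (grid_map m n al bt)) (i, j) = on_ob F (al i, bt j)"
 "i <= i' ==> i' <= m ==> j <= n ==>
   on_hor (dfun_compose (grid m n) F (grid_map m n al bt)) ((i, i'), j) = on_hor F ((al i, al i'), bt j)"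
 "i <= m ==> j <= j' ==> j' <= n ==>
   on_ver (dfun_compose (grid m n) F (grid_map m n al bt)) (i, j, j') = on_ver F (al i, bt j, bt j')"
 "i <= i' ==> i' <= m ==> j <= j' ==> j' <= n ==>
   on_sq (dfun_compose (grid m n) F (grid_map m n al bt)) ((i, i'), j, j') = on_sq F ((al i, al i'), bt j, bt j')"
 by (simp_all add: dfun_compose_def grid_map_def compose_def grid_simps)

primrec composite :: "('o, 'm) cat => (nat => 'o) => (nat => 'm) => nat => nat => 'm" where
 "composite C p a i 0 = ident C (p i)"
| "composite C p a i (Suc d) = cmp C (a (i + d)) (composite C p a i d)"

lemma (in category) composite_arrows:
 assumes a: "!!k. k < m ==> a k \<in> arrows C (p k) (p (Suc k))" and p: "!!k. k <= m ==> p k \<in> Ob C"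
 shows "i + d <= m ==> composite C p a i d \<in> arrows C (p i) (p (i + d))"
proof (induction d)
 case (Suc d)
 then show ?case using cmp_arrows[OF _ a[of "i + d"], of "composite C p a i d" "p i"] by simp
qed (use ident_closed p in simp)

lemma (in category) composite_add:
 assumes a: "!!k. k < m ==> a k \<in> arrows C (p k) (p (Suc k))" and p: "!!k. k <= m ==> p k \<in> Ob C"
 shows "i + d + e <= m ==> cmp C (composite C p a (i + d) e) (composite C p a i d) = composite C p a i (d + e)"
proof (induction e)
 case 0
 then show ?case using ident_left[OF composite_arrows[where m = m and a = a and p = p, OF a p, of i d]] by simp
next
 case (Suc e)
 note d = composite_arrows[where m = m and a = a and p = p, OF a p, of i d]
  and e = composite_arrows[where m = m and a = a and p = p, OF a p, of "i + d" e]
 show ?case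
  using assoc_arrows[OF d e a[of "i + d + e"]] Suc by (simp add: add.assoc)
qed

text \<open>A composable family is determined by its identities and unit steps. It is applied to
  horizontal and vertical morphisms and to squares in both directions.\<close>

lemma composable_eqI:
 assumes "!!k. k <= m ==> Q k k = Q' k k" "!!k. k < m ==> Q k (Suc k) = Q' k (Suc k)"
  and "!!i k. i <= k ==> k < m ==> cmp C (Q k (Suc k)) (Q i k) = Q i (Suc k)"
  and "!!i k. i <= k ==> k < m ==> cmp C (Q' k (Suc k)) (Q' i k) = Q' i (Suc k)"
  and "i <= i'" "i' <= m"
 shows "Q i i' = Q' i i'"
 using assms(5,6)
proof (induction i' rule: dec_induct)
 case (step k)
 then show ?case using assms(2)[of k] assms(3)[of i k] assms(4)[of i k] by simp
qed (use assms(1) in simp)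

context double_category begin

text \<open>Unit edges determine all edges; then unit squares determine the squares of width one by
  vertical composition, and these determine all squares by horizontal composition.\<close>

lemma grid_dfun_eqI:
 assumes F: "F \<in> GDF m n" and G: "G \<in> GDF m n"
  and ob: "!!i j. i <= m ==> j <= n ==> on_ob F (i, j) = on_ob G (i, j)"
  and hr: "!!i j. i < m ==> j <= n ==> on_hor F ((i, Suc i), j) = on_hor G ((i, Suc i), j)"
  and vr: "!!i j. i <= m ==> j < n ==> on_ver F (i, j, Suc j) = on_ver G (i, j, Suc j)"
  and sq: "!!i j. i < m ==> j < n ==> on_sq F ((i, Suc i), j, Suc j) = on_sq G ((i, Suc i), j, Suc j)"
 shows "F = G"
proof -
 note F' = grid_dfunD[OF F] and G' = grid_dfunD[OF G]
 have hor: "on_hor F ((i, i'), j) = on_hor G ((i, i'), j)" if "i <= i'" "i' <= m" "j <= n" for i i' j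
  by (rule composable_eqI[of m "%i i'. on_hor F ((i, i'), j)" "%i i'. on_hor G ((i, i'), j)" "hor D", OF _ hr F'(4) G'(4)])
   (use that F'(3) G'(3) ob in simp_all)
 have ver: "on_ver F (i, j, j') = on_ver G (i, j, j')" if "i <= m" "j <= j'" "j' <= n" for i j j'
  by (rule composable_eqI[of n "%j j'. on_ver F (i, j, j')" "%j j'. on_ver G (i, j, j')" "ver D", OF _ vr F'(7) G'(7)])
   (use that F'(6) G'(6) ob in simp_all)
 have sq1: "on_sq F ((i, Suc i), j, j') = on_sq G ((i, Suc i), j, j')" if "i < m" "j <= j'" "j' <= n" for i j j'
  by (rule composable_eqI[of n "%j j'. on_sq F ((i, Suc i), j, j')" "%j j'. on_sq G ((i, Suc i), j, j')" "vsq D", OF _ sq F'(12) G'(12)])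
   (use that F'(10) G'(10) hor in simp_all)
 have sq2: "on_sq F ((i, i'), j, j') = on_sq G ((i, i'), j, j')" if "i <= i'" "i' <= m" "j <= j'" "j' <= n" for i i' j j'
  by (rule composable_eqI[of m "%i i'. on_sq F ((i, i'), j, j')" "%i i'. on_sq G ((i, i'), j, j')" "hsq D", OF _ sq1 F'(11) G'(11)])
   (use that F'(9) G'(9) ver in simp_all)
 note eF = grid_dfun_ext[OF F] and eG = grid_dfun_ext[OF G]
 have "on_ob F = on_ob G" by (rule extensionalityI[OF eF(1) eG(1)]) (auto simp: grid_simps ob)
 moreover have "on_hor F = on_hor G" by (rule extensionalityI[OF eF(2) eG(2)]) (auto simp: grid_simps hor)
 moreover have "on_ver F = on_ver G" by (rule extensionalityI[OF eF(3) eG(3)]) (auto simp: grid_simps ver)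
 moreover have "on_sq F = on_sq G" by (rule extensionalityI[OF eF(4) eG(4)]) (auto simp: grid_simps sq2)
 ultimately show ?thesis by simp
qed

text \<open>The grid is free on its unit squares.\<close>

lemma grid_glue:
 assumes ob: "!!i j. i <= m ==> j <= n ==> p i j \<in> OB"
  and a: "!!i j. i < m ==> j <= n ==> a i j \<in> hm (p i j) (p (Suc i) j)"
  and b: "!!i j. i <= m ==> j < n ==> b i j \<in> vm (p i j) (p i (Suc j))"
  and s: "!!i j. i < m ==> j < n ==> s i j \<in> sq (a i j) (b i j) (b (Suc i) j) (a i (Suc j))"
 obtains F where "F \<in> GDF m n"
  "!!i j. i <= m ==> j <= n ==> on_ob F (i, j) = p i j"
  "!!i j. i < m ==> j <= n ==> on_hor F ((i, Suc i), j) = a i j"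
  "!!i j. i <= m ==> j < n ==> on_ver F (i, j, Suc j) = b i j"
  "!!i j. i < m ==> j < n ==> on_sq F ((i, Suc i), j, Suc j) = s i j"
proof -
 \<comment> \<open>Each column of unit squares is composed vertically to a strip \<open>S1\<close>,
   and the strips are composed horizontally. With this order horizontal functoriality is
   associativity, and interchange enters in \<open>vc\<close>.\<close>
 define A where "A i d j = composite (hor D) (%i. p i j) (%i. a i j) i d" for i d j
 define Bv where "Bv i j e = composite (ver D) (p i) (b i) j e" for i j e
 define S1 where "S1 i j e = composite (vsq D) (a i) (s i) j e" for i j e
 define S where "S i d j e = composite (hsq D) (%i. Bv i j e) (%i. S1 i j e) i d" for i d j e
 have A: "A i d j \<in> hm (p i j) (p (i + d) j)" if "i + d <= m" "j <= n" for i d j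
  unfolding A_def using that a ob by (intro H.composite_arrows[where m = m]) auto
 have B: "Bv i j e \<in> vm (p i j) (p i (j + e))" if "i <= m" "j + e <= n" for i j e
  unfolding Bv_def using that b ob same_objects by (intro V.composite_arrows[where m = n]) auto
 have S1: "S1 i j e \<in> sq (a i j) (Bv i j e) (Bv (Suc i) j e) (a i (j + e))" if "i < m" "j + e <= n" for i j e
  using that
 proof (induction e)
  case 0
  then show ?case using sq_idvs[OF a[of i j]] by (simp add: S1_def Bv_def)
 next
  case (Suc e)
  then show ?case using sq_vcmp[OF Suc.IH s[of i "j + e"]] by (simp add: S1_def Bv_def)
 qed
 have S: "S i d j e \<in> sq (A i d j) (Bv i j e) (Bv (i + d) j e) (A i d (j + e))" if "i + d <= m" "j + e <= n" for i d j e
  using that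
 proof (induction d)
  case 0
  then show ?case using sq_idhs[OF B[of i j e]] by (simp add: S_def A_def)
 next
  case (Suc d)
  then show ?case using sq_hcmp[OF Suc.IH S1[of "i + d" j e]] by (simp add: S_def A_def)
 qed
 have vid: "S i d j 0 = idvs (A i d j)" if "i + d <= m" "j <= n" for i d j
  using that
 proof (induction d)
  case 0
  then show ?case using ident_ident[of "p i j"] ob by (simp add: S_def A_def Bv_def)
 next
  case (Suc d)
  have "S i (Suc d) j 0 = idvs (a (i + d) j) \<bullet>h idvs (A i d j)"
   using Suc by (simp add: S_def S1_def)
  also have "\<dots> = idvs (a (i + d) j \<circ>h A i d j)"
   using vident_cmp[of "A i d j" "a (i + d) j"] arrowsD[OF A[of i d j]] arrowsD[OF a[of "i + d" j]] Suc.prems by simp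
  finally show ?case by (simp add: A_def)
 qed
 have Bc: "Bv i (j + e) e' \<circ>v Bv i j e = Bv i j (e + e')" if "i <= m" "j + e + e' <= n" for i j e e'
  unfolding Bv_def by (rule V.composite_add[where m = n]) (use that b ob same_objects in auto)
 have S1c: "S1 i (j + e) e' \<bullet>v S1 i j e = S1 i j (e + e')" if "i < m" "j + e + e' <= n" for i j e e'
  unfolding S1_def
  by (rule VS.composite_add[where m = n]) (use that s[THEN sqD(3)] a[THEN arrowsD(1)] vsq_objects in auto)
 have vc: "S i d (j + e) e' \<bullet>v S i d j e = S i d j (e + e')" if "i + d <= m" "j + e + e' <= n" for i d j e e'
  using that
 proof (induction d)
  case 0
  then show ?case
   using hident_cmp[of "Bv i j e" "Bv i (j + e) e'"] arrowsD[OF B[of i j e]] arrowsD[OF B[of i "j + e" e']] Bc[of i j e e']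
   by (simp add: S_def)
 next
  case (Suc d)
  have "S i (Suc d) (j + e) e' \<bullet>v S i (Suc d) j e =
    (S1 (i + d) (j + e) e' \<bullet>h S i d (j + e) e') \<bullet>v (S1 (i + d) j e \<bullet>h S i d j e)"
   by (simp add: S_def)
  also have "\<dots> = (S1 (i + d) (j + e) e' \<bullet>v S1 (i + d) j e) \<bullet>h (S i d (j + e) e' \<bullet>v S i d j e)"
   using Suc.prems exchange[OF S[of i d j e] S1[of "i + d" j e] S[of i d "j + e" e'] S1[of "i + d" "j + e" e']] by simp
  also have "\<dots> = S i (Suc d) j (e + e')"
   using Suc S1c[of "i + d" j e e'] by (simp add: S_def)
  finally show ?case .
 qed
 have Ac: "A (i + d) d' j \<circ>h A i d j = A i (d + d') j" if "i + d + d' <= m" "j <= n" for i d d' j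
  unfolding A_def by (rule H.composite_add[where m = m]) (use that a ob in auto)
 have hc: "S (i + d) d' j e \<bullet>h S i d j e = S i (d + d') j e" if "i + d + d' <= m" "j + e <= n" for i d d' j e
  unfolding S_def
  by (rule HS.composite_add[where m = m]) (use that S1[THEN sqD(2)] B[THEN arrowsD(1)] hsq_objects in auto)
 let ?F = "\<lparr>on_ob = restrict (%(i, j). p i j) (GO m n),
  on_hor = restrict (%((i, i'), j). A i (i' - i) j) (Ar (hor (grid m n))),
  on_ver = restrict (%(i, j, j'). Bv i j (j' - j)) (Ar (ver (grid m n))),
  on_sq = restrict (%((i, i'), j, j'). S i (i' - i) j (j' - j)) (Sq (grid m n))\<rparr>"
 have "?F \<in> GDF m n"
 proof (rule grid_dfunI)
  show "(%((i, i'), j). A i (i' - i) j) ((i', i''), j) \<circ>h (%((i, i'), j). A i (i' - i) j) ((i, i'), j) = (%((i, i'), j). A i (i' - i) j) ((i, i''), j)"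
   if "i <= i'" "i' <= i''" "i'' <= m" "j <= n" for i i' i'' j
   using Ac[of i "i' - i" "i'' - i'" j] that by simp
  show "(%(i, j, j'). Bv i j (j' - j)) (i, j', j'') \<circ>v (%(i, j, j'). Bv i j (j' - j)) (i, j, j') = (%(i, j, j'). Bv i j (j' - j)) (i, j, j'')"
   if "i <= m" "j <= j'" "j' <= j''" "j'' <= n" for i j j' j''
   using Bc[of i j "j' - j" "j'' - j'"] that by simp
  show "(%((i, i'), j, j'). S i (i' - i) j (j' - j)) ((i', i''), j, j') \<bullet>h (%((i, i'), j, j'). S i (i' - i) j (j' - j)) ((i, i'), j, j') =
    (%((i, i'), j, j'). S i (i' - i) j (j' - j)) ((i, i''), j, j')"
   if "i <= i'" "i' <= i''" "i'' <= m" "j <= j'" "j' <= n" for i i' i'' j j'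
   using hc[of i "i' - i" "i'' - i'" j "j' - j"] that by simp
  show "(%((i, i'), j, j'). S i (i' - i) j (j' - j)) ((i, i'), j', j'') \<bullet>v (%((i, i'), j, j'). S i (i' - i) j (j' - j)) ((i, i'), j, j') =
    (%((i, i'), j, j'). S i (i' - i) j (j' - j)) ((i, i'), j, j'')"
   if "i <= i'" "i' <= m" "j <= j'" "j' <= j''" "j'' <= n" for i i' j j' j''
   using vc[of i "i' - i" j "j' - j" "j'' - j'"] that by simp
  show "(%((i, i'), j, j'). S i (i' - i) j (j' - j)) ((i, i'), j, j') \<in> sq ((%((i, i'), j). A i (i' - i) j) ((i, i'), j))
    ((%(i, j, j'). Bv i j (j' - j)) (i, j, j')) ((%(i, j, j'). Bv i j (j' - j)) (i', j, j')) ((%((i, i'), j). A i (i' - i) j) ((i, i'), j'))"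
   if "i <= i'" "i' <= m" "j <= j'" "j' <= n" for i i' j j'
   using S[of i "i' - i" j "j' - j"] that by simp
  show "(%((i, i'), j). A i (i' - i) j) ((i, i'), j) \<in> hm ((%(i, j). p i j) (i, j)) ((%(i, j). p i j) (i', j))"
   if "i <= i'" "i' <= m" "j <= n" for i i' j using A[of i "i' - i" j] that by simp
  show "(%(i, j, j'). Bv i j (j' - j)) (i, j, j') \<in> vm ((%(i, j). p i j) (i, j)) ((%(i, j). p i j) (i, j'))"
   if "i <= m" "j <= j'" "j' <= n" for i j j' using B[of i j "j' - j"] that by simp
 qed (use ob vid in \<open>auto simp: A_def Bv_def S_def\<close>)
 then show ?thesis
 proof (rule that)
  show "on_hor ?F ((i, Suc i), j) = a i j" if "i < m" "j <= n" for i j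
   using that H.ident_right[OF a[OF that]] by (simp add: grid_simps A_def Suc_diff_le)
  show "on_ver ?F (i, j, Suc j) = b i j" if "i <= m" "j < n" for i j
   using that V.ident_right[OF b[OF that]] by (simp add: grid_simps Bv_def Suc_diff_le)
  show "on_sq ?F ((i, Suc i), j, Suc j) = s i j" if "i < m" "j < n" for i j
   using that hsq_unit(1)[OF S1[of i j "Suc 0"]] vsq_unit(1)[OF s[OF that]]
   by (simp add: grid_simps S_def S1_def Suc_diff_le)
 qed (simp add: grid_simps)
qed

end

text \<open>The maps between groupoids are written as plain functions whose restrictions are
  functors; this gives the functor laws for the plain functions.\<close>

lemma functorsD_restrict:
 assumes F: "(restrict p (Ob C), restrict q (Ar C)) \<in> functors C D"
 shows "A \<in> Ob C ==> p A \<in> Ob D"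
  "f \<in> arrows C A B ==> A \<in> Ob C ==> B \<in> Ob C ==> q f \<in> arrows D (p A) (p B)"
  "A \<in> Ob C ==> ident C A \<in> Ar C ==> q (ident C A) = ident D (p A)"
  "f \<in> arrows C A B ==> g \<in> arrows C B A' ==> cmp C g f \<in> Ar C ==> q (cmp C g f) = cmp D (q g) (q f)"
proof -
 show "A \<in> Ob C ==> p A \<in> Ob D" using functors_Ob[OF F, of A] by simp
 show "f \<in> arrows C A B ==> A \<in> Ob C ==> B \<in> Ob C ==> q f \<in> arrows D (p A) (p B)"
  using functors_arrows[OF F, of f A B] arrowsD(1)[of f C A B] by simp
 show "A \<in> Ob C ==> ident C A \<in> Ar C ==> q (ident C A) = ident D (p A)"
  using functors_ident[OF F, of A] by simp
 show "f \<in> arrows C A B ==> g \<in> arrows C B A' ==> cmp C g f \<in> Ar C ==> q (cmp C g f) = cmp D (q g) (q f)"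
  using functors_cmp[OF F, of f A B g A'] arrowsD(1)[of f C A B] arrowsD(1)[of g C B A'] by simp
qed

lemma cells_nerveE:
 assumes "x \<in> cells (nerve C) n"
 obtains P Q where "x = (P, Q)" "(P, Q) \<in> functors (ordinal n) C"
 using assms by (cases x) (auto simp: cells_nerve)

lemma nerve_map_cong:
 assumes x: "x \<in> cells (nerve C) n" and "!!A. A \<in> Ob C ==> p A = p' A" "!!f. f \<in> Ar C ==> q f = q' f"
 shows "nerve_map p q n x = nerve_map p' q' n x"
proof (rule cells_nerveE[OF x])
 fix P Q assume e: "x = (P, Q)" and F: "(P, Q) \<in> functors (ordinal n) C"
 show ?thesis
  unfolding e nerve_map_eq using functors_ordinalD(1)[OF F] arrowsD(1)[OF functors_ordinalD(2)[OF F]] assms(2,3)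
  by (auto simp: fun_eq_iff restrict_def)
qed

lemma nerve_map_nerve_map: "nerve_map p q n (nerve_map p' q' n x) = nerve_map (%A. p (p' A)) (%f. q (q' f)) n x"
 by (cases x) (auto simp: nerve_map_eq fun_eq_iff restrict_def)

lemma nerve_map_ident:
 assumes x: "x \<in> cells (nerve C) n" and "!!A. A \<in> Ob C ==> p A = A" "!!f. f \<in> Ar C ==> q f = f"
 shows "nerve_map p q n x = x"
proof -
 have "nerve_map p q n x = nerve_map (\<lambda>A\<in>Ob C. A) (\<lambda>f\<in>Ar C. f) n x"
  by (rule nerve_map_cong[OF x]) (use assms in auto)
 then show ?thesis using nerve_map_id x by (simp add: cells_nerve)
qed

lemma simplicial_map_cong:
 assumes "simplicial_map X Y f" "simplicial_set X" "!!n x. x \<in> cells X n ==> f n x = g n x"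
 shows "simplicial_map X Y g"
 using assms by (auto simp: simplicial_map_def simplicial_set_restr)

lemma weak_equivalence_cong:
 assumes w: "weak_equivalence X Y f" and e: "!!n x. x \<in> cells X n ==> f n x = g n x"
 shows "weak_equivalence X Y g"
proof -
 have s: "simplicial_set X" "simplicial_set Y" "simplicial_map X Y f" using w by (auto simp: weak_equivalence_def)
 show ?thesis
  using simplicial_map_cong[OF s(3,1) e] s(1,2)
   homotopy_equivalence_cong[of _ _ "rmap Y f" "rmap Y g"] realization_map_cong[OF s e] w
  by (simp add: weak_equivalence_def)
qed

lemma simplicial_map_nerve_map':
 assumes F: "(restrict p (Ob C), restrict q (Ar C)) \<in> functors C D"
 shows "simplicial_map (nerve C) (nerve D) (nerve_map p q)"
 by (rule simplicial_map_cong[OF simplicial_map_nerve_map[OF F] simplicial_set_nerve]) (auto intro: nerve_map_cong)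

lemma weak_equivalence_inv_into:
 assumes X: "simplicial_set X" and Y: "simplicial_set Y" and f: "simplicial_map X Y f"
  and bij: "!!n. bij_betw (f n) (cells X n) (cells Y n)"
 shows "weak_equivalence Y X (%n. inv_into (cells X n) (f n))"
 by (rule weak_equivalence_bij[OF Y X simplicial_map_inv_into[OF assms]]) (rule bij_betw_inv_into[OF bij])

section \<open>Nerves of pullbacks\<close>

definition pullback_cat where
 "pullback_cat C1 C2 p1 q1 p2 q2 = \<lparr>
   Ob = {(x, y). x \<in> Ob C1 & y \<in> Ob C2 & p1 x = p2 y},
   Ar = {(f, g). f \<in> Ar C1 & g \<in> Ar C2 & q1 f = q2 g},
   src = map_prod (src C1) (src C2), trg = map_prod (trg C1) (trg C2),
   ident = map_prod (ident C1) (ident C2),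
   cmp = (%(g, g') (f, f'). (cmp C1 g f, cmp C2 g' f'))\<rparr>"

lemma simplicial_set_pullback:
 assumes "simplicial_set X" "simplicial_set Y" "simplicial_map X Z p" "simplicial_map Y Z q"
 shows "simplicial_set (pullback_sset X Y p q)"
 using assms unfolding simplicial_set_def simplicial_map_def pullback_sset_def by auto

locale cat_cospan = C1: groupoid_cat C1 + C2: groupoid_cat C2 + C3: groupoid_cat C3
 for C1 :: "('a, 'b) cat" and C2 :: "('c, 'd) cat" and C3 :: "('e, 'f) cat" +
 fixes p1 q1 p2 q2
 assumes F1: "(restrict p1 (Ob C1), restrict q1 (Ar C1)) \<in> functors C1 C3"
  and F2: "(restrict p2 (Ob C2), restrict q2 (Ar C2)) \<in> functors C2 C3"
begin

abbreviation "PB \<equiv> pullback_cat C1 C2 p1 q1 p2 q2"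
abbreviation "PS \<equiv> pullback_sset (nerve C1) (nerve C2) (nerve_map p1 q1) (nerve_map p2 q2)"
abbreviation "pairing n x \<equiv> (nerve_map fst fst n x, nerve_map snd snd n x)"

lemma PB_simps:
 "(x, y) \<in> Ob PB \<longleftrightarrow> x \<in> Ob C1 & y \<in> Ob C2 & p1 x = p2 y"
 "(f, g) \<in> Ar PB \<longleftrightarrow> f \<in> Ar C1 & g \<in> Ar C2 & q1 f = q2 g"
 "src PB (f, g) = (src C1 f, src C2 g)" "trg PB (f, g) = (trg C1 f, trg C2 g)"
 "ident PB (x, y) = (ident C1 x, ident C2 y)"
 "cmp PB (f', g') (f, g) = (cmp C1 f' f, cmp C2 g' g)"
 by (simp_all add: pullback_cat_def)

lemma PB_arrows: "(f, g) \<in> arrows PB (x, y) (x', y') \<longleftrightarrow> f \<in> arrows C1 x x' & g \<in> arrows C2 y y' & q1 f = q2 g"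
 by (auto simp: arrows_def PB_simps)

lemma q_src_trg:
 assumes "f \<in> arrows C1 x x'" "g \<in> arrows C2 y y'" "q1 f = q2 g"
 shows "p1 x = p2 y" "p1 x' = p2 y'"
 using arrowsD(2,3)[OF functorsD_restrict(2)[OF F1 assms(1) C1.arrows_Ob[OF assms(1)]]]
  arrowsD(2,3)[OF functorsD_restrict(2)[OF F2 assms(2) C2.arrows_Ob[OF assms(2)]]] assms(3) by simp_all

lemma q_cmp:
 assumes f: "f \<in> arrows C1 x x'" "g \<in> arrows C2 y y'" "q1 f = q2 g" and f': "f' \<in> arrows C1 x' x''" "g' \<in> arrows C2 y' y''" "q1 f' = q2 g'"
 shows "q1 (cmp C1 f' f) = q2 (cmp C2 g' g)"
 using functorsD_restrict(4)[OF F1 f(1) f'(1) arrowsD(1)[OF C1.cmp_arrows[OF f(1) f'(1)]]]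
  functorsD_restrict(4)[OF F2 f(2) f'(2) arrowsD(1)[OF C2.cmp_arrows[OF f(2) f'(2)]]] f f' by simp

lemma q_ident:
 assumes "x \<in> Ob C1" "y \<in> Ob C2" "p1 x = p2 y"
 shows "q1 (ident C1 x) = q2 (ident C2 y)"
 using functorsD_restrict(3)[OF F1 assms(1) arrowsD(1)[OF C1.ident_closed[OF assms(1)]]]
  functorsD_restrict(3)[OF F2 assms(2) arrowsD(1)[OF C2.ident_closed[OF assms(2)]]] assms by simp

text \<open>Both sides are inverse to the same arrow of \<open>C3\<close>.\<close>

lemma q_inv:
 assumes f: "f \<in> arrows C1 x x'" "g \<in> arrows C2 y y'" "q1 f = q2 g"
 shows "q1 (C1.iv f) = q2 (C2.iv g)"
proof -
 note fi = C1.inv_arrows[OF f(1)] and gi = C2.inv_arrows[OF f(2)]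
 note o = C1.arrows_Ob[OF f(1)] C2.arrows_Ob[OF f(2)]
 note F = functorsD_restrict[OF F1] and G = functorsD_restrict[OF F2]
 have "inverses C3 (q1 f) (q1 (C1.iv f))"
  using F(4)[OF f(1) fi] F(4)[OF fi f(1)] F(3) C1.inv_left[OF f(1)] C1.inv_right[OF f(1)] o arrowsD(1)[OF C1.ident_closed]
  by (intro C3.inversesI[OF F(2)[OF f(1)] F(2)[OF fi]]) auto
 moreover have "inverses C3 (q2 g) (q2 (C2.iv g))"
  using G(4)[OF f(2) gi] G(4)[OF gi f(2)] G(3) C2.inv_left[OF f(2)] C2.inv_right[OF f(2)] o arrowsD(1)[OF C2.ident_closed]
  by (intro C3.inversesI[OF G(2)[OF f(2)] G(2)[OF gi]]) auto
 ultimately show ?thesis using C3.inverses_unique f(3) by simp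
qed

lemma groupoid_PB: "groupoid_cat PB"
proof -
 have arr: "f \<in> arrows C1 (src C1 f) (trg C1 f)" "g \<in> arrows C2 (src C2 g) (trg C2 g)" if "(f, g) \<in> Ar PB" for f g
  using that by (simp_all add: PB_simps arrows_def)
 have cat: "category PB"
 proof
  fix x assume x: "x \<in> Ar PB"
  obtain f g where e: "x = (f, g)" by (cases x)
  note a = arr[OF x[unfolded e]] and q = x[unfolded e PB_simps, THEN conjunct2, THEN conjunct2]
  show "src PB x \<in> Ob PB" "trg PB x \<in> Ob PB"
   using C1.arrows_Ob[OF a(1)] C2.arrows_Ob[OF a(2)] q_src_trg[OF a q] by (simp_all add: e PB_simps)
  show "cmp PB x (ident PB (src PB x)) = x" "cmp PB (ident PB (trg PB x)) x = x"
   using C1.ident_left[OF a(1)] C2.ident_left[OF a(2)] C1.ident_right[OF a(1)] C2.ident_right[OF a(2)] by (simp_all add: e PB_simps)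
  fix y assume y: "y \<in> Ar PB" "src PB y = trg PB x"
  obtain f' g' where e': "y = (f', g')" by (cases y)
  have b: "f' \<in> arrows C1 (trg C1 f) (trg C1 f')" "g' \<in> arrows C2 (trg C2 g) (trg C2 g')" "q1 f' = q2 g'"
   using y by (auto simp: e e' PB_simps arrows_def)
  show "cmp PB y x \<in> arrows PB (src PB x) (trg PB y)"
   using C1.cmp_arrows[OF a(1) b(1)] C2.cmp_arrows[OF a(2) b(2)] q_cmp[OF a q b] by (simp add: e e' PB_simps PB_arrows)
  fix z assume z: "z \<in> Ar PB" "src PB z = trg PB y"
  obtain f'' g'' where e'': "z = (f'', g'')" by (cases z)
  have c: "f'' \<in> arrows C1 (trg C1 f') (trg C1 f'')" "g'' \<in> arrows C2 (trg C2 g') (trg C2 g'')"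
   using z by (auto simp: e' e'' PB_simps arrows_def)
  show "cmp PB z (cmp PB y x) = cmp PB (cmp PB z y) x"
   using C1.assoc_arrows[OF a(1) b(1) c(1)] C2.assoc_arrows[OF a(2) b(2) c(2)] by (simp add: e e' e'' PB_simps)
 next
  fix x assume x: "x \<in> Ob PB"
  obtain A B where e: "x = (A, B)" by (cases x)
  show "ident PB x \<in> arrows PB x x"
   using x C1.ident_closed[of A] C2.ident_closed[of B] q_ident[of A B] by (simp add: e PB_simps PB_arrows)
 qed
 then interpret P: category PB .
 have "\<exists>y. inverses PB x y" if x: "x \<in> Ar PB" for x
 proof -
  obtain f g where e: "x = (f, g)" by (cases x)
  note a = arr[OF x[unfolded e]] and q = x[unfolded e PB_simps, THEN conjunct2, THEN conjunct2]
  have "inverses PB (f, g) (C1.iv f, C2.iv g)"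
   by (rule P.inversesI[where A = "(src C1 f, src C2 g)" and B = "(trg C1 f, trg C2 g)"])
    (use a q q_inv[OF a q] C1.inv_arrows[OF a(1)] C2.inv_arrows[OF a(2)] C1.inv_left[OF a(1)] C2.inv_left[OF a(2)]
     C1.inv_right[OF a(1)] C2.inv_right[OF a(2)] in \<open>simp_all add: PB_simps PB_arrows\<close>)
  then show ?thesis using e by blast
 qed
 then show ?thesis using cat by (simp add: groupoid_cat_def groupoid_cat_axioms_def)
qed

lemma projections: "(restrict fst (Ob PB), restrict fst (Ar PB)) \<in> functors PB C1"
 "(restrict snd (Ob PB), restrict snd (Ar PB)) \<in> functors PB C2"
proof -
 interpret P: groupoid_cat PB by (rule groupoid_PB)
 show "(restrict fst (Ob PB), restrict fst (Ar PB)) \<in> functors PB C1"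
  "(restrict snd (Ob PB), restrict snd (Ar PB)) \<in> functors PB C2"
  by (rule functors_restrictI[OF P.category_axioms]; auto simp: arrows_def pullback_cat_def)+
qed

lemma simplicial_set_PS: "simplicial_set PS"
 by (rule simplicial_set_pullback[OF simplicial_set_nerve simplicial_set_nerve simplicial_map_nerve_map'[OF F1] simplicial_map_nerve_map'[OF F2]])

lemma cells_PS: "cells PS n = {(x, y). x \<in> cells (nerve C1) n & y \<in> cells (nerve C2) n & nerve_map p1 q1 n x = nerve_map p2 q2 n y}"
 by (simp add: pullback_sset_def)

lemma pairing_cells: "x \<in> cells (nerve PB) n ==> pairing n x \<in> cells PS n"
 using simplicial_map_cells[OF simplicial_map_nerve_map'[OF projections(1)], of x n]
  simplicial_map_cells[OF simplicial_map_nerve_map'[OF projections(2)], of x n]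
 by (auto simp: cells_PS nerve_map_nerve_map pullback_cat_def intro!: nerve_map_cong)

text \<open>A functor into the pullback is a pair of functors that agree in \<open>C3\<close>; the
  inverse map pairs their values, and extensionality fixes the rest.\<close>

lemma bij_pairing: "bij_betw (pairing n) (cells (nerve PB) n) (cells PS n)"
proof (rule bij_betwI[where g = "%((P1, Q1), (P2, Q2)). ((\<lambda>i\<in>{..n}. (P1 i, P2 i)), (\<lambda>e\<in>{(i, j). i <= j & j <= n}. (Q1 e, Q2 e)))"])
 show "pairing n \<in> cells (nerve PB) n \<rightarrow> cells PS n" using pairing_cells by blast
 let ?g = "%((P1, Q1), (P2, Q2)). ((\<lambda>i\<in>{..n}. (P1 i, P2 i)), (\<lambda>e\<in>{(i, j). i <= j & j <= n}. (Q1 e, Q2 e)))"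
 show "?g (pairing n x) = x" if x: "x \<in> cells (nerve PB) n" for x
 proof (rule cells_nerveE[OF x])
  fix P Q assume e: "x = (P, Q)" and F: "(P, Q) \<in> functors (ordinal n) PB"
  show ?thesis
   unfolding e nerve_map_eq using extensional_arb[OF functors_ordinalD(5)[OF F]] extensional_arb[OF functors_ordinalD(6)[OF F]]
   by (auto simp: fun_eq_iff restrict_def)
 qed
 have y: "?g y \<in> cells (nerve PB) n & pairing n (?g y) = y" if y: "y \<in> cells PS n" for y
 proof -
  obtain P1 Q1 P2 Q2 where e: "y = ((P1, Q1), (P2, Q2))" by (metis prod.collapse)
  have F: "(P1, Q1) \<in> functors (ordinal n) C1" and G: "(P2, Q2) \<in> functors (ordinal n) C2"
   and eq: "nerve_map p1 q1 n (P1, Q1) = nerve_map p2 q2 n (P2, Q2)"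
   using y by (auto simp: e cells_PS cells_nerve)
  note F' = functors_ordinalD[OF F] and G' = functors_ordinalD[OF G]
  have p: "p1 (P1 i) = p2 (P2 i)" if "i <= n" for i
   using fun_cong[OF eq[unfolded nerve_map_eq prod.inject, THEN conjunct1], of i] that by simp
  have q: "q1 (Q1 (i, j)) = q2 (Q2 (i, j))" if "i <= j" "j <= n" for i j
   using fun_cong[OF eq[unfolded nerve_map_eq prod.inject, THEN conjunct2], of "(i, j)"] that by simp
  have "?g y \<in> functors (ordinal n) PB"
   unfolding e prod.case
   by (rule functors_ordinalI) (use F'(1-4) G'(1-4) p q in \<open>simp_all add: PB_simps PB_arrows\<close>)
  moreover have "pairing n (?g y) = y"
   unfolding e prod.case nerve_map_eq
   using extensional_arb[OF F'(5)] extensional_arb[OF F'(6)] extensional_arb[OF G'(5)] extensional_arb[OF G'(6)]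
   by (auto simp: fun_eq_iff restrict_def)
  ultimately show ?thesis by (simp add: cells_nerve)
 qed
 then show "?g \<in> cells PS n \<rightarrow> cells (nerve PB) n" "!!y. y \<in> cells PS n ==> pairing n (?g y) = y" by blast+
qed

lemma simplicial_map_pairing: "simplicial_map (nerve PB) PS pairing"
 using simplicial_map_restr[OF simplicial_map_nerve_map'[OF projections(1)]] simplicial_map_restr[OF simplicial_map_nerve_map'[OF projections(2)]] pairing_cells
 unfolding simplicial_map_def by (auto simp: pullback_sset_def)

lemmas weak_equivalence_pairing = weak_equivalence_bij[OF simplicial_set_nerve simplicial_set_PS simplicial_map_pairing bij_pairing]
lemmas weak_equivalence_pairing_inv = weak_equivalence_inv_into[OF simplicial_set_nerve simplicial_set_PS simplicial_map_pairing bij_pairing]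

text \<open>Since pairing is an isomorphism onto the pullback of nerves, the pullback may be formed
  before taking nerves. Both directions are used: one to prove stability, one to exploit it.\<close>

lemma weak_equivalence_into_PS:
 "weak_equivalence X PS (%n x. (nerve_map r s n (f n x), nerve_map r' s' n (f n x))) \<longleftrightarrow>
  weak_equivalence X (nerve PB) (%n x. nerve_map (%A. (r A, r' A)) (%g. (s g, s' g)) n (f n x))"
 (is "?l \<longleftrightarrow> ?r")
proof
 have e: "nerve_map fst fst n (nerve_map (%A. (r A, r' A)) (%g. (s g, s' g)) n x) = nerve_map r s n x"
  "nerve_map snd snd n (nerve_map (%A. (r A, r' A)) (%g. (s g, s' g)) n x) = nerve_map r' s' n x" for n x
  by (simp_all add: nerve_map_nerve_map)
 show "?r ==> ?l"
 proof (rule weak_equivalence_compose[OF _ weak_equivalence_pairing])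
  show "(nerve_map r s n (f n x), nerve_map r' s' n (f n x)) =
    pairing n (nerve_map (%A. (r A, r' A)) (%g. (s g, s' g)) n (f n x))" for n x
   by (simp only: e)
 qed
 have i: "inv_into (cells (nerve PB) n) (pairing n) (nerve_map r s n x, nerve_map r' s' n x) =
   nerve_map (%A. (r A, r' A)) (%g. (s g, s' g)) n x"
  if mem: "(nerve_map r s n x, nerve_map r' s' n x) \<in> cells PS n" for n x
 proof -
  have "(nerve_map r s n x, nerve_map r' s' n x) \<in> pairing n ` cells (nerve PB) n"
   unfolding bij_betw_imp_surj_on[OF bij_pairing] by (rule mem)
  then obtain y where y: "y \<in> cells (nerve PB) n" "pairing n y = (nerve_map r s n x, nerve_map r' s' n x)"
   by (elim imageE) simp
  have "y = nerve_map (%A. (r A, r' A)) (%g. (s g, s' g)) n x"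
  proof (rule cells_nerveE[OF y(1)])
   fix P Q assume e: "y = (P, Q)" and F: "(P, Q) \<in> functors (ordinal n) PB"
   obtain P' Q' where x: "x = (P', Q')" by (cases x)
   have eq: "nerve_map fst fst n (P, Q) = nerve_map r s n (P', Q')" "nerve_map snd snd n (P, Q) = nerve_map r' s' n (P', Q')"
    using y(2) unfolding e x by simp_all
   have "P i = (r (P' i), r' (P' i))" if "i <= n" for i
    using fun_cong[OF eq(1)[unfolded nerve_map_eq prod.inject, THEN conjunct1], of i]
     fun_cong[OF eq(2)[unfolded nerve_map_eq prod.inject, THEN conjunct1], of i] that by (simp add: prod_eq_iff)
   moreover have "Q (i, j) = (s (Q' (i, j)), s' (Q' (i, j)))" if "i <= j" "j <= n" for i j
    using fun_cong[OF eq(1)[unfolded nerve_map_eq prod.inject, THEN conjunct2], of "(i, j)"]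
     fun_cong[OF eq(2)[unfolded nerve_map_eq prod.inject, THEN conjunct2], of "(i, j)"] that by (simp add: prod_eq_iff)
   ultimately show ?thesis
    unfolding e x nerve_map_eq using extensional_arb[OF functors_ordinalD(5)[OF F]] extensional_arb[OF functors_ordinalD(6)[OF F]]
    by (auto simp: fun_eq_iff restrict_def)
  qed
  then show ?thesis using bij_betw_inv_into_left[OF bij_pairing y(1)] y(2) by simp
 qed
 assume l: ?l
 then have m: "simplicial_map X PS (%n x. (nerve_map r s n (f n x), nerve_map r' s' n (f n x)))"
  by (simp add: weak_equivalence_def)
 show ?r
  by (rule weak_equivalence_compose[OF l weak_equivalence_pairing_inv]) (simp add: i[OF simplicial_map_cells[OF m]])
qed

text \<open>The counterpart for maps out of a fibre product, as they occur in the definition of a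
  pointed bisimplicial space.\<close>

lemma weak_equivalence_from_PS:
 assumes w: "weak_equivalence (nerve PB) (nerve E) (nerve_map (%A. r (fst A)) (%g. s (fst g)))"
 shows "weak_equivalence PS (nerve E) (%n (x, y). nerve_map r s n x)"
proof (rule weak_equivalence_compose[OF weak_equivalence_pairing_inv w])
 fix n z assume z: "z \<in> cells PS n"
 let ?y = "inv_into (cells (nerve PB) n) (pairing n) z"
 have "pairing n ?y = z" by (rule bij_betw_inv_into_right[OF bij_pairing z])
 from arg_cong[OF this, of fst] have "fst z = nerve_map fst fst n ?y" by (simp only: fst_conv)
 then show "(case z of (x, y) => nerve_map r s n x) = nerve_map (%A. r (fst A)) (%g. s (fst g)) n ?y"
  by (simp add: case_prod_unfold nerve_map_nerve_map)
qed

end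

section \<open>Nerves of chains\<close>

lemma simplicial_set_chain:
 assumes X: "simplicial_set X" and p: "simplicial_map X Z p" and q: "simplicial_map X Z q"
 shows "simplicial_set (chain_sset n X p q)"
 unfolding simplicial_set_def
proof (intro conjI allI ballI)
 fix l m al x assume a: "al \<in> Delta l m" and x: "x \<in> cells (chain_sset n X p q) m"
 show "restr (chain_sset n X p q) l m al x \<in> cells (chain_sset n X p q) l"
  using x simplicial_set_restr[OF X a] simplicial_map_restr[OF p a] simplicial_map_restr[OF q a]
  by (auto simp: chain_sset_def PiE_iff)
next
 fix m x assume x: "x \<in> cells (chain_sset n X p q) m"
 then show "restr (chain_sset n X p q) m m (Delta_id m) x = x"
  using simplicial_set_id[OF X] by (auto simp: chain_sset_def PiE_iff extensional_def fun_eq_iff restrict_def)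
next
 fix l m r al bt x assume "al \<in> Delta l m" "bt \<in> Delta m r" "x \<in> cells (chain_sset n X p q) r"
 then show "restr (chain_sset n X p q) l r (compose {..l} bt al) x =
   restr (chain_sset n X p q) l m al (restr (chain_sset n X p q) m r bt x)"
  using simplicial_set_comp[OF X] by (auto simp: chain_sset_def PiE_iff fun_eq_iff restrict_def)
qed

text \<open>If objects and arrows of \<open>C\<close> are exactly the matching chains of those of
  \<open>C1\<close>, the map of simplices is bijective: a chain of simplices lifts entry by entry,
  and since the maps \<open>S i\<close> are jointly injective, functoriality of the lift can be
  checked after applying them.\<close>

lemma weak_equivalence_chain:
 assumes C: "category C" and C1: "category C1"
  and R: "!!i. i < n ==> (restrict (R i) (Ob C), restrict (S i) (Ar C)) \<in> functors C C1"
  and P0: "(restrict p0 (Ob C1), restrict q0 (Ar C1)) \<in> functors C1 C0"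
  and P1: "(restrict p1 (Ob C1), restrict q1 (Ar C1)) \<in> functors C1 C0"
  and ch: "!!i x. Suc i < n ==> x \<in> Ob C ==> p1 (R i x) = p0 (R (Suc i) x)"
   "!!i f. Suc i < n ==> f \<in> Ar C ==> q1 (S i f) = q0 (S (Suc i) f)"
  and inj: "!!x y. x \<in> Ob C ==> y \<in> Ob C ==> (!!i. i < n ==> R i x = R i y) ==> x = y"
   "!!f g. f \<in> Ar C ==> g \<in> Ar C ==> (!!i. i < n ==> S i f = S i g) ==> f = g"
  and sur: "!!X. (!!i. i < n ==> X i \<in> Ob C1) ==> (!!i. Suc i < n ==> p1 (X i) = p0 (X (Suc i))) ==>
    \<exists>x\<in>Ob C. \<forall>i<n. R i x = X i"
   "!!X. (!!i. i < n ==> X i \<in> Ar C1) ==> (!!i. Suc i < n ==> q1 (X i) = q0 (X (Suc i))) ==>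
    \<exists>x\<in>Ar C. \<forall>i<n. S i x = X i"
 shows "weak_equivalence (nerve C) (chain_sset n (nerve C1) (nerve_map p0 q0) (nerve_map p1 q1))
  (%r x. \<lambda>i\<in>{..<n}. nerve_map (R i) (S i) r x)"
proof -
 interpret C: category C by (rule C)
 let ?f = "%r x. \<lambda>i\<in>{..<n}. nerve_map (R i) (S i) r x"
 let ?Y = "chain_sset n (nerve C1) (nerve_map p0 q0) (nerve_map p1 q1)"
 note sm = simplicial_map_nerve_map'[OF R]
 have cellsY: "cells ?Y r = {x \<in> {..<n} \<rightarrow>\<^sub>E cells (nerve C1) r. \<forall>i. Suc i < n --> nerve_map p1 q1 r (x i) = nerve_map p0 q0 r (x (Suc i))}" for r
  by (simp add: chain_sset_def)
 have fc: "?f r x \<in> cells ?Y r" if x: "x \<in> cells (nerve C) r" for r x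
  using simplicial_map_cells[OF sm x] nerve_map_cong[OF x, of "%A. p1 (R _ A)" "%A. p0 (R (Suc _) A)"] ch
  by (auto simp: cellsY nerve_map_nerve_map intro!: nerve_map_cong[OF x])
 have map: "simplicial_map (nerve C) ?Y ?f"
  unfolding simplicial_map_def
 proof (intro conjI allI ballI)
  show "?f m (restr (nerve C) m l al x) = restr ?Y m l al (?f l x)" if "al \<in> Delta m l" "x \<in> cells (nerve C) l" for m l al x
   using simplicial_map_restr[OF sm that] by (auto simp: chain_sset_def fun_eq_iff restrict_def)
 qed (rule fc)
 have bij: "bij_betw (?f r) (cells (nerve C) r) (cells ?Y r)" for r
  unfolding bij_betw_def
 proof
  show "inj_on (?f r) (cells (nerve C) r)"
  proof (rule inj_onI)
   fix x y assume x: "x \<in> cells (nerve C) r" and y: "y \<in> cells (nerve C) r" and eq: "?f r x = ?f r y"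
   obtain P Q where e: "x = (P, Q)" and F: "(P, Q) \<in> functors (ordinal r) C" by (rule cells_nerveE[OF x])
   obtain P' Q' where e': "y = (P', Q')" and F': "(P', Q') \<in> functors (ordinal r) C" by (rule cells_nerveE[OF y])
   have eqi: "nerve_map (R i) (S i) r (P, Q) = nerve_map (R i) (S i) r (P', Q')" if "i < n" for i
    using fun_cong[OF eq, of i] that by (simp add: e e')
   note D = functors_ordinalD[OF F] and D' = functors_ordinalD[OF F']
   have "P j = P' j" if "j <= r" for j
    by (rule inj(1)[OF D(1)[OF that] D'(1)[OF that]])
     (use fun_cong[OF eqi[unfolded nerve_map_eq prod.inject, THEN conjunct1], of _ j] that in simp)
   moreover have "Q (j, k) = Q' (j, k)" if "j <= k" "k <= r" for j k
    by (rule inj(2)[OF arrowsD(1)[OF D(2)[OF that]] arrowsD(1)[OF D'(2)[OF that]]])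
     (use fun_cong[OF eqi[unfolded nerve_map_eq prod.inject, THEN conjunct2], of _ "(j, k)"] that in simp)
   ultimately show "x = y" unfolding e e' using functors_ordinal_eqI[OF F F'] by simp
  qed
  show "?f r ` cells (nerve C) r = cells ?Y r"
  proof
   show "cells ?Y r \<subseteq> ?f r ` cells (nerve C) r"
   proof
    fix z assume z: "z \<in> cells ?Y r"
    have zc: "z i \<in> cells (nerve C1) r" if "i < n" for i using z that by (auto simp: cellsY)
    have zch: "nerve_map p1 q1 r (fst (z i), snd (z i)) = nerve_map p0 q0 r (fst (z (Suc i)), snd (z (Suc i)))" if "Suc i < n" for i
     using z that by (auto simp: cellsY)
    note Z = cells_nerveD[OF zc]
    have "\<exists>x\<in>Ob C. \<forall>i<n. R i x = fst (z i) j" if "j <= r" for j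
     by (rule sur(1)) (use Z(1) that fun_cong[OF zch[unfolded nerve_map_eq prod.inject, THEN conjunct1], of _ j] in simp_all)
    then obtain P where P: "!!j. j <= r ==> P j \<in> Ob C" "!!j i. j <= r ==> i < n ==> R i (P j) = fst (z i) j" by metis
    have "\<exists>f\<in>Ar C. \<forall>i<n. S i f = snd (z i) (j, k)" if "j <= k" "k <= r" for j k
     by (rule sur(2)) (use arrowsD(1)[OF Z(2)] that fun_cong[OF zch[unfolded nerve_map_eq prod.inject, THEN conjunct2], of _ "(j, k)"] in simp_all)
    then obtain Q where Q: "!!j k. j <= k ==> k <= r ==> Q j k \<in> Ar C" "!!j k i. j <= k ==> k <= r ==> i < n ==> S i (Q j k) = snd (z i) (j, k)" by metis
    \<comment> \<open>Objects and arrows were lifted independently; joint injectivity of the maps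
      \<open>R i\<close> shows that the ends of the lifted arrows are the lifted objects.\<close>
    have Qa: "Q j k \<in> arrows C (P j) (P k)" if "j <= k" "k <= r" for j k
    proof -
     have a: "Q j k \<in> arrows C (src C (Q j k)) (trg C (Q j k))" using Q(1)[OF that] by (simp add: arrows_def)
     note o = C.arrows_Ob[OF a]
     have "R i (src C (Q j k)) = R i (P j)" "R i (trg C (Q j k)) = R i (P k)" if i: "i < n" for i
      using arrowsD(2,3)[OF functorsD_restrict(2)[OF R[OF i] a o]] arrowsD(2,3)[OF Z(2)[OF i, of j k]] Q(2) P(2) i \<open>j <= k\<close> \<open>k <= r\<close> by simp_all
     then have "src C (Q j k) = P j" "trg C (Q j k) = P k"
      using inj(1)[OF o(1) P(1)[of j]] inj(1)[OF o(2) P(1)[of k]] that by simp_all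
     then show ?thesis using a by simp
    qed
    let ?x = "((\<lambda>j\<in>{..r}. P j), (\<lambda>(j, k)\<in>{(j, k). j <= k & k <= r}. Q j k))"
    have idA: "ident C (P j) \<in> Ar C" if "j <= r" for j using arrowsD(1)[OF C.ident_closed[OF P(1)[OF that]]] .
    have "?x \<in> functors (ordinal r) C"
    proof (rule functors_ordinalI)
     fix j assume j: "j <= r"
     have "Q j j = ident C (P j)"
     proof (rule inj(2)[OF Q(1)[OF order_refl j] idA[OF j]])
      show "S i (Q j j) = S i (ident C (P j))" if i: "i < n" for i
       using functorsD_restrict(3)[OF R[OF i] P(1)[OF j] idA[OF j]] Q(2)[OF order_refl j i] Z(3)[OF i j] P(2)[OF j i] by simp
     qed
     then show "(\<lambda>(j, k)\<in>{(j, k). j <= k & k <= r}. Q j k) (j, j) = ident C ((\<lambda>j\<in>{..r}. P j) j)" using j by simp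
    next
     fix j k l assume jk: "j <= k" "k <= l" "l <= r"
     then have a: "Q j k \<in> arrows C (P j) (P k)" "Q k l \<in> arrows C (P k) (P l)" using Qa by simp_all
     note c = arrowsD(1)[OF C.cmp_arrows[OF a]]
     have "cmp C (Q k l) (Q j k) = Q j l"
     proof (rule inj(2)[OF c])
      show "S i (cmp C (Q k l) (Q j k)) = S i (Q j l)" if i: "i < n" for i
       using functorsD_restrict(4)[OF R[OF i] a c] Q(2)[of _ _ i] Z(4)[OF i jk] i jk by simp
     qed (use Q(1) jk in simp)
     then show "cmp C ((\<lambda>(j, k)\<in>{(j, k). j <= k & k <= r}. Q j k) (k, l)) ((\<lambda>(j, k)\<in>{(j, k). j <= k & k <= r}. Q j k) (j, k)) =
       (\<lambda>(j, k)\<in>{(j, k). j <= k & k <= r}. Q j k) (j, l)" using jk by simp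
    qed (use P(1) Qa in simp_all)
    then have x: "?x \<in> cells (nerve C) r" by (simp add: cells_nerve)
    moreover have "?f r ?x = z"
    proof (rule extensionalityI[of _ "{..<n}"])
     fix i assume "i \<in> {..<n}"
     then have i: "i < n" by simp
     have F: "(fst (z i), snd (z i)) \<in> functors (ordinal r) C1" using zc[OF i] by (simp add: cells_nerve)
     note N = simplicial_map_cells[OF sm[OF i] x, unfolded nerve_map_eq cells_nerve]
     have "nerve_map (R i) (S i) r ?x = (fst (z i), snd (z i))"
      unfolding nerve_map_eq using functors_ordinal_eqI[OF N F] P(2) Q(2) i by simp
     then show "?f r ?x i = z i" using i by simp
    qed (use z in \<open>auto simp: cellsY PiE_def\<close>)
    ultimately show "z \<in> ?f r ` cells (nerve C) r" by (rule rev_image_eqI[OF _ sym])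
   qed
  qed (rule image_subsetI[OF fc])
 qed
 show ?thesis
  by (rule weak_equivalence_bij[OF simplicial_set_nerve
    simplicial_set_chain[OF simplicial_set_nerve simplicial_map_nerve_map'[OF P0] simplicial_map_nerve_map'[OF P1]] map bij])
qed

context shared_dblcat begin

text \<open>Naturality propagates by pasting: along edges first, then vertically over strips of unit
  width in \<open>col\<close>, then horizontally in \<open>row\<close>. The component squares can be
  chosen freely because they are unique.\<close>

lemma hnatural_gridI:
 assumes F: "F \<in> GDF m n" and G: "G \<in> GDF m n"
  and th: "!!i j. i <= m ==> j <= n ==> te (i, j) \<in> hi (on_ob F (i, j)) (on_ob G (i, j))"
  and h: "!!i j. i < m ==> j <= n ==>
   te (Suc i, j) \<circ>h on_hor F ((i, Suc i), j) = on_hor G ((i, Suc i), j) \<circ>h te (i, j)"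
  and v: "!!i j. i <= m ==> j < n ==>
   ph (te (i, Suc j)) \<circ>v on_ver F (i, j, Suc j) = on_ver G (i, j, Suc j) \<circ>v ph (te (i, j))"
  and s: "!!i j s t. i < m ==> j < n ==>
   s \<in> sq (te (i, j)) (on_ver F (i, j, Suc j)) (on_ver G (i, j, Suc j)) (te (i, Suc j)) ==>
   t \<in> sq (te (Suc i, j)) (on_ver F (Suc i, j, Suc j)) (on_ver G (Suc i, j, Suc j)) (te (Suc i, Suc j)) ==>
   t \<bullet>h on_sq F ((i, Suc i), j, Suc j) = on_sq G ((i, Suc i), j, Suc j) \<bullet>h s"
 shows "hnatural (grid m n) F G te"
proof -
 interpret dfun_target D ph "grid m n"
  by (simp add: dfun_target_def shared_dblcat_axioms double_category_grid)
 note F' = grid_dfunD[OF F] and G' = grid_dfunD[OF G]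
 note ta = th[THEN H.isos_arrows] and pa = th[THEN phi_arrow]
 have hh: "te (i', j) \<circ>h on_hor F ((i, i'), j) = on_hor G ((i, i'), j) \<circ>h te (i, j)" if ii: "i <= i'" "i' <= m" and j: "j <= n" for i i' j
  using ii
 proof (induction i' rule: dec_induct)
  case base
  then show ?case using F'(3) G'(3) j H.ident_left[OF ta] H.ident_right[OF ta] by simp
 next
  case (step k)
  have k: "i <= k" "k <= Suc k" "Suc k <= m" "k < m" "k <= m" "i <= m" using step by simp_all
  show ?case
   using H.natural_cmp[OF F'(2)[OF k(1,5) j] F'(2)[OF k(2,3) j] G'(2)[OF k(1,5) j] G'(2)[OF k(2,3) j]
     ta[OF k(6) j] ta[OF k(5) j] ta[OF k(3) j] step.IH[OF k(5)] h[OF k(4) j]]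
    F'(4)[OF k(1,2,3) j] G'(4)[OF k(1,2,3) j] by simp
 qed
 have vv: "ph (te (i, j')) \<circ>v on_ver F (i, j, j') = on_ver G (i, j, j') \<circ>v ph (te (i, j))" if jj: "j <= j'" "j' <= n" and i: "i <= m" for i j j'
  using jj
 proof (induction j' rule: dec_induct)
  case base
  then show ?case using F'(6) G'(6) i V.ident_left[OF pa] V.ident_right[OF pa] by simp
 next
  case (step k)
  have k: "j <= k" "k <= Suc k" "Suc k <= n" "k < n" "k <= n" "j <= n" using step by simp_all
  show ?case
   using V.natural_cmp[OF F'(5)[OF i k(1,5)] F'(5)[OF i k(2,3)] G'(5)[OF i k(1,5)] G'(5)[OF i k(2,3)]
     pa[OF i k(6)] pa[OF i k(5)] pa[OF i k(3)] step.IH[OF k(5)] v[OF i k(4)]]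
    F'(7)[OF i k(1,2,3)] G'(7)[OF i k(1,2,3)] by simp
 qed
 define et where "et i j j' = (SOME s. s \<in> sq (te (i, j)) (on_ver F (i, j, j')) (on_ver G (i, j, j')) (te (i, j')))" for i j j'
 have eta: "et i j j' \<in> sq (te (i, j)) (on_ver F (i, j, j')) (on_ver G (i, j, j')) (te (i, j'))"
  if "i <= m" "j <= j'" "j' <= n" for i j j'
  unfolding et_def
  by (rule someI_ex) (use sq_ver[OF F'(5)[OF that] G'(5)[OF that] th th] vv that in simp)
 have etaI: "s = et i j j'" if "s \<in> sq (te (i, j)) (on_ver F (i, j, j')) (on_ver G (i, j, j')) (te (i, j'))"
  "i <= m" "j <= j'" "j' <= n" for s i j j'
  by (rule sq_ver_unique[OF th th that(1) eta]) (use that in simp_all)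
 have eta0: "et i j j = idvs (te (i, j))" if "i <= m" "j <= n" for i j
  by (rule etaI[symmetric]) (use sq_idvs[OF ta[OF that]] F'(6) G'(6) that in simp_all)
 have etac: "et i j' (Suc j') \<bullet>v et i j j' = et i j (Suc j')" if "i <= m" "j <= j'" "Suc j' <= n" for i j j'
  by (rule etaI) (use sq_vcmp[OF eta[of i j j'] eta[of i j' "Suc j'"]] F'(7)[of i j j' "Suc j'"] G'(7)[of i j j' "Suc j'"] that in simp_all)
 have col: "et (Suc i) j j' \<bullet>h on_sq F ((i, Suc i), j, j') = on_sq G ((i, Suc i), j, j') \<bullet>h et i j j'"
  if i: "i < m" and jj: "j <= j'" "j' <= n" for i j j'
  using jj
 proof (induction j' rule: dec_induct)
  case base
  note c = arrowsD[OF F'(2)[of i "Suc i" j]] arrowsD[OF G'(2)[of i "Suc i" j]] arrowsD[OF ta[of i j]] arrowsD[OF ta[of "Suc i" j]]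
  show ?case using base i F'(10)[of i "Suc i" j] G'(10)[of i "Suc i" j] eta0 h[OF i base] c
    vident_cmp[of "on_hor F ((i, Suc i), j)" "te (Suc i, j)"] vident_cmp[of "te (i, j)" "on_hor G ((i, Suc i), j)"]
   by simp
 next
  case (step k)
  have k: "j <= k" "k <= Suc k" "Suc k <= n" "k < n" "k <= n" "j <= n" using step by simp_all
  have ii: "i <= Suc i" "Suc i <= m" "i <= m" using i by simp_all
  show ?case
   using exchange[OF F'(8)[OF ii(1,2) k(1,5)] eta[OF ii(2) k(1,5)] F'(8)[OF ii(1,2) k(2,3)] eta[OF ii(2) k(2,3)]]
    exchange[OF eta[OF ii(3) k(1,5)] G'(8)[OF ii(1,2) k(1,5)] eta[OF ii(3) k(2,3)] G'(8)[OF ii(1,2) k(2,3)]]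
    F'(12)[OF ii(1,2) k(1,2,3)] G'(12)[OF ii(1,2) k(1,2,3)] etac[OF ii(2) k(1,3)] etac[OF ii(3) k(1,3)]
    step.IH[OF k(5)] s[OF i k(4) eta[OF ii(3) k(2,3)] eta[OF ii(2) k(2,3)]]
   by simp
 qed
 have row: "et i' j j' \<bullet>h on_sq F ((i, i'), j, j') = on_sq G ((i, i'), j, j') \<bullet>h et i j j'"
  if ii: "i <= i'" "i' <= m" and jj: "j <= j'" "j' <= n" for i i' j j'
  using ii
 proof (induction i' rule: dec_induct)
  case base
  then show ?case using F'(9)[of i j j'] G'(9)[of i j j'] jj hsq_unit[OF eta[OF base jj]] by simp
 next
  case (step k)
  have k: "i <= k" "k <= Suc k" "Suc k <= m" "k < m" "k <= m" "i <= m" using step by simp_all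
  show ?case
   using HS.natural_cmp[OF sqD(2)[OF F'(8)[OF k(1,5) jj]] sqD(2)[OF F'(8)[OF k(2,3) jj]]
     sqD(2)[OF G'(8)[OF k(1,5) jj]] sqD(2)[OF G'(8)[OF k(2,3) jj]]
     sqD(2)[OF eta[OF k(6) jj]] sqD(2)[OF eta[OF k(5) jj]] sqD(2)[OF eta[OF k(3) jj]] step.IH[OF k(5)] col[OF k(4) jj]]
    F'(11)[OF k(1,2,3) jj] G'(11)[OF k(1,2,3) jj] by simp
 qed
 show ?thesis
 proof (rule hnaturalI)
  show "te A \<in> hi (on_ob F A) (on_ob G A)" if "A \<in> COb" for A using that th by (auto simp: grid_simps)
  show "te (trg (hor (grid m n)) f) \<circ>h on_hor F f = on_hor G f \<circ>h te (src (hor (grid m n)) f)"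
   if "f \<in> Ar (hor (grid m n))" for f using that hh by (auto simp: grid_simps)
  show "ph (te (trg (ver (grid m n)) u)) \<circ>v on_ver F u = on_ver G u \<circ>v ph (te (src (ver (grid m n)) u))"
   if "u \<in> Ar (ver (grid m n))" for u using that vv by (auto simp: grid_simps)
  fix si u v A A' B B' s t
  assume *: "si \<in> squares (grid m n) (top_edge (grid m n) si) u v (bottom_edge (grid m n) si)"
   "u \<in> arrows (ver (grid m n)) A A'" "v \<in> arrows (ver (grid m n)) B B'"
   "s \<in> sq (te A) (on_ver F u) (on_ver G u) (te A')" "t \<in> sq (te B) (on_ver F v) (on_ver G v) (te B')"
  obtain i i' j j' where e: "si = ((i, i'), j, j')" by (metis prod.exhaust)
  have l: "i <= i'" "i' <= m" "j <= j'" "j' <= n" "i <= m"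
   and eq: "u = (i, j, j')" "v = (i', j, j')" "A = (i, j)" "A' = (i, j')" "B = (i', j)" "B' = (i', j')"
   using * unfolding e by (auto simp: grid_simps squares_def arrows_def)
  show "t \<bullet>h on_sq F si = on_sq G si \<bullet>h s"
   unfolding e using etaI[OF *(4)[unfolded eq] l(5,3,4)] etaI[OF *(5)[unfolded eq] l(2,3,4)] row[OF l(1-4)] by simp
 qed
qed

end

lemma weak_equivalence_nerve_restrict:
 assumes C: "groupoid_cat C" and E: "groupoid_cat E"
  and F: "(restrict P (Ob C), restrict Q (Ar C)) \<in> functors C E"
  and eso: "!!e. e \<in> Ob E ==> \<exists>c\<in>Ob C. \<exists>g. g \<in> arrows E (P c) e"
  and full: "!!c c' g. c \<in> Ob C ==> c' \<in> Ob C ==> g \<in> arrows E (P c) (P c') ==> \<exists>f\<in>arrows C c c'. Q f = g"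
  and faithful: "!!c c' f f'. f \<in> arrows C c c' ==> f' \<in> arrows C c c' ==> Q f = Q f' ==> f = f'"
 shows "weak_equivalence (nerve C) (nerve E) (nerve_map P Q)"
proof (rule weak_equivalence_cong)
 have r: "restrict Q (Ar C) f = Q f" if "f \<in> arrows C c c'" for f c c' using that by (simp add: arrows_def)
 show "weak_equivalence (nerve C) (nerve E) (nerve_map (restrict P (Ob C)) (restrict Q (Ar C)))"
 proof (rule weak_equivalence_nerve[OF C E F])
  show "\<exists>c\<in>Ob C. \<exists>g. g \<in> arrows E (restrict P (Ob C) c) e" if "e \<in> Ob E" for e using eso[OF that] by auto
  show "\<exists>f\<in>arrows C c c'. restrict Q (Ar C) f = g"
   if "c \<in> Ob C" "c' \<in> Ob C" "g \<in> arrows E (restrict P (Ob C) c) (restrict P (Ob C) c')" for c c' g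
  proof -
   obtain f where f: "f \<in> arrows C c c'" "Q f = g" using full[of c c' g] \<open>c \<in> Ob C\<close> \<open>c' \<in> Ob C\<close> \<open>g \<in> _\<close> by auto
   then show ?thesis using r[OF f(1)] by (intro bexI[OF _ f(1)]) (simp only:)
  qed
  show "f = f'" if "f \<in> arrows C c c'" "f' \<in> arrows C c c'" "restrict Q (Ar C) f = restrict Q (Ar C) f'" for c c' f f'
   using faithful[OF that(1,2)] that(3) unfolding r[OF that(1)] r[OF that(2)] by blast
 qed
 show "nerve_map (restrict P (Ob C)) (restrict Q (Ar C)) n x = nerve_map P Q n x" if "x \<in> cells (nerve C) n" for n x
  by (rule nerve_map_cong[OF that]) simp_all
qed

lemma weak_equivalence_nerve_restrictD:
 assumes C: "groupoid_cat C" and E: "groupoid_cat E"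
  and F: "(restrict P (Ob C), restrict Q (Ar C)) \<in> functors C E"
  and w: "weak_equivalence (nerve C) (nerve E) (nerve_map P Q)"
 shows "e \<in> Ob E ==> \<exists>c\<in>Ob C. \<exists>g. g \<in> arrows E (P c) e"
  "s \<in> Ob C ==> t \<in> Ob C ==> g \<in> arrows E (P s) (P t) ==> \<exists>f\<in>arrows C s t. Q f = g"
proof -
 have r: "restrict Q (Ar C) f = Q f" if "f \<in> arrows C c c'" for f c c' using that by (simp add: arrows_def)
 have w': "weak_equivalence (nerve C) (nerve E) (nerve_map (restrict P (Ob C)) (restrict Q (Ar C)))"
  by (rule weak_equivalence_cong[OF w]) (rule nerve_map_cong, auto)
 note N = weak_equivalence_nerveD[OF C E F w']
 show "\<exists>c\<in>Ob C. \<exists>g. g \<in> arrows E (P c) e" if "e \<in> Ob E" using N(1)[OF that] by auto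
 show "\<exists>f\<in>arrows C s t. Q f = g" if "s \<in> Ob C" "t \<in> Ob C" "g \<in> arrows E (P s) (P t)"
 proof -
  obtain f where f: "f \<in> arrows C s t" "restrict Q (Ar C) f = g" using N(2)[of s t g] \<open>s \<in> Ob C\<close> \<open>t \<in> Ob C\<close> \<open>g \<in> _\<close> by auto
  then show ?thesis using r[OF f(1)] by (intro bexI[OF _ f(1)]) (simp only:)
 qed
qed

section \<open>The classifying diagram as a bisimplicial space\<close>

lemma compose_Delta_id:
 assumes "ka \<in> extensional (GO m n)"
 shows "compose (GO m n) ka (map_prod (Delta_id m) (Delta_id n)) = ka"
 by (rule extensionalityI[of _ "GO m n"]) (use assms in \<open>auto simp: compose_def Delta_id_def grid_simps\<close>)

lemma compose_grid_assoc:
 assumes "al \<in> Delta m m'" "bt \<in> Delta n n'"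
 shows "compose (GO m n) ka (map_prod (compose {..m} al' al) (compose {..n} bt' bt)) =
  compose (GO m n) (compose (Ob (hor (grid m' n'))) ka (map_prod al' bt')) (map_prod al bt)"
 using Delta_le[OF assms(1)] Delta_le[OF assms(2)] by (auto simp: compose_def grid_simps fun_eq_iff restrict_def)

context shared_dblcat begin

abbreviation "DL m n \<equiv> dfun_groupoid (grid m n) D"
abbreviation "bp m n al bt F \<equiv> dfun_compose (grid m n) F (grid_map m n al bt)"
abbreviation "bq m n al bt \<equiv> %(F, G, te, te'). (bp m n al bt F, bp m n al bt G,
 compose (GO m n) te (map_prod al bt), compose (GO m n) te' (map_prod al bt))"
abbreviation "CD \<equiv> classifying_diagram D"

lemma dfun_target_grid: "dfun_target D ph (grid m n)"
 by (simp add: dfun_target_def shared_dblcat_axioms double_category_grid)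

lemmas DL_simps = dfun_target.DG_simps[OF dfun_target_grid] and DL_Ar = dfun_target.DG_Ar[OF dfun_target_grid]
 and DL_arrows = dfun_target.DG_arrows[OF dfun_target_grid] and DL_arrowE = dfun_target.DG_arrowE[OF dfun_target_grid]
 and DL_arrowI = dfun_target.DG_arrowI[OF dfun_target_grid] and DL_cmp = dfun_target.DG_cmp[OF dfun_target_grid]
 and DL_ident = dfun_target.DG_ident[OF dfun_target_grid] and groupoid_DL = dfun_target.groupoid_DG[OF dfun_target_grid]

text \<open>The vertical components are images of the horizontal ones, so the latter decide.\<close>

lemma DL_arrow_eqI:
 assumes "(F, G, te, te') \<in> Ar (DL m n)" "(F, G, ka, ka') \<in> Ar (DL m n)" "!!i j. i <= m ==> j <= n ==> te (i, j) = ka (i, j)"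
 shows "(F, G, te, te') = (F, G, ka, ka')"
proof -
 have "te = ka"
  by (rule extensionalityI[of _ "GO m n"]) (use assms in \<open>auto simp: DL_Ar grid_simps\<close>)
 then show ?thesis using assms(1,2) by (simp add: DL_Ar)
qed

lemma CD_simps: "level CD m n = nerve (DL m n)" "bact CD m n m' n' al bt = nerve_map (bp m n al bt) (bq m n al bt)"
 by (simp_all add: classifying_diagram_def Let_def)

lemma bp_mem:
 assumes "al \<in> Delta m m'" "bt \<in> Delta n n'" "F \<in> GDF m' n'"
 shows "bp m n al bt F \<in> GDF m n"
 by (rule double_functors_compose[OF double_category_grid double_category_grid grid_map_dfun[OF assms(1,2)] assms(3)])

lemma bp_functor:
 assumes a: "al \<in> Delta m m'" and b: "bt \<in> Delta n n'"
 shows "(restrict (bp m n al bt) (Ob (DL m' n')), restrict (bq m n al bt) (Ar (DL m' n'))) \<in> functors (DL m' n') (DL m n)"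
 using dfun_target.precompose_functor[OF dfun_target_grid double_category_grid grid_map_dfun[OF a b], of "map_prod al bt"]
 by (simp add: grid_map_def DL_simps)

lemma simplicial_map_bact:
 assumes "al \<in> Delta m m'" "bt \<in> Delta n n'"
 shows "simplicial_map (level CD m' n') (level CD m n) (bact CD m n m' n' al bt)"
 unfolding CD_simps by (rule simplicial_map_nerve_map'[OF bp_functor[OF assms]])

lemma bp_bp:
 assumes a: "al \<in> Delta m m'" "bt \<in> Delta n n'" and a': "al' \<in> Delta m' m''" "bt' \<in> Delta n' n''" and F: "F \<in> GDF m'' n''"
 shows "bp m n al bt (bp m' n' al' bt' F) = bp m n (compose {..m} al' al) (compose {..n} bt' bt) F"
proof -
 have c: "compose {..m} al' al \<in> Delta m m''" "compose {..n} bt' bt \<in> Delta n n''"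
  using a a' Delta_le Delta_mono by (auto intro!: DeltaI simp: compose_def)
 note le = Delta_le[OF a(1)] Delta_le[OF a(2)] Delta_mono[OF a(1)] Delta_mono[OF a(2)]
 show ?thesis
  by (rule grid_dfun_eqI[OF bp_mem[OF a bp_mem[OF a' F]] bp_mem[OF c F]])
   (simp_all add: grid_pre_simps le compose_def)
qed

lemma bq_bq:
 assumes a: "al \<in> Delta m m'" "bt \<in> Delta n n'" and a': "al' \<in> Delta m' m''" "bt' \<in> Delta n' n''" and x: "x \<in> Ar (DL m'' n'')"
 shows "bq m n al bt (bq m' n' al' bt' x) = bq m n (compose {..m} al' al) (compose {..n} bt' bt) x"
proof (cases x)
 case (fields F G te te')
 show ?thesis using x unfolding fields DL_Ar by (simp add: bp_bp[OF a a'] compose_grid_assoc[OF a])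
qed

lemma bisimplicial_space_classifying_diagram: "bisimplicial_space CD"
 unfolding bisimplicial_space_def
proof (intro conjI allI ballI)
 fix m n
 show "simplicial_set (level CD m n)" by (simp add: CD_simps simplicial_set_nerve)
 have ip: "bp m n (Delta_id m) (Delta_id n) F = F" if "F \<in> GDF m n" for F
  by (rule grid_dfun_eqI[OF bp_mem[OF Delta_id_mem Delta_id_mem that] that]) (simp_all add: grid_pre_simps Delta_id_def)
 have iq: "bq m n (Delta_id m) (Delta_id n) x = x" if "x \<in> Ar (DL m n)" for x
 proof -
  obtain F G te te' where x: "x = (F, G, te, te')" by (cases x)
  show ?thesis using that unfolding x DL_Ar by (simp add: ip compose_Delta_id)
 qed
 fix l x assume "x \<in> cells (level CD m n) l"
 then have x: "x \<in> cells (nerve (DL m n)) l" by (simp only: CD_simps)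
 show "bact CD m n m n (Delta_id m) (Delta_id n) l x = x"
  unfolding CD_simps by (rule nerve_map_ident[OF x]) (simp_all only: DL_simps(1) ip iq)
next
 fix m n m' n' al bt assume a: "al \<in> Delta m m'" "bt \<in> Delta n n'"
 show "simplicial_map (level CD m' n') (level CD m n) (bact CD m n m' n' al bt)"
  by (rule simplicial_map_bact[OF a])
 fix m'' n'' al' bt' l x assume a': "al' \<in> Delta m' m''" "bt' \<in> Delta n' n''" and "x \<in> cells (level CD m'' n'') l"
 then have x: "x \<in> cells (nerve (DL m'' n'')) l" by (simp only: CD_simps)
 show "bact CD m n m'' n'' (compose {..m} al' al) (compose {..n} bt' bt) l x =
   bact CD m n m' n' al bt l (bact CD m' n' m'' n'' al' bt' l x)"
  unfolding CD_simps nerve_map_nerve_map by (rule nerve_map_cong[OF x]) (simp_all only: DL_simps(1) bp_bp[OF a a'] bq_bq[OF a a'])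
qed

section \<open>Zero objects\<close>

abbreviation "Z0 \<equiv> zero_groupoid D"

lemma Z0_simps:
 "A \<in> Ob Z0 \<longleftrightarrow> zero_object D A"
 "src Z0 (f, f') = src (hor D) f" "trg Z0 (f, f') = trg (hor D) f"
 "ident Z0 A = (idh A, idv A)" "cmp Z0 (g, g') (f, f') = (g \<circ>h f, g' \<circ>v f')"
 by (simp_all add: zero_groupoid_def)

lemma Z0_arrows: "x \<in> arrows Z0 A B \<longleftrightarrow> zero_object D A & zero_object D B & (\<exists>f\<in>hi A B. x = (f, ph f))"
proof (cases x)
 case (Pair f f')
 show ?thesis
  unfolding Pair arrows_def zero_groupoid_def shared_iso_iff using H.isos_arrows by (auto simp: arrows_def)
qed

lemma zero_objectD:
 assumes "zero_object D A"
 shows "A \<in> OB" "B \<in> OB ==> \<exists>!f. f \<in> hm A B" "B \<in> OB ==> \<exists>!u. u \<in> vm B A"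
 using assms same_objects by (auto simp: zero_object_def initial_def terminal_def)

text \<open>Initiality in \<open>hor D\<close> suffices: the unique morphisms in the two directions
  are inverse to each other.\<close>

lemma zero_iso:
 assumes A: "zero_object D A" and B: "zero_object D B"
 shows "\<exists>!f. f \<in> hi A B"
proof -
 note o = zero_objectD(1)[OF A] zero_objectD(1)[OF B]
 obtain f where f: "f \<in> hm A B" "!!f'. f' \<in> hm A B ==> f' = f" using zero_objectD(2)[OF A o(2)] by blast
 obtain g where g: "g \<in> hm B A" using zero_objectD(2)[OF B o(1)] by blast
 have "g \<circ>h f = idh A" "f \<circ>h g = idh B"
  using zero_objectD(2)[OF A o(1)] zero_objectD(2)[OF B o(2)] H.cmp_arrows[OF f(1) g] H.cmp_arrows[OF g f(1)]
   H.ident_closed[OF o(1)] H.ident_closed[OF o(2)] by blast+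
 then have "f \<in> hi A B" by (intro H.isosI[OF f(1) H.inversesI[OF f(1) g]])
 then show ?thesis using f(2) H.isos_arrows by blast
qed

lemma groupoid_Z0: "groupoid_cat Z0"
proof -
 have ar: "x \<in> arrows Z0 (src Z0 x) (trg Z0 x)" if "x \<in> Ar Z0" for x
  using that by (simp add: arrows_def)
 have cat: "category Z0"
 proof
  fix x assume "x \<in> Ar Z0"
  note x = ar[OF this]
  obtain f where f: "zero_object D (src Z0 x)" "zero_object D (trg Z0 x)" "f \<in> hi (src Z0 x) (trg Z0 x)" "x = (f, ph f)"
   using x unfolding Z0_arrows by blast
  then show "src Z0 x \<in> Ob Z0" "trg Z0 x \<in> Ob Z0" by (simp_all only: Z0_simps)
  have "cmp Z0 (f, ph f) (ident Z0 (src Z0 x)) = (f, ph f)" "cmp Z0 (ident Z0 (trg Z0 x)) (f, ph f) = (f, ph f)"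
   using H.ident_left H.ident_right V.ident_left V.ident_right H.isos_arrows[OF f(3)] phi_arrow[OF f(3)]
   by (simp_all only: Z0_simps)
  then show "cmp Z0 x (ident Z0 (src Z0 x)) = x" "cmp Z0 (ident Z0 (trg Z0 x)) x = x" unfolding f(4)[symmetric] .
  fix y assume "y \<in> Ar Z0" "src Z0 y = trg Z0 x"
  then have "y \<in> arrows Z0 (trg Z0 x) (trg Z0 y)" using ar[of y] by simp
  then obtain g where g: "zero_object D (trg Z0 y)" "g \<in> hi (trg Z0 x) (trg Z0 y)" "y = (g, ph g)"
   unfolding Z0_arrows by blast
  have yx: "cmp Z0 y x = (g \<circ>h f, ph (g \<circ>h f))" using f(4) g(3) phi_cmp[OF f(3) g(2)] by (simp only: Z0_simps)
  then show "cmp Z0 y x \<in> arrows Z0 (src Z0 x) (trg Z0 y)"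
   using f(1) g(1) H.isos_cmp[OF f(3) g(2)] unfolding Z0_arrows by blast
  fix z assume "z \<in> Ar Z0" "src Z0 z = trg Z0 y"
  then have "z \<in> arrows Z0 (trg Z0 y) (trg Z0 z)" using ar[of z] by simp
  then obtain h where h: "h \<in> hi (trg Z0 y) (trg Z0 z)" "z = (h, ph h)"
   unfolding Z0_arrows by blast
  show "cmp Z0 z (cmp Z0 y x) = cmp Z0 (cmp Z0 z y) x"
   unfolding f(4) g(3) h(2) Z0_simps
   using H.assoc_arrows[OF f(3)[THEN H.isos_arrows] g(2)[THEN H.isos_arrows] h(1)[THEN H.isos_arrows]]
    V.assoc_arrows[OF phi_arrow[OF f(3)] phi_arrow[OF g(2)] phi_arrow[OF h(1)]] by simp
 next
  fix A assume A: "A \<in> Ob Z0"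
  then show "ident Z0 A \<in> arrows Z0 A A"
   using H.isos_ident[of A] phi_ident[of A] zero_objectD(1)[of A] unfolding Z0_arrows Z0_simps by auto
 qed
 then interpret Z: category Z0 .
 show ?thesis
 proof
  fix x assume "x \<in> Ar Z0"
  note x = ar[OF this]
  obtain f where f: "zero_object D (src Z0 x)" "zero_object D (trg Z0 x)" "f \<in> hi (src Z0 x) (trg Z0 x)" "x = (f, ph f)"
   using x unfolding Z0_arrows by blast
  note i = H.isos_inv[OF f(3)]
  have y: "(hinv f, ph (hinv f)) \<in> arrows Z0 (trg Z0 x) (src Z0 x)" using i(1) f(1,2) unfolding Z0_arrows by blast
  have "inverses Z0 x (hinv f, ph (hinv f))"
   by (rule Z.inversesI[OF x y])
    (use phi_inv[OF f(3)] arrowsD[OF phi_arrow[OF f(3)]] f(4) i in \<open>auto simp: Z0_simps inverses_def\<close>)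
  then show "\<exists>g. inverses Z0 x g" by blast
 qed
qed

text \<open>The groupoid of zero objects is nonempty and has exactly one arrow between any two
  objects.\<close>

lemma contractible_base:
 assumes "zero_object D A"
 shows "contractible_sset (base CD)"
proof -
 have "contractible_sset (nerve Z0)"
 proof (rule contractible_nerve[OF groupoid_Z0])
  show "A \<in> Ob Z0" using assms by (simp only: Z0_simps)
  fix a b assume "a \<in> Ob Z0" "b \<in> Ob Z0"
  then have "zero_object D a" "zero_object D b" by (simp_all only: Z0_simps)
  then show "\<exists>!f. f \<in> arrows Z0 a b" using zero_iso[of a b] unfolding Z0_arrows by blast
 qed
 then show ?thesis by (simp add: classifying_diagram_def)
qed

abbreviation "aug_ar \<equiv> %(f, f'). (object_dfun D (src (hor D) f), object_dfun D (trg (hor D) f),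
 (\<lambda>_\<in>GO 0 0. f), (\<lambda>_\<in>GO 0 0. f'))"

lemma CD_base: "base CD = nerve Z0" "augmentation CD = nerve_map (object_dfun D) aug_ar"
 by (simp_all add: classifying_diagram_def)

lemma object_dfun_mem: "A \<in> OB ==> object_dfun D A \<in> GDF 0 0"
 unfolding object_dfun_def
 using H.ident_closed[of A] V.ident_closed[of A] same_objects sq_idhs[of "idv A" A A] ident_ident[of A]
  H.ident_left[of "idh A" A A] V.ident_left[of "idv A" A A] hsq_unit(1)[of "idhs (idv A)" "idh A" "idv A" "idv A" "idh A"]
  vsq_unit(1)[of "idhs (idv A)" "idh A" "idv A" "idv A" "idh A"]
 by (intro grid_dfunI) (auto simp: grid_simps)

lemma object_dfun_ob: "on_ob (object_dfun D A) (0, 0) = A"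
 by (simp add: object_dfun_def grid_simps)

lemma aug_ar_mem:
 assumes f: "f \<in> hi A B"
 shows "aug_ar (f, ph f) \<in> arrows (DL 0 0) (object_dfun D A) (object_dfun D B)"
proof -
 note fa = arrowsD[OF H.isos_arrows[OF f]] and o = hi_Ob[OF f]
 have "hnatural (grid 0 0) (object_dfun D A) (object_dfun D B) (\<lambda>_\<in>GO 0 0. f)"
  by (rule hnatural_gridI[OF object_dfun_mem[OF o(1)] object_dfun_mem[OF o(2)]])
   (use f in \<open>simp_all add: object_dfun_ob grid_simps\<close>)
 then show ?thesis
  using object_dfun_mem[OF o(1)] object_dfun_mem[OF o(2)] fa by (simp add: DL_arrows restrict_extensional fun_eq_iff)
qed

lemma aug_functor: "(restrict (object_dfun D) (Ob Z0), restrict aug_ar (Ar Z0)) \<in> functors Z0 (DL 0 0)"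
proof (rule functors_restrictI)
 show "category Z0" using groupoid_Z0 by (simp add: groupoid_cat_def)
 show "object_dfun D A \<in> Ob (DL 0 0)" if "A \<in> Ob Z0" for A
  using object_dfun_mem zero_objectD(1)[of A] that by (simp add: Z0_simps DL_simps)
 show "aug_ar x \<in> arrows (DL 0 0) (object_dfun D A) (object_dfun D B)" if "x \<in> arrows Z0 A B" for x A B
  using that aug_ar_mem unfolding Z0_arrows by blast
 show "aug_ar (ident Z0 A) = ident (DL 0 0) (object_dfun D A)" if "A \<in> Ob Z0" for A
  using that H.ident_closed[of A] zero_objectD(1)[of A]
  by (auto simp: Z0_simps DL_simps arrows_def fun_eq_iff restrict_def grid_simps object_dfun_ob)
 show "aug_ar (cmp Z0 y x) = cmp (DL 0 0) (aug_ar y) (aug_ar x)"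
  if xy: "x \<in> arrows Z0 A B" "y \<in> arrows Z0 B A'" for x y A B A'
 proof -
  obtain f g where e: "f \<in> hi A B" "x = (f, ph f)" "g \<in> hi B A'" "y = (g, ph g)" using xy unfolding Z0_arrows by blast
  show ?thesis
   using H.cmp_arrows[OF e(1)[THEN H.isos_arrows] e(3)[THEN H.isos_arrows]]
    arrowsD[OF e(1)[THEN H.isos_arrows]] arrowsD[OF e(3)[THEN H.isos_arrows]]
   by (auto simp: e Z0_simps DL_simps arrows_def fun_eq_iff restrict_def)
 qed
qed

lemma preaugmented_classifying_diagram: "preaugmented CD"
 unfolding preaugmented_def CD_base CD_simps
 using bisimplicial_space_classifying_diagram simplicial_set_nerve simplicial_map_nerve_map'[OF aug_functor] by blast

end

section \<open>The Segal maps\<close>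

lemma edge_simps: "edge i 0 = i" "edge i (Suc 0) = Suc i"
 and vertex_simps: "vertex i 0 = i"
 and Delta_id_simps: "j <= k ==> Delta_id k j = j"
 by (simp_all add: edge_def vertex_def Delta_id_def)

lemma edge_mem: "i < n ==> edge i \<in> Delta 1 n"
 by (rule DeltaI) (auto simp: edge_def)

lemma vertex_mem: "i <= n ==> vertex i \<in> Delta 0 n"
 by (rule DeltaI) (auto simp: vertex_def)

lemma compose_edge_vertex: "compose {..0} (edge i) (vertex 0) = vertex i" "compose {..0} (edge i) (vertex 1) = vertex (Suc i)"
 by (auto simp: compose_def edge_def vertex_def fun_eq_iff restrict_def)

context shared_dblcat begin

lemma CD_ends:
 "h_end CD k i = nerve_map (bp 0 k (vertex i) (Delta_id k)) (bq 0 k (vertex i) (Delta_id k))"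
 "v_end CD l i = nerve_map (bp l 0 (Delta_id l) (vertex i)) (bq l 0 (Delta_id l) (vertex i))"
 "h_segal_map CD n k = (%r x. \<lambda>i\<in>{..<n}. nerve_map (bp 1 k (edge i) (Delta_id k)) (bq 1 k (edge i) (Delta_id k)) r x)"
 "v_segal_map CD l m = (%r x. \<lambda>i\<in>{..<m}. nerve_map (bp l 1 (Delta_id l) (edge i)) (bq l 1 (Delta_id l) (edge i)) r x)"
 by (simp_all only: h_end_def v_end_def h_segal_map_def v_segal_map_def CD_simps)

lemma DL_arrowI_grid:
 assumes "F \<in> GDF m n" "G \<in> GDF m n" "hnatural (grid m n) F G te"
 shows "(F, G, restrict te (GO m n), restrict (%A. ph (te A)) (GO m n)) \<in> arrows (DL m n) F G"
 using assms by (simp add: DL_arrows fun_eq_iff dfun_target.hnatural_restrict[OF dfun_target_grid])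

text \<open>Common to both directions: \<open>al i\<close> and \<open>bt i\<close> embed the
  \<open>i\<close>-th slab of the large grid, while \<open>gm\<close> and \<open>de\<close> embed
  the two ends of a slab. By \<open>cov\<close> the slabs contain every vertex, unit edge and unit
  square, which gives injectivity and local checks of naturality; \<open>sur\<close> and
  \<open>surT\<close> are the gluing of double functors and of components.\<close>

lemma segal_equivalence:
 fixes al bt gm de :: "nat => nat => nat"
 assumes ab: "!!i. i < n ==> al i \<in> Delta a1 a" "!!i. i < n ==> bt i \<in> Delta b1 b"
  and gd: "!!e. e <= 1 ==> gm e \<in> Delta a0 a1" "!!e. e <= 1 ==> de e \<in> Delta b0 b1"
  and ov: "!!i. Suc i < n ==> compose {..a0} (al i) (gm 1) = compose {..a0} (al (Suc i)) (gm 0)"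
   "!!i. Suc i < n ==> compose {..b0} (bt i) (de 1) = compose {..b0} (bt (Suc i)) (de 0)"
  and cov: "!!x y. x <= a ==> y <= b ==> \<exists>i<n. \<exists>x'\<le>a1. \<exists>y'\<le>b1. x = al i x' & y = bt i y'"
   "!!x y. x < a ==> y <= b ==> \<exists>i<n. \<exists>x'<a1. \<exists>y'\<le>b1. x = al i x' & Suc x = al i (Suc x') & y = bt i y'"
   "!!x y. x <= a ==> y < b ==> \<exists>i<n. \<exists>x'\<le>a1. \<exists>y'<b1. x = al i x' & y = bt i y' & Suc y = bt i (Suc y')"
   "!!x y. x < a ==> y < b ==> \<exists>i<n. \<exists>x'<a1. \<exists>y'<b1. x = al i x' & Suc x = al i (Suc x') & y = bt i y' & Suc y = bt i (Suc y')"
  and sur: "!!X. (!!i. i < n ==> X i \<in> GDF a1 b1) ==>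
    (!!i. Suc i < n ==> bp a0 b0 (gm 1) (de 1) (X i) = bp a0 b0 (gm 0) (de 0) (X (Suc i))) ==>
    \<exists>F\<in>GDF a b. \<forall>i<n. bp a1 b1 (al i) (bt i) F = X i"
  and surT: "!!T :: nat => nat \<times> nat => 'h. (!!i x y. Suc i < n ==> x <= a0 ==> y <= b0 ==> T i (gm 1 x, de 1 y) = T (Suc i) (gm 0 x, de 0 y)) ==>
    \<exists>te. \<forall>i<n. \<forall>x\<le>a1. \<forall>y\<le>b1. te (al i x, bt i y) = T i (x, y)"
 shows "weak_equivalence (nerve (DL a b))
  (chain_sset n (nerve (DL a1 b1)) (nerve_map (bp a0 b0 (gm 0) (de 0)) (bq a0 b0 (gm 0) (de 0))) (nerve_map (bp a0 b0 (gm 1) (de 1)) (bq a0 b0 (gm 1) (de 1))))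
  (%r x. \<lambda>i\<in>{..<n}. nerve_map (bp a1 b1 (al i) (bt i)) (bq a1 b1 (al i) (bt i)) r x)"
proof (rule weak_equivalence_chain)
 interpret K: dfun_target D ph "grid a1 b1" by (rule dfun_target_grid)
 let ?R = "%i. bp a1 b1 (al i) (bt i)"
 have e: "(0::nat) <= 1" "(1::nat) <= 1" by simp_all
 note g0 = gd[OF e(1)] and g1 = gd[OF e(2)]
 show "category (DL a b)" "category (DL a1 b1)" using groupoid_DL by (auto simp: groupoid_cat_def)
 show "(restrict (?R i) (Ob (DL a b)), restrict (bq a1 b1 (al i) (bt i)) (Ar (DL a b))) \<in> functors (DL a b) (DL a1 b1)" if "i < n" for i
  by (rule bp_functor[OF ab[OF that]])
 show "(restrict (bp a0 b0 (gm 0) (de 0)) (Ob (DL a1 b1)), restrict (bq a0 b0 (gm 0) (de 0)) (Ar (DL a1 b1))) \<in> functors (DL a1 b1) (DL a0 b0)"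
  "(restrict (bp a0 b0 (gm 1) (de 1)) (Ob (DL a1 b1)), restrict (bq a0 b0 (gm 1) (de 1)) (Ar (DL a1 b1))) \<in> functors (DL a1 b1) (DL a0 b0)"
  by (rule bp_functor[OF g0], rule bp_functor[OF g1])
 show "bp a0 b0 (gm 1) (de 1) (?R i F) = bp a0 b0 (gm 0) (de 0) (?R (Suc i) F)" if "Suc i < n" "F \<in> Ob (DL a b)" for i F
  unfolding bp_bp[OF g1 ab[OF Suc_lessD[OF that(1)]] that(2)[unfolded DL_simps]] bp_bp[OF g0 ab[OF that(1)] that(2)[unfolded DL_simps]] ov[OF that(1)] ..
 show "bq a0 b0 (gm 1) (de 1) (bq a1 b1 (al i) (bt i) x) = bq a0 b0 (gm 0) (de 0) (bq a1 b1 (al (Suc i)) (bt (Suc i)) x)"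
  if "Suc i < n" "x \<in> Ar (DL a b)" for i x
  unfolding bq_bq[OF g1 ab[OF Suc_lessD[OF that(1)]] that(2)] bq_bq[OF g0 ab[OF that(1)] that(2)] ov[OF that(1)] ..
 note pre = grid_pre_simps[where m = a1 and n = b1, symmetric]
 show inj: "F = G" if F: "F \<in> Ob (DL a b)" and G: "G \<in> Ob (DL a b)" and eq: "!!i. i < n ==> ?R i F = ?R i G" for F G
 proof (rule grid_dfun_eqI[OF F[unfolded DL_simps] G[unfolded DL_simps]])
  fix x y
  {
   assume "x <= a" "y <= b"
   from cov(1)[OF this] obtain i x' y' where c: "i < n" "x' <= a1" "y' <= b1" "x = al i x'" "y = bt i y'" by blast
   show "on_ob F (x, y) = on_ob G (x, y)" unfolding c(4,5) pre(1)[OF c(2,3), of _ "al i" "bt i"] eq[OF c(1)] ..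
  next
   assume "x < a" "y <= b"
   from cov(2)[OF this] obtain i x' y' where c: "i < n" "x' < a1" "y' <= b1" "Suc x = al i (Suc x')" "x = al i x'" "y = bt i y'" by blast
   show "on_hor F ((x, Suc x), y) = on_hor G ((x, Suc x), y)"
    unfolding c(4) unfolding c(5,6) pre(2)[OF le_SucI[OF order_refl] Suc_leI[OF c(2)] c(3), of _ "al i" "bt i"] eq[OF c(1)] ..
  next
   assume "x <= a" "y < b"
   from cov(3)[OF this] obtain i x' y' where c: "i < n" "x' <= a1" "y' < b1" "Suc y = bt i (Suc y')" "x = al i x'" "y = bt i y'" by blast
   show "on_ver F (x, y, Suc y) = on_ver G (x, y, Suc y)"
    unfolding c(4) unfolding c(5,6) pre(3)[OF c(2) le_SucI[OF order_refl] Suc_leI[OF c(3)], of _ "al i" "bt i"] eq[OF c(1)] ..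
  next
   assume "x < a" "y < b"
   from cov(4)[OF this] obtain i x' y' where c: "i < n" "x' < a1" "y' < b1" "Suc x = al i (Suc x')" "Suc y = bt i (Suc y')" "x = al i x'" "y = bt i y'" by blast
   show "on_sq F ((x, Suc x), y, Suc y) = on_sq G ((x, Suc x), y, Suc y)"
    unfolding c(4,5) unfolding c(6,7) pre(4)[OF le_SucI[OF order_refl] Suc_leI[OF c(2)] le_SucI[OF order_refl] Suc_leI[OF c(3)], of _ "al i" "bt i"] eq[OF c(1)] ..
  }
 qed
 show "f = g" if f: "f \<in> Ar (DL a b)" and g: "g \<in> Ar (DL a b)" and eq: "!!i. i < n ==> bq a1 b1 (al i) (bt i) f = bq a1 b1 (al i) (bt i) g" for f g
 proof -
  obtain F G te te' where f': "f = (F, G, te, te')" by (cases f)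
  obtain F1 G1 te1 te1' where g': "g = (F1, G1, te1, te1')" by (cases g)
  note f = f[unfolded f' DL_Ar] and g = g[unfolded g' DL_Ar]
  have "F = F1" "G = G1" by (rule inj; use f g eq in \<open>simp add: f' g' DL_simps\<close>)+
  moreover have "te = te1"
  proof (rule extensionalityI)
   show "te \<in> extensional (GO a b)" "te1 \<in> extensional (GO a b)" using f g by blast+
   fix A assume "A \<in> GO a b"
   then obtain x y where A: "A = (x, y)" "x <= a" "y <= b" by (auto simp: grid_simps)
   obtain i x' y' where c: "i < n" "x' <= a1" "y' <= b1" "x = al i x'" "y = bt i y'" using cov(1)[OF A(2,3)] by blast
   have "compose (GO a1 b1) te (map_prod (al i) (bt i)) = compose (GO a1 b1) te1 (map_prod (al i) (bt i))"
    using eq[OF c(1)] unfolding f' g' by simp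
   from fun_cong[OF this, of "(x', y')"] show "te A = te1 A" using c(2,3) by (simp add: A(1) c(4,5) compose_def grid_simps)
  qed
  ultimately show ?thesis using f g unfolding f' g' by simp
 qed
 show sur': "\<exists>F\<in>Ob (DL a b). \<forall>i<n. ?R i F = X i"
  if "!!i. i < n ==> X i \<in> Ob (DL a1 b1)" "!!i. Suc i < n ==> bp a0 b0 (gm 1) (de 1) (X i) = bp a0 b0 (gm 0) (de 0) (X (Suc i))" for X
  unfolding DL_simps by (rule sur[of X]) (use that in \<open>simp_all only: DL_simps\<close>)
 show "\<exists>x\<in>Ar (DL a b). \<forall>i<n. bq a1 b1 (al i) (bt i) x = X i"
  if XA: "!!i. i < n ==> X i \<in> Ar (DL a1 b1)" and ch: "!!i. Suc i < n ==> bq a0 b0 (gm 1) (de 1) (X i) = bq a0 b0 (gm 0) (de 0) (X (Suc i))" for X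
 proof -
  define Fs where "Fs i = fst (X i)" for i
  define Gs where "Gs i = fst (snd (X i))" for i
  define T where "T i = fst (snd (snd (X i)))" for i
  define T' where "T' i = snd (snd (snd (X i)))" for i
  have Xe: "X i = (Fs i, Gs i, T i, T' i)" for i by (simp add: Fs_def Gs_def T_def T'_def)
  note XA' = XA[unfolded Xe DL_Ar]
  note ch' = ch[unfolded Xe prod.case]
  have "\<exists>F\<in>Ob (DL a b). \<forall>i<n. ?R i F = Fs i" by (rule sur') (use XA' ch' in \<open>simp_all only: DL_simps prod.inject\<close>)
  then obtain F where F: "F \<in> GDF a b" "!!i. i < n ==> ?R i F = Fs i" by (auto simp: DL_simps)
  have "\<exists>F\<in>Ob (DL a b). \<forall>i<n. ?R i F = Gs i" by (rule sur') (use XA' ch' in \<open>simp_all only: DL_simps prod.inject\<close>)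
  then obtain G where G: "G \<in> GDF a b" "!!i. i < n ==> ?R i G = Gs i" by (auto simp: DL_simps)
  have "T i (gm 1 x, de 1 y) = T (Suc i) (gm 0 x, de 0 y)" if "Suc i < n" "x <= a0" "y <= b0" for i x y
   using ch'[OF that(1), unfolded prod.inject, THEN conjunct2, THEN conjunct2, THEN conjunct1, THEN fun_cong, of "(x, y)"] that
   by (simp add: compose_def grid_simps)
  from surT[of T, OF this] obtain te where t: "!!i x y. i < n ==> x <= a1 ==> y <= b1 ==> te (al i x, bt i y) = T i (x, y)" by blast
  have hn: "hnatural (grid a1 b1) (?R i F) (?R i G) (T i)" if "i < n" for i using XA'[OF that] F(2)[OF that] G(2)[OF that] by simp
  note N = K.hnaturalD[OF hn]
  have "hnatural (grid a b) F G te"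
  proof (rule hnatural_gridI[OF F(1) G(1)])
   fix x y
   {
    assume "x <= a" "y <= b"
    from cov(1)[OF this] obtain i x' y' where c: "i < n" "x' <= a1" "y' <= b1" "x = al i x'" "y = bt i y'" by blast
    show "te (x, y) \<in> hi (on_ob F (x, y)) (on_ob G (x, y))"
     using N(1)[OF c(1), of "(x', y')"] c(2,3) unfolding c(4,5) t[OF c(1-3)] by (simp add: grid_simps grid_pre_simps)
   next
    assume "x < a" "y <= b"
    from cov(2)[OF this] obtain i x' y' where c: "i < n" "x' < a1" "y' <= b1" "Suc x = al i (Suc x')" "x = al i x'" "y = bt i y'" by blast
    show "te (Suc x, y) \<circ>h on_hor F ((x, Suc x), y) = on_hor G ((x, Suc x), y) \<circ>h te (x, y)"
     unfolding c(4) unfolding c(5,6)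
     using N(2)[OF c(1), of "((x', Suc x'), y')" "(x', y')" "(Suc x', y')"] c(1-3) by (simp add: t grid_simps arrows_def grid_pre_simps)
   next
    assume "x <= a" "y < b"
    from cov(3)[OF this] obtain i x' y' where c: "i < n" "x' <= a1" "y' < b1" "Suc y = bt i (Suc y')" "x = al i x'" "y = bt i y'" by blast
    show "ph (te (x, Suc y)) \<circ>v on_ver F (x, y, Suc y) = on_ver G (x, y, Suc y) \<circ>v ph (te (x, y))"
     unfolding c(4) unfolding c(5,6)
     using N(3)[OF c(1), of "(x', y', Suc y')" "(x', y')" "(x', Suc y')"] c(1-3) by (simp add: t grid_simps arrows_def grid_pre_simps)
   next
    fix s u
    assume "x < a" "y < b" and s: "s \<in> sq (te (x, y)) (on_ver F (x, y, Suc y)) (on_ver G (x, y, Suc y)) (te (x, Suc y))"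
     and u: "u \<in> sq (te (Suc x, y)) (on_ver F (Suc x, y, Suc y)) (on_ver G (Suc x, y, Suc y)) (te (Suc x, Suc y))"
    from cov(4)[OF this(1,2)] obtain i x' y' where c: "i < n" "x' < a1" "y' < b1" "Suc x = al i (Suc x')" "Suc y = bt i (Suc y')" "x = al i x'" "y = bt i y'" by blast
    note s = s[unfolded c(4,5), unfolded c(6,7)] and u = u[unfolded c(4,5), unfolded c(6,7)]
    show "u \<bullet>h on_sq F ((x, Suc x), y, Suc y) = on_sq G ((x, Suc x), y, Suc y) \<bullet>h s"
     unfolding c(4,5) unfolding c(6,7)
     using N(4)[OF c(1), of "((x', Suc x'), y', Suc y')" "((x', Suc x'), y')" "(x', y', Suc y')" "(Suc x', y', Suc y')" "((x', Suc x'), Suc y')"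
      "(x', y')" "(x', Suc y')" "(Suc x', y')" "(Suc x', Suc y')" s u] s u c(1-3)
     by (simp add: t grid_simps arrows_def squares_def grid_pre_simps)
   }
  qed
  note x = DL_arrowI_grid[OF F(1) G(1) this, THEN arrowsD(1)]
  let ?x = "(F, G, restrict te (GO a b), restrict (%A. ph (te A)) (GO a b))"
  have "bq a1 b1 (al i) (bt i) ?x = X i" if i: "i < n" for i
  proof -
   note m = functorsD_restrict(2)[OF bp_functor[OF ab[OF i]] DL_arrowI_grid[OF F(1) G(1) \<open>hnatural (grid a b) F G te\<close>], unfolded DL_simps,
     OF F(1) G(1), THEN arrowsD(1), unfolded prod.case F(2)[OF i] G(2)[OF i]]
   show ?thesis
    unfolding prod.case F(2)[OF i] G(2)[OF i] Xe
    by (rule DL_arrow_eqI[OF m XA[OF i, unfolded Xe]])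
     (use t[OF i] Delta_le[OF ab(1)[OF i]] Delta_le[OF ab(2)[OF i]] in \<open>simp add: compose_def grid_simps\<close>)
  qed
  then show ?thesis using x by blast
 qed
qed

lemma glue_sequence:
 assumes "0 < n" and ch: "!!i. Suc i < n ==> q i = p (Suc i)"
 obtains W where "!!i. i < n ==> W i = p i" "!!i. i < n ==> W (Suc i) = q i"
proof
 \<comment> \<open>The index \<open>n\<close> is the source of no entry, so its value is the target
   of the last one; this is where \<open>0 < n\<close> matters.\<close>
 let ?W = "%i. if i < n then p i else q (n - 1)"
 show "?W i = p i" if "i < n" for i using that by simp
 show "?W (Suc i) = q i" if "i < n" for i using ch[of i] that by (cases "Suc i < n") (auto simp: not_less dest: le_antisym)
qed

lemma grid_covers:
 assumes "0 < n"
 shows "x <= n ==> \<exists>i<n. \<exists>x'\<le>1. x = edge i x'" "x < n ==> \<exists>i<n. \<exists>x'<1. x = edge i x' & Suc x = edge i (Suc x')"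
  "y <= k ==> \<exists>y'\<le>k. y = Delta_id k y'" "y < k ==> \<exists>y'<k. y = Delta_id k y' & Suc y = Delta_id k (Suc y')"
proof -
 show "\<exists>i<n. \<exists>x'\<le>1. x = edge i x'" if "x <= n"
 proof (cases "x < n")
  case False
  \<comment> \<open>The last vertex starts no edge and is reached as the target of the last
    one.\<close>
  then have "x = edge (n - 1) 1" using assms that by (simp add: edge_def)
  then show ?thesis using assms by (intro exI[of _ "n - 1"]) auto
 next
  case True
  then show ?thesis by (intro exI[of _ x] conjI exI[of _ "0::nat"]) (simp_all add: edge_simps)
 qed
qed (auto simp: edge_simps Delta_id_simps)

text \<open>Matching slabs agree on their common column, so their vertices, edges and squares
  assemble to the data of \<open>grid_glue\<close>.\<close>

lemma h_segal:
 assumes n: "n \<ge> 2"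
 shows "weak_equivalence (level CD n k) (chain_sset n (level CD 1 k) (h_end CD k 0) (h_end CD k 1)) (h_segal_map CD n k)"
 unfolding CD_simps CD_ends
proof (rule segal_equivalence[of n edge 1 n "%_. Delta_id k" k k vertex 0 "%_. Delta_id k" k])
 have n0: "0 < n" using n by simp
 note cov = grid_covers[OF n0]
 show "\<exists>F\<in>GDF n k. \<forall>i<n. bp 1 k (edge i) (Delta_id k) F = X i"
  if X: "!!i. i < n ==> X i \<in> GDF 1 k"
   and ch: "!!i. Suc i < n ==> bp 0 k (vertex 1) (Delta_id k) (X i) = bp 0 k (vertex 0) (Delta_id k) (X (Suc i))" for X
 proof -
  note X' = grid_dfunD[OF X]
  have cho: "on_ob (X i) (Suc 0, j) = on_ob (X (Suc i)) (0, j)" if "Suc i < n" "j <= k" for i j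
   using arg_cong[OF ch[OF that(1)], of "%F. on_ob F (0, j)"] that by (simp add: grid_pre_simps vertex_simps Delta_id_simps)
  have chv: "on_ver (X i) (Suc 0, j, Suc j) = on_ver (X (Suc i)) (0, j, Suc j)" if "Suc i < n" "j < k" for i j
   using arg_cong[OF ch[OF that(1)], of "%F. on_ver F (0, j, Suc j)"] that by (simp add: grid_pre_simps vertex_simps Delta_id_simps)
  \<comment> \<open>A whole column is packed into one restricted function, so that
    \<open>glue_sequence\<close> glues all its entries at once.\<close>
  have "(\<lambda>j\<in>{..k}. on_ob (X i) (Suc 0, j)) = (\<lambda>j\<in>{..k}. on_ob (X (Suc i)) (0, j))" if "Suc i < n" for i
   using cho[OF that] by auto
  from glue_sequence[OF n0, of "%i. \<lambda>j\<in>{..k}. on_ob (X i) (Suc 0, j)" "%i. \<lambda>j\<in>{..k}. on_ob (X i) (0, j)", OF this]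
  obtain p where p: "!!i. i < n ==> p i = (\<lambda>j\<in>{..k}. on_ob (X i) (0, j))" "!!i. i < n ==> p (Suc i) = (\<lambda>j\<in>{..k}. on_ob (X i) (Suc 0, j))" by blast
  have "(\<lambda>j\<in>{..<k}. on_ver (X i) (Suc 0, j, Suc j)) = (\<lambda>j\<in>{..<k}. on_ver (X (Suc i)) (0, j, Suc j))" if "Suc i < n" for i
   using chv[OF that] by auto
  from glue_sequence[OF n0, of "%i. \<lambda>j\<in>{..<k}. on_ver (X i) (Suc 0, j, Suc j)" "%i. \<lambda>j\<in>{..<k}. on_ver (X i) (0, j, Suc j)", OF this]
  obtain b where b: "!!i. i < n ==> b i = (\<lambda>j\<in>{..<k}. on_ver (X i) (0, j, Suc j))" "!!i. i < n ==> b (Suc i) = (\<lambda>j\<in>{..<k}. on_ver (X i) (Suc 0, j, Suc j))" by blast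
  have i': "\<exists>i'<n. i = i' \<or> i = Suc i'" if "i <= n" for i using that n0 by (cases "i < n") (auto intro: exI[of _ "n - 1"])
  obtain F where F: "F \<in> GDF n k"
   "!!i j. i <= n ==> j <= k ==> on_ob F (i, j) = p i j"
   "!!i j. i < n ==> j <= k ==> on_hor F ((i, Suc i), j) = on_hor (X i) ((0, Suc 0), j)"
   "!!i j. i <= n ==> j < k ==> on_ver F (i, j, Suc j) = b i j"
   "!!i j. i < n ==> j < k ==> on_sq F ((i, Suc i), j, Suc j) = on_sq (X i) ((0, Suc 0), j, Suc j)"
  proof (rule grid_glue[of n k p "%i j. on_hor (X i) ((0, Suc 0), j)" b "%i j. on_sq (X i) ((0, Suc 0), j, Suc j)"])
   show "p i j \<in> OB" if "i <= n" "j <= k" for i j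
    using i'[OF that(1)] X'(1)[of _ 0 j] X'(1)[of _ "Suc 0" j] that(2) p by auto
   show "on_hor (X i) ((0, Suc 0), j) \<in> hm (p i j) (p (Suc i) j)" if "i < n" "j <= k" for i j
    using X'(2)[OF that(1), of 0 "Suc 0" j] that p by simp
   show "b i j \<in> vm (p i j) (p i (Suc j))" if "i <= n" "j < k" for i j
    using i'[OF that(1)] X'(5)[of _ 0 j "Suc j"] X'(5)[of _ "Suc 0" j "Suc j"] that(2) p b by auto
   show "on_sq (X i) ((0, Suc 0), j, Suc j) \<in> sq (on_hor (X i) ((0, Suc 0), j)) (b i j) (b (Suc i) j) (on_hor (X i) ((0, Suc 0), Suc j))"
    if "i < n" "j < k" for i j
    using X'(8)[OF that(1), of 0 "Suc 0" j "Suc j"] that b by simp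
  qed blast
  have le1: "x <= Suc 0 \<longleftrightarrow> x = 0 \<or> x = Suc 0" for x by auto
  have "bp 1 k (edge i) (Delta_id k) F = X i" if i: "i < n" for i
   by (rule grid_dfun_eqI[OF bp_mem[OF edge_mem[OF i] Delta_id_mem F(1)] X[OF i]])
    (use i F(2-5) p[OF i] b[OF i] in \<open>auto simp: grid_pre_simps edge_simps Delta_id_simps le1\<close>)
  then show ?thesis using F(1) by blast
 qed
 show "\<exists>te. \<forall>i<n. \<forall>x\<le>1. \<forall>y\<le>k. te (edge i x, Delta_id k y) = T i (x, y)"
  if ch: "!!i x y. Suc i < n ==> x <= 0 ==> y <= k ==> T i (vertex 1 x, Delta_id k y) = T (Suc i) (vertex 0 x, Delta_id k y)"
  for T :: "nat => nat \<times> nat => 'h"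
 proof -
  have "(\<lambda>j\<in>{..k}. T i (Suc 0, j)) = (\<lambda>j\<in>{..k}. T (Suc i) (0, j))" if "Suc i < n" for i
   using ch[OF that, of 0, simplified] by (auto simp: fun_eq_iff vertex_simps Delta_id_simps)
  from glue_sequence[OF n0, of "%i. \<lambda>j\<in>{..k}. T i (Suc 0, j)" "%i. \<lambda>j\<in>{..k}. T i (0, j)", OF this]
  obtain W where W: "!!i. i < n ==> W i = (\<lambda>j\<in>{..k}. T i (0, j))" "!!i. i < n ==> W (Suc i) = (\<lambda>j\<in>{..k}. T i (Suc 0, j))" by blast
  have le1: "x <= Suc 0 \<longleftrightarrow> x = 0 \<or> x = Suc 0" for x by auto
  show ?thesis
   by (rule exI[of _ "%(i, j). W i j"]) (auto simp: W edge_simps Delta_id_simps le1)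
 qed
 show "compose {..0} (edge i) (vertex 1) = compose {..0} (edge (Suc i)) (vertex 0)" for i unfolding compose_edge_vertex ..
 show "\<exists>i<n. \<exists>x'\<le>1. \<exists>y'\<le>k. x = edge i x' & y = Delta_id k y'" if "x <= n" "y <= k" for x y
  using cov(1)[OF that(1)] cov(3)[OF that(2)] by blast
 show "\<exists>i<n. \<exists>x'<1. \<exists>y'\<le>k. x = edge i x' & Suc x = edge i (Suc x') & y = Delta_id k y'" if "x < n" "y <= k" for x y
  using cov(2)[OF that(1)] cov(3)[OF that(2)] by blast
 show "\<exists>i<n. \<exists>x'\<le>1. \<exists>y'<k. x = edge i x' & y = Delta_id k y' & Suc y = Delta_id k (Suc y')" if "x <= n" "y < k" for x y
  using cov(1)[OF that(1)] cov(4)[OF that(2)] by blast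
 show "\<exists>i<n. \<exists>x'<1. \<exists>y'<k. x = edge i x' & Suc x = edge i (Suc x') & y = Delta_id k y' & Suc y = Delta_id k (Suc y')" if "x < n" "y < k" for x y
  using cov(2)[OF that(1)] cov(4)[OF that(2)] by blast
qed (rule edge_mem, assumption | rule vertex_mem, assumption | rule Delta_id_mem | rule refl)+

text \<open>As for \<open>h_segal\<close>, with slabs stacked along rows instead of columns.\<close>

lemma v_segal:
 assumes n: "n \<ge> 2"
 shows "weak_equivalence (level CD k n) (chain_sset n (level CD k 1) (v_end CD k 0) (v_end CD k 1)) (v_segal_map CD k n)"
 unfolding CD_simps CD_ends
proof (rule segal_equivalence[of n "%_. Delta_id k" k k edge 1 n "%_. Delta_id k" k vertex 0])
 have n0: "0 < n" using n by simp
 note cov = grid_covers[OF n0]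
 show "\<exists>F\<in>GDF k n. \<forall>i<n. bp k 1 (Delta_id k) (edge i) F = X i"
  if X: "!!i. i < n ==> X i \<in> GDF k 1"
   and ch: "!!i. Suc i < n ==> bp k 0 (Delta_id k) (vertex 1) (X i) = bp k 0 (Delta_id k) (vertex 0) (X (Suc i))" for X
 proof -
  note X' = grid_dfunD[OF X]
  have cho: "on_ob (X i) (j, Suc 0) = on_ob (X (Suc i)) (j, 0)" if "Suc i < n" "j <= k" for i j
   using arg_cong[OF ch[OF that(1)], of "%F. on_ob F (j, 0)"] that by (simp add: grid_pre_simps vertex_simps Delta_id_simps)
  have chv: "on_hor (X i) ((j, Suc j), Suc 0) = on_hor (X (Suc i)) ((j, Suc j), 0)" if "Suc i < n" "j < k" for i j
   using arg_cong[OF ch[OF that(1)], of "%F. on_hor F ((j, Suc j), 0)"] that by (simp add: grid_pre_simps vertex_simps Delta_id_simps)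
  have "(\<lambda>j\<in>{..k}. on_ob (X i) (j, Suc 0)) = (\<lambda>j\<in>{..k}. on_ob (X (Suc i)) (j, 0))" if "Suc i < n" for i
   using cho[OF that] by auto
  from glue_sequence[OF n0, of "%i. \<lambda>j\<in>{..k}. on_ob (X i) (j, Suc 0)" "%i. \<lambda>j\<in>{..k}. on_ob (X i) (j, 0)", OF this]
  obtain p where p: "!!i. i < n ==> p i = (\<lambda>j\<in>{..k}. on_ob (X i) (j, 0))" "!!i. i < n ==> p (Suc i) = (\<lambda>j\<in>{..k}. on_ob (X i) (j, Suc 0))" by blast
  have "(\<lambda>j\<in>{..<k}. on_hor (X i) ((j, Suc j), Suc 0)) = (\<lambda>j\<in>{..<k}. on_hor (X (Suc i)) ((j, Suc j), 0))" if "Suc i < n" for i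
   using chv[OF that] by auto
  from glue_sequence[OF n0, of "%i. \<lambda>j\<in>{..<k}. on_hor (X i) ((j, Suc j), Suc 0)" "%i. \<lambda>j\<in>{..<k}. on_hor (X i) ((j, Suc j), 0)", OF this]
  obtain b where b: "!!i. i < n ==> b i = (\<lambda>j\<in>{..<k}. on_hor (X i) ((j, Suc j), 0))" "!!i. i < n ==> b (Suc i) = (\<lambda>j\<in>{..<k}. on_hor (X i) ((j, Suc j), Suc 0))" by blast
  have i': "\<exists>i'<n. i = i' \<or> i = Suc i'" if "i <= n" for i using that n0 by (cases "i < n") (auto intro: exI[of _ "n - 1"])
  obtain F where F: "F \<in> GDF k n"
   "!!i j. i <= n ==> j <= k ==> on_ob F (j, i) = p i j"
   "!!i j. i < n ==> j <= k ==> on_ver F (j, i, Suc i) = on_ver (X i) (j, 0, Suc 0)"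
   "!!i j. i <= n ==> j < k ==> on_hor F ((j, Suc j), i) = b i j"
   "!!i j. i < n ==> j < k ==> on_sq F ((j, Suc j), i, Suc i) = on_sq (X i) ((j, Suc j), 0, Suc 0)"
  proof (rule grid_glue[of k n "%j i. p i j" "%j i. b i j" "%j i. on_ver (X i) (j, 0, Suc 0)" "%j i. on_sq (X i) ((j, Suc j), 0, Suc 0)"])
   show "p i j \<in> OB" if "i <= n" "j <= k" for i j
    using i'[OF that(1)] X'(1)[of _ j 0] X'(1)[of _ j "Suc 0"] that(2) p by auto
   show "on_ver (X i) (j, 0, Suc 0) \<in> vm (p i j) (p (Suc i) j)" if "i < n" "j <= k" for i j
    using X'(5)[OF that(1), of j 0 "Suc 0"] that p by simp
   show "b i j \<in> hm (p i j) (p i (Suc j))" if "i <= n" "j < k" for i j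
    using i'[OF that(1)] X'(2)[of _ j "Suc j" 0] X'(2)[of _ j "Suc j" "Suc 0"] that(2) p b by auto
   show "on_sq (X i) ((j, Suc j), 0, Suc 0) \<in> sq (b i j) (on_ver (X i) (j, 0, Suc 0)) (on_ver (X i) (Suc j, 0, Suc 0)) (b (Suc i) j)"
    if "i < n" "j < k" for i j
    using X'(8)[OF that(1), of j "Suc j" 0 "Suc 0"] that b by simp
  qed blast
  have le1: "x <= Suc 0 \<longleftrightarrow> x = 0 \<or> x = Suc 0" for x by auto
  have "bp k 1 (Delta_id k) (edge i) F = X i" if i: "i < n" for i
   by (rule grid_dfun_eqI[OF bp_mem[OF Delta_id_mem edge_mem[OF i] F(1)] X[OF i]])
    (use i F(2-5) p[OF i] b[OF i] in \<open>auto simp: grid_pre_simps edge_simps Delta_id_simps le1\<close>)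
  then show ?thesis using F(1) by blast
 qed
 show "\<exists>te. \<forall>i<n. \<forall>x\<le>k. \<forall>y\<le>1. te (Delta_id k x, edge i y) = T i (x, y)"
  if ch: "!!i x y. Suc i < n ==> x <= k ==> y <= 0 ==> T i (Delta_id k x, vertex 1 y) = T (Suc i) (Delta_id k x, vertex 0 y)"
  for T :: "nat => nat \<times> nat => 'h"
 proof -
  have "(\<lambda>j\<in>{..k}. T i (j, Suc 0)) = (\<lambda>j\<in>{..k}. T (Suc i) (j, 0))" if "Suc i < n" for i
   using ch[OF that, of _ 0, simplified] by (auto simp: fun_eq_iff vertex_simps Delta_id_simps)
  from glue_sequence[OF n0, of "%i. \<lambda>j\<in>{..k}. T i (j, Suc 0)" "%i. \<lambda>j\<in>{..k}. T i (j, 0)", OF this]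
  obtain W where W: "!!i. i < n ==> W i = (\<lambda>j\<in>{..k}. T i (j, 0))" "!!i. i < n ==> W (Suc i) = (\<lambda>j\<in>{..k}. T i (j, Suc 0))" by blast
  have le1: "x <= Suc 0 \<longleftrightarrow> x = 0 \<or> x = Suc 0" for x by auto
  show ?thesis
   by (rule exI[of _ "%(j, i). W i j"]) (auto simp: W edge_simps Delta_id_simps le1)
 qed
 show "compose {..0} (edge i) (vertex 1) = compose {..0} (edge (Suc i)) (vertex 0)" for i unfolding compose_edge_vertex ..
 show "\<exists>i<n. \<exists>x'\<le>k. \<exists>y'\<le>1. x = Delta_id k x' & y = edge i y'" if "x <= k" "y <= n" for x y
  using cov(1)[OF that(2)] cov(3)[OF that(1)] by blast
 show "\<exists>i<n. \<exists>x'<k. \<exists>y'\<le>1. x = Delta_id k x' & Suc x = Delta_id k (Suc x') & y = edge i y'" if "x < k" "y <= n" for x y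
  using cov(1)[OF that(2)] cov(4)[OF that(1)] by blast
 show "\<exists>i<n. \<exists>x'\<le>k. \<exists>y'<1. x = Delta_id k x' & y = edge i y' & Suc y = edge i (Suc y')" if "x <= k" "y < n" for x y
  using cov(2)[OF that(2)] cov(3)[OF that(1)] by blast
 show "\<exists>i<n. \<exists>x'<k. \<exists>y'<1. x = Delta_id k x' & Suc x = Delta_id k (Suc x') & y = edge i y' & Suc y = edge i (Suc y')" if "x < k" "y < n" for x y
  using cov(2)[OF that(2)] cov(4)[OF that(1)] by blast
qed (rule edge_mem, assumption | rule vertex_mem, assumption | rule Delta_id_mem | rule refl)+

end

section \<open>Arrows, squares and their isomorphisms\<close>

context shared_dblcat begin

abbreviation "sqd \<equiv> square_dfun D"

lemma square_dfun_eq: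
 assumes F: "F \<in> GDF 1 1"
 shows "sqd (on_sq F ((0, 1), 0, 1)) = F"
proof -
 note F' = grid_dfunD[OF F] and ext = grid_dfun_ext[OF F]
 have le1: "i <= Suc 0 \<longleftrightarrow> i = 0 \<or> i = Suc 0" for i by auto
 let ?s = "on_sq F ((0, 1), 0, 1)"
 have s: "?s \<in> sq (on_hor F ((0, 1), 0)) (on_ver F (0, 0, 1)) (on_ver F (1, 0, 1)) (on_hor F ((0, 1), 1))"
  using F'(8)[of 0 1 0 1] by simp
 then have e: "top_edge D ?s = on_hor F ((0, 1), 0)" "bottom_edge D ?s = on_hor F ((0, 1), 1)"
  "left_edge D ?s = on_ver F (0, 0, 1)" "right_edge D ?s = on_ver F (1, 0, 1)" by (auto simp: squares_def)
 have c: "on_hor F ((0, Suc 0), 0) \<in> hm (on_ob F (0, 0)) (on_ob F (Suc 0, 0))" "on_hor F ((0, Suc 0), Suc 0) \<in> hm (on_ob F (0, Suc 0)) (on_ob F (Suc 0, Suc 0))"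
  using F'(2)[of 0 1 0] F'(2)[of 0 1 1] by simp_all
 note c' = arrowsD[OF c(1)] arrowsD[OF c(2)]
 have "on_ob (sqd ?s) = on_ob F"
  by (rule extensionalityI[OF _ ext(1)]) (use c' e in \<open>auto simp: square_dfun_def Let_def grid_simps le1\<close>)
 moreover have "on_hor (sqd ?s) = on_hor F"
  by (rule extensionalityI[OF _ ext(2)]) (use c' e F'(3) in \<open>auto simp: square_dfun_def Let_def grid_simps le1\<close>)
 moreover have "on_ver (sqd ?s) = on_ver F"
  by (rule extensionalityI[OF _ ext(3)]) (use c' e F'(6) in \<open>auto simp: square_dfun_def Let_def grid_simps le1\<close>)
 moreover have "on_sq (sqd ?s) = on_sq F"
  by (rule extensionalityI[OF _ ext(4)]) (use c' e F'(6,9) F'(10)[of 0 1] in \<open>auto simp: square_dfun_def Let_def grid_simps le1\<close>)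
 ultimately show ?thesis by (intro dfun.equality) (simp_all add: square_dfun_def Let_def)
qed

text \<open>Freeness of the grid gives a double functor whose unit square is \<open>s\<close>, and
  \<open>square_dfun_eq\<close> identifies it with the explicit one.\<close>

lemma square_dfun_mem:
 assumes s: "s \<in> sq f h k g"
 shows "sqd s \<in> GDF 1 1"
proof -
 note S = sqD[OF s]
 have b: "f \<in> hm (src (hor D) f) (trg (hor D) f)" "g \<in> hm (src (hor D) g) (trg (hor D) g)"
  "h \<in> vm (src (hor D) f) (src (hor D) g)" "k \<in> vm (trg (hor D) f) (trg (hor D) g)"
  using S(4-7) by (simp_all add: arrows_def)
 note o = H.arrows_Ob[OF b(1)] H.arrows_Ob[OF b(2)]
 let ?row = "%j. if j = (0::nat) then f else g"
 obtain F where "F \<in> GDF 1 1" "on_sq F ((0, Suc 0), 0, Suc 0) = s"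
 proof (rule grid_glue[of 1 1 "%i j. if i = 0 then src (hor D) (?row j) else trg (hor D) (?row j)" "%i j. ?row j"
    "%i j. if i = 0 then h else k" "%i j. s"])
  fix F assume F: "F \<in> GDF 1 1" and "!!i j. i < 1 ==> j < 1 ==> on_sq F ((i, Suc i), j, Suc j) = s"
  then show thesis using that[OF F] by simp
 qed (use s b o in auto)
 then show ?thesis using square_dfun_eq[of F] by simp
qed

lemma square_dfun_simps:
 assumes s: "s \<in> sq f h k g"
 shows "on_hor (sqd s) ((0, Suc 0), 0) = f" "on_hor (sqd s) ((0, Suc 0), Suc 0) = g"
  "on_ver (sqd s) (0, 0, Suc 0) = h" "on_ver (sqd s) (Suc 0, 0, Suc 0) = k" "on_sq (sqd s) ((0, Suc 0), 0, Suc 0) = s"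
  "on_ob (sqd s) (0, 0) = src (hor D) f" "on_ob (sqd s) (Suc 0, 0) = trg (hor D) f"
  "on_ob (sqd s) (0, Suc 0) = src (hor D) g" "on_ob (sqd s) (Suc 0, Suc 0) = trg (hor D) g"
 using s by (auto simp: square_dfun_def Let_def grid_simps squares_def)

lemma GDF_square:
 assumes F: "F \<in> GDF 1 1"
 obtains s f h k g where "s \<in> sq f h k g" "F = sqd s"
 using square_dfun_eq[OF F] grid_dfunD(8)[OF F, of 0 1 0 1] by force

lemma hnatural_square_dfun:
 assumes s: "s \<in> sq f h k g" and s': "s' \<in> sq f' h' k' g'"
 shows "hnatural (grid 1 1) (sqd s) (sqd s') te \<longleftrightarrow>
  te (0, 0) \<in> hi (src (hor D) f) (src (hor D) f') & te (Suc 0, 0) \<in> hi (trg (hor D) f) (trg (hor D) f') &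
  te (0, Suc 0) \<in> hi (src (hor D) g) (src (hor D) g') & te (Suc 0, Suc 0) \<in> hi (trg (hor D) g) (trg (hor D) g') &
  te (Suc 0, 0) \<circ>h f = f' \<circ>h te (0, 0) & te (Suc 0, Suc 0) \<circ>h g = g' \<circ>h te (0, Suc 0) &
  ph (te (0, Suc 0)) \<circ>v h = h' \<circ>v ph (te (0, 0)) & ph (te (Suc 0, Suc 0)) \<circ>v k = k' \<circ>v ph (te (Suc 0, 0)) &
  (\<forall>u\<in>sq (te (0, 0)) h h' (te (0, Suc 0)). \<forall>t\<in>sq (te (Suc 0, 0)) k k' (te (Suc 0, Suc 0)). t \<bullet>h s = s' \<bullet>h u)"
 (is "?l \<longleftrightarrow> ?r")
proof
 interpret dfun_target D ph "grid 1 1" by (rule dfun_target_grid)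
 note v = square_dfun_simps[OF s] square_dfun_simps[OF s']
 assume n: ?l
 note N = hnaturalD[OF n]
 show ?r
  using N(1)[of "(0, 0)"] N(1)[of "(Suc 0, 0)"] N(1)[of "(0, Suc 0)"] N(1)[of "(Suc 0, Suc 0)"]
   N(2)[of "((0, Suc 0), 0)" "(0, 0)" "(Suc 0, 0)"] N(2)[of "((0, Suc 0), Suc 0)" "(0, Suc 0)" "(Suc 0, Suc 0)"]
   N(3)[of "(0, 0, Suc 0)" "(0, 0)" "(0, Suc 0)"] N(3)[of "(Suc 0, 0, Suc 0)" "(Suc 0, 0)" "(Suc 0, Suc 0)"]
   N(4)[of "((0, Suc 0), 0, Suc 0)" "((0, Suc 0), 0)" "(0, 0, Suc 0)" "(Suc 0, 0, Suc 0)" "((0, Suc 0), Suc 0)" "(0, 0)" "(0, Suc 0)" "(Suc 0, 0)" "(Suc 0, Suc 0)"]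
  by (simp add: v grid_simps arrows_def squares_def)
next
 note v = square_dfun_simps[OF s] square_dfun_simps[OF s']
 have le1: "i <= Suc 0 \<longleftrightarrow> i = 0 \<or> i = Suc 0" for i by auto
 assume ?r
 then show ?l
  by (intro hnatural_gridI[OF square_dfun_mem[OF s] square_dfun_mem[OF s']]) (auto simp: v le1)
qed

lemma vertical_GDF:
 assumes h: "h \<in> vm A C"
 obtains L where "L \<in> GDF 0 1" "on_ver L (0, 0, Suc 0) = h"
proof -
 obtain L where "L \<in> GDF 0 1" "on_ver L (0, 0, Suc 0) = h"
 proof (rule grid_glue[of 0 1 "%i j. if j = 0 then A else C" undefined "%i j. h" undefined])
  fix F assume F: "F \<in> GDF 0 1" and "!!i j. i <= 0 ==> j < 1 ==> on_ver F (i, j, Suc j) = h"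
  then show thesis using that[OF F] by simp
 qed (use h V.arrows_Ob[OF h] same_objects in auto)
 then show thesis by (rule that)
qed

lemma horizontal_GDF:
 assumes f: "f \<in> hm A B"
 obtains T where "T \<in> GDF 1 0" "on_hor T ((0, Suc 0), 0) = f"
proof -
 obtain T where "T \<in> GDF 1 0" "on_hor T ((0, Suc 0), 0) = f"
 proof (rule grid_glue[of 1 0 "%i j. if i = 0 then A else B" "%i j. f" undefined undefined])
  fix F assume F: "F \<in> GDF 1 0" and "!!i j. i < 1 ==> j <= 0 ==> on_hor F ((i, Suc i), j) = f"
  then show thesis using that[OF F] by simp
 qed (use f H.arrows_Ob[OF f] in auto)
 then show thesis by (rule that)
qed

lemma vertical_GDF_arrow:
 assumes L: "L \<in> GDF 0 1"
 shows "on_ver L (0, 0, Suc 0) \<in> vm (on_ob L (0, 0)) (on_ob L (0, Suc 0))"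
 using grid_dfunD(5)[OF L, of 0 0 1] by simp

lemma horizontal_GDF_arrow:
 assumes T: "T \<in> GDF 1 0"
 shows "on_hor T ((0, Suc 0), 0) \<in> hm (on_ob T (0, 0)) (on_ob T (Suc 0, 0))"
 using grid_dfunD(2)[OF T, of 0 1 0] by simp

lemma vertical_GDF_eqI:
 assumes L: "L \<in> GDF 0 1" and L': "L' \<in> GDF 0 1" and e: "on_ver L (0, 0, Suc 0) = on_ver L' (0, 0, Suc 0)"
 shows "L = L'"
proof -
 have le1: "i <= Suc 0 \<longleftrightarrow> i = 0 \<or> i = Suc 0" for i by auto
 show ?thesis
  by (rule grid_dfun_eqI[OF L L'])
   (use arrowsD(2,3)[OF vertical_GDF_arrow[OF L]] arrowsD(2,3)[OF vertical_GDF_arrow[OF L']] e in \<open>auto simp: le1\<close>)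
qed

lemma horizontal_GDF_eqI:
 assumes L: "T \<in> GDF 1 0" and L': "T' \<in> GDF 1 0" and e: "on_hor T ((0, Suc 0), 0) = on_hor T' ((0, Suc 0), 0)"
 shows "T = T'"
proof -
 have le1: "i <= Suc 0 \<longleftrightarrow> i = 0 \<or> i = Suc 0" for i by auto
 show ?thesis
  by (rule grid_dfun_eqI[OF L L'])
   (use arrowsD(2,3)[OF horizontal_GDF_arrow[OF L]] arrowsD(2,3)[OF horizontal_GDF_arrow[OF L']] e in \<open>auto simp: le1\<close>)
qed

lemma hnatural_vertical:
 assumes L: "L \<in> GDF 0 1" and L': "L' \<in> GDF 0 1"
 shows "hnatural (grid 0 1) L L' te \<longleftrightarrow> te (0, 0) \<in> hi (on_ob L (0, 0)) (on_ob L' (0, 0)) &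
  te (0, Suc 0) \<in> hi (on_ob L (0, Suc 0)) (on_ob L' (0, Suc 0)) &
  ph (te (0, Suc 0)) \<circ>v on_ver L (0, 0, Suc 0) = on_ver L' (0, 0, Suc 0) \<circ>v ph (te (0, 0))"
 (is "?l \<longleftrightarrow> ?r")
proof
 interpret dfun_target D ph "grid 0 1" by (rule dfun_target_grid)
 assume n: ?l
 note N = hnaturalD[OF n]
 show ?r using N(1)[of "(0, 0)"] N(1)[of "(0, Suc 0)"] N(3)[of "(0, 0, Suc 0)" "(0, 0)" "(0, Suc 0)"]
  by (simp add: grid_simps arrows_def)
next
 have le1: "i <= Suc 0 \<longleftrightarrow> i = 0 \<or> i = Suc 0" for i by auto
 assume ?r
 then show ?l by (intro hnatural_gridI[OF L L']) (auto simp: le1)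
qed

lemma hnatural_horizontal:
 assumes L: "T \<in> GDF 1 0" and L': "T' \<in> GDF 1 0"
 shows "hnatural (grid 1 0) T T' te \<longleftrightarrow> te (0, 0) \<in> hi (on_ob T (0, 0)) (on_ob T' (0, 0)) &
  te (Suc 0, 0) \<in> hi (on_ob T (Suc 0, 0)) (on_ob T' (Suc 0, 0)) &
  te (Suc 0, 0) \<circ>h on_hor T ((0, Suc 0), 0) = on_hor T' ((0, Suc 0), 0) \<circ>h te (0, 0)"
 (is "?l \<longleftrightarrow> ?r")
proof
 interpret dfun_target D ph "grid 1 0" by (rule dfun_target_grid)
 assume n: ?l
 note N = hnaturalD[OF n]
 show ?r using N(1)[of "(0, 0)"] N(1)[of "(Suc 0, 0)"] N(2)[of "((0, Suc 0), 0)" "(0, 0)" "(Suc 0, 0)"]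
  by (simp add: grid_simps arrows_def)
next
 have le1: "i <= Suc 0 \<longleftrightarrow> i = 0 \<or> i = Suc 0" for i by auto
 assume ?r
 then show ?l by (intro hnatural_gridI[OF L L']) (auto simp: le1)
qed

text \<open>The new square is \<open>s\<close> with the inverse of the left comparison square pasted
  to its left and the right comparison square pasted to its right. Composed with the comparison
  square at the left, the inverse cancels.\<close>

lemma transport_square:
 assumes s: "s \<in> sq f h k g"
  and a: "al \<in> hi (src (hor D) f) A" and b: "bt \<in> hi (trg (hor D) f) B"
  and c: "gm \<in> hi (src (hor D) g) C" and d: "de \<in> hi (trg (hor D) g) E"
  and f': "f' \<in> hm A B" "bt \<circ>h f = f' \<circ>h al" and g': "g' \<in> hm C E" "de \<circ>h g = g' \<circ>h gm"
  and h': "h' \<in> vm A C" "ph gm \<circ>v h = h' \<circ>v ph al" and k': "k' \<in> vm B E" "ph de \<circ>v k = k' \<circ>v ph bt"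
 obtains s' where "s' \<in> sq f' h' k' g'" "!!u t. u \<in> sq al h h' gm ==> t \<in> sq bt k k' de ==> t \<bullet>h s = s' \<bullet>h u"
proof -
 note S = sqD[OF s]
 have fe: "f \<in> hm (src (hor D) f) (trg (hor D) f)" "g \<in> hm (src (hor D) g) (trg (hor D) g)"
  "h \<in> vm (src (hor D) f) (src (hor D) g)" "k \<in> vm (trg (hor D) f) (trg (hor D) g)"
  using S(4-7) by (simp_all add: arrows_def)
 note ai = H.isos_inv[OF a] and ci = H.isos_inv[OF c]
 note pa = phi_inv[OF a] and pc = phi_inv[OF c]
 note aa = H.isos_arrows[OF a] and ca = H.isos_arrows[OF c] and aia = H.isos_arrows[OF ai(1)] and cia = H.isos_arrows[OF ci(1)]
 have pa': "ph al \<circ>v ph (hinv al) = idv A" using pa arrowsD[OF phi_arrow[OF a]] by (simp add: inverses_def)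
 have pc': "ph (hinv gm) \<circ>v ph gm = idv (src (hor D) g)" using pc arrowsD[OF phi_arrow[OF c]] by (simp add: inverses_def)
 note pA = phi_arrow[OF a] phi_arrow[OF c] phi_arrow[OF ai(1)] phi_arrow[OF ci(1)]
 \<comment> \<open>Naturality on the left edge is turned around, which is the condition for the
   inverse comparison square to exist.\<close>
 have "h \<circ>v ph (hinv al) = (ph (hinv gm) \<circ>v (ph gm \<circ>v h)) \<circ>v ph (hinv al)"
  using V.assoc_arrows[OF fe(3) pA(2) pA(4)] pc' V.ident_left[OF fe(3)] by simp
 also have "\<dots> = ph (hinv gm) \<circ>v (h' \<circ>v (ph al \<circ>v ph (hinv al)))"
  using V.assoc_arrows[OF pA(3) pA(1) h'(1)] V.assoc_arrows[OF pA(3) V.cmp_arrows[OF pA(1) h'(1)] pA(4)] h'(2) by simp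
 also have "\<dots> = ph (hinv gm) \<circ>v h'" using pa' V.ident_right[OF h'(1)] by simp
 finally obtain l where l: "l \<in> sq (hinv al) h' h (hinv gm)" using sq_ver[OF h'(1) fe(3) ai(1) ci(1)] by auto
 obtain r where r: "r \<in> sq bt k k' de" using sq_ver[OF fe(4) k'(1) b d] k'(2) by auto
 let ?s = "r \<bullet>h (s \<bullet>h l)"
 have sl: "s \<bullet>h l \<in> sq (f \<circ>h hinv al) h' k (g \<circ>h hinv gm)" by (rule sq_hcmp[OF l s])
 have "bt \<circ>h (f \<circ>h hinv al) = f'"
  using H.assoc_arrows[OF aia fe(1) H.isos_arrows[OF b]] H.assoc_arrows[OF aia aa f'(1)] f'(2) ai(3) H.ident_right[OF f'(1)] by simp
 moreover have "de \<circ>h (g \<circ>h hinv gm) = g'"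
  using H.assoc_arrows[OF cia fe(2) H.isos_arrows[OF d]] H.assoc_arrows[OF cia ca g'(1)] g'(2) ci(3) H.ident_right[OF g'(1)] by simp
 ultimately have s': "?s \<in> sq f' h' k' g'" using sq_hcmp[OF sl r] by simp
 have "t \<bullet>h s = ?s \<bullet>h u" if u: "u \<in> sq al h h' gm" and t: "t \<in> sq bt k k' de" for u t
 proof -
  have tr: "t = r" by (rule sq_ver_unique[OF b d t r])
  have io: "idh (src (hor D) f) \<in> hi (src (hor D) f) (src (hor D) f)" "idh (src (hor D) g) \<in> hi (src (hor D) g) (src (hor D) g)"
   using H.isos_ident H.arrows_Ob[OF fe(1)] H.arrows_Ob[OF fe(2)] by simp_all
  have "l \<bullet>h u = idhs h"
   by (rule sq_ver_unique[OF io]) (use sq_hcmp[OF u l] sq_idhs[OF fe(3)] ai(2) ci(2) in simp_all)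
  then have "s \<bullet>h (l \<bullet>h u) = s" using hsq_unit(1)[OF s] by simp
  then show ?thesis using hsq_assoc[OF u l s] hsq_assoc[OF u sl r] tr by simp
 qed
 with s' show thesis by (rule that)
qed

end

section \<open>Stability\<close>

context cat_cospan begin

lemma functor_into_PB:
 assumes E: "category E"
  and R: "(restrict r (Ob E), restrict s (Ar E)) \<in> functors E C1"
  and R': "(restrict r' (Ob E), restrict s' (Ar E)) \<in> functors E C2"
  and comm: "!!x. x \<in> Ob E ==> p1 (r x) = p2 (r' x)" "!!f. f \<in> Ar E ==> q1 (s f) = q2 (s' f)"
 shows "(restrict (%A. (r A, r' A)) (Ob E), restrict (%g. (s g, s' g)) (Ar E)) \<in> functors E PB"
proof -
 interpret E: category E by (rule E)
 note D = functorsD_restrict[OF R] and D' = functorsD_restrict[OF R']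
 show ?thesis
 proof (rule functors_restrictI[OF E])
  show "(r A, r' A) \<in> Ob PB" if "A \<in> Ob E" for A using D(1) D'(1) comm(1) that by (simp add: PB_simps)
  show "(s f, s' f) \<in> arrows PB (r A, r' A) (r B, r' B)" if "f \<in> arrows E A B" for f A B
   using D(2)[OF that E.arrows_Ob[OF that]] D'(2)[OF that E.arrows_Ob[OF that]] comm(2)[OF arrowsD(1)[OF that]] by (simp add: PB_arrows)
  show "(s (ident E A), s' (ident E A)) = ident PB (r A, r' A)" if "A \<in> Ob E" for A
   using D(3)[OF that] D'(3)[OF that] arrowsD(1)[OF E.ident_closed[OF that]] by (simp add: PB_simps)
  show "(s (cmp E g f), s' (cmp E g f)) = cmp PB (s g, s' g) (s f, s' f)" if "f \<in> arrows E A B" "g \<in> arrows E B A'" for f g A B A'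
   using D(4)[OF that] D'(4)[OF that] arrowsD(1)[OF E.cmp_arrows[OF that]] by (simp add: PB_simps)
 qed
qed

text \<open>In this direction objects of the pullback are hit exactly, so the comparison arrow for
  essential surjectivity is an identity.\<close>

lemma weak_equivalence_pairI:
 assumes E: "groupoid_cat E"
  and R: "(restrict r (Ob E), restrict s (Ar E)) \<in> functors E C1"
  and R': "(restrict r' (Ob E), restrict s' (Ar E)) \<in> functors E C2"
  and comm: "!!x. x \<in> Ob E ==> p1 (r x) = p2 (r' x)" "!!f. f \<in> Ar E ==> q1 (s f) = q2 (s' f)"
  and sur: "!!x y. x \<in> Ob C1 ==> y \<in> Ob C2 ==> p1 x = p2 y ==> \<exists>c\<in>Ob E. r c = x & r' c = y"
  and full: "!!c c' g g'. c \<in> Ob E ==> c' \<in> Ob E ==> g \<in> arrows C1 (r c) (r c') ==> g' \<in> arrows C2 (r' c) (r' c') ==>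
   q1 g = q2 g' ==> \<exists>f\<in>arrows E c c'. s f = g & s' f = g'"
  and faithful: "!!c c' f f'. f \<in> arrows E c c' ==> f' \<in> arrows E c c' ==> s f = s f' ==> s' f = s' f' ==> f = f'"
 shows "weak_equivalence (nerve E) PS (%n x. (nerve_map r s n x, nerve_map r' s' n x))"
proof -
 interpret P: groupoid_cat PB by (rule groupoid_PB)
 have cat: "category E" using E by (simp add: groupoid_cat_def)
 have fu: "(restrict (%A. (r A, r' A)) (Ob E), restrict (%g. (s g, s' g)) (Ar E)) \<in> functors E PB"
  by (rule functor_into_PB[OF cat R R']) (fact comm)+
 show ?thesis
  unfolding weak_equivalence_into_PS
 proof (rule weak_equivalence_nerve_restrict[OF E groupoid_PB fu])
  fix e assume e: "e \<in> Ob PB"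
  obtain x y where xy: "e = (x, y)" by (cases e)
  obtain c where c: "c \<in> Ob E" "r c = x" "r' c = y" using sur[of x y] e unfolding xy PB_simps by blast
  have "ident PB e \<in> arrows PB (r c, r' c) e" unfolding c(2,3) xy[symmetric] by (rule P.ident_closed[OF e])
  then show "\<exists>c\<in>Ob E. \<exists>g. g \<in> arrows PB (r c, r' c) e" using c(1) by blast
 next
  fix c c' g assume c: "c \<in> Ob E" "c' \<in> Ob E" and g: "g \<in> arrows PB (r c, r' c) (r c', r' c')"
  obtain x y where xy: "g = (x, y)" by (cases g)
  show "\<exists>f\<in>arrows E c c'. (s f, s' f) = g" using full[OF c, of x y] g unfolding xy PB_arrows by auto
 next
  show "f = f'" if "f \<in> arrows E c c'" "f' \<in> arrows E c c'" "(s f, s' f) = (s f', s' f')" for c c' f f'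
   using faithful[OF that(1,2)] that(3) by simp
 qed
qed

text \<open>In this direction objects of the pullback are hit only up to a pair of arrows that agree
  over the common corner.\<close>

lemma weak_equivalence_pairD:
 assumes E: "groupoid_cat E"
  and R: "(restrict r (Ob E), restrict s (Ar E)) \<in> functors E C1"
  and R': "(restrict r' (Ob E), restrict s' (Ar E)) \<in> functors E C2"
  and comm: "!!x. x \<in> Ob E ==> p1 (r x) = p2 (r' x)" "!!f. f \<in> Ar E ==> q1 (s f) = q2 (s' f)"
  and w: "weak_equivalence (nerve E) PS (%n x. (nerve_map r s n x, nerve_map r' s' n x))"
 shows "x \<in> Ob C1 ==> y \<in> Ob C2 ==> p1 x = p2 y ==>
   \<exists>c\<in>Ob E. \<exists>g\<in>arrows C1 (r c) x. \<exists>g'\<in>arrows C2 (r' c) y. q1 g = q2 g'"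
  "c \<in> Ob E ==> c' \<in> Ob E ==> g \<in> arrows C1 (r c) (r c') ==> g' \<in> arrows C2 (r' c) (r' c') ==>
   q1 g = q2 g' ==> \<exists>f\<in>arrows E c c'. s f = g & s' f = g'"
proof -
 have cat: "category E" using E by (simp add: groupoid_cat_def)
 have fu: "(restrict (%A. (r A, r' A)) (Ob E), restrict (%g. (s g, s' g)) (Ar E)) \<in> functors E PB"
  by (rule functor_into_PB[OF cat R R']) (fact comm)+
 note W = weak_equivalence_nerve_restrictD[OF E groupoid_PB fu w[unfolded weak_equivalence_into_PS]]
 show "\<exists>c\<in>Ob E. \<exists>g\<in>arrows C1 (r c) x. \<exists>g'\<in>arrows C2 (r' c) y. q1 g = q2 g'" if "x \<in> Ob C1" "y \<in> Ob C2" "p1 x = p2 y"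
 proof -
  have "(x, y) \<in> Ob PB" using that by (simp add: PB_simps)
  from W(1)[OF this] obtain c g where c: "c \<in> Ob E" "g \<in> arrows PB (r c, r' c) (x, y)" by blast
  then show ?thesis by (cases g) (auto simp only: PB_arrows)
 qed
 show "\<exists>f\<in>arrows E c c'. s f = g & s' f = g'"
  if c: "c \<in> Ob E" "c' \<in> Ob E" and g: "g \<in> arrows C1 (r c) (r c')" "g' \<in> arrows C2 (r' c) (r' c')" "q1 g = q2 g'"
 proof -
  have "(g, g') \<in> arrows PB (r c, r' c) (r c', r' c')" using g by (simp add: PB_arrows)
  from W(2)[OF c this] show ?thesis by simp
 qed
qed

end

section \<open>Edges of a square and their common corner\<close>

context shared_dblcat begin

text \<open>For \<open>e = 0\<close> these take the left and top edges, a span at the top left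
  corner; for \<open>e = 1\<close> the right and bottom edges, a cospan at the bottom right corner.
  The parameter treats both halves of stability together.\<close>

abbreviation "ved e \<equiv> bp 0 1 (vertex e) (Delta_id 1)"
abbreviation "veq e \<equiv> bq 0 1 (vertex e) (Delta_id 1)"
abbreviation "hed e \<equiv> bp 1 0 (Delta_id 1) (vertex e)"
abbreviation "heq e \<equiv> bq 1 0 (Delta_id 1) (vertex e)"
abbreviation "vco e \<equiv> bp 0 0 (Delta_id 0) (vertex e)"
abbreviation "vcq e \<equiv> bq 0 0 (Delta_id 0) (vertex e)"
abbreviation "hco e \<equiv> bp 0 0 (vertex e) (Delta_id 0)"
abbreviation "hcq e \<equiv> bq 0 0 (vertex e) (Delta_id 0)"

lemma edge_functors:
 assumes "e <= 1"
 shows "(restrict (ved e) (Ob (DL 1 1)), restrict (veq e) (Ar (DL 1 1))) \<in> functors (DL 1 1) (DL 0 1)"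
  "(restrict (hed e) (Ob (DL 1 1)), restrict (heq e) (Ar (DL 1 1))) \<in> functors (DL 1 1) (DL 1 0)"
  "(restrict (vco e) (Ob (DL 0 1)), restrict (vcq e) (Ar (DL 0 1))) \<in> functors (DL 0 1) (DL 0 0)"
  "(restrict (hco e) (Ob (DL 1 0)), restrict (hcq e) (Ar (DL 1 0))) \<in> functors (DL 1 0) (DL 0 0)"
 using bp_functor[OF vertex_mem[OF assms] Delta_id_mem] bp_functor[OF Delta_id_mem vertex_mem[OF assms]] by blast+

lemma edge_mems:
 assumes "e <= 1"
 shows "F \<in> GDF 1 1 ==> ved e F \<in> GDF 0 1" "F \<in> GDF 1 1 ==> hed e F \<in> GDF 1 0"
  "L \<in> GDF 0 1 ==> vco e L \<in> GDF 0 0" "T \<in> GDF 1 0 ==> hco e T \<in> GDF 0 0"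
 using bp_mem[OF vertex_mem[OF assms] Delta_id_mem] bp_mem[OF Delta_id_mem vertex_mem[OF assms]] by blast+

lemma edge_corner:
 assumes e: "e <= 1"
 shows "F \<in> Ob (DL 1 1) ==> vco e (ved e F) = hco e (hed e F)"
  "x \<in> Ar (DL 1 1) ==> vcq e (veq e x) = hcq e (heq e x)"
proof -
 have v: "compose {..0} (Delta_id 1) (vertex e) = vertex e" "compose {..0} (vertex e) (Delta_id 0) = vertex e"
  using e by (auto simp: compose_def vertex_def Delta_id_def fun_eq_iff restrict_def)
 note m = vertex_mem[OF e] Delta_id_mem
 show "F \<in> Ob (DL 1 1) ==> vco e (ved e F) = hco e (hed e F)"
  unfolding DL_simps by (simp only: bp_bp[OF m(2,1) m(1,2)] bp_bp[OF m(1,2) m(2,1)] v)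
 show "vcq e (veq e x) = hcq e (heq e x)" if "x \<in> Ar (DL 1 1)"
  unfolding bq_bq[OF m(2,1) m(1,2) that] bq_bq[OF m(1,2) m(2,1) that] v ..
qed

lemma edge_simps2:
 assumes "e <= 1"
 shows "on_ver (ved e F) (0, 0, Suc 0) = on_ver F (e, 0, Suc 0)" "on_hor (hed e F) ((0, Suc 0), 0) = on_hor F ((0, Suc 0), e)"
  "j <= 1 ==> on_ob (ved e F) (0, j) = on_ob F (e, j)" "i <= 1 ==> on_ob (hed e F) (i, 0) = on_ob F (i, e)"
  "on_ob (vco e L) (0, 0) = on_ob L (0, e)" "on_ob (hco e T) (0, 0) = on_ob T (e, 0)"
 using assms by (simp_all add: grid_pre_simps vertex_simps Delta_id_simps)

lemma corner_eq:
 assumes e: "e <= 1" and L: "L \<in> GDF 0 1" and T: "T \<in> GDF 1 0"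
 shows "vco e L = hco e T \<longleftrightarrow> on_ob L (0, e) = on_ob T (e, 0)"
proof
 assume "vco e L = hco e T"
 from arg_cong[OF this, of "%F. on_ob F (0, 0)"] show "on_ob L (0, e) = on_ob T (e, 0)" by (simp add: edge_simps2[OF e])
next
 assume "on_ob L (0, e) = on_ob T (e, 0)"
 then show "vco e L = hco e T"
  by (intro grid_dfun_eqI[OF edge_mems(3)[OF e L] edge_mems(4)[OF e T]]) (simp_all add: edge_simps2[OF e])
qed

text \<open>The corner opposite to the two prescribed edges stays fixed with the identity, and the
  two remaining edges absorb the isomorphisms: for \<open>e = 0\<close> they are composed with
  inverses at their sources, for \<open>e = 1\<close> with the isomorphisms at their
  targets.\<close>

lemma transport_dfun:
 assumes e: "e <= 1" and F: "F \<in> GDF 1 1" and L: "L \<in> GDF 0 1" and T: "T \<in> GDF 1 0"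
  and t: "hnatural (grid 0 1) (ved e F) L te" and k: "hnatural (grid 1 0) (hed e F) T ka" and tk: "te (0, e) = ka (e, 0)"
 obtains F' xx where "F' \<in> GDF 1 1" "ved e F' = L" "hed e F' = T" "hnatural (grid 1 1) F F' xx"
  "xx (e, 0) = te (0, 0)" "xx (e, 1) = te (0, 1)" "xx (0, e) = ka (0, 0)" "xx (1, e) = ka (1, 0)"
proof -
 note result = that
 obtain s f h k g where s: "s \<in> sq f h k g" and Fs: "F = sqd s" by (rule GDF_square[OF F])
 note S = sqD[OF s]
 have fe: "f \<in> hm (src (hor D) f) (trg (hor D) f)" "g \<in> hm (src (hor D) g) (trg (hor D) g)"
  "h \<in> vm (src (hor D) f) (src (hor D) g)" "k \<in> vm (trg (hor D) f) (trg (hor D) g)"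
  using S(4-7) by (simp_all add: arrows_def)
 note v = square_dfun_simps[OF s] edge_simps2[OF e] edge_simps2[OF e, unfolded One_nat_def]
 note t' = t[unfolded hnatural_vertical[OF edge_mems(1)[OF e F] L]] and k' = k[unfolded hnatural_horizontal[OF edge_mems(2)[OF e F] T]]
 have t2: "te (0, 0) \<in> hi (on_ob (sqd s) (e, 0)) (on_ob L (0, 0))" "te (0, Suc 0) \<in> hi (on_ob (sqd s) (e, Suc 0)) (on_ob L (0, Suc 0))"
  "ph (te (0, Suc 0)) \<circ>v on_ver (sqd s) (e, 0, Suc 0) = on_ver L (0, 0, Suc 0) \<circ>v ph (te (0, 0))"
  using t' by (simp_all add: v Fs)
 have k2: "ka (0, 0) \<in> hi (on_ob (sqd s) (0, e)) (on_ob T (0, 0))" "ka (Suc 0, 0) \<in> hi (on_ob (sqd s) (Suc 0, e)) (on_ob T (Suc 0, 0))"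
  "ka (Suc 0, 0) \<circ>h on_hor (sqd s) ((0, Suc 0), e) = on_hor T ((0, Suc 0), 0) \<circ>h ka (0, 0)"
  using k' by (simp_all add: v Fs)
 note La = vertical_GDF_arrow[OF L] and Ta = horizontal_GDF_arrow[OF T]
 \<comment> \<open>The common end of both cases: the transported square and the isomorphisms at its
   four corners give all the conclusions.\<close>
 have fin: thesis if s': "s' \<in> sq f' h' k' g'" and sq: "!!u t. u \<in> sq al h h' gm ==> t \<in> sq bt k k' de ==> t \<bullet>h s = s' \<bullet>h u"
  and a: "al \<in> hi (src (hor D) f) (src (hor D) f')" "bt \<in> hi (trg (hor D) f) (trg (hor D) f')"
   "gm \<in> hi (src (hor D) g) (src (hor D) g')" "de \<in> hi (trg (hor D) g) (trg (hor D) g')"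
  and b: "bt \<circ>h f = f' \<circ>h al" "de \<circ>h g = g' \<circ>h gm" "ph gm \<circ>v h = h' \<circ>v ph al" "ph de \<circ>v k = k' \<circ>v ph bt"
  and c: "on_ver (sqd s') (e, 0, Suc 0) = on_ver L (0, 0, Suc 0)" "on_hor (sqd s') ((0, Suc 0), e) = on_hor T ((0, Suc 0), 0)"
  and X: "xx = (%(i, j). if i = (0::nat) then if j = (0::nat) then al else gm else if j = 0 then bt else de)"
   "xx (e, 0) = te (0, 0)" "xx (e, 1) = te (0, 1)" "xx (0, e) = ka (0, 0)" "xx (1, e) = ka (1, 0)"
  for s' f' h' k' g' al bt gm de xx
 proof (rule result)
  show F': "sqd s' \<in> GDF 1 1" by (rule square_dfun_mem[OF s'])
  show "ved e (sqd s') = L" by (rule vertical_GDF_eqI[OF edge_mems(1)[OF e F'] L]) (simp only: v c)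
  show "hed e (sqd s') = T" by (rule horizontal_GDF_eqI[OF edge_mems(2)[OF e F'] T]) (simp only: v c)
  show "hnatural (grid 1 1) F (sqd s') xx"
   unfolding Fs hnatural_square_dfun[OF s s'] X(1) using a b sq by simp
 qed (use X in simp_all)
 consider "e = 0" | "e = 1" using e by linarith
 then show thesis
 proof cases
  case 1
  let ?f = "on_hor T ((0, Suc 0), 0)" and ?h = "on_ver L (0, 0, Suc 0)"
  let ?al = "te (0, 0)" and ?bt = "ka (Suc 0, 0)" and ?gm = "te (0, Suc 0)" and ?de = "idh (trg (hor D) g)"
  have hi: "?al \<in> hi (src (hor D) f) (on_ob L (0, 0))" "?bt \<in> hi (trg (hor D) f) (on_ob T (Suc 0, 0))" "?gm \<in> hi (src (hor D) g) (on_ob L (0, Suc 0))"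
   "?al \<in> hi (src (hor D) f) (on_ob T (0, 0))"
   using t2 k2 tk 1 by (simp_all add: square_dfun_simps[OF s])
  have d: "?de \<in> hi (trg (hor D) g) (trg (hor D) g)" using H.isos_ident H.arrows_Ob[OF fe(2)] by simp
  have ob: "on_ob L (0, 0) = on_ob T (0, 0)" using H.isos_arrows[OF hi(1)] H.isos_arrows[OF hi(4)] by (simp add: arrows_def)
  note bi = H.isos_inv[OF hi(2)] and ci = H.isos_inv[OF hi(3)]
  let ?g = "g \<circ>h hinv ?gm" and ?k = "k \<circ>v ph (hinv ?bt)"
  have g: "?g \<in> hm (on_ob L (0, Suc 0)) (trg (hor D) g)" by (rule H.cmp_arrows[OF H.isos_arrows[OF ci(1)] fe(2)])
  have k: "?k \<in> vm (on_ob T (Suc 0, 0)) (trg (hor D) g)" by (rule V.cmp_arrows[OF phi_arrow[OF bi(1)] fe(4)])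
  have nf: "?bt \<circ>h f = ?f \<circ>h ?al" "ph ?gm \<circ>v h = ?h \<circ>v ph ?al"
   using t2 k2 tk 1 by (simp_all add: square_dfun_simps[OF s])
  have ng: "?de \<circ>h g = ?g \<circ>h ?gm"
   using H.assoc_arrows[OF H.isos_arrows[OF hi(3)] H.isos_arrows[OF ci(1)] fe(2)] ci(2) H.ident_left[OF fe(2)] H.ident_right[OF fe(2)] by simp
  have "ph (hinv ?bt) \<circ>v ph ?bt = idv (trg (hor D) f)"
   using phi_cmp[OF hi(2) bi(1)] bi(2) phi_ident H.arrows_Ob[OF fe(1)] by simp
  then have nk: "ph ?de \<circ>v k = ?k \<circ>v ph ?bt"
   using V.assoc_arrows[OF phi_arrow[OF hi(2)] phi_arrow[OF bi(1)] fe(4)] phi_ident H.arrows_Ob[OF fe(2)] V.ident_left[OF fe(4)] V.ident_right[OF fe(4)] by simp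
  obtain s' where s': "s' \<in> sq ?f ?h ?k ?g" "!!u t. u \<in> sq ?al h ?h ?gm ==> t \<in> sq ?bt k ?k ?de ==> t \<bullet>h s = s' \<bullet>h u"
   by (rule transport_square[OF s hi(4,2,3) d Ta nf(1) g ng La[unfolded ob] nf(2) k nk]) blast
  show thesis
   by (rule fin[OF s'(1,2) _ _ _ _ nf(1) ng nf(2) nk _ _ refl])
    (use hi d arrowsD[OF Ta] arrowsD[OF La] arrowsD[OF g] square_dfun_simps[OF s'(1)] 1 tk in simp_all)
 next
  case 2
  let ?g = "on_hor T ((0, Suc 0), 0)" and ?k = "on_ver L (0, 0, Suc 0)"
  let ?al = "idh (src (hor D) f)" and ?bt = "te (0, 0)" and ?gm = "ka (0, 0)" and ?de = "te (0, Suc 0)"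
  have hi: "?bt \<in> hi (trg (hor D) f) (on_ob L (0, 0))" "?gm \<in> hi (src (hor D) g) (on_ob T (0, 0))" "?de \<in> hi (trg (hor D) g) (on_ob L (0, Suc 0))"
   "?de \<in> hi (trg (hor D) g) (on_ob T (Suc 0, 0))"
   using t2 k2 tk 2 by (simp_all add: square_dfun_simps[OF s])
  have a: "?al \<in> hi (src (hor D) f) (src (hor D) f)" using H.isos_ident H.arrows_Ob[OF fe(1)] by simp
  have ob: "on_ob L (0, Suc 0) = on_ob T (Suc 0, 0)" using H.isos_arrows[OF hi(3)] H.isos_arrows[OF hi(4)] by (simp add: arrows_def)
  let ?f = "?bt \<circ>h f" and ?h = "ph ?gm \<circ>v h"
  have f: "?f \<in> hm (src (hor D) f) (on_ob L (0, 0))" by (rule H.cmp_arrows[OF fe(1) H.isos_arrows[OF hi(1)]])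
  have h: "?h \<in> vm (src (hor D) f) (on_ob T (0, 0))" by (rule V.cmp_arrows[OF fe(3) phi_arrow[OF hi(2)]])
  have ng: "?de \<circ>h g = ?g \<circ>h ?gm" "ph ?de \<circ>v k = ?k \<circ>v ph ?bt"
   using t2 k2 tk 2 by (simp_all add: square_dfun_simps[OF s])
  have nf: "?bt \<circ>h f = ?f \<circ>h ?al" using H.ident_right[OF f] by simp
  have nh: "ph ?gm \<circ>v h = ?h \<circ>v ph ?al" using V.ident_right[OF h] phi_ident H.arrows_Ob[OF fe(1)] by simp
  obtain s' where s': "s' \<in> sq ?f ?h ?k ?g" "!!u t. u \<in> sq ?al h ?h ?gm ==> t \<in> sq ?bt k ?k ?de ==> t \<bullet>h s = s' \<bullet>h u"
   by (rule transport_square[OF s a hi(1,2,4) f nf Ta ng(1) h nh La[unfolded ob] ng(2)]) blast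
  show thesis
   by (rule fin[OF s'(1,2) _ _ _ _ nf ng(1) nh ng(2) _ _ refl])
    (use hi a arrowsD[OF Ta] arrowsD[OF La] arrowsD[OF f] square_dfun_simps[OF s'(1)] 2 tk in simp_all)
 qed
qed

text \<open>One corner remains. For \<open>e = 0\<close> it is the target of the right edge of
  \<open>F\<close>, which is epic; for \<open>e = 1\<close> it is the source of the top edge of
  \<open>G\<close>, which is monic. Naturality on that edge determines the component.\<close>

lemma corner_unique:
 assumes me: "monic_epic D" and e: "e <= 1" and F: "F \<in> GDF 1 1" and G: "G \<in> GDF 1 1"
  and n: "hnatural (grid 1 1) F G te" "hnatural (grid 1 1) F G ka"
  and eq: "!!i j. i <= 1 ==> j <= 1 ==> i = e \<or> j = e ==> te (i, j) = ka (i, j)" and ij: "i <= 1" "j <= 1"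
 shows "te (i, j) = ka (i, j)"
proof (cases "i = e \<or> j = e")
 case False
 obtain s f h k g where s: "s \<in> sq f h k g" and Fs: "F = sqd s" by (rule GDF_square[OF F])
 obtain s' f' h' k' g' where s': "s' \<in> sq f' h' k' g'" and Gs: "G = sqd s'" by (rule GDF_square[OF G])
 note T = n(1)[unfolded Fs Gs hnatural_square_dfun[OF s s']] and K = n(2)[unfolded Fs Gs hnatural_square_dfun[OF s s']]
 consider "e = 0" "i = 1" "j = 1" | "e = 1" "i = 0" "j = 0" using e ij False by linarith
 then show ?thesis
 proof cases
  case 1
  have k: "k \<in> vm (trg (hor D) f) (trg (hor D) g)" by (rule sqD(7)[OF s])
  then have ep: "epic (ver D) k" using me by (auto simp: monic_epic_def arrows_def)
  have t: "te (Suc 0, Suc 0) \<in> hi (trg (hor D) g) (trg (hor D) g')" "ka (Suc 0, Suc 0) \<in> hi (trg (hor D) g) (trg (hor D) g')"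
   using T K by blast+
  have "ph (te (Suc 0, Suc 0)) \<circ>v k = ph (ka (Suc 0, Suc 0)) \<circ>v k" using T K eq[of 1 0] 1 by simp
  then have "ph (te (Suc 0, Suc 0)) = ph (ka (Suc 0, Suc 0))"
   using ep[unfolded epic_def arrowsD(3)[OF k], THEN conjunct2, rule_format,
     OF V.arrows_Ob(2)[OF phi_arrow[OF t(1)]] phi_arrow[OF t(1)] phi_arrow[OF t(2)]] by blast
  then show ?thesis using phi_inj[OF t] 1 by simp
 next
  case 2
  have f: "f' \<in> Ar (hor D)" using sqD(4)[OF s'] by (simp add: arrows_def)
  then have mo: "monic (hor D) f'" using me by (auto simp: monic_epic_def)
  have t: "te (0, 0) \<in> hi (src (hor D) f) (src (hor D) f')" "ka (0, 0) \<in> hi (src (hor D) f) (src (hor D) f')"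
   using T K by blast+
  have "f' \<circ>h te (0, 0) = f' \<circ>h ka (0, 0)" using T K eq[of 1 0] 2 by simp
  then show ?thesis
   using mo[unfolded monic_def, THEN conjunct2, rule_format, OF hi_Ob(1)[OF t(1)] H.isos_arrows[OF t(1)] H.isos_arrows[OF t(2)]] 2
   by blast
 qed
qed (use eq ij in blast)

text \<open>The existence parts of the extension axiom at the corner \<open>e\<close>, for edges and
  for isomorphisms of edges. They are the counterparts of essential surjectivity and of
  fullness.\<close>

definition "edges_extend e \<longleftrightarrow>
 (\<forall>L\<in>GDF 0 1. \<forall>T\<in>GDF 1 0. on_ob L (0, e) = on_ob T (e, 0) --> (\<exists>F\<in>GDF 1 1. ved e F = L & hed e F = T))"

definition "edge_isos_extend e \<longleftrightarrow>
 (\<forall>F\<in>GDF 1 1. \<forall>G\<in>GDF 1 1. \<forall>te ka. hnatural (grid 0 1) (ved e F) (ved e G) te --> hnatural (grid 1 0) (hed e F) (hed e G) ka -->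
   te (0, e) = ka (e, 0) --> (\<exists>xx. hnatural (grid 1 1) F G xx & xx (e, 0) = te (0, 0) & xx (e, 1) = te (0, 1) &
    xx (0, e) = ka (0, 0) & xx (1, e) = ka (1, 0)))"

end

section \<open>The extension axiom in terms of edges and their isomorphisms\<close>

context shared_dblcat begin

abbreviation "corners e \<equiv> {(i, j). i <= Suc 0 & j <= Suc 0 & (i = e \<or> j = e)}"

lemma square_isos_fixing_iff:
 assumes s: "s \<in> Sq D" and t: "t \<in> Sq D"
 shows "(te, te') \<in> square_isos_fixing D (corners e) s t \<longleftrightarrow>
  te \<in> extensional (GO 1 1) & te' = (\<lambda>A\<in>GO 1 1. ph (te A)) & hnatural (grid 1 1) (sqd s) (sqd t) te &
  (\<forall>i\<le>1. \<forall>j\<le>1. i = e \<or> j = e --> te (i, j) = idh (on_ob (sqd s) (i, j)))"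
proof -
 have S: "sqd s \<in> GDF 1 1" "sqd t \<in> GDF 1 1" using square_dfun_mem s t by (auto simp: squares_def)
 have i: "ph (idh (on_ob (sqd s) (i, j))) = idv (on_ob (sqd s) (i, j))" if "i <= Suc 0" "j <= Suc 0" for i j
  using phi_ident grid_dfunD(1)[OF S(1), of i j] that by simp
 show ?thesis
  unfolding square_isos_fixing_def using dfun_target.natural_shared_isos_iff[OF dfun_target_grid S] i by (auto simp: grid_simps)
qed

lemma square_extension_iso:
 assumes se: "square_extension D" and e: "e <= 1" and F: "F \<in> GDF 1 1" and G: "G \<in> GDF 1 1"
  and eq: "ved e F = ved e G" "hed e F = hed e G"
 obtains xx where "hnatural (grid 1 1) F G xx" "!!i j. i <= 1 ==> j <= 1 ==> i = e \<or> j = e ==> xx (i, j) = idh (on_ob F (i, j))"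
proof -
 obtain s f h k g where s: "s \<in> sq f h k g" and Fs: "F = sqd s" by (rule GDF_square[OF F])
 obtain s' f' h' k' g' where s': "s' \<in> sq f' h' k' g'" and Gs: "G = sqd s'" by (rule GDF_square[OF G])
 note S = sqD[OF s] and S' = sqD[OF s']
 have v: "on_ver F (e, 0, Suc 0) = on_ver G (e, 0, Suc 0)" "on_hor F ((0, Suc 0), e) = on_hor G ((0, Suc 0), e)"
  using eq edge_simps2(1,2)[OF e, of F] edge_simps2(1,2)[OF e, of G] by simp_all
 consider "e = 0" | "e = 1" using e by linarith
 then have "\<exists>te. te \<in> square_isos_fixing D (corners e) s s'"
 proof cases
  case 1
  have c: "corners e = {(0, 0), (1, 0), (0, 1)}" using 1 by auto
  have "h' = h" "f' = f" using v by (simp_all add: 1 Fs Gs square_dfun_simps[OF s] square_dfun_simps[OF s'])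
  then have m: "s \<in> {s \<in> Sq D. left_edge D s = h & top_edge D s = f}" "s' \<in> {s \<in> Sq D. left_edge D s = h & top_edge D s = f}"
   using s s' by (auto simp: squares_def)
  have "extends_uniquely D {(0, 0), (1, 0), (0, 1)} {s \<in> Sq D. left_edge D s = h & top_edge D s = f}"
   using se S(4,6) by (auto simp: square_extension_def arrows_def)
  then show ?thesis unfolding c extends_uniquely_def using m by blast
 next
  case 2
  have c: "corners e = {(0, 1), (1, 1), (1, 0)}" using 2 by auto
  have "k' = k" "g' = g" using v by (simp_all add: 2 Fs Gs square_dfun_simps[OF s] square_dfun_simps[OF s'])
  then have m: "s \<in> {s \<in> Sq D. bottom_edge D s = g & right_edge D s = k}" "s' \<in> {s \<in> Sq D. bottom_edge D s = g & right_edge D s = k}"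
   using s s' by (auto simp: squares_def)
  have "extends_uniquely D {(0, 1), (1, 1), (1, 0)} {s \<in> Sq D. bottom_edge D s = g & right_edge D s = k}"
   using se S(5,7) by (auto simp: square_extension_def arrows_def)
  then show ?thesis unfolding c extends_uniquely_def using m by blast
 qed
 then obtain te te' where "(te, te') \<in> square_isos_fixing D (corners e) s s'" by auto
 then show thesis using that[of te] S(1) S'(1) unfolding square_isos_fixing_iff[OF S(1) S'(1)] Fs Gs by blast
qed

lemma edges_extend_if_square_extension:
 assumes se: "square_extension D" and e: "e <= 1"
 shows "edges_extend e"
 unfolding edges_extend_def
proof (intro ballI impI)
 fix L T assume L: "L \<in> GDF 0 1" and T: "T \<in> GDF 1 0" and o: "on_ob L (0, e) = on_ob T (e, 0)"
 let ?h = "on_ver L (0, 0, Suc 0)" and ?f = "on_hor T ((0, Suc 0), 0)"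
 note La = arrowsD[OF vertical_GDF_arrow[OF L]] and Ta = arrowsD[OF horizontal_GDF_arrow[OF T]]
 have "\<exists>s. s \<in> Sq D & on_ver (sqd s) (e, 0, Suc 0) = ?h & on_hor (sqd s) ((0, Suc 0), e) = ?f"
 proof -
  consider "e = 0" | "e = 1" using e by linarith
  then show ?thesis
  proof cases
   case 1
   have "extends_uniquely D {(0, 0), (1, 0), (0, 1)} {s \<in> Sq D. left_edge D s = ?h & top_edge D s = ?f}"
    using se La Ta o 1 by (simp add: square_extension_def)
   then obtain s where "s \<in> Sq D" "left_edge D s = ?h" "top_edge D s = ?f" by (auto simp: extends_uniquely_def)
   then show ?thesis using square_dfun_simps[of s ?f ?h "right_edge D s" "bottom_edge D s"] 1 by (auto simp: squares_def)
  next
   case 2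
   have "extends_uniquely D {(0, 1), (1, 1), (1, 0)} {s \<in> Sq D. bottom_edge D s = ?f & right_edge D s = ?h}"
    using se La Ta o 2 by (simp add: square_extension_def)
   then obtain s where "s \<in> Sq D" "right_edge D s = ?h" "bottom_edge D s = ?f" by (auto simp: extends_uniquely_def)
   then show ?thesis using square_dfun_simps[of s "top_edge D s" "left_edge D s" ?h ?f] 2 by (auto simp: squares_def)
  qed
 qed
 then obtain s where s: "s \<in> Sq D" "on_ver (sqd s) (e, 0, Suc 0) = ?h" "on_hor (sqd s) ((0, Suc 0), e) = ?f" by blast
 have F: "sqd s \<in> GDF 1 1" using square_dfun_mem s(1) by (auto simp: squares_def)
 have "ved e (sqd s) = L" by (rule vertical_GDF_eqI[OF edge_mems(1)[OF e F] L]) (simp only: edge_simps2[OF e] s)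
 moreover have "hed e (sqd s) = T" by (rule horizontal_GDF_eqI[OF edge_mems(2)[OF e F] T]) (simp only: edge_simps2[OF e] s)
 ultimately show "\<exists>F\<in>GDF 1 1. ved e F = L & hed e F = T" using F by blast
qed

text \<open>Transporting \<open>F\<close> along the given isomorphisms produces a square with the
  same two edges as \<open>G\<close>. The axiom joins it to \<open>G\<close> by an isomorphism that
  is the identity on these edges, and the composite extends the given isomorphisms.\<close>

lemma edge_isos_extend_if_square_extension:
 assumes se: "square_extension D" and e: "e <= 1"
 shows "edge_isos_extend e"
 unfolding edge_isos_extend_def
proof (intro ballI allI impI)
 fix F G te ka
 assume F: "F \<in> GDF 1 1" and G: "G \<in> GDF 1 1" and t: "hnatural (grid 0 1) (ved e F) (ved e G) te"
  and k: "hnatural (grid 1 0) (hed e F) (hed e G) ka" and tk: "te (0, e) = ka (e, 0)"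
 interpret T: dfun_target D ph "grid 1 1" by (rule dfun_target_grid)
 obtain F' xx where F': "F' \<in> GDF 1 1" "ved e F' = ved e G" "hed e F' = hed e G" "hnatural (grid 1 1) F F' xx"
  "xx (e, 0) = te (0, 0)" "xx (e, 1) = te (0, 1)" "xx (0, e) = ka (0, 0)" "xx (1, e) = ka (1, 0)"
  by (rule transport_dfun[OF e F edge_mems(1)[OF e G] edge_mems(2)[OF e G] t k tk])
 obtain ze where z: "hnatural (grid 1 1) F' G ze" "!!i j. i <= 1 ==> j <= 1 ==> i = e \<or> j = e ==> ze (i, j) = idh (on_ob F' (i, j))"
  by (rule square_extension_iso[OF se e F'(1) G F'(2,3)]) blast
 have v: "ze (i, j) \<circ>h xx (i, j) = xx (i, j)" if "i <= 1" "j <= 1" "i = e \<or> j = e" for i j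
  using H.ident_left[OF H.isos_arrows[OF T.hnaturalD(1)[OF F'(4), of "(i, j)"]]] z(2)[OF that] that(1,2) by (simp add: grid_simps)
 show "\<exists>xx. hnatural (grid 1 1) F G xx & xx (e, 0) = te (0, 0) & xx (e, 1) = te (0, 1) & xx (0, e) = ka (0, 0) & xx (1, e) = ka (1, 0)"
  by (intro exI[of _ "\<lambda>A\<in>GO 1 1. ze A \<circ>h xx A"] conjI T.hnatural_comp[OF F F'(1) G F'(4) z(1)])
   (use v[of e 0] v[of e 1] v[of 0 e] v[of 1 e] e F'(5-8) in \<open>simp_all add: grid_simps\<close>)
qed

text \<open>Existence extends the identities of the common edges; uniqueness is
  \<open>corner_unique\<close>.\<close>

lemma square_isos_fixing_unique:
 assumes me: "monic_epic D" and ie: "edge_isos_extend e" and e: "e <= 1" and s: "s \<in> Sq D" and t: "t \<in> Sq D"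
  and eq: "on_ver (sqd s) (e, 0, Suc 0) = on_ver (sqd t) (e, 0, Suc 0)" "on_hor (sqd s) ((0, Suc 0), e) = on_hor (sqd t) ((0, Suc 0), e)"
 shows "\<exists>!te. te \<in> square_isos_fixing D (corners e) s t"
proof (rule ex_ex1I)
 have S: "sqd s \<in> GDF 1 1" "sqd t \<in> GDF 1 1" using square_dfun_mem s t by (auto simp: squares_def)
 note m = edge_mems(1,2)[OF e S(1)]
 note m' = edge_mems(1,2)[OF e S(2)]
 have ve: "ved e (sqd s) = ved e (sqd t)" by (rule vertical_GDF_eqI[OF m(1) m'(1)]) (simp only: edge_simps2[OF e] eq)
 have he: "hed e (sqd s) = hed e (sqd t)" by (rule horizontal_GDF_eqI[OF m(2) m'(2)]) (simp only: edge_simps2[OF e] eq)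
 have n: "hnatural (grid 0 1) (ved e (sqd s)) (ved e (sqd t)) (\<lambda>A\<in>GO 0 1. idh (on_ob (ved e (sqd s)) A))"
  "hnatural (grid 1 0) (hed e (sqd s)) (hed e (sqd t)) (\<lambda>A\<in>GO 1 0. idh (on_ob (hed e (sqd s)) A))"
  unfolding ve[symmetric] he[symmetric]
  by (rule dfun_target.hnatural_ident[OF dfun_target_grid m(1)]) (rule dfun_target.hnatural_ident[OF dfun_target_grid m(2)])
 have "(\<lambda>A\<in>GO 0 1. idh (on_ob (ved e (sqd s)) A)) (0, e) = (\<lambda>A\<in>GO 1 0. idh (on_ob (hed e (sqd s)) A)) (e, 0)"
  using e edge_simps2(3)[OF e e, of "sqd s"] edge_simps2(4)[OF e e, of "sqd s"] by (simp add: grid_simps)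
 from ie[unfolded edge_isos_extend_def, rule_format, OF S n this]
 obtain xx where x: "hnatural (grid 1 1) (sqd s) (sqd t) xx" "xx (e, 0) = idh (on_ob (sqd s) (e, 0))" "xx (e, 1) = idh (on_ob (sqd s) (e, 1))"
  "xx (0, e) = idh (on_ob (sqd s) (0, e))" "xx (1, e) = idh (on_ob (sqd s) (1, e))"
  using edge_simps2(3)[OF e, of _ "sqd s"] edge_simps2(4)[OF e, of _ "sqd s"] by (auto simp: grid_simps)
 have ij: "xx (i, j) = idh (on_ob (sqd s) (i, j))" if "i <= 1" "j <= 1" "i = e \<or> j = e" for i j
 proof -
  have "i = 0 \<or> i = 1" "j = 0 \<or> j = 1" using that by linarith+
  then show ?thesis using that(3) x(2-5) by auto
 qed
 note a = DL_arrowI_grid[OF S x(1), unfolded DL_arrows]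
 show "\<exists>te. te \<in> square_isos_fixing D (corners e) s t"
  by (rule exI[of _ "(restrict xx (GO 1 1), restrict (%A. ph (xx A)) (GO 1 1))"])
   (unfold square_isos_fixing_iff[OF s t], use a ij in \<open>auto simp: grid_simps\<close>)
 fix x y assume xy: "x \<in> square_isos_fixing D (corners e) s t" "y \<in> square_isos_fixing D (corners e) s t"
 obtain te te' where x: "x = (te, te')" by (cases x)
 obtain ka ka' where y: "y = (ka, ka')" by (cases y)
 note X = xy(1)[unfolded x square_isos_fixing_iff[OF s t]] and Y = xy(2)[unfolded y square_isos_fixing_iff[OF s t]]
 have n: "hnatural (grid 1 1) (sqd s) (sqd t) te" "hnatural (grid 1 1) (sqd s) (sqd t) ka" using X Y by blast+
 have eq': "te (i, j) = ka (i, j)" if "i <= 1" "j <= 1" "i = e \<or> j = e" for i j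
  using X[THEN conjunct2, THEN conjunct2, THEN conjunct2, rule_format, OF that] Y[THEN conjunct2, THEN conjunct2, THEN conjunct2, rule_format, OF that] by simp
 have "te = ka"
 proof (rule extensionalityI[of _ "GO 1 1"])
  fix A assume "A \<in> GO 1 1"
  then obtain i j where A: "A = (i, j)" "i <= 1" "j <= 1" by (auto simp: grid_simps)
  show "te A = ka A" unfolding A(1) by (rule corner_unique[OF me e S n eq' A(2,3)])
 qed (use X Y in blast)+
 then show "x = y" using X Y by (simp add: x y)
qed

lemma square_extension_if_edges_extend:
 assumes me: "monic_epic D" and ex: "edges_extend 0" "edges_extend 1" and ie: "edge_isos_extend 0" "edge_isos_extend 1"
 shows "square_extension D"
 unfolding square_extension_def extends_uniquely_def
proof (intro conjI ballI impI)
 have c: "corners 0 = {(0, 0), (1, 0), (0, 1)}" "corners 1 = {(0, 1), (1, 1), (1, 0)}" by auto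
 have ex': "\<exists>F\<in>GDF 1 1. on_ver F (e, 0, Suc 0) = h & on_hor F ((0, Suc 0), e) = f"
  if e: "e <= 1" and "edges_extend e" and h: "h \<in> vm A C" and f: "f \<in> hm A' B'" and o: "(if e = 0 then A = A' else C = B')" for e h f A C A' B'
 proof -
  obtain L where L: "L \<in> GDF 0 1" "on_ver L (0, 0, Suc 0) = h" by (rule vertical_GDF[OF h])
  obtain T where T: "T \<in> GDF 1 0" "on_hor T ((0, Suc 0), 0) = f" by (rule horizontal_GDF[OF f])
  have "on_ob L (0, e) = on_ob T (e, 0)"
   using e o arrowsD(2,3)[OF vertical_GDF_arrow[OF L(1)]] arrowsD(2,3)[OF horizontal_GDF_arrow[OF T(1)]] arrowsD(2,3)[OF h] arrowsD(2,3)[OF f] L(2) T(2)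
   by (cases e) simp_all
  then obtain F where "F \<in> GDF 1 1" "ved e F = L" "hed e F = T" using \<open>edges_extend e\<close> L(1) T(1) unfolding edges_extend_def by blast
  then show ?thesis using L(2) T(2) edge_simps2(1,2)[OF e, of F] by (intro bexI[of _ F]) simp_all
 qed
 {
  fix h f assume h: "h \<in> Ar (ver D)" and f: "f \<in> Ar (hor D)" and o: "src (ver D) h = src (hor D) f"
  have "\<exists>F\<in>GDF 1 1. on_ver F (0, 0, Suc 0) = h & on_hor F ((0, Suc 0), 0) = f"
   by (rule ex'[OF _ ex(1), of h "src (ver D) h" "trg (ver D) h" f "src (hor D) f" "trg (hor D) f"])
    (simp_all add: arrows_def h f o)
  then obtain F where F: "F \<in> GDF 1 1" "on_ver F (0, 0, Suc 0) = h" "on_hor F ((0, Suc 0), 0) = f" by blast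
  obtain s f' h' k g where s: "s \<in> sq f' h' k g" "F = sqd s" by (rule GDF_square[OF F(1)])
  then have "s \<in> {s \<in> Sq D. left_edge D s = h & top_edge D s = f}"
   using F(2,3) square_dfun_simps[OF s(1)] by (simp add: squares_def)
  then show "{s \<in> Sq D. left_edge D s = h & top_edge D s = f} \<noteq> {}" by blast
  fix s t assume "s \<in> {s \<in> Sq D. left_edge D s = h & top_edge D s = f}" "t \<in> {s \<in> Sq D. left_edge D s = h & top_edge D s = f}"
  then have st: "s \<in> sq f h (right_edge D s) (bottom_edge D s)" "t \<in> sq f h (right_edge D t) (bottom_edge D t)" by (auto simp: squares_def)
  show "\<exists>!te. te \<in> square_isos_fixing D {(0, 0), (1, 0), (0, 1)} s t"
   unfolding c(1)[symmetric]
   by (rule square_isos_fixing_unique[OF me ie(1) _ sqD(1)[OF st(1)] sqD(1)[OF st(2)]])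
    (simp_all only: square_dfun_simps[OF st(1)] square_dfun_simps[OF st(2)] le0)
 next
  fix f h assume f: "f \<in> Ar (hor D)" and h: "h \<in> Ar (ver D)" and o: "trg (hor D) f = trg (ver D) h"
  have "\<exists>F\<in>GDF 1 1. on_ver F (1, 0, Suc 0) = h & on_hor F ((0, Suc 0), 1) = f"
   by (rule ex'[OF _ ex(2), of h "src (ver D) h" "trg (ver D) h" f "src (hor D) f" "trg (hor D) f"])
    (simp_all add: arrows_def h f o)
  then obtain F where F: "F \<in> GDF 1 1" "on_ver F (1, 0, Suc 0) = h" "on_hor F ((0, Suc 0), 1) = f" by blast
  obtain s f' h' k g where s: "s \<in> sq f' h' k g" "F = sqd s" by (rule GDF_square[OF F(1)])
  then have "s \<in> {s \<in> Sq D. bottom_edge D s = f & right_edge D s = h}"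
   using F(2,3) square_dfun_simps[OF s(1)] by (simp add: squares_def)
  then show "{s \<in> Sq D. bottom_edge D s = f & right_edge D s = h} \<noteq> {}" by blast
  fix s t assume "s \<in> {s \<in> Sq D. bottom_edge D s = f & right_edge D s = h}" "t \<in> {s \<in> Sq D. bottom_edge D s = f & right_edge D s = h}"
  then have st: "s \<in> sq (top_edge D s) (left_edge D s) h f" "t \<in> sq (top_edge D t) (left_edge D t) h f" by (auto simp: squares_def)
  show "\<exists>!te. te \<in> square_isos_fixing D {(0, 1), (1, 1), (1, 0)} s t"
   unfolding c(2)[symmetric]
   by (rule square_isos_fixing_unique[OF me ie(2) _ sqD(1)[OF st(1)] sqD(1)[OF st(2)]])
    (simp_all only: square_dfun_simps[OF st(1)] square_dfun_simps[OF st(2)] order_refl One_nat_def)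
 }
qed

section \<open>Stability as an equivalence of groupoids\<close>

lemma compose_edge:
 assumes "e <= 1"
 shows "j <= 1 ==> compose (GO 0 1) te (map_prod (vertex e) (Delta_id 1)) (0, j) = te (e, j)"
  "j <= 1 ==> compose (GO 1 0) te (map_prod (Delta_id 1) (vertex e)) (j, 0) = te (j, e)"
  "compose (GO 0 0) te (map_prod (Delta_id 0) (vertex e)) (0, 0) = te (0, e)"
  "compose (GO 0 0) te (map_prod (vertex e) (Delta_id 0)) (0, 0) = te (e, 0)"
 using assms by (simp_all add: compose_def grid_simps vertex_simps Delta_id_simps)

lemma corner_arrow:
 assumes e: "e <= 1" and c: "vcq e (L, L', te, te') = hcq e (T, T', ka, ka')"
 shows "te (0, e) = ka (e, 0)"
 using fun_cong[OF c[unfolded prod.case prod.inject, THEN conjunct2, THEN conjunct2, THEN conjunct1], of "(0, 0)"] compose_edge(3,4)[OF e] by metis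

lemma edges_full:
 assumes ie: "edge_isos_extend e" and e: "e <= 1" and F: "F \<in> Ob (DL 1 1)" "G \<in> Ob (DL 1 1)"
  and g: "g \<in> arrows (DL 0 1) (ved e F) (ved e G)" "g' \<in> arrows (DL 1 0) (hed e F) (hed e G)" "vcq e g = hcq e g'"
 shows "\<exists>f\<in>arrows (DL 1 1) F G. veq e f = g & heq e f = g'"
proof -
 note F = F[unfolded DL_simps]
 obtain te where t: "g = (ved e F, ved e G, te, \<lambda>A\<in>GO 0 1. ph (te A))" "hnatural (grid 0 1) (ved e F) (ved e G) te"
  by (rule DL_arrowE[OF g(1)]) blast
 obtain ka where k: "g' = (hed e F, hed e G, ka, \<lambda>A\<in>GO 1 0. ph (ka A))" "hnatural (grid 1 0) (hed e F) (hed e G) ka"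
  by (rule DL_arrowE[OF g(2)]) blast
 obtain xx where x: "hnatural (grid 1 1) F G xx" "xx (e, 0) = te (0, 0)" "xx (e, 1) = te (0, 1)" "xx (0, e) = ka (0, 0)" "xx (1, e) = ka (1, 0)"
  using ie[unfolded edge_isos_extend_def, rule_format, OF F t(2) k(2) corner_arrow[OF e g(3)[unfolded t(1) k(1)]]] by blast
 have le1: "i <= 1 \<longleftrightarrow> i = 0 \<or> i = 1" for i :: nat by auto
 let ?xx = "restrict xx (GO 1 1)"
 have r: "?xx (i, j) = xx (i, j)" if "i <= 1" "j <= 1" for i j using that by (simp add: grid_simps)
 note a = DL_arrowI_grid[OF F x(1)]
 note Fv = functorsD_restrict(2)[OF edge_functors(1)[OF e] a, unfolded DL_simps, OF F, THEN arrowsD(1)]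
 note Fh = functorsD_restrict(2)[OF edge_functors(2)[OF e] a, unfolded DL_simps, OF F, THEN arrowsD(1)]
 show ?thesis
 proof (intro bexI[OF _ a] conjI)
  show "veq e (F, G, ?xx, restrict (%A. ph (xx A)) (GO 1 1)) = g"
   unfolding t(1) prod.case
  proof (rule DL_arrow_eqI[OF Fv[unfolded prod.case] arrowsD(1)[OF g(1)[unfolded t(1)]]])
   fix i j :: nat assume "i <= 0" and j: "j <= 1"
   then show "compose (GO 0 1) ?xx (map_prod (vertex e) (Delta_id 1)) (i, j) = te (i, j)"
    using compose_edge(1)[OF e j, of ?xx] r[OF e j] x(2,3) j unfolding le1 by auto
  qed
  show "heq e (F, G, ?xx, restrict (%A. ph (xx A)) (GO 1 1)) = g'"
   unfolding k(1) prod.case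
  proof (rule DL_arrow_eqI[OF Fh[unfolded prod.case] arrowsD(1)[OF g(2)[unfolded k(1)]]])
   fix i j :: nat assume i: "i <= 1" and "j <= 0"
   then show "compose (GO 1 0) ?xx (map_prod (Delta_id 1) (vertex e)) (i, j) = ka (i, j)"
    using compose_edge(2)[OF e i, of ?xx] r[OF i e] x(4,5) i unfolding le1 by auto
  qed
 qed
qed

lemma edges_faithful:
 assumes me: "monic_epic D" and e: "e <= 1" and x: "x \<in> arrows (DL 1 1) F G" and y: "y \<in> arrows (DL 1 1) F G"
  and eq: "veq e x = veq e y" "heq e x = heq e y"
 shows "x = y"
proof -
 obtain te where t: "x = (F, G, te, \<lambda>A\<in>GO 1 1. ph (te A))" "F \<in> GDF 1 1" "G \<in> GDF 1 1" "hnatural (grid 1 1) F G te"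
  by (rule DL_arrowE[OF x]) blast
 obtain ka where k: "y = (F, G, ka, \<lambda>A\<in>GO 1 1. ph (ka A))" "hnatural (grid 1 1) F G ka"
  by (rule DL_arrowE[OF y]) blast
 note E = eq[unfolded t(1) k(1) prod.case prod.inject, THEN conjunct2, THEN conjunct2, THEN conjunct1]
 have "te (i, j) = ka (i, j)" if ij: "i <= 1" "j <= 1" "i = e \<or> j = e" for i j
  using ij(3) fun_cong[OF E(1), of "(0, j)"] fun_cong[OF E(2), of "(i, 0)"]
  unfolding compose_edge(1)[OF e ij(2)] compose_edge(2)[OF e ij(1)] by blast
 then show ?thesis
  unfolding t(1) k(1) using corner_unique[OF me e t(2,3,4) k(2)]
  by (intro DL_arrow_eqI[OF arrowsD(1)[OF x[unfolded t(1)]] arrowsD(1)[OF y[unfolded k(1)]]]) blast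
qed

lemma edges_surjective:
 assumes "edges_extend e" "e <= 1" "L \<in> Ob (DL 0 1)" "T \<in> Ob (DL 1 0)" "vco e L = hco e T"
 shows "\<exists>F\<in>Ob (DL 1 1). ved e F = L & hed e F = T"
 using assms corner_eq[OF assms(2), of L T] unfolding edges_extend_def DL_simps by blast

text \<open>The hypothesis gives a square whose edges are merely isomorphic to \<open>L\<close> and
  \<open>T\<close>, compatibly at the corner; \<open>transport_dfun\<close> replaces it by one with
  exactly these edges.\<close>

lemma edges_extendI:
 assumes e: "e <= 1"
  and w: "!!L T. L \<in> Ob (DL 0 1) ==> T \<in> Ob (DL 1 0) ==> vco e L = hco e T ==>
   \<exists>F\<in>Ob (DL 1 1). \<exists>g\<in>arrows (DL 0 1) (ved e F) L. \<exists>g'\<in>arrows (DL 1 0) (hed e F) T. vcq e g = hcq e g'"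
 shows "edges_extend e"
 unfolding edges_extend_def
proof (intro ballI impI)
 fix L T assume L: "L \<in> GDF 0 1" and T: "T \<in> GDF 1 0" and o: "on_ob L (0, e) = on_ob T (e, 0)"
 obtain F g g' where F: "F \<in> GDF 1 1" and g: "g \<in> arrows (DL 0 1) (ved e F) L" "g' \<in> arrows (DL 1 0) (hed e F) T" "vcq e g = hcq e g'"
  using w[unfolded DL_simps, OF L T] o corner_eq[OF e L T] by blast
 obtain te where t: "g = (ved e F, L, te, \<lambda>A\<in>GO 0 1. ph (te A))" "hnatural (grid 0 1) (ved e F) L te"
  by (rule DL_arrowE[OF g(1)]) blast
 obtain ka where k: "g' = (hed e F, T, ka, \<lambda>A\<in>GO 1 0. ph (ka A))" "hnatural (grid 1 0) (hed e F) T ka"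
  by (rule DL_arrowE[OF g(2)]) blast
 show "\<exists>F\<in>GDF 1 1. ved e F = L & hed e F = T"
  by (rule transport_dfun[OF e F L T t(2) k(2) corner_arrow[OF e g(3)[unfolded t(1) k(1)]]]) blast
qed

text \<open>The grid with one vertex has one component, which identifies an arrow once its ends are
  known.\<close>

lemma corner_arrow_eqI:
 assumes e: "e <= 1" and y: "y \<in> arrows (DL 0 0) X Y" "fst (snd (snd y)) (0, 0) = bt"
 shows "(L, L', te, te') \<in> arrows (DL 0 1) L L' ==> vco e L = X ==> vco e L' = Y ==> te (0, e) = bt ==> vcq e (L, L', te, te') = y"
  "(T, T', te, te') \<in> arrows (DL 1 0) T T' ==> hco e T = X ==> hco e T' = Y ==> te (e, 0) = bt ==> hcq e (T, T', te, te') = y"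
proof -
 obtain ka where k: "y = (X, Y, ka, \<lambda>A\<in>GO 0 0. ph (ka A))" by (rule DL_arrowE[OF y(1)]) blast
 note m = arrowsD(1)[OF y(1)[unfolded k]]
 show "vcq e (L, L', te, te') = y"
  if g: "(L, L', te, te') \<in> arrows (DL 0 1) L L'" and c: "vco e L = X" "vco e L' = Y" and t: "te (0, e) = bt"
 proof -
  have o: "L \<in> Ob (DL 0 1)" "L' \<in> Ob (DL 0 1)" using g by (simp_all add: DL_arrows DL_simps)
  note x = functorsD_restrict(2)[OF edge_functors(3)[OF e] g o, THEN arrowsD(1), unfolded prod.case c]
  show ?thesis unfolding k prod.case c
   by (rule DL_arrow_eqI[OF x m]) (use compose_edge(3)[OF e, of te] t y(2) k in simp)
 qed
 show "hcq e (T, T', te, te') = y"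
  if g: "(T, T', te, te') \<in> arrows (DL 1 0) T T'" and c: "hco e T = X" "hco e T' = Y" and t: "te (e, 0) = bt"
 proof -
  have o: "T \<in> Ob (DL 1 0)" "T' \<in> Ob (DL 1 0)" using g by (simp_all add: DL_arrows DL_simps)
  note x = functorsD_restrict(2)[OF edge_functors(4)[OF e] g o, THEN arrowsD(1), unfolded prod.case c]
  show ?thesis unfolding k prod.case c
   by (rule DL_arrow_eqI[OF x m]) (use compose_edge(4)[OF e, of te] t y(2) k in simp)
 qed
qed

lemma corner_arrow_eq:
 assumes e: "e <= 1" and g: "(L, L', te, te') \<in> arrows (DL 0 1) L L'" and g': "(T, T', ka, ka') \<in> arrows (DL 1 0) T T'"
  and c: "vco e L = hco e T" "vco e L' = hco e T'" "te (0, e) = ka (e, 0)"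
 shows "vcq e (L, L', te, te') = hcq e (T, T', ka, ka')"
proof -
 have o: "T \<in> Ob (DL 1 0)" "T' \<in> Ob (DL 1 0)" using g' by (simp_all add: DL_arrows DL_simps)
 show ?thesis
  by (rule corner_arrow_eqI(1)[OF e functorsD_restrict(2)[OF edge_functors(4)[OF e] g' o] _ g c])
   (simp only: prod.case fst_conv snd_conv compose_edge(4)[OF e])
qed

lemma edge_isos_extendI:
 assumes e: "e <= 1"
  and w: "!!F G g g'. F \<in> Ob (DL 1 1) ==> G \<in> Ob (DL 1 1) ==> g \<in> arrows (DL 0 1) (ved e F) (ved e G) ==>
   g' \<in> arrows (DL 1 0) (hed e F) (hed e G) ==> vcq e g = hcq e g' ==> \<exists>f\<in>arrows (DL 1 1) F G. veq e f = g & heq e f = g'"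
 shows "edge_isos_extend e"
 unfolding edge_isos_extend_def
proof (intro ballI allI impI)
 fix F G te ka
 assume F: "F \<in> GDF 1 1" and G: "G \<in> GDF 1 1" and t: "hnatural (grid 0 1) (ved e F) (ved e G) te"
  and k: "hnatural (grid 1 0) (hed e F) (hed e G) ka" and tk: "te (0, e) = ka (e, 0)"
 have le1: "i <= 1 \<longleftrightarrow> i = 0 \<or> i = 1" for i :: nat by auto
 note FG = F[folded DL_simps(1)] G[folded DL_simps(1)]
 note g = DL_arrowI_grid[OF edge_mems(1)[OF e F] edge_mems(1)[OF e G] t]
 note g' = DL_arrowI_grid[OF edge_mems(2)[OF e F] edge_mems(2)[OF e G] k]
 have "restrict te (GO 0 1) (0, e) = restrict ka (GO 1 0) (e, 0)" using tk e by (simp add: grid_simps)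
 note c = corner_arrow_eq[OF e g g' edge_corner(1)[OF e FG(1)] edge_corner(1)[OF e FG(2)] this]
 obtain f where f: "f \<in> arrows (DL 1 1) F G" "veq e f = (ved e F, ved e G, restrict te (GO 0 1), restrict (%A. ph (te A)) (GO 0 1))"
  "heq e f = (hed e F, hed e G, restrict ka (GO 1 0), restrict (%A. ph (ka A)) (GO 1 0))"
  using w[OF FG g g' c] by blast
 obtain xx where x: "f = (F, G, xx, \<lambda>A\<in>GO 1 1. ph (xx A))" "hnatural (grid 1 1) F G xx"
  by (rule DL_arrowE[OF f(1)]) blast
 note E = f(2,3)[unfolded x(1) prod.case prod.inject, THEN conjunct2, THEN conjunct2, THEN conjunct1]
 have v: "xx (e, j) = te (0, j)" "xx (j, e) = ka (j, 0)" if j: "j <= 1" for j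
  using fun_cong[OF E(1), of "(0, j)"] fun_cong[OF E(2), of "(j, 0)"] j
  unfolding compose_edge(1)[OF e j] compose_edge(2)[OF e j] by (simp_all add: grid_simps)
 show "\<exists>xx. hnatural (grid 1 1) F G xx & xx (e, 0) = te (0, 0) & xx (e, 1) = te (0, 1) & xx (0, e) = ka (0, 0) & xx (1, e) = ka (1, 0)"
  using x(2) v[of 0] v[of 1] by auto
qed

text \<open>Faithfulness is available from \<open>edges_faithful\<close>, so at each corner the weak
  equivalence amounts to \<open>edges_extend\<close> and \<open>edge_isos_extend\<close>, which
  together are the extension axiom.\<close>

lemma stable_iff:
 assumes me: "monic_epic D"
 shows "stable_bispace CD \<longleftrightarrow> square_extension D"
proof -
 interpret S: cat_cospan "DL 0 1" "DL 1 0" "DL 0 0" "vco 0" "vcq 0" "hco 0" "hcq 0"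
  unfolding cat_cospan_def cat_cospan_axioms_def using groupoid_DL edge_functors(3,4)[of 0] by blast
 \<comment> \<open>The second fibre product of \<open>stable_bispace\<close> lists the horizontal
   edge first, which explains the exchanged arguments for the corner 1.\<close>
 interpret C: cat_cospan "DL 1 0" "DL 0 1" "DL 0 0" "hco 1" "hcq 1" "vco 1" "vcq 1"
  unfolding cat_cospan_def cat_cospan_axioms_def using groupoid_DL edge_functors(3,4)[of 1] by blast
 have st: "stable_bispace CD \<longleftrightarrow>
   weak_equivalence (nerve (DL 1 1)) S.PS (%n x. (nerve_map (ved 0) (veq 0) n x, nerve_map (hed 0) (heq 0) n x)) &
   weak_equivalence (nerve (DL 1 1)) C.PS (%n x. (nerve_map (hed 1) (heq 1) n x, nerve_map (ved 1) (veq 1) n x))"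
  unfolding stable_bispace_def CD_simps CD_ends ..
 have e: "(0::nat) <= 1" "(1::nat) <= 1" by simp_all
 note SF = edge_functors(1,2)[OF e(1)] edge_corner[OF e(1)]
 note CF = edge_functors(2,1)[OF e(2)] edge_corner[OF e(2), symmetric]
 show ?thesis
 proof
  assume se: "square_extension D"
  note X = edges_extend_if_square_extension[OF se] edge_isos_extend_if_square_extension[OF se]
  show "stable_bispace CD"
   unfolding st
  proof
   show "weak_equivalence (nerve (DL 1 1)) S.PS (%n x. (nerve_map (ved 0) (veq 0) n x, nerve_map (hed 0) (heq 0) n x))"
    by (rule S.weak_equivalence_pairI[OF groupoid_DL SF])
     (use edges_surjective[OF X(1)[OF e(1)] e(1)] edges_full[OF X(2)[OF e(1)] e(1)] edges_faithful[OF me e(1)] in blast)+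
   show "weak_equivalence (nerve (DL 1 1)) C.PS (%n x. (nerve_map (hed 1) (heq 1) n x, nerve_map (ved 1) (veq 1) n x))"
   proof (rule C.weak_equivalence_pairI[OF groupoid_DL CF])
    show "\<exists>F\<in>Ob (DL 1 1). hed 1 F = T & ved 1 F = L" if "T \<in> Ob (DL 1 0)" "L \<in> Ob (DL 0 1)" "hco 1 T = vco 1 L" for T L
     using edges_surjective[OF X(1)[OF e(2)] e(2) that(2,1) that(3)[symmetric]] by blast
    show "\<exists>f\<in>arrows (DL 1 1) F G. heq 1 f = g & veq 1 f = g'"
     if "F \<in> Ob (DL 1 1)" "G \<in> Ob (DL 1 1)" "g \<in> arrows (DL 1 0) (hed 1 F) (hed 1 G)" "g' \<in> arrows (DL 0 1) (ved 1 F) (ved 1 G)" "hcq 1 g = vcq 1 g'" for F G g g'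
     using edges_full[OF X(2)[OF e(2)] e(2) that(1,2,4,3) that(5)[symmetric]] by blast
    show "f = f'" if "f \<in> arrows (DL 1 1) c c'" "f' \<in> arrows (DL 1 1) c c'" "heq 1 f = heq 1 f'" "veq 1 f = veq 1 f'" for c c' f f'
     by (rule edges_faithful[OF me e(2) that(1,2,4,3)])
   qed
  qed
 next
  assume "stable_bispace CD"
  note w = this[unfolded st, THEN conjunct1] this[unfolded st, THEN conjunct2]
  note W0 = S.weak_equivalence_pairD[OF groupoid_DL SF(1,2) _ _ w(1)] and W1 = C.weak_equivalence_pairD[OF groupoid_DL CF(1,2) _ _ w(2)]
  have "edges_extend 0" by (rule edges_extendI[OF e(1) W0(1)]) (use SF(3,4) in blast)+
  moreover have "edge_isos_extend 0" by (rule edge_isos_extendI[OF e(1) W0(2)]) (use SF(3,4) in blast)+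
  moreover have "edges_extend 1"
  proof (rule edges_extendI[OF e(2)])
   fix L T assume "L \<in> Ob (DL 0 1)" "T \<in> Ob (DL 1 0)" "vco 1 L = hco 1 T"
   from W1(1)[OF CF(3,4) this(2,1) this(3)[symmetric]]
   show "\<exists>F\<in>Ob (DL 1 1). \<exists>g\<in>arrows (DL 0 1) (ved 1 F) L. \<exists>g'\<in>arrows (DL 1 0) (hed 1 F) T. vcq 1 g = hcq 1 g'" by metis
  qed
  moreover have "edge_isos_extend 1"
  proof (rule edge_isos_extendI[OF e(2)])
   fix F G g g' assume a: "F \<in> Ob (DL 1 1)" "G \<in> Ob (DL 1 1)" "g \<in> arrows (DL 0 1) (ved 1 F) (ved 1 G)" "g' \<in> arrows (DL 1 0) (hed 1 F) (hed 1 G)" "vcq 1 g = hcq 1 g'"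
   from W1(2)[OF CF(3,4) a(1,2,4,3) a(5)[symmetric]]
   show "\<exists>f\<in>arrows (DL 1 1) F G. veq 1 f = g & heq 1 f = g'" by blast
  qed
  ultimately show "square_extension D" by (intro square_extension_if_edges_extend[OF me])
 qed
qed

end

section \<open>Pointedness\<close>

context shared_dblcat begin

lemma point_eqI: "F \<in> GDF 0 0 ==> G \<in> GDF 0 0 ==> on_ob F (0, 0) = on_ob G (0, 0) ==> F = G"
 by (rule grid_dfun_eqI[of _ 0 0]) simp_all

text \<open>Common to the horizontal and the vertical case: \<open>C1\<close> consists of the arrows in one direction,
 and \<open>p1\<close> and \<open>p\<close> take their zero and their other end.\<close>

lemma pointed_equivalence:
 assumes C1: "groupoid_cat C1"
  and F1: "(restrict p1 (Ob C1), restrict q1 (Ar C1)) \<in> functors C1 (DL 0 0)"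
  and F: "(restrict p (Ob C1), restrict q (Ar C1)) \<in> functors C1 (DL 0 0)"
  and ex: "!!e. e \<in> GDF 0 0 ==> \<exists>T\<in>Ob C1. \<exists>A. zero_object D A & p1 T = object_dfun D A & p T = e"
  and full: "!!T T' A A' al y. T \<in> Ob C1 ==> T' \<in> Ob C1 ==> zero_object D A ==> zero_object D A' ==> p1 T = object_dfun D A ==>
   p1 T' = object_dfun D A' ==> al \<in> hi A A' ==> y \<in> arrows (DL 0 0) (p T) (p T') ==>
   \<exists>x\<in>arrows C1 T T'. q1 x = aug_ar (al, ph al) & q x = y"
  and faithful: "!!T T' x x'. x \<in> arrows C1 T T' ==> x' \<in> arrows C1 T T' ==> q1 x = q1 x' ==> q x = q x' ==> x = x'"
 shows "weak_equivalence (pullback_sset (nerve C1) (nerve Z0) (nerve_map p1 q1) (nerve_map (object_dfun D) aug_ar))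
  (nerve (DL 0 0)) (%n (x, y). nerve_map p q n x)"
proof -
 interpret C: cat_cospan C1 Z0 "DL 0 0" p1 q1 "object_dfun D" aug_ar
  unfolding cat_cospan_def cat_cospan_axioms_def using C1 F1 groupoid_Z0 groupoid_DL aug_functor by blast
 interpret P: groupoid_cat C.PB by (rule C.groupoid_PB)
 note D = functorsD_restrict[OF F]
 have "weak_equivalence (nerve C.PB) (nerve (DL 0 0)) (nerve_map (%A. p (fst A)) (%g. q (fst g)))"
 proof (rule weak_equivalence_nerve_restrict[OF C.groupoid_PB groupoid_DL])
  show "(restrict (%A. p (fst A)) (Ob C.PB), restrict (%g. q (fst g)) (Ar C.PB)) \<in> functors C.PB (DL 0 0)"
  proof (rule functors_restrictI)
   show "category C.PB" by (rule P.category_axioms)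
   show "p (fst A) \<in> Ob (DL 0 0)" if "A \<in> Ob C.PB" for A using that D(1) by (cases A) (simp add: C.PB_simps)
   show "q (fst f) \<in> arrows (DL 0 0) (p (fst A)) (p (fst B))" if "f \<in> arrows C.PB A B" for f A B
    using that D(2) C.C1.arrows_Ob by (cases f; cases A; cases B) (simp add: C.PB_arrows)
   show "q (fst (ident C.PB A)) = ident (DL 0 0) (p (fst A))" if "A \<in> Ob C.PB" for A
    using that D(3) arrowsD(1)[OF C.C1.ident_closed] by (cases A) (simp add: C.PB_simps)
   show "q (fst (cmp C.PB g f)) = cmp (DL 0 0) (q (fst g)) (q (fst f))" if "f \<in> arrows C.PB A B" "g \<in> arrows C.PB B A'" for f g A B A'
   proof -
    obtain f1 f2 g1 g2 where e: "f = (f1, f2)" "g = (g1, g2)" by (metis prod.exhaust)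
    have a: "f1 \<in> arrows C1 (fst A) (fst B)" "g1 \<in> arrows C1 (fst B) (fst A')"
     using that unfolding e by (cases A; cases B; cases A'; simp only: C.PB_arrows fst_conv)+
    show ?thesis using D(4)[OF a arrowsD(1)[OF C.C1.cmp_arrows[OF a]]] unfolding e C.PB_simps by simp
   qed
  qed
  fix e assume e: "e \<in> Ob (DL 0 0)"
  then obtain T A where T: "T \<in> Ob C1" "zero_object D A" "p1 T = object_dfun D A" "p T = e" using ex DL_simps(1) by blast
  have "(T, A) \<in> Ob C.PB" using T by (simp add: C.PB_simps Z0_simps)
  moreover have "ident (DL 0 0) e \<in> arrows (DL 0 0) (p (fst (T, A))) e" using C.C3.ident_closed[OF e] T(4) by simp
  ultimately show "\<exists>c\<in>Ob C.PB. \<exists>g. g \<in> arrows (DL 0 0) (p (fst c)) e" by blast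
 next
  fix c c' g assume c: "c \<in> Ob C.PB" "c' \<in> Ob C.PB" and g: "g \<in> arrows (DL 0 0) (p (fst c)) (p (fst c'))"
  obtain T A where e: "c = (T, A)" by (cases c)
  obtain T' A' where e': "c' = (T', A')" by (cases c')
  have o: "T \<in> Ob C1" "T' \<in> Ob C1" "zero_object D A" "zero_object D A'" "p1 T = object_dfun D A" "p1 T' = object_dfun D A'"
   using c by (simp_all add: e e' C.PB_simps Z0_simps)
  obtain al where a: "al \<in> hi A A'" using zero_iso[OF o(3,4)] by blast
  obtain x where x: "x \<in> arrows C1 T T'" "q1 x = aug_ar (al, ph al)" "q x = g" using full[OF o a g[unfolded e e' fst_conv]] by blast
  have "(x, (al, ph al)) \<in> arrows C.PB c c'" unfolding e e' C.PB_arrows Z0_arrows using x a o by blast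
  then show "\<exists>f\<in>arrows C.PB c c'. q (fst f) = g" using x(3) by force
 next
  fix c c' f f' assume f: "f \<in> arrows C.PB c c'" "f' \<in> arrows C.PB c c'" and eq: "q (fst f) = q (fst f')"
  obtain T A where e: "c = (T, A)" by (cases c)
  obtain T' A' where e': "c' = (T', A')" by (cases c')
  obtain x a where y: "f = (x, a)" by (cases f)
  obtain x' a' where y': "f' = (x', a')" by (cases f')
  note X = f(1)[unfolded e e' y C.PB_arrows Z0_arrows] and X' = f(2)[unfolded e e' y' C.PB_arrows Z0_arrows]
  have aa: "a = a'" using X X' zero_iso[of A A'] by blast
  have "x = x'" by (rule faithful) (use X X' eq aa in \<open>auto simp: y y'\<close>)
  then show "f = f'" using aa by (simp add: y y')
 qed
 then show ?thesis by (rule C.weak_equivalence_from_PS)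
qed

lemma DL_arrow_component:
 assumes "y \<in> arrows (DL m n) F G" "i <= m" "j <= n"
 shows "fst (snd (snd y)) (i, j) \<in> hi (on_ob F (i, j)) (on_ob G (i, j))"
 by (rule DL_arrowE[OF assms(1)]) (use dfun_target.hnaturalD(1)[OF dfun_target_grid, of m n F G _ "(i, j)"] assms(2,3) in \<open>auto simp: grid_simps\<close>)

lemma arrow_le1: "i <= (1::nat) \<longleftrightarrow> i = 0 \<or> i = 1"
 by auto

text \<open>Every object receives a morphism from the zero object, and its uniqueness makes the
  naturality square of any pair of isomorphisms at the ends commute.\<close>

lemma pointed_horizontal:
 assumes z: "zero_object D z"
 shows "weak_equivalence (pullback_sset (nerve (DL 1 0)) (nerve Z0) (nerve_map (hco 0) (hcq 0)) (nerve_map (object_dfun D) aug_ar))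
  (nerve (DL 0 0)) (%n (x, y). nerve_map (hco 1) (hcq 1) n x)"
proof (rule pointed_equivalence[OF groupoid_DL edge_functors(4)[of 0] edge_functors(4)[of 1]])
 have e: "(0::nat) <= 1" "(1::nat) <= 1" by simp_all
 fix X assume X: "X \<in> GDF 0 0"
 note o = zero_objectD(1)[OF z] grid_dfunD(1)[OF X, of 0 0]
 obtain f where f: "f \<in> hm z (on_ob X (0, 0))" using ex1_implies_ex[OF zero_objectD(2)[OF z o(2)[OF le0 le0]]] by blast
 obtain T where T: "T \<in> GDF 1 0" "on_hor T ((0, Suc 0), 0) = f" by (rule horizontal_GDF[OF f])
 have t: "on_ob T (0, 0) = z" "on_ob T (1, 0) = on_ob X (0, 0)" using horizontal_GDF_arrow[OF T(1)] T(2) f by (auto simp: arrows_def)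
 have "hco 0 T = object_dfun D z" "hco 1 T = X"
  using t by (intro point_eqI edge_mems(4) e T(1) X object_dfun_mem o; simp only: edge_simps2[OF e(1)] edge_simps2[OF e(2)] object_dfun_ob)+
 then show "\<exists>T\<in>Ob (DL 1 0). \<exists>A. zero_object D A & hco 0 T = object_dfun D A & hco 1 T = X"
  using T(1) z unfolding DL_simps by blast
next
 have e: "(0::nat) <= 1" "(1::nat) <= 1" by simp_all
 fix T T' A A' al y
 assume "T \<in> Ob (DL 1 0)" "T' \<in> Ob (DL 1 0)" and A: "zero_object D A" "zero_object D A'"
  and c: "hco 0 T = object_dfun D A" "hco 0 T' = object_dfun D A'" and a: "al \<in> hi A A'" and y: "y \<in> arrows (DL 0 0) (hco 1 T) (hco 1 T')"
 then have T: "T \<in> GDF 1 0" "T' \<in> GDF 1 0" by (simp_all only: DL_simps)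
 have o: "on_ob T (0, 0) = A" "on_ob T' (0, 0) = A'"
  using edge_simps2(6)[OF e(1), of T] edge_simps2(6)[OF e(1), of T'] unfolding c object_dfun_ob by simp_all
 let ?bt = "fst (snd (snd y)) (0, 0)"
 have b: "?bt \<in> hi (on_ob T (1, 0)) (on_ob T' (1, 0))" using DL_arrow_component[OF y, of 0 0] edge_simps2(6)[OF e(2), of T] edge_simps2(6)[OF e(2), of T'] by simp
 note f = horizontal_GDF_arrow[OF T(1), unfolded o] and f' = horizontal_GDF_arrow[OF T(2), unfolded o]
 have "?bt \<circ>h on_hor T ((0, Suc 0), 0) = on_hor T' ((0, Suc 0), 0) \<circ>h al"
  using zero_objectD(2)[OF A(1) H.arrows_Ob(2)[OF f']] H.cmp_arrows[OF f H.isos_arrows[OF b[unfolded One_nat_def]]] H.cmp_arrows[OF H.isos_arrows[OF a] f'] by blast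
 then have "hnatural (grid 1 0) T T' (%(i, j). if i = (0::nat) then al else ?bt)"
  unfolding hnatural_horizontal[OF T] using a b o by simp
 note g = DL_arrowI_grid[OF T this]
 show "\<exists>x\<in>arrows (DL 1 0) T T'. hcq 0 x = aug_ar (al, ph al) & hcq 1 x = y"
  by (rule bexI[OF _ g], rule conjI, rule corner_arrow_eqI(2)[OF e(1) aug_ar_mem[OF a] refl g c], simp add: grid_simps,
    rule corner_arrow_eqI(2)[OF e(2) y refl g refl refl], simp add: grid_simps)
next
 have e: "(0::nat) <= 1" "(1::nat) <= 1" by simp_all
 fix T T' x x' assume x: "x \<in> arrows (DL 1 0) T T'" "x' \<in> arrows (DL 1 0) T T'" and eq: "hcq 0 x = hcq 0 x'" "hcq 1 x = hcq 1 x'"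
 obtain te where t: "x = (T, T', te, \<lambda>A\<in>GO 1 0. ph (te A))" by (rule DL_arrowE[OF x(1)]) blast
 obtain ka where k: "x' = (T, T', ka, \<lambda>A\<in>GO 1 0. ph (ka A))" by (rule DL_arrowE[OF x(2)]) blast
 note E = eq[unfolded t(1) k(1) prod.case prod.inject, THEN conjunct2, THEN conjunct2, THEN conjunct1, THEN fun_cong, of "(0, 0)"]
 have v: "te (0, 0) = ka (0, 0)" "te (1, 0) = ka (1, 0)" using E unfolding compose_edge(4)[OF e(1)] compose_edge(4)[OF e(2)] by blast+
 show "x = x'" unfolding t k
  by (rule DL_arrow_eqI[OF x(1)[unfolded t, THEN arrowsD(1)] x(2)[unfolded k, THEN arrowsD(1)]]) (use v arrow_le1 in auto)
qed simp_all

text \<open>Dual to the horizontal case: the zero object is terminal for vertical morphisms, so the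
  zero end is the target.\<close>

lemma pointed_vertical:
 assumes z: "zero_object D z"
 shows "weak_equivalence (pullback_sset (nerve (DL 0 1)) (nerve Z0) (nerve_map (vco 1) (vcq 1)) (nerve_map (object_dfun D) aug_ar))
  (nerve (DL 0 0)) (%n (x, y). nerve_map (vco 0) (vcq 0) n x)"
proof (rule pointed_equivalence[OF groupoid_DL edge_functors(3)[of 1] edge_functors(3)[of 0]])
 have e: "(0::nat) <= 1" "(1::nat) <= 1" by simp_all
 fix X assume X: "X \<in> GDF 0 0"
 note o = zero_objectD(1)[OF z] grid_dfunD(1)[OF X, of 0 0]
 obtain f where f: "f \<in> vm (on_ob X (0, 0)) z" using ex1_implies_ex[OF zero_objectD(3)[OF z o(2)[OF le0 le0]]] by blast
 obtain T where T: "T \<in> GDF 0 1" "on_ver T (0, 0, Suc 0) = f" by (rule vertical_GDF[OF f])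
 have t: "on_ob T (0, 1) = z" "on_ob T (0, 0) = on_ob X (0, 0)" using vertical_GDF_arrow[OF T(1)] T(2) f by (auto simp: arrows_def)
 have "vco 1 T = object_dfun D z" "vco 0 T = X"
  using t by (intro point_eqI edge_mems(3) e T(1) X object_dfun_mem o; simp only: edge_simps2[OF e(1)] edge_simps2[OF e(2)] object_dfun_ob)+
 then show "\<exists>T\<in>Ob (DL 0 1). \<exists>A. zero_object D A & vco 1 T = object_dfun D A & vco 0 T = X"
  using T(1) z unfolding DL_simps by blast
next
 have e: "(0::nat) <= 1" "(1::nat) <= 1" by simp_all
 fix T T' A A' al y
 assume "T \<in> Ob (DL 0 1)" "T' \<in> Ob (DL 0 1)" and A: "zero_object D A" "zero_object D A'"
  and c: "vco 1 T = object_dfun D A" "vco 1 T' = object_dfun D A'" and a: "al \<in> hi A A'" and y: "y \<in> arrows (DL 0 0) (vco 0 T) (vco 0 T')"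
 then have T: "T \<in> GDF 0 1" "T' \<in> GDF 0 1" by (simp_all only: DL_simps)
 have o: "on_ob T (0, Suc 0) = A" "on_ob T' (0, Suc 0) = A'"
  using edge_simps2(5)[OF e(2), of T] edge_simps2(5)[OF e(2), of T'] unfolding c object_dfun_ob by simp_all
 let ?bt = "fst (snd (snd y)) (0, 0)"
 have b: "?bt \<in> hi (on_ob T (0, 0)) (on_ob T' (0, 0))" using DL_arrow_component[OF y, of 0 0] edge_simps2(5)[OF e(1), of T] edge_simps2(5)[OF e(1), of T'] by simp
 note f = vertical_GDF_arrow[OF T(1), unfolded o] and f' = vertical_GDF_arrow[OF T(2), unfolded o]
 have "ph al \<circ>v on_ver T (0, 0, Suc 0) = on_ver T' (0, 0, Suc 0) \<circ>v ph ?bt"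
  using zero_objectD(3)[OF A(2)] V.arrows_Ob(1)[OF f] V.cmp_arrows[OF f phi_arrow[OF a]] V.cmp_arrows[OF phi_arrow[OF b] f'] same_objects by blast
 then have "hnatural (grid 0 1) T T' (%(i, j). if j = (0::nat) then ?bt else al)"
  unfolding hnatural_vertical[OF T] using a b o by simp
 note g = DL_arrowI_grid[OF T this]
 show "\<exists>x\<in>arrows (DL 0 1) T T'. vcq 1 x = aug_ar (al, ph al) & vcq 0 x = y"
  by (rule bexI[OF _ g], rule conjI, rule corner_arrow_eqI(1)[OF e(2) aug_ar_mem[OF a] refl g c], simp add: grid_simps,
    rule corner_arrow_eqI(1)[OF e(1) y refl g refl refl], simp add: grid_simps)
next
 have e: "(0::nat) <= 1" "(1::nat) <= 1" by simp_all
 fix T T' x x' assume x: "x \<in> arrows (DL 0 1) T T'" "x' \<in> arrows (DL 0 1) T T'" and eq: "vcq 1 x = vcq 1 x'" "vcq 0 x = vcq 0 x'"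
 obtain te where t: "x = (T, T', te, \<lambda>A\<in>GO 0 1. ph (te A))" by (rule DL_arrowE[OF x(1)]) blast
 obtain ka where k: "x' = (T, T', ka, \<lambda>A\<in>GO 0 1. ph (ka A))" by (rule DL_arrowE[OF x(2)]) blast
 note E = eq[unfolded t(1) k(1) prod.case prod.inject, THEN conjunct2, THEN conjunct2, THEN conjunct1, THEN fun_cong, of "(0, 0)"]
 have v: "te (0, 0) = ka (0, 0)" "te (0, 1) = ka (0, 1)" using E unfolding compose_edge(3)[OF e(1)] compose_edge(3)[OF e(2)] by blast+
 show "x = x'" unfolding t k
  by (rule DL_arrow_eqI[OF x(1)[unfolded t, THEN arrowsD(1)] x(2)[unfolded k, THEN arrowsD(1)]]) (use v arrow_le1 in auto)
qed simp_all

text \<open>A zero object gives contractibility and both equivalences. Conversely, a nonempty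
  realization of the base has a simplex, and the vertices of a simplex of this nerve are zero
  objects.\<close>

lemma pointed_iff: "pointed_bispace CD \<longleftrightarrow> pointed_dblcat D"
proof
 assume "pointed_dblcat D"
 then obtain z where z: "zero_object D z" by (auto simp: pointed_dblcat_def)
 show "pointed_bispace CD"
  unfolding pointed_bispace_def CD_simps CD_ends CD_base(2)
  using contractible_base[OF z] pointed_horizontal[OF z] pointed_vertical[OF z] by (simp add: CD_base(1))
next
 assume "pointed_bispace CD"
 then have "topspace (realization (nerve Z0)) \<noteq> {}" by (simp add: pointed_bispace_def contractible_sset_def CD_base)
 then obtain n x where x: "x \<in> cells (nerve Z0) n" by (auto simp: topspace_realization topspace_simplex_sum)
 show "pointed_dblcat D"
  by (rule cells_nerveE[OF x]) (use functors_ordinalD(1)[of _ _ n Z0 0] in \<open>auto simp: pointed_dblcat_def Z0_simps\<close>)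
qed

end

theorem theorem1p5:
  fixes D :: "('o, 'h, 'v, 's) dblcat"
  shows "(reverse_CGW D \<longrightarrow> pointed_stable_double_segal_space (classifying_diagram D)) \<and>
    (double_category D \<and> has_shared_isos D \<and>
     (\<forall>f\<in>Ar (hor D). monic (hor D) f) \<and> (\<forall>u\<in>Ar (ver D). epic (ver D) u) \<and>
     pointed_stable_double_segal_space (classifying_diagram D)
     \<longrightarrow> reverse_CGW D)"
proof -
 \<comment> \<open>Preaugmentation and the Segal conditions hold for every double category with
   shared isomorphisms, so both claims follow from this equivalence.\<close>
 have "pointed_stable_double_segal_space (classifying_diagram D) \<longleftrightarrow> pointed_dblcat D & square_extension D"
  if D: "double_category D" "has_shared_isos D" "monic_epic D"
 proof -
  interpret double_category D by (rule D(1))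
  obtain ph where "shared_dblcat D ph" using ex_shared[OF D(2)] by blast
  then interpret shared_dblcat D ph .
  show ?thesis
   using preaugmented_classifying_diagram pointed_iff stable_iff[OF D(3)] h_segal v_segal bisimplicial_space_classifying_diagram
   by (auto simp: pointed_stable_double_segal_space_def double_segal_space_def)
 qed
 then show ?thesis by (auto simp: reverse_CGW_def monic_epic_def)
qed

end
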